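(* Let $n\ge2$ and $m,m'\ge0$. Put $m_n=m$, $m'_n=m'$. For integers $m_{n-1},\dots,m_2\ge0$, $m'_{n-1},\dots,m'_2\ge0$ and $m_1$ with $$m\ge m_{n-1}\ge\cdots\ge m_2,\qquad m'\ge m'_{n-1}\ge\cdots\ge m'_2,\qquad m_2\ge m_1\ge -m'_2,$$ set $$\Xi_{{\bf m},{\bf m}',m_1}=t^{n;m,m'}_{m_{n-1},m'_{n-1}}\,t^{n-1;m_{n-1},m'_{n-1}}_{m_{n-2},m'_{n-2}}\cdots t^{3;m_3,m'_3}_{m_2,m'_2}\,t^{2;m_2,m'_2}_{m_1}\,t^{1;m_1}.$$ Then the polynomials $\Xi_{{\bf m},{\bf m}',m_1}$ form a basis of the space $\mathcal H_{m,m'}$ of homogeneous $q$-harmonic polynomials. If moreover $q>0$, this basis is orthogonal with respect to the scalar product $\langle\cdot,\cdot\rangle$.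
   Context: Let $q$ be a nonzero complex number that is not a root of unity (for the scalar product, $q$ is a positive real number, $q\ne1$). Put $[a]=(q^a-q^{-a})/(q-q^{-1})$, $(a;t)_s=(1-a)(1-at)\cdots(1-at^{s-1})$ and ${}_2\varphi_1(a,b;c;t;x)=\sum_{k\ge0}\frac{(a;t)_k(b;t)_k}{(c;t)_k(t;t)_k}x^k$. $\mathcal A$ is the unital associative $\mathbb C$-algebra generated by $z_1,\dots,z_n,w_1,\dots,w_n$ with relations $z_iz_j=qz_jz_i$ and $w_iw_j=q^{-1}w_jw_i$ for $i<j$; $w_jz_i=qz_iw_j$ for $i\ne j$; $w_kz_k=z_kw_k+(1-q^2)\sum_{s<k}z_sw_s$. Both the monomials $z_1^{r_1}\cdots z_n^{r_n}w_1^{s_1}\cdots w_n^{s_n}$ and the monomials $w_1^{r_1}\cdots w_n^{r_n}z_1^{s_1}\cdots z_n^{s_n}$ form bases of $\mathcal A$. $\mathcal A_{m,m'}$ is the subspace of polynomials homogeneous of degree $m$ in the $z_i$ and of degree $m'$ in the $w_i$. Linear operators $\partial_i,\bar\partial_i$ on $\mathcal A$ are defined on these bases by $\partial_i(z_1^{r_1}\cdots z_n^{r_n}w_1^{s_1}\cdots w_n^{s_n})=q^{r_{i+1}+\cdots+r_n}[r_i]\,z_1^{r_1}\cdots z_i^{r_i-1}\cdots z_n^{r_n}w_1^{s_1}\cdots w_n^{s_n}$ and $\bar\partial_i(w_1^{r_1}\cdots w_n^{r_n}z_1^{s_1}\cdots z_n^{s_n})=q^{-(r_{i+1}+\cdots+r_n)}[r_i]\,w_1^{r_1}\cdots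 w_i^{r_i-1}\cdots w_n^{r_n}z_1^{s_1}\cdots z_n^{s_n}$ (both are $0$ if $r_i=0$). $\Delta_q=\sum_{i=1}^n\partial_i\bar\partial_i$ $(=\sum_{i=1}^n q^{2(i-1)}\bar\partial_i\partial_i)$, and $\mathcal H_{m,m'}=\{p\in\mathcal A_{m,m'}:\Delta_qp=0\}$, $\mathcal H=\{p\in\mathcal A:\Delta_q p=0\}$. For $1\le j\le n$ put $Q_j=\sum_{i=1}^jz_iw_i$, $Q=Q_n$; the $Q_j$ commute with each other. For $2\le p\le n$ and integers $0\le b\le a$, $0\le b'\le a'$ define $t^{p;a,a'}_{b,b'}\in\mathcal A$ as follows. If $a-b\ge a'-b'$: $$t^{p;a,a'}_{b,b'}=q^{-2(a-b)(a'-b')}\frac{(q^{-2a'-2b-2p+4};q^2)_{a'-b'}}{(q^{-2a-2a'-2p+4};q^2)_{a'-b'}}\;z_p^{a-b-a'+b'}\,Q_p^{a'-b'}\,{}_2\varphi_1\bigl(q^{-2(a'-b')},q^{2(a+b'+p-1)};q^{2(b+b'+p-1)};q^2;q^2Q_{p-1}/Q_p\bigr).$$ If $a-b\le a'-b'$: $$t^{p;a,a'}_{b,b'}=q^{-2(a-b)(a'-b')}\frac{(q^{-2a-2b'-2p+4};q^2)_{a-b}}{(q^{-2a-2a'-2p+4};q^2)_{a-b}}\;Q_p^{a-b}\,{}_2\varphi_1\bigl(q^{-2(a-b)},q^{2(a'+b+p-1)};q^{2(b+b'+p-1)};q^2;q^2Q_{p-1}/Q_p\bigr)\,w_p^{a'-b'-a+b}.$$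 Here $Q_p^N\,{}_2\varphi_1(q^{-2N},\dots)$ is the polynomial in $Q_p,Q_{p-1}$ obtained from the terminating series with $Q_p^N(Q_{p-1}/Q_p)^k:=Q_p^{N-k}Q_{p-1}^k$. For $p=2$ write $t^{2;a,a'}_{c}=t^{2;a,a'}_{c,0}$ for $c\ge0$ and $t^{2;a,a'}_{c}=t^{2;a,a'}_{0,-c}$ for $c\le0$. Finally $t^{1;c}=z_1^{c}$ for $c>0$, $t^{1;0}=1$, $t^{1;c}=w_1^{-c}$ for $c<0$. Scalar product ($q>0$, $q\neq 1$): $\mathcal A$ is a $*$-algebra with $z_i^*=w_i$, $w_i^*=z_i$. Let $\tau:\mathcal A\to\mathcal A/\mathcal I$ be the quotient map, $\mathcal I$ the two-sided ideal generated by $Q-1$. $\tau\mathcal A$ is $\mathbb Z^n$-graded, $\tau\mathcal A=\bigoplus_\lambda(\tau\mathcal A)^\lambda$, with $z_i$ of degree $\epsilon_i$ and $w_i$ of degree $-\epsilon_i$ ($\epsilon_i$ the standard basis). $h:\tau\mathcal A\to\mathbb C$ is the linear functional vanishing on $(\tau\mathcal A)^\lambda$ for $\lambda\ne0$, with $$h(w_1^{\mu_1}\cdots w_n^{\mu_n}z_n^{\mu_n}\cdots z_1^{\mu_1})=\frac{(q^2;q^2)_{\mu_1}\cdots(q^2;q^2)_{\mu_n}(q^2;q^2)_{n-1}}{(q^2;q^2)_{\mu_1+\cdots+\mu_n+n-1}}$$ (these monomials span $(\tau\mathcal A)^0$ and $h$ is well defined). The scalar product on $\mathcal H$ is $\langle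 p_1,p_2\rangle=h((\tau p_1)(\tau p_2)^* )$. *)

theory Defs
  imports Complex_Main "HOL-Library.Poly_Mapping" "HOL-Library.FuncSet"
begin

class complex_algebra_1 = ring_1 +
  fixes scaleC :: "complex \<Rightarrow> 'a \<Rightarrow> 'a" (infixr "*\<^sub>C" 75)
  assumes scaleC_add_right: "a *\<^sub>C (x + y) = a *\<^sub>C x + a *\<^sub>C y"
    and scaleC_add_left: "(a + b) *\<^sub>C x = a *\<^sub>C x + b *\<^sub>C x"
    and scaleC_scaleC: "a *\<^sub>C b *\<^sub>C x = (a * b) *\<^sub>C x"
    and scaleC_one: "1 *\<^sub>C x = x"
    and mult_scaleC_left: "(a *\<^sub>C x) * y = a *\<^sub>C (x * y)"
    and mult_scaleC_right: "x * (a *\<^sub>C y) = a *\<^sub>C (x * y)"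

interpretation complex_vector: vector_space "scaleC :: complex \<Rightarrow> 'a \<Rightarrow> 'a::complex_algebra_1"
  by unfold_locales
    (simp_all add: scaleC_add_right scaleC_add_left scaleC_scaleC scaleC_one)


section \<open>The algebra given by generators and relations\<close>

text \<open>
  The free complex algebra on a set of letters is the monoid algebra of the free monoid; the latter
  is written additively because multiplication of \<open>poly_mapping\<close> is convolution over addition.
\<close>

datatype 'g free_word = Free_Word (letters: "'g list")

instantiation free_word :: (type) monoid_add
begin

definition zero_free_word :: "'a free_word" where
  "0 = Free_Word []"

definition plus_free_word :: "'a free_word \<Rightarrow> 'a free_word \<Rightarrow> 'a free_word" where
  "u + v = Free_Word (letters u @ letters v)"

instance
  by standard (simp_all add: zero_free_word_def plus_free_word_def)

end

datatype gen = GZ nat | GW nat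

type_synonym free_poly = "gen free_word \<Rightarrow>\<^sub>0 complex"

definition gens :: "nat \<Rightarrow> gen set" where
  "gens n = GZ ` {1..n} \<union> GW ` {1..n}"

definition words :: "nat \<Rightarrow> gen free_word set" where
  "words n = {u. set (letters u) \<subseteq> gens n}"

definition free_alg :: "nat \<Rightarrow> free_poly set" where
  "free_alg n = {p. Poly_Mapping.keys p \<subseteq> words n}"

definition free_const :: "complex \<Rightarrow> free_poly" where
  "free_const c = Poly_Mapping.single 0 c"

definition free_gen :: "gen \<Rightarrow> free_poly" where
  "free_gen g = Poly_Mapping.single (Free_Word [g]) 1"

text \<open>The two-sided ideal generated by \<open>R\<close> in the (unital sub)ring with carrier \<open>C\<close>.\<close>

inductive_set ideal_gen :: "'a::ring_1 set \<Rightarrow> 'a set \<Rightarrow> 'a set" for C R where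
  zero: "0 \<in> ideal_gen C R"
| base: "r \<in> R \<Longrightarrow> r \<in> ideal_gen C R"
| add: "x \<in> ideal_gen C R \<Longrightarrow> y \<in> ideal_gen C R \<Longrightarrow> x + y \<in> ideal_gen C R"
| mult_left: "c \<in> C \<Longrightarrow> x \<in> ideal_gen C R \<Longrightarrow> c * x \<in> ideal_gen C R"
| mult_right: "x \<in> ideal_gen C R \<Longrightarrow> c \<in> C \<Longrightarrow> x * c \<in> ideal_gen C R"

text \<open>The differences of the two sides of the defining relations.\<close>

definition relators :: "nat \<Rightarrow> complex \<Rightarrow> free_poly set" where
  "relators n q = (let Z = (\<lambda>i. free_gen (GZ i)); W = (\<lambda>i. free_gen (GW i)) in
     {Z i * Z j - free_const q * Z j * Z i | i j. 1 \<le> i \<and> i < j \<and> j \<le> n}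
   \<union> {W i * W j - free_const (inverse q) * W j * W i | i j. 1 \<le> i \<and> i < j \<and> j \<le> n}
   \<union> {W j * Z i - free_const q * Z i * W j | i j. i \<in> {1..n} \<and> j \<in> {1..n} \<and> i \<noteq> j}
   \<union> {W k * Z k - (Z k * W k + free_const (1 - q\<^sup>2) * (\<Sum>s\<in>{1..<k}. Z s * W s)) | k. k \<in> {1..n}})"

definition word_val ::
  "(nat \<Rightarrow> 'a::complex_algebra_1) \<Rightarrow> (nat \<Rightarrow> 'a) \<Rightarrow> gen free_word \<Rightarrow> 'a" where
  "word_val z w u = prod_list (map (\<lambda>g. case g of GZ i \<Rightarrow> z i | GW i \<Rightarrow> w i) (letters u))"

definition eval_free ::
  "(nat \<Rightarrow> 'a::complex_algebra_1) \<Rightarrow> (nat \<Rightarrow> 'a) \<Rightarrow> free_poly \<Rightarrow> 'a" where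
  "eval_free z w p = (\<Sum>u\<in>Poly_Mapping.keys p. Poly_Mapping.lookup p u *\<^sub>C word_val z w u)"

text \<open>
  The type \<open>'a\<close> is the algebra presented by the generators \<open>z 1, \<dots>, z n, w 1, \<dots>, w n\<close> and the
  relations: the evaluation map from the free algebra is onto, and its kernel is the ideal generated
  by the relators. Values of \<open>z\<close>, \<open>w\<close> outside \<open>{1..n}\<close> play no role.
\<close>

definition presents :: "nat \<Rightarrow> complex \<Rightarrow> (nat \<Rightarrow> 'a::complex_algebra_1) \<Rightarrow> (nat \<Rightarrow> 'a) \<Rightarrow> bool" where
  "presents n q z w \<longleftrightarrow>
     eval_free z w ` free_alg n = UNIV \<and>
     {p \<in> free_alg n. eval_free z w p = 0} = ideal_gen (free_alg n) (relators n q)"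


section \<open>Monomials, degrees and q-harmonic polynomials\<close>

text \<open>\<open>mono_up n x r\<close> is $x_1^{r_1} \cdots x_n^{r_n}$, and \<open>mono_down n x r\<close> is
  $x_n^{r_n} \cdots x_1^{r_1}$.\<close>

definition mono_up :: "nat \<Rightarrow> (nat \<Rightarrow> 'a::monoid_mult) \<Rightarrow> (nat \<Rightarrow> nat) \<Rightarrow> 'a" where
  "mono_up n x r = prod_list (map (\<lambda>i. x i ^ r i) [1..<Suc n])"

definition mono_down :: "nat \<Rightarrow> (nat \<Rightarrow> 'a::monoid_mult) \<Rightarrow> (nat \<Rightarrow> nat) \<Rightarrow> 'a" where
  "mono_down n x r = prod_list (map (\<lambda>i. x i ^ r i) (rev [1..<Suc n]))"

definition qnum :: "complex \<Rightarrow> int \<Rightarrow> complex" where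
  "qnum q a = (q powi a - q powi (- a)) / (q - inverse q)"

text \<open>
  The operators are determined by their values on the two monomial bases. If \<open>r i = 0\<close> the factor
  \<open>qnum q 0 = 0\<close> kills the right-hand side, so the truncated \<open>r i - 1\<close> is harmless.
\<close>

definition pd ::
  "nat \<Rightarrow> complex \<Rightarrow> (nat \<Rightarrow> 'a::complex_algebra_1) \<Rightarrow> (nat \<Rightarrow> 'a) \<Rightarrow> nat \<Rightarrow> 'a \<Rightarrow> 'a" where
  "pd n q z w i = (THE D. Vector_Spaces.linear scaleC scaleC D \<and>
     (\<forall>r s. D (mono_up n z r * mono_up n w s) =
        (q ^ (\<Sum>k\<in>{i<..n}. r k) * qnum q (int (r i))) *\<^sub>C
          (mono_up n z (r(i := r i - 1)) * mono_up n w s)))"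

definition pd_bar ::
  "nat \<Rightarrow> complex \<Rightarrow> (nat \<Rightarrow> 'a::complex_algebra_1) \<Rightarrow> (nat \<Rightarrow> 'a) \<Rightarrow> nat \<Rightarrow> 'a \<Rightarrow> 'a" where
  "pd_bar n q z w i = (THE D. Vector_Spaces.linear scaleC scaleC D \<and>
     (\<forall>r s. D (mono_up n w r * mono_up n z s) =
        (q powi (- int (\<Sum>k\<in>{i<..n}. r k)) * qnum q (int (r i))) *\<^sub>C
          (mono_up n w (r(i := r i - 1)) * mono_up n z s)))"

definition q_laplace ::
  "nat \<Rightarrow> complex \<Rightarrow> (nat \<Rightarrow> 'a::complex_algebra_1) \<Rightarrow> (nat \<Rightarrow> 'a) \<Rightarrow> 'a \<Rightarrow> 'a" where
  "q_laplace n q z w p = (\<Sum>i = 1..n. pd n q z w i (pd_bar n q z w i p))"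

definition word_weight :: "gen free_word \<Rightarrow> nat \<Rightarrow> int" where
  "word_weight u i = int (count_list (letters u) (GZ i)) - int (count_list (letters u) (GW i))"

definition hom_polys ::
  "nat \<Rightarrow> (nat \<Rightarrow> 'a::complex_algebra_1) \<Rightarrow> (nat \<Rightarrow> 'a) \<Rightarrow> nat \<Rightarrow> nat \<Rightarrow> 'a set" where
  "hom_polys n z w m m' = complex_vector.span (word_val z w ` {u \<in> words n.
     length (filter (\<lambda>g. g \<in> range GZ) (letters u)) = m \<and>
     length (filter (\<lambda>g. g \<in> range GW) (letters u)) = m'})"

definition q_harmonics ::
  "nat \<Rightarrow> complex \<Rightarrow> (nat \<Rightarrow> 'a::complex_algebra_1) \<Rightarrow> (nat \<Rightarrow> 'a) \<Rightarrow> nat \<Rightarrow> nat \<Rightarrow> 'a set" where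
  "q_harmonics n q z w m m' = {p \<in> hom_polys n z w m m'. q_laplace n q z w p = 0}"

definition Qpoly :: "(nat \<Rightarrow> 'a::ring_1) \<Rightarrow> (nat \<Rightarrow> 'a) \<Rightarrow> nat \<Rightarrow> 'a" where
  "Qpoly z w j = (\<Sum>i = 1..j. z i * w i)"


section \<open>The polynomials t and their products\<close>

definition qpoch :: "complex \<Rightarrow> complex \<Rightarrow> nat \<Rightarrow> complex" where
  "qpoch a t s = (\<Prod>j<s. 1 - a * t ^ j)"

definition phi21_coeff :: "complex \<Rightarrow> complex \<Rightarrow> complex \<Rightarrow> complex \<Rightarrow> nat \<Rightarrow> complex" where
  "phi21_coeff a b c t k = (qpoch a t k * qpoch b t k) / (qpoch c t k * qpoch t t k)"

text \<open>
  $Q_p^N\,{}_2\varphi_1(q^{-2N}, b; c; q^2; q^2 Q_{p-1}/Q_p)$; the series terminates since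
  $(q^{-2N};q^2)_k = 0$ for $k > N$.
\<close>

definition Qphi :: "complex \<Rightarrow> (nat \<Rightarrow> 'a::complex_algebra_1) \<Rightarrow> (nat \<Rightarrow> 'a) \<Rightarrow> nat \<Rightarrow> nat \<Rightarrow>
    complex \<Rightarrow> complex \<Rightarrow> 'a" where
  "Qphi q z w p N b c = (\<Sum>k\<le>N. (phi21_coeff (q powi (- 2 * int N)) b c (q\<^sup>2) k * (q\<^sup>2) ^ k) *\<^sub>C
     (Qpoly z w p ^ (N - k) * Qpoly z w (p - 1) ^ k))"

text \<open>
  \<open>t_poly q z w p a a' b b'\<close> is $t^{p;a,a'}_{b,b'}$, meant for \<open>2 \<le> p\<close>, \<open>b \<le> a\<close>, \<open>b' \<le> a'\<close>, so that
  no natural-number subtraction is truncated. The two formulas agree when \<open>a - b = a' - b'\<close>.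
\<close>

definition t_poly :: "complex \<Rightarrow> (nat \<Rightarrow> 'a::complex_algebra_1) \<Rightarrow> (nat \<Rightarrow> 'a) \<Rightarrow>
    nat \<Rightarrow> nat \<Rightarrow> nat \<Rightarrow> nat \<Rightarrow> nat \<Rightarrow> 'a" where
  "t_poly q z w p a a' b b' =
    (if a - b \<ge> a' - b' then
       (q powi (- 2 * int (a - b) * int (a' - b'))
         * qpoch (q powi (- 2 * int a' - 2 * int b - 2 * int p + 4)) (q\<^sup>2) (a' - b')
         / qpoch (q powi (- 2 * int a - 2 * int a' - 2 * int p + 4)) (q\<^sup>2) (a' - b')) *\<^sub>C
       (z p ^ ((a - b) - (a' - b'))
         * Qphi q z w p (a' - b') (q ^ (2 * (a + b' + p - 1))) (q ^ (2 * (b + b' + p - 1))))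
     else
       (q powi (- 2 * int (a - b) * int (a' - b'))
         * qpoch (q powi (- 2 * int a - 2 * int b' - 2 * int p + 4)) (q\<^sup>2) (a - b)
         / qpoch (q powi (- 2 * int a - 2 * int a' - 2 * int p + 4)) (q\<^sup>2) (a - b)) *\<^sub>C
       (Qphi q z w p (a - b) (q ^ (2 * (a' + b + p - 1))) (q ^ (2 * (b + b' + p - 1)))
         * w p ^ ((a' - b') - (a - b))))"

definition t_two :: "complex \<Rightarrow> (nat \<Rightarrow> 'a::complex_algebra_1) \<Rightarrow> (nat \<Rightarrow> 'a) \<Rightarrow>
    nat \<Rightarrow> nat \<Rightarrow> int \<Rightarrow> 'a" where
  "t_two q z w a a' c =
    (if c \<ge> 0 then t_poly q z w 2 a a' (nat c) 0 else t_poly q z w 2 a a' 0 (nat (- c)))"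

definition t_one :: "(nat \<Rightarrow> 'a::monoid_mult) \<Rightarrow> (nat \<Rightarrow> 'a) \<Rightarrow> int \<Rightarrow> 'a" where
  "t_one z w c = (if c \<ge> 0 then z 1 ^ nat c else w 1 ^ nat (- c))"

text \<open>
  The indices $({\bf m}, {\bf m}', m_1)$. The sequences are indexed by \<open>{2..n}\<close>, and
  extensionality makes them determined by their values there.
\<close>

definition patterns :: "nat \<Rightarrow> nat \<Rightarrow> nat \<Rightarrow> ((nat \<Rightarrow> nat) \<times> (nat \<Rightarrow> nat) \<times> int) set" where
  "patterns n m m' = {(M, M', c).
     M \<in> extensional {2..n} \<and> M' \<in> extensional {2..n} \<and>
     M n = m \<and> M' n = m' \<and>
     (\<forall>p\<in>{2..<n}. M p \<le> M (Suc p)) \<and> (\<forall>p\<in>{2..<n}. M' p \<le> M' (Suc p)) \<and>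
     c \<le> int (M 2) \<and> - int (M' 2) \<le> c}"

definition Xi :: "nat \<Rightarrow> complex \<Rightarrow> (nat \<Rightarrow> 'a::complex_algebra_1) \<Rightarrow> (nat \<Rightarrow> 'a) \<Rightarrow>
    (nat \<Rightarrow> nat) \<times> (nat \<Rightarrow> nat) \<times> int \<Rightarrow> 'a" where
  "Xi n q z w = (\<lambda>(M, M', c).
     prod_list (map (\<lambda>p. t_poly q z w p (M p) (M' p) (M (p - 1)) (M' (p - 1))) (rev [3..<Suc n]))
       * t_two q z w (M 2) (M' 2) c * t_one z w c)"


section \<open>The scalar product\<close>

text \<open>The involution of the $*$-algebra; it exists for real \<open>q\<close>.\<close>

definition qstar :: "nat \<Rightarrow> (nat \<Rightarrow> 'a::complex_algebra_1) \<Rightarrow> (nat \<Rightarrow> 'a) \<Rightarrow> 'a \<Rightarrow> 'a" where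
  "qstar n z w = (THE f. (\<forall>x y. f (x + y) = f x + f y) \<and> (\<forall>c x. f (c *\<^sub>C x) = cnj c *\<^sub>C f x) \<and>
     (\<forall>x y. f (x * y) = f y * f x) \<and> (\<forall>x. f (f x) = x) \<and>
     (\<forall>i\<in>{1..n}. f (z i) = w i \<and> f (w i) = z i))"

text \<open>\<open>\<tau>\<close> is a quotient map by the two-sided ideal generated by $Q - 1$.\<close>

definition sphere_quotient :: "nat \<Rightarrow> (nat \<Rightarrow> 'a::complex_algebra_1) \<Rightarrow> (nat \<Rightarrow> 'a) \<Rightarrow>
    ('a \<Rightarrow> 'b::complex_algebra_1) \<Rightarrow> bool" where
  "sphere_quotient n z w \<tau> \<longleftrightarrow>
     Vector_Spaces.linear scaleC scaleC \<tau> \<and> (\<forall>x y. \<tau> (x * y) = \<tau> x * \<tau> y) \<and> \<tau> 1 = 1 \<and>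
     surj \<tau> \<and> {x. \<tau> x = 0} = ideal_gen UNIV {Qpoly z w n - 1}"

definition sphere_component :: "nat \<Rightarrow> (nat \<Rightarrow> 'a::complex_algebra_1) \<Rightarrow> (nat \<Rightarrow> 'a) \<Rightarrow>
    ('a \<Rightarrow> 'b::complex_algebra_1) \<Rightarrow> (nat \<Rightarrow> int) \<Rightarrow> 'b set" where
  "sphere_component n z w \<tau> \<nu> =
     complex_vector.span ((\<lambda>u. \<tau> (word_val z w u)) ` {u \<in> words n. word_weight u = \<nu>})"

definition sphere_functional :: "nat \<Rightarrow> complex \<Rightarrow> (nat \<Rightarrow> 'a::complex_algebra_1) \<Rightarrow> (nat \<Rightarrow> 'a) \<Rightarrow>
    ('a \<Rightarrow> 'b::complex_algebra_1) \<Rightarrow> 'b \<Rightarrow> complex" where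
  "sphere_functional n q z w \<tau> = (THE h. Vector_Spaces.linear scaleC (*) h \<and>
     (\<forall>\<nu>. \<nu> \<noteq> (\<lambda>_. 0) \<longrightarrow> (\<forall>x\<in>sphere_component n z w \<tau> \<nu>. h x = 0)) \<and>
     (\<forall>\<mu>. h (\<tau> (mono_up n w \<mu> * mono_down n z \<mu>)) =
        (\<Prod>i = 1..n. qpoch (q\<^sup>2) (q\<^sup>2) (\<mu> i)) * qpoch (q\<^sup>2) (q\<^sup>2) (n - 1)
          / qpoch (q\<^sup>2) (q\<^sup>2) ((\<Sum>i = 1..n. \<mu> i) + n - 1)))"

text \<open>The $*$-structure of the quotient is the induced one, $(\tau p)^* = \tau(p^*)$.\<close>

definition scalar_prod :: "nat \<Rightarrow> complex \<Rightarrow> (nat \<Rightarrow> 'a::complex_algebra_1) \<Rightarrow> (nat \<Rightarrow> 'a) \<Rightarrow>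
    ('a \<Rightarrow> 'b::complex_algebra_1) \<Rightarrow> 'a \<Rightarrow> 'a \<Rightarrow> complex" where
  "scalar_prod n q z w \<tau> p1 p2 = sphere_functional n q z w \<tau> (\<tau> p1 * \<tau> (qstar n z w p2))"

end

theory Submission
  imports Defs "HOL-Computational_Algebra.Polynomial"
begin

text \<open>
  Put $t = q^2$. Let $y$ be harmonic in the variables of index less than $p$. The Laplacian of
  $Q_p^{N-k} z_p^r Q_{p-1}^k y$ (or the analogue with $w_p^r$) is a combination of two elements of the
  same shape, so that a combination over $k$ is harmonic if and only if its coefficients satisfy a
  first-order recursion; the solution is the terminating series in the definition of $t^p$. By
  induction on $p$, the products $Q_p^k\,\Xi$ span, because $z_p$-, $w_p$-monomials can be rewritten
  triangularly, and the $\Xi$ are independent, because their leading terms in $z_p, w_p$ are. Since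
  $\Delta_q Q^k h$ is a nonzero multiple of $Q^{k-1} h$ for harmonic $h$, a harmonic element only
  involves $k = 0$.

  For the orthogonality, the functional $H_p$ on the algebra in the first $p$ pairs of variables
  satisfies $H_p(Q_p x) = H_p(x)$, and on elements of degree $d$ of the smaller algebra it is
  $(1 - t^{p-1}) / (1 - t^{d+p-1})$ times $H_{p-1}$. Hence inserting $Q_{p-1}^i$ between the powers of
  $z_p$ and $w_p$ gives a constant multiple of $1 / (t^{i+\beta}; t)_{r+1}$. These are the moments for
  which the series in $t^p$, little q-Jacobi polynomials, are orthogonal by the q-binomial theorem.
\<close>

text \<open>The difference operators and the functional are given by definite descriptions, so both
  orders of monomials must first be shown to be bases of the presented algebra. Spanning is
  reordering. Independence is the real obstacle: it is read off from a representation by weighted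
  shifts whose free parameters separate the monomials. The operators and functionals are then
  treated as arbitrary maps satisfying the defining formulas. The same derivatives thus serve every
  smaller number of variables, and the induction on p never has to compare two descriptions. The
  engine is that Q_p is central in the algebra of the first p pairs and that its commutator with the
  Laplacian acts on bidegree (a, b) as the scalar q^(p-1) [a+b+p], a q-Euler identity in disguise.
  Exchanging z and w together with q and 1/q is a symmetry up to rescaling and halves the reordering
  work. The functional is studied on the algebra itself; it passes to the sphere because it vanishes
  on every multiple of Q - 1.\<close>

interpretation complex_vector_pair: vector_space_pair
  "scaleC :: complex \<Rightarrow> 'a \<Rightarrow> 'a::complex_algebra_1" "scaleC :: complex \<Rightarrow> 'b \<Rightarrow> 'b::complex_algebra_1"
  ..

lemmas scaleC_mult_simps = mult_scaleC_left mult_scaleC_right scaleC_scaleC scaleC_one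

lemma scaleC_power: "(a *\<^sub>C x) ^ k = (a ^ k) *\<^sub>C (x ^ k)" for x :: "'a::complex_algebra_1"
  by (induction k) (simp_all add: scaleC_mult_simps)

lemma scaleC_diff_right: "a *\<^sub>C (x - y) = a *\<^sub>C x - a *\<^sub>C y" for x :: "'a::complex_algebra_1"
  by (rule complex_vector.scale_right_diff_distrib)

lemma scaleC_sum_right: "a *\<^sub>C sum f S = (\<Sum>i\<in>S. a *\<^sub>C f i)"
  for f :: "'b \<Rightarrow> 'a::complex_algebra_1"
  by (rule complex_vector.scale_sum_right)

section \<open>q-commuting elements and monomials\<close>

text \<open>Except for \<open>w k\<close> with \<open>z k\<close>, any two generators commute up to
  a scalar. Keeping the scalar as an explicit parameter lets the factors multiply along products and
  powers.\<close>

definition q_commute :: "complex \<Rightarrow> 'a::complex_algebra_1 \<Rightarrow> 'a \<Rightarrow> bool" where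
  "q_commute c x y \<longleftrightarrow> x * y = c *\<^sub>C (y * x)"

lemma q_commute_mult_right:
  "q_commute c x y \<Longrightarrow> q_commute d x y' \<Longrightarrow> q_commute (c * d) x (y * y')"
proof -
  assume a: "q_commute c x y" "q_commute d x y'"
  have "x * (y * y') = (x * y) * y'" by (simp add: mult.assoc)
  also have "\<dots> = c *\<^sub>C (y * (x * y'))" using a by (simp add: q_commute_def scaleC_mult_simps mult.assoc)
  also have "\<dots> = (c * d) *\<^sub>C (y * y' * x)" using a by (simp add: q_commute_def scaleC_mult_simps mult.assoc)
  finally show ?thesis by (simp add: q_commute_def)
qed

lemma q_commute_mult_left:
  "q_commute c x y \<Longrightarrow> q_commute d x' y \<Longrightarrow> q_commute (c * d) (x * x') y"
proof -
  assume a: "q_commute c x y" "q_commute d x' y"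
  have "x * x' * y = x * (x' * y)" by (simp add: mult.assoc)
  also have "\<dots> = d *\<^sub>C ((x * y) * x')"
    using a(2) by (simp add: q_commute_def scaleC_mult_simps mult.assoc)
  also have "\<dots> = (c * d) *\<^sub>C (y * (x * x'))"
    using a(1) by (simp only: q_commute_def mult_scaleC_left scaleC_scaleC mult.commute[of d c] mult.assoc)
  finally show ?thesis by (simp add: q_commute_def)
qed

lemma q_commute_1 [simp]: "q_commute 1 x 1" "q_commute 1 1 x"
  by (simp_all add: q_commute_def)

lemma q_commute_0 [simp]: "q_commute c x 0" "q_commute c 0 x"
  by (simp_all add: q_commute_def)

lemma q_commute_refl [simp]: "q_commute 1 x x"
  by (simp add: q_commute_def)

lemma q_commute_power_right: "q_commute c x y \<Longrightarrow> q_commute (c ^ k) x (y ^ k)"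
  by (induction k) (simp_all add: q_commute_mult_right)

lemma q_commute_power_left: "q_commute c x y \<Longrightarrow> q_commute (c ^ k) (x ^ k) y"
  by (induction k) (simp_all add: q_commute_mult_left)

lemma q_commute_add_right: "q_commute c x y \<Longrightarrow> q_commute c x y' \<Longrightarrow> q_commute c x (y + y')"
  by (simp add: q_commute_def algebra_simps scaleC_add_right)

lemma q_commute_add_left: "q_commute c x y \<Longrightarrow> q_commute c x' y \<Longrightarrow> q_commute c (x + x') y"
  by (simp add: q_commute_def algebra_simps scaleC_add_right)

lemma q_commute_sum_right: "(\<And>i. i \<in> S \<Longrightarrow> q_commute c x (f i)) \<Longrightarrow> q_commute c x (sum f S)"
  by (induction S rule: infinite_finite_induct) (simp_all add: q_commute_add_right)

lemma q_commute_sum_left: "(\<And>i. i \<in> S \<Longrightarrow> q_commute c (f i) y) \<Longrightarrow> q_commute c (sum f S) y"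
  by (induction S rule: infinite_finite_induct) (simp_all add: q_commute_add_left)

lemma q_commute_scale_right: "q_commute c x y \<Longrightarrow> q_commute c x (a *\<^sub>C y)"
  by (simp add: q_commute_def scaleC_mult_simps mult.commute)

lemma q_commute_scale_left: "q_commute c x y \<Longrightarrow> q_commute c (a *\<^sub>C x) y"
  by (simp add: q_commute_def scaleC_mult_simps mult.commute)

lemma q_commute_sym: "q_commute c x y \<Longrightarrow> c \<noteq> 0 \<Longrightarrow> q_commute (inverse c) y x"
  by (simp add: q_commute_def scaleC_mult_simps)

lemma q_commute_span_right:
  assumes "\<And>y. y \<in> S \<Longrightarrow> q_commute c x y" "y \<in> complex_vector.span S"
  shows "q_commute c x y"
  using assms(2)
  by (induction rule: complex_vector.span_induct_alt)
     (simp_all add: q_commute_add_right q_commute_scale_right assms(1))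

lemma q_commute_mult_right':
  "q_commute c x y \<Longrightarrow> q_commute d x y' \<Longrightarrow> e = c * d \<Longrightarrow> q_commute e x (y * y')"
  using q_commute_mult_right by blast

lemma q_commute_mult_left':
  "q_commute c x y \<Longrightarrow> q_commute d x' y \<Longrightarrow> e = c * d \<Longrightarrow> q_commute e (x * x') y"
  using q_commute_mult_left by blast

lemma mono_up_0 [simp]: "mono_up 0 x r = 1"
  by (simp add: mono_up_def)

lemma mono_up_Suc: "mono_up (Suc m) x r = mono_up m x r * x (Suc m) ^ r (Suc m)"
  by (simp add: mono_up_def)

lemma mono_down_0 [simp]: "mono_down 0 x r = 1"
  by (simp add: mono_down_def)

lemma mono_down_Suc: "mono_down (Suc m) x r = x (Suc m) ^ r (Suc m) * mono_down m x r"
  by (simp add: mono_down_def)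

lemma mono_up_cong: "(\<And>i. i \<in> {1..m} \<Longrightarrow> r i = s i) \<Longrightarrow> mono_up m x r = mono_up m x s"
  by (induction m) (simp_all add: mono_up_Suc)

lemma mono_down_cong: "(\<And>i. i \<in> {1..m} \<Longrightarrow> r i = s i) \<Longrightarrow> mono_down m x r = mono_down m x s"
  by (induction m) (simp_all add: mono_down_Suc)

lemma mono_up_upd:
  fixes r :: "nat \<Rightarrow> nat" and j m :: nat
  shows "m < j \<Longrightarrow> mono_up m x (r(j := a)) = mono_up m x r"
  by (rule mono_up_cong) auto

lemma mono_down_upd:
  fixes r :: "nat \<Rightarrow> nat" and j m :: nat
  shows "m < j \<Longrightarrow> mono_down m x (r(j := a)) = mono_down m x r"
  by (rule mono_down_cong) auto

lemma mono_up_mono: "p \<le> m \<Longrightarrow> (\<And>i. i \<in> {p<..m} \<Longrightarrow> r i = 0) \<Longrightarrow> mono_up m x r = mono_up p x r"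
proof (induction m)
  case (Suc m)
  then show ?case by (cases "p = Suc m") (auto simp: mono_up_Suc)
qed simp

lemma mono_up_Suc_upd:
  fixes r :: "nat \<Rightarrow> nat" and j m :: nat
  shows
  "j \<noteq> Suc m \<Longrightarrow> mono_up (Suc m) x (r(j := a)) = mono_up m x (r(j := a)) * x (Suc m) ^ r (Suc m)"
  "mono_up (Suc m) x (r(Suc m := a)) = mono_up m x r * x (Suc m) ^ a"
  by (simp_all add: mono_up_Suc mono_up_upd)

lemma mono_down_Suc_upd:
  fixes r :: "nat \<Rightarrow> nat" and j m :: nat
  shows
  "j \<noteq> Suc m \<Longrightarrow> mono_down (Suc m) x (r(j := a)) = x (Suc m) ^ r (Suc m) * mono_down m x (r(j := a))"
  "mono_down (Suc m) x (r(Suc m := a)) = x (Suc m) ^ a * mono_down m x r"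
  by (simp_all add: mono_down_Suc mono_down_upd)

lemma mono_up_zero: "(\<And>i. i \<in> {1..m} \<Longrightarrow> r i = 0) \<Longrightarrow> mono_up m x r = 1"
  by (induction m) (simp_all add: mono_up_Suc)

lemma q_commute_mono_up:
  assumes "\<And>i. i \<in> {1..m} \<Longrightarrow> q_commute c y (x i)" "c \<noteq> 0"
  shows "q_commute (c powi (\<Sum>k\<in>{1..m}. int (r k))) y (mono_up m x r)"
  using assms
proof (induction m)
  case (Suc m)
  have 1: "q_commute (c ^ r (Suc m)) y (x (Suc m) ^ r (Suc m))"
    using Suc.prems by (intro q_commute_power_right) simp
  have 2: "q_commute (c powi (\<Sum>k\<in>{1..m}. int (r k))) y (mono_up m x r)"
    using Suc by simp
  show ?case
    unfolding mono_up_Suc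
    by (rule q_commute_mult_right'[OF 2 1]) (simp add: power_int_add Suc.prems)
qed simp

lemma mono_up_scale:
  "mono_up m (\<lambda>k. a k *\<^sub>C x k) r = (\<Prod>k\<in>{1..m}. a k ^ r k) *\<^sub>C mono_up m x r"
  for x :: "nat \<Rightarrow> 'a::complex_algebra_1"
  by (induction m) (simp_all add: mono_up_Suc scaleC_power scaleC_mult_simps prod.nat_ivl_Suc' mult_ac)

text \<open>Both halves of the generators fit, the \<open>z i\<close> with constant \<open>q\<close>
  and the \<open>w i\<close> with constant \<open>inverse q\<close>, so reordering inside a half is
  done once.\<close>

locale q_commuting_family =
  fixes n :: nat and c :: complex and x :: "nat \<Rightarrow> 'a::complex_algebra_1"
  assumes c0: "c \<noteq> 0"
    and comm: "1 \<le> i \<Longrightarrow> i < j \<Longrightarrow> j \<le> n \<Longrightarrow> q_commute c (x i) (x j)"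
begin

text \<open>The new factor travels right to position \<open>j\<close>, and each factor it passes
  contributes \<open>inverse c\<close>; hence the integer exponent.\<close>

lemma left_mult_mono_up:
  fixes r :: "nat \<Rightarrow> nat" and j m :: nat
  assumes "j \<in> {1..m}" "m \<le> n"
  shows "x j * mono_up m x r = (c powi (- (\<Sum>k\<in>{1..<j}. int (r k)))) *\<^sub>C mono_up m x (r(j := Suc (r j)))"
  using assms
proof (induction m)
  case (Suc m)
  have mn: "m \<le> n" using Suc.prems by simp
  show ?case
  proof (cases "j \<le> m")
    case True
    then have jm: "j \<in> {1..m}" using Suc.prems by simp
    have jm': "j \<noteq> Suc m" using True by simp
    show ?thesis
      by (simp only: Suc.IH[OF jm mn] mono_up_Suc_upd(1)[OF jm'] mono_up_Suc[of m x r] mult_scaleC_left flip: mult.assoc)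
  next
    case False
    then have j: "j = Suc m" using Suc.prems by auto
    have "q_commute (inverse c powi (\<Sum>k\<in>{1..m}. int (r k))) (x j) (mono_up m x r)"
      using Suc.prems j c0 by (intro q_commute_mono_up q_commute_sym comm) auto
    then have "x j * mono_up m x r = (c powi (- (\<Sum>k\<in>{1..<j}. int (r k)))) *\<^sub>C (mono_up m x r * x j)"
      unfolding j by (simp only: q_commute_def power_int_minus power_int_inverse atLeastLessThanSuc_atLeastAtMost)
    then have "x j * mono_up (Suc m) x r
        = (c powi (- (\<Sum>k\<in>{1..<j}. int (r k)))) *\<^sub>C (mono_up m x r * x j * x j ^ r j)"
      by (simp only: j mono_up_Suc mult_scaleC_left flip: mult.assoc)
    then show ?thesis
      unfolding j mono_up_Suc_upd(2) by (simp only: power_Suc mult.assoc)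
  qed
qed simp

lemma right_mult_mono_up:
  fixes r :: "nat \<Rightarrow> nat" and j m :: nat
  assumes "j \<in> {1..m}" "m \<le> n"
  shows "mono_up m x r * x j = (c powi (- (\<Sum>k\<in>{j<..m}. int (r k)))) *\<^sub>C mono_up m x (r(j := Suc (r j)))"
  using assms
proof (induction m)
  case (Suc m)
  have mn: "m \<le> n" using Suc.prems by simp
  show ?case
  proof (cases "j \<le> m")
    case True
    then have jm: "j \<in> {1..m}" using Suc.prems by simp
    have jm': "j \<noteq> Suc m" using True by simp
    have "q_commute (inverse c ^ r (Suc m)) (x (Suc m) ^ r (Suc m)) (x j)"
      using Suc.prems True c0 by (intro q_commute_power_left q_commute_sym comm) auto
    then have "mono_up (Suc m) x r * x j
        = inverse c ^ r (Suc m) *\<^sub>C ((mono_up m x r * x j) * x (Suc m) ^ r (Suc m))"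
      by (simp add: mono_up_Suc q_commute_def scaleC_mult_simps mult.assoc)
    also have "\<dots> = (inverse c ^ r (Suc m) * c powi (- (\<Sum>k\<in>{j<..m}. int (r k)))) *\<^sub>C mono_up (Suc m) x (r(j := Suc (r j)))"
      by (simp only: Suc.IH[OF jm mn] mono_up_Suc_upd(1)[OF jm'] mult_scaleC_left scaleC_scaleC)
    also have "{j<..Suc m} = insert (Suc m) {j<..m}" using True by auto
    then have "inverse c ^ r (Suc m) * c powi (- (\<Sum>k\<in>{j<..m}. int (r k)))
       = c powi (- (\<Sum>k\<in>{j<..Suc m}. int (r k)))"
      using c0 by (simp add: power_int_minus power_int_add power_inverse del: minus_add_distrib)
    finally show ?thesis .
  next
    case False
    then have j: "j = Suc m" using Suc.prems by auto
    show ?thesis unfolding j mono_up_Suc_upd(2) mono_up_Suc[of m x r]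
      by (simp add: mult.assoc power_commutes scaleC_one)
  qed
qed simp

lemma left_mult_mono_down:
  fixes r :: "nat \<Rightarrow> nat" and j m :: nat
  assumes "j \<in> {1..m}" "m \<le> n"
  shows "x j * mono_down m x r = (c powi (\<Sum>k\<in>{j<..m}. int (r k))) *\<^sub>C mono_down m x (r(j := Suc (r j)))"
  using assms
proof (induction m)
  case (Suc m)
  have mn: "m \<le> n" using Suc.prems by simp
  show ?case
  proof (cases "j \<le> m")
    case True
    then have jm: "j \<in> {1..m}" using Suc.prems by simp
    have jm': "j \<noteq> Suc m" using True by simp
    have "q_commute (c ^ r (Suc m)) (x j) (x (Suc m) ^ r (Suc m))"
      using Suc.prems True c0 by (intro q_commute_power_right comm) auto
    then have "x j * mono_down (Suc m) x r = c ^ r (Suc m) *\<^sub>C (x (Suc m) ^ r (Suc m) * (x j * mono_down m x r))"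
      by (simp add: mono_down_Suc q_commute_def scaleC_mult_simps flip: mult.assoc)
    also have "\<dots> = (c ^ r (Suc m) * c powi (\<Sum>k\<in>{j<..m}. int (r k))) *\<^sub>C mono_down (Suc m) x (r(j := Suc (r j)))"
      by (simp only: Suc.IH[OF jm mn] mono_down_Suc_upd(1)[OF jm'] mult_scaleC_right scaleC_scaleC)
    also have "{j<..Suc m} = insert (Suc m) {j<..m}" using True by auto
    then have "c ^ r (Suc m) * c powi (\<Sum>k\<in>{j<..m}. int (r k)) = c powi (\<Sum>k\<in>{j<..Suc m}. int (r k))"
      using c0 by (simp add: power_int_add)
    finally show ?thesis .
  next
    case False
    then have j: "j = Suc m" using Suc.prems by auto
    show ?thesis unfolding j mono_down_Suc_upd(2) mono_down_Suc[of m x r]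
      by (simp add: mult.assoc scaleC_one)
  qed
qed simp

text \<open>Reversing the order costs only a nonzero scalar. The functional is prescribed on
  descending \<open>z\<close>-monomials, while the bases use ascending ones.\<close>

lemma mono_down_eq_mono_up:
  assumes "m \<le> n"
  shows "\<exists>d. d \<noteq> 0 \<and> mono_down m x r = d *\<^sub>C mono_up m x r"
  using assms
proof (induction m)
  case 0
  show ?case by (rule exI[of _ 1]) (simp add: scaleC_mult_simps)
next
  case (Suc m)
  then obtain d where d: "d \<noteq> 0" "mono_down m x r = d *\<^sub>C mono_up m x r" by auto
  let ?e = "(inverse c powi (\<Sum>k\<in>{1..m}. int (r k))) ^ r (Suc m)"
  have "q_commute ?e (x (Suc m) ^ r (Suc m)) (mono_up m x r)"
    using Suc.prems c0 by (intro q_commute_power_left q_commute_mono_up q_commute_sym comm) auto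
  then show ?case
    using d c0 by (intro exI[of _ "d * ?e"])
      (simp add: mono_down_Suc mono_up_Suc q_commute_def scaleC_mult_simps)
qed

end

section \<open>The defining relations\<close>

text \<open>Only the relations are assumed, not that they are all relations. This is stable under
  shrinking \<open>n\<close> and under the exchange of \<open>z\<close> and \<open>w\<close>;
  freeness enters separately as \<open>zw_free\<close>.\<close>

locale q_weyl =
  fixes n :: nat and q :: complex and z w :: "nat \<Rightarrow> 'a::complex_algebra_1"
  assumes q0: "q \<noteq> 0"
    and not_root: "k > 0 \<Longrightarrow> q ^ k \<noteq> 1"
    and zz: "1 \<le> i \<Longrightarrow> i < j \<Longrightarrow> j \<le> n \<Longrightarrow> q_commute q (z i) (z j)"
    and ww: "1 \<le> i \<Longrightarrow> i < j \<Longrightarrow> j \<le> n \<Longrightarrow> q_commute (inverse q) (w i) (w j)"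
    and wz: "i \<in> {1..n} \<Longrightarrow> j \<in> {1..n} \<Longrightarrow> i \<noteq> j \<Longrightarrow> q_commute q (w j) (z i)"
    and wzk: "k \<in> {1..n} \<Longrightarrow> w k * z k = z k * w k + (1 - q\<^sup>2) *\<^sub>C Qpoly z w (k - 1)"
begin

abbreviation Q where "Q \<equiv> Qpoly z w"

sublocale zf: q_commuting_family n q z
  by unfold_locales (simp_all add: q0 zz)

sublocale wf: q_commuting_family n "inverse q" w
  by unfold_locales (simp_all add: q0 ww)

lemma q_weyl_mono: "p \<le> n \<Longrightarrow> q_weyl p q z w"
  by unfold_locales (auto simp: q0 not_root zz ww wz wzk)

lemma zz': "1 \<le> i \<Longrightarrow> i < j \<Longrightarrow> j \<le> n \<Longrightarrow> q_commute (inverse q) (z j) (z i)"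
  by (intro q_commute_sym zz q0)

lemma ww': "1 \<le> i \<Longrightarrow> i < j \<Longrightarrow> j \<le> n \<Longrightarrow> q_commute q (w j) (w i)"
  using q_commute_sym[OF ww] q0 by force

lemma Q_0 [simp]: "Q 0 = 0"
  by (simp add: Qpoly_def)

lemma Q_Suc: "Q (Suc j) = Q j + z (Suc j) * w (Suc j)"
  by (simp add: Qpoly_def)

lemma z_mult_w: "k \<ge> 1 \<Longrightarrow> z k * w k = Q k - Q (k - 1)"
  by (cases k) (simp_all add: Q_Suc)

text \<open>Together with \<open>z_mult_w\<close> this turns the one relation that is not a
  q-commutation into linear expressions in \<open>Q k\<close> and \<open>Q (k - 1)\<close>.\<close>

lemma w_mult_z: "k \<in> {1..n} \<Longrightarrow> w k * z k = Q k - q\<^sup>2 *\<^sub>C Q (k - 1)"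
  by (simp add: wzk z_mult_w complex_vector.scale_left_diff_distrib)

lemma Q_z_less: 
  assumes "j < k" "k \<le> n"
  shows "q_commute (q\<^sup>2) (Q j) (z k)"
  unfolding Qpoly_def
  by (intro q_commute_sum_left q_commute_mult_left'[of q _ _ q] zz wz) 
    (use assms in \<open>auto simp: power2_eq_square\<close>)

lemma w_Q_less: 
  assumes "j < k" "k \<le> n"
  shows "q_commute (q\<^sup>2) (w k) (Q j)"
  unfolding Qpoly_def
  by (intro q_commute_sum_right q_commute_mult_right'[of q _ _ q] ww' wz) 
    (use assms in \<open>auto simp: power2_eq_square\<close>)

text \<open>At \<open>j = k\<close> the factor \<open>q^2\<close> from moving
  \<open>Q (k - 1)\<close> past \<open>z k\<close> is compensated exactly by the term with
  \<open>1 - q^2\<close> in the relation for \<open>w k * z k\<close>. Each further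
  \<open>z i * w i\<close> contributes \<open>inverse q * q\<close>.\<close>

lemma Q_z_ge:
  assumes "k \<in> {1..n}" "k \<le> j" "j \<le> n"
  shows "q_commute 1 (Q j) (z k)"
  using assms(2,3)
proof (induction j rule: dec_induct)
  case base
  have "Q (k-1) * z k = q\<^sup>2 *\<^sub>C (z k * Q (k-1))"
    using Q_z_less[of "k-1" k] assms(1) by (simp add: q_commute_def)
  moreover have "Q k = Q (k-1) + z k * w k" using assms(1) by (simp add: z_mult_w)
  moreover have "z k * w k * z k = z k * (w k * z k)" by (rule mult.assoc)
  ultimately show ?case using assms(1)
    by (simp add: q_commute_def distrib_left distrib_right wzk scaleC_mult_simps
        complex_vector.scale_left_diff_distrib right_diff_distrib mult.assoc)
next
  case (step j)
  have "q_commute (inverse q) (z (Suc j)) (z k)" "q_commute q (w (Suc j)) (z k)"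
    using step assms by (auto intro!: zz' wz)
  then have "q_commute 1 (z (Suc j) * w (Suc j)) (z k)"
    by (rule q_commute_mult_left') (use q0 in simp)
  then show ?case using step by (simp add: Q_Suc q_commute_add_left)
qed

lemma w_Q_ge:
  assumes "k \<in> {1..n}" "k \<le> j" "j \<le> n"
  shows "q_commute 1 (w k) (Q j)"
  using assms(2,3)
proof (induction j rule: dec_induct)
  case base
  have "w k * Q (k-1) = q\<^sup>2 *\<^sub>C (Q (k-1) * w k)"
    using w_Q_less[of "k-1" k] assms(1) by (simp add: q_commute_def)
  moreover have "Q k = Q (k-1) + z k * w k" using assms(1) by (simp add: z_mult_w)
  moreover have "w k * (z k * w k) = (w k * z k) * w k" by (simp add: mult.assoc)
  ultimately show ?case using assms(1)
    by (simp add: q_commute_def distrib_left distrib_right wzk scaleC_mult_simps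
        complex_vector.scale_left_diff_distrib left_diff_distrib)
next
  case (step j)
  have "q_commute (inverse q) (w k) (w (Suc j))" "q_commute q (w k) (z (Suc j))"
    using step assms by (auto intro!: ww wz)
  then have "q_commute 1 (w k) (z (Suc j) * w (Suc j))"
    by (intro q_commute_mult_right'[of q _ _ "inverse q"]) (use q0 in auto)
  then show ?case using step by (simp add: Q_Suc q_commute_add_right)
qed

lemma Q_w_ge:
  assumes "k \<in> {1..n}" "k \<le> j" "j \<le> n"
  shows "q_commute 1 (Q j) (w k)"
  using q_commute_sym[OF w_Q_ge[OF assms]] by simp

text \<open>The algebra with parameter \<open>q\<close> is also the algebra with parameter \<open>inverse q\<close> with the roles
  of \<open>z\<close> and \<open>w\<close> exchanged, up to a rescaling that also rescales each \<open>Q j\<close>.\<close>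

definition zd where "zd k = (q powi (- 2 * int k)) *\<^sub>C w k"

text \<open>The scalars in \<open>zd\<close> are chosen so that this sum telescopes: by
  \<open>w_mult_z\<close> the next summand is a multiple of \<open>Q (Suc j) - q^2 Q j\<close>,
  whose second part cancels the previous value.\<close>

lemma Qpoly_dual: "j \<le> n \<Longrightarrow> Qpoly zd z j = (q powi (- 2 * int j)) *\<^sub>C Q j"
proof (induction j)
  case (Suc j)
  have "Qpoly zd z (Suc j) = Qpoly zd z j + zd (Suc j) * z (Suc j)"
    by (simp add: Qpoly_def)
  also have "\<dots> = (q powi (- 2 * int j)) *\<^sub>C Q j + (q powi (- 2 * int (Suc j))) *\<^sub>C (Q (Suc j) - q\<^sup>2 *\<^sub>C Q j)"
    using Suc by (simp add: zd_def[of "Suc j"] mult_scaleC_left w_mult_z)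
  also have "\<dots> = (q powi (- 2 * int (Suc j))) *\<^sub>C Q (Suc j)"
  proof -
    have "q powi (- 2 * int (Suc j)) * q powi 2 = q powi (- 2 * int j)"
      by (subst power_int_add[symmetric]) (auto simp: q0)
    then show ?thesis unfolding scaleC_diff_right scaleC_scaleC by simp
  qed
  finally show ?case .
qed (simp add: Qpoly_def)

text \<open>Both products of \<open>z k\<close> and \<open>w k\<close> are linear in
  \<open>Q k\<close> and \<open>Q (k - 1)\<close>, so the relation for the exchanged pair is an
  identity of scalars. The others are the old q-commutations, the one between the two families read
  backwards.\<close>

lemma dual: "q_weyl n (inverse q) zd z"
proof
  show "inverse q ^ k \<noteq> 1" if "k > 0" for k
    using not_root[OF that] by (simp add: power_inverse)
  fix k assume k: "k \<in> {1..n}"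
  then obtain j where j: "k = Suc j" by (cases k) auto
  define e where "e = q powi (- 2 * int k)"
  have "z k * zd k = e *\<^sub>C (Q k - Q j)"
    using k by (simp add: zd_def z_mult_w scaleC_mult_simps j e_def)
  moreover have "zd k * z k = e *\<^sub>C (Q k - q\<^sup>2 *\<^sub>C Q j)"
    using k by (simp add: zd_def w_mult_z scaleC_mult_simps j e_def)
  moreover have "(1 - (inverse q)\<^sup>2) *\<^sub>C Qpoly zd z j = (e * (q\<^sup>2 - 1)) *\<^sub>C Q j"
  proof -
    have "q powi (- 2 * int j) = e * q powi 2"
      unfolding e_def by (subst power_int_add[symmetric]) (auto simp: q0 j)
    then have 1: "q powi (- 2 * int j) = e * q\<^sup>2" by simp
    have 2: "(inverse q)\<^sup>2 * q\<^sup>2 = 1"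
      by (simp add: q0 flip: power_mult_distrib)
    have *: "(1 - a) * (e * b) = e * (b - a * b)" for a b :: complex
      by (simp add: algebra_simps)
    have "(1 - (inverse q)\<^sup>2) * (e * q\<^sup>2) = e * (q\<^sup>2 - (inverse q)\<^sup>2 * q\<^sup>2)"
      by (rule *)
    also have "\<dots> = e * (q\<^sup>2 - 1)" by (simp only: 2)
    finally have 3: "(1 - (inverse q)\<^sup>2) * (e * q\<^sup>2) = e * (q\<^sup>2 - 1)" .
    have "Qpoly zd z j = (e * q\<^sup>2) *\<^sub>C Q j"
      using Qpoly_dual[of j] k j 1 by simp
    then show ?thesis by (simp only: scaleC_scaleC 3)
  qed
  ultimately show "z k * zd k = zd k * z k + (1 - (inverse q)\<^sup>2) *\<^sub>C Qpoly zd z (k - 1)"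
    by (simp only: j diff_Suc_1) (simp add: scaleC_diff_right scaleC_scaleC right_diff_distrib
        complex_vector.scale_left_diff_distrib)
qed (auto simp: q0 zd_def zz ww intro!: q_commute_scale_left q_commute_scale_right q_commute_sym[OF wz])

lemma mono_up_zd: "\<exists>d. d \<noteq> 0 \<and> mono_up m zd r = d *\<^sub>C mono_up m w r"
  by (rule exI[of _ "\<Prod>k\<in>{1..m}. (q powi (- 2 * int k)) ^ r k"])
     (simp add: zd_def[abs_def] mono_up_scale q0)

text \<open>Moving \<open>w k\<close> past one factor after another produces \<open>1 - q^2\<close>
  times a geometric sum in \<open>q^2\<close>, that is \<open>1 - q^(2a)\<close>. This vanishes at
  \<open>a = 0\<close>, so the truncated exponent \<open>a - 1\<close> does no harm.\<close>

lemma w_power_z: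
  assumes "k \<in> {1..n}"
  shows "w k * z k ^ a = z k ^ a * w k + (1 - q powi (2 * int a)) *\<^sub>C (z k ^ (a - 1) * Q (k - 1))"
proof (induction a)
  case (Suc a)
  have Qz: "Q (k-1) * z k = q\<^sup>2 *\<^sub>C (z k * Q (k-1))"
    using Q_z_less[of "k-1" k] assms(1) by (simp add: q_commute_def)
  have p: "q powi (2 * int (Suc a)) = q powi (2 * int a) * q\<^sup>2"
    using power_int_add[of q "2 * int a" 2] q0 by (simp add: algebra_simps)
  have z1: "(1 - q powi (2 * int a)) *\<^sub>C (z k ^ (a - 1) * z k * Q (k - 1)) = (1 - q powi (2 * int a)) *\<^sub>C (z k ^ a * Q (k - 1))"
    by (cases a) (simp_all add: power_commutes)
  have "w k * z k ^ Suc a = (w k * z k ^ a) * z k" by (simp add: power_commutes mult.assoc)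
  also have "\<dots> = z k ^ a * (w k * z k) + (1 - q powi (2 * int a)) *\<^sub>C (z k ^ (a - 1) * (Q (k - 1) * z k))"
    by (simp only: Suc distrib_right mult.assoc mult_scaleC_left)
  also have "\<dots> = z k ^ Suc a * w k + (1 - q\<^sup>2) *\<^sub>C (z k ^ a * Q (k - 1))
     + q\<^sup>2 *\<^sub>C ((1 - q powi (2 * int a)) *\<^sub>C (z k ^ (a - 1) * z k * Q (k - 1)))"
    by (simp only: wzk[OF assms] Qz distrib_left mult_scaleC_right scaleC_scaleC mult.assoc[symmetric] power_Suc2
        mult.commute[of "q\<^sup>2"])
  also have "\<dots> = z k ^ Suc a * w k + ((1 - q\<^sup>2) + q\<^sup>2 * (1 - q powi (2 * int a))) *\<^sub>C (z k ^ a * Q (k - 1))"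
    by (simp only: z1 scaleC_scaleC scaleC_add_left add.assoc)
  finally show ?case unfolding p by (simp add: right_diff_distrib)
qed simp

lemma w_mono_up_z_gt:
  assumes "m < j" "j \<le> n"
  shows "q_commute (q powi (\<Sum>k\<in>{1..m}. int (r k))) (w j) (mono_up m z r)"
  using assms q0 by (intro q_commute_mono_up wz) auto

text \<open>Each \<open>z k\<close> with \<open>k \<noteq> j\<close> gives one factor
  \<open>q\<close> to a passing \<open>w j\<close>. The correction \<open>Q (j - 1)\<close>, born at
  position \<open>j\<close>, gives \<open>q^2\<close> for every later \<open>z k\<close>, whence the
  doubled tail sum.\<close>

lemma w_mono_up_z:
  fixes r :: "nat \<Rightarrow> nat" and j m :: nat
  assumes "j \<in> {1..m}" "m \<le> n"
  shows "w j * mono_up m z r =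
    (q powi ((\<Sum>k\<in>{1..<j}. int (r k)) + (\<Sum>k\<in>{j<..m}. int (r k)))) *\<^sub>C (mono_up m z r * w j)
    + ((1 - q powi (2 * int (r j))) * q powi ((\<Sum>k\<in>{1..<j}. int (r k)) + 2 * (\<Sum>k\<in>{j<..m}. int (r k))))
      *\<^sub>C (mono_up m z (r(j := r j - 1)) * Q (j - 1))"
  using assms
proof (induction m)
  case (Suc m)
  have mn: "m \<le> n" using Suc.prems by simp
  show ?case
  proof (cases "j \<le> m")
    case True
    then have jm: "j \<in> {1..m}" using Suc.prems by simp
    let ?a = "r (Suc m)" let ?Z = "z (Suc m) ^ r (Suc m)"
    let ?A = "\<Sum>k\<in>{1..<j}. int (r k)" let ?B = "\<Sum>k\<in>{j<..m}. int (r k)"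
    have s: "(\<Sum>k\<in>{j<..Suc m}. int (r k)) = ?B + int ?a"
    proof -
      have "{j<..Suc m} = insert (Suc m) {j<..m}" using True by auto
      then show ?thesis by simp
    qed
    note IH = Suc.IH[OF jm mn]
    have jm': "j \<noteq> Suc m" using True by simp
    have 1: "w j * ?Z = q ^ ?a *\<^sub>C (?Z * w j)"
      using q_commute_power_right[OF wz[of "Suc m" j], of ?a] Suc.prems True by (simp add: q_commute_def)
    have 2: "Q (j - 1) * ?Z = (q\<^sup>2) ^ ?a *\<^sub>C (?Z * Q (j - 1))"
      using q_commute_power_right[OF Q_z_less[of "j-1" "Suc m"], of ?a] Suc.prems True by (simp add: q_commute_def)
    have "w j * mono_up (Suc m) z r = w j * mono_up m z r * ?Z"
      by (simp add: mono_up_Suc mult.assoc)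
    also have "\<dots> = (q powi (?A + ?B) * q ^ ?a) *\<^sub>C (mono_up (Suc m) z r * w j)
       + ((1 - q powi (2 * int (r j))) * q powi (?A + 2 * ?B) * (q\<^sup>2) ^ ?a) *\<^sub>C (mono_up (Suc m) z (r(j := r j - 1)) * Q (j - 1))"
      by (simp only: IH mono_up_Suc_upd(1)[OF jm'] mono_up_Suc[of m z r] distrib_right mult.assoc mult_scaleC_left 1 2
         mult_scaleC_right scaleC_scaleC)
    also have "q powi (?A + ?B) * q ^ ?a = q powi (?A + (\<Sum>k\<in>{j<..Suc m}. int (r k)))"
      using q0 by (simp add: s power_int_add)
    also have "(1 - q powi (2 * int (r j))) * q powi (?A + 2 * ?B) * (q\<^sup>2) ^ ?a
      = (1 - q powi (2 * int (r j))) * q powi (?A + 2 * (\<Sum>k\<in>{j<..Suc m}. int (r k)))"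
      using q0 by (simp add: s power_int_add distrib_left power_int_mult)
    finally show ?thesis .
  next
    case False
    then have j: "j = Suc m" using Suc.prems by auto
    have 1: "w j * mono_up m z r = (q powi (\<Sum>k\<in>{1..m}. int (r k))) *\<^sub>C (mono_up m z r * w j)"
      using w_mono_up_z_gt[of m j r] Suc.prems j by (simp add: q_commute_def)
    have "w j * mono_up (Suc m) z r = w j * mono_up m z r * z j ^ r j"
      by (simp add: mono_up_Suc mult.assoc j)
    also have "\<dots> = (q powi (\<Sum>k\<in>{1..m}. int (r k))) *\<^sub>C (mono_up m z r * (w j * z j ^ r j))"
      by (simp add: 1 scaleC_mult_simps mult.assoc)
    also have "\<dots> = (q powi (\<Sum>k\<in>{1..m}. int (r k))) *\<^sub>C (mono_up m z r * z j ^ r j * w j)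
      + ((1 - q powi (2 * int (r j))) * (q powi (\<Sum>k\<in>{1..m}. int (r k)))) *\<^sub>C (mono_up m z r * z j ^ (r j - 1) * Q (j - 1))"
      using w_power_z[of j "r j"] Suc.prems j
      by (simp add: distrib_left scaleC_add_right scaleC_mult_simps mult.assoc mult.commute)
    finally show ?thesis
      unfolding j mono_up_Suc_upd(2) mono_up_Suc[of m z r]
      by (simp add: atLeastLessThanSuc_atLeastAtMost del: sum.op_ivl_Suc)
  qed
qed simp

end

section \<open>Words and monomials\<close>

lemma word_val_zero [simp]: "word_val z w 0 = 1"
  by (simp add: word_val_def zero_free_word_def)

lemma word_val_Nil [simp]: "word_val z w (Free_Word []) = 1"
  by (simp add: word_val_def)

lemma word_val_Cons: 
  "word_val z w (Free_Word (g # gs)) = (case g of GZ i \<Rightarrow> z i | GW i \<Rightarrow> w i) * word_val z w (Free_Word gs)"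
  by (simp add: word_val_def)

lemma word_val_plus: "word_val z w (u + v) = word_val z w u * word_val z w v"
  by (simp add: word_val_def plus_free_word_def)

lemma eval_free_superset:
  "finite S \<Longrightarrow> Poly_Mapping.keys p \<subseteq> S \<Longrightarrow>
   eval_free z w p = (\<Sum>u\<in>S. Poly_Mapping.lookup p u *\<^sub>C word_val z w u)"
  unfolding eval_free_def by (rule sum.mono_neutral_left) (auto simp: in_keys_iff)

lemma eval_free_single: "eval_free z w (Poly_Mapping.single u c) = c *\<^sub>C word_val z w u"
  by (cases "c = 0") (simp_all add: eval_free_def)

lemma eval_free_add: "eval_free z w (p + p') = eval_free z w p + eval_free z w p'"
  by (simp add: eval_free_superset[of "Poly_Mapping.keys p \<union> Poly_Mapping.keys p'"] keys_add lookup_add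
      scaleC_add_left sum.distrib)

lemma eval_free_zero [simp]: "eval_free z w 0 = 0"
  by (simp add: eval_free_def)

lemma eval_free_uminus: "eval_free z w (- p) = - eval_free z w p"
  by (simp add: eval_free_def sum_negf)

lemma eval_free_diff: "eval_free z w (p - p') = eval_free z w p - eval_free z w p'"
  using eval_free_add[of z w p "- p'"] by (simp add: eval_free_uminus)

lemma eval_free_sum: "eval_free z w (sum f S) = (\<Sum>i\<in>S. eval_free z w (f i))"
  by (induction S rule: infinite_finite_induct) (simp_all add: eval_free_add)

lemma sum_single_lookup:
  "(\<Sum>u\<in>Poly_Mapping.keys p. Poly_Mapping.single u (Poly_Mapping.lookup p u)) = p"
proof (rule poly_mapping_eqI)
  fix k
  show "Poly_Mapping.lookup (\<Sum>u\<in>Poly_Mapping.keys p. Poly_Mapping.single u (Poly_Mapping.lookup p u)) k = Poly_Mapping.lookup p k"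
    by (simp add: lookup_sum lookup_single when_def sum.delta in_keys_iff)
qed

lemma eval_free_mult: "eval_free z w (p * p') = eval_free z w p * eval_free z w p'"
proof -
  have p: "p = (\<Sum>u\<in>Poly_Mapping.keys p. Poly_Mapping.single u (Poly_Mapping.lookup p u))" for p :: free_poly
    by (rule sum_single_lookup[symmetric])
  have "eval_free z w (p * p') = (\<Sum>u\<in>Poly_Mapping.keys p. \<Sum>v\<in>Poly_Mapping.keys p'.
     (Poly_Mapping.lookup p u * Poly_Mapping.lookup p' v) *\<^sub>C word_val z w (u + v))"
    by (subst p, subst (2) p) (simp only: sum_product mult_single eval_free_sum eval_free_single)
  also have "\<dots> = eval_free z w p * eval_free z w p'"
    by (simp only: eval_free_def sum_product word_val_plus mult_scaleC_left mult_scaleC_right scaleC_scaleC)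
       (simp add: mult.commute)
  finally show ?thesis .
qed

lemma eval_free_const: "eval_free z w (free_const c) = c *\<^sub>C 1"
  by (simp add: free_const_def eval_free_single)

lemma eval_free_gen: "eval_free z w (free_gen g) = (case g of GZ i \<Rightarrow> z i | GW i \<Rightarrow> w i)"
  by (simp add: free_gen_def eval_free_single word_val_def split: gen.split)

lemmas eval_free_simps = eval_free_diff eval_free_add eval_free_mult eval_free_sum eval_free_const eval_free_gen

lemma presents_q_weyl:
  assumes "presents n q z w" "q \<noteq> 0" "\<forall>k>0. q ^ k \<noteq> 1"
  shows "q_weyl n q z w"
proof
  have rel: "eval_free z w p = 0" if "p \<in> relators n q" for p
    using ideal_gen.base[OF that, of "free_alg n"] assms(1) unfolding presents_def by blast
  show "q \<noteq> 0" "k > 0 \<Longrightarrow> q ^ k \<noteq> 1" for k using assms by auto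
  show "q_commute q (z i) (z j)" if "1 \<le> i" "i < j" "j \<le> n" for i j
  proof -
    have "free_gen (GZ i) * free_gen (GZ j) - free_const q * free_gen (GZ j) * free_gen (GZ i) \<in> relators n q"
      using that by (auto simp: relators_def Let_def)
    from rel[OF this] show ?thesis
      by (simp add: eval_free_simps q_commute_def scaleC_mult_simps)
  qed
  show "q_commute (inverse q) (w i) (w j)" if "1 \<le> i" "i < j" "j \<le> n" for i j
  proof -
    have "free_gen (GW i) * free_gen (GW j) - free_const (inverse q) * free_gen (GW j) * free_gen (GW i) \<in> relators n q"
      using that by (auto simp: relators_def Let_def)
    from rel[OF this] show ?thesis
      by (simp add: eval_free_simps q_commute_def scaleC_mult_simps)
  qed
  show "q_commute q (w j) (z i)" if "i \<in> {1..n}" "j \<in> {1..n}" "i \<noteq> j" for i j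
  proof -
    have "free_gen (GW j) * free_gen (GZ i) - free_const q * free_gen (GZ i) * free_gen (GW j) \<in> relators n q"
      using that unfolding relators_def Let_def by blast
    from rel[OF this] show ?thesis
      by (simp add: eval_free_simps q_commute_def scaleC_mult_simps)
  qed
  show "w k * z k = z k * w k + (1 - q\<^sup>2) *\<^sub>C Qpoly z w (k - 1)" if "k \<in> {1..n}" for k
  proof -
    have "free_gen (GW k) * free_gen (GZ k) - (free_gen (GZ k) * free_gen (GW k) +
      free_const (1 - q\<^sup>2) * (\<Sum>s\<in>{1..<k}. free_gen (GZ s) * free_gen (GW s))) \<in> relators n q"
      using that unfolding relators_def Let_def by blast
    from rel[OF this] have "w k * z k = z k * w k + (1 - q\<^sup>2) *\<^sub>C (\<Sum>s\<in>{1..<k}. z s * w s)"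
      by (simp add: eval_free_simps scaleC_mult_simps)
    moreover have "{1..<k} = {1..k - 1}" by auto
    ultimately show ?thesis by (simp only: Qpoly_def)
  qed
qed

text \<open>Exponents are normalised to vanish outside \<open>{1..p}\<close>. Otherwise one monomial
  would have many indices and no family of monomials could be independent.\<close>

definition exponents :: "nat \<Rightarrow> (nat \<Rightarrow> nat) set" where
  "exponents p = {r. \<forall>i. i \<notin> {1..p} \<longrightarrow> r i = 0}"

lemma exponents_upd: "r \<in> exponents p \<Longrightarrow> j \<in> {1..p} \<Longrightarrow> r(j := a) \<in> exponents p"
  by (auto simp: exponents_def)

lemma exponents_mono: "p \<le> m \<Longrightarrow> exponents p \<subseteq> exponents m"
  by (auto simp: exponents_def)

definition cut :: "nat \<Rightarrow> (nat \<Rightarrow> nat) \<Rightarrow> nat \<Rightarrow> nat" where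
  "cut p r i = (if i \<in> {1..p} then r i else 0)"

lemma cut_exponents [simp]: "cut p r \<in> exponents p"
  by (simp add: cut_def exponents_def)

lemma mono_up_cut [simp]: "mono_up p x (cut p r) = mono_up p x r"
  by (rule mono_up_cong) (simp add: cut_def)

lemma mono_up_exponents: "p \<le> m \<Longrightarrow> r \<in> exponents p \<Longrightarrow> mono_up m x r = mono_up p x r"
  by (rule mono_up_mono) (auto simp: exponents_def)

definition zdeg :: "gen free_word \<Rightarrow> nat" where
  "zdeg u = length (filter (\<lambda>g. g \<in> range GZ) (letters u))"

definition wdeg :: "gen free_word \<Rightarrow> nat" where
  "wdeg u = length (filter (\<lambda>g. g \<in> range GW) (letters u))"

lemma zdeg_simps [simp]:
  "zdeg (Free_Word []) = 0" "zdeg (Free_Word (GZ i # gs)) = Suc (zdeg (Free_Word gs))"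
  "zdeg (Free_Word (GW i # gs)) = zdeg (Free_Word gs)" "zdeg (u + v) = zdeg u + zdeg v" "zdeg 0 = 0"
  by (auto simp: zdeg_def plus_free_word_def zero_free_word_def)

lemma wdeg_simps [simp]:
  "wdeg (Free_Word []) = 0" "wdeg (Free_Word (GW i # gs)) = Suc (wdeg (Free_Word gs))"
  "wdeg (Free_Word (GZ i # gs)) = wdeg (Free_Word gs)" "wdeg (u + v) = wdeg u + wdeg v" "wdeg 0 = 0"
  by (auto simp: wdeg_def plus_free_word_def zero_free_word_def)

lemma weight_simps [simp]:
  "word_weight (Free_Word []) i = 0"
  "word_weight (Free_Word (GZ j # gs)) i = word_weight (Free_Word gs) i + (if i = j then 1 else 0)"
  "word_weight (Free_Word (GW j # gs)) i = word_weight (Free_Word gs) i - (if i = j then 1 else 0)"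
  "word_weight (u + v) i = word_weight u i + word_weight v i" "word_weight 0 i = 0"
  by (auto simp: word_weight_def plus_free_word_def zero_free_word_def)

lemma words_simps [simp]:
  "Free_Word [] \<in> words p" "Free_Word (g # gs) \<in> words p \<longleftrightarrow> g \<in> gens p \<and> Free_Word gs \<in> words p"
  "u + v \<in> words p \<longleftrightarrow> u \<in> words p \<and> v \<in> words p" "0 \<in> words p"
  by (auto simp: words_def plus_free_word_def zero_free_word_def)

lemma gens_simps [simp]: "GZ i \<in> gens p \<longleftrightarrow> i \<in> {1..p}" "GW i \<in> gens p \<longleftrightarrow> i \<in> {1..p}"
  by (auto simp: gens_def)

lemma words_mono: "p \<le> m \<Longrightarrow> words p \<subseteq> words m"
  by (force simp: words_def gens_def)

lemma span_mult_left:
  assumes "\<And>y. y \<in> S \<Longrightarrow> a * y \<in> complex_vector.span T" "x \<in> complex_vector.span S"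
  shows "a * x \<in> complex_vector.span (T :: 'a::complex_algebra_1 set)"
  using assms(2)
  by (induction rule: complex_vector.span_induct_alt)
     (simp_all add: distrib_left mult_scaleC_right complex_vector.span_add complex_vector.span_scale
       complex_vector.span_zero assms(1))

lemma span_mult_right:
  assumes "\<And>y. y \<in> S \<Longrightarrow> y * a \<in> complex_vector.span T" "x \<in> complex_vector.span S"
  shows "x * a \<in> complex_vector.span (T :: 'a::complex_algebra_1 set)"
  using assms(2)
  by (induction rule: complex_vector.span_induct_alt)
     (simp_all add: distrib_right mult_scaleC_left complex_vector.span_add complex_vector.span_scale
       complex_vector.span_zero assms(1))

lemma span_mult:
  assumes "\<And>x y. x \<in> S \<Longrightarrow> y \<in> T \<Longrightarrow> x * y \<in> complex_vector.span U"
    "x \<in> complex_vector.span S" "y \<in> complex_vector.span T"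
  shows "x * y \<in> complex_vector.span (U :: 'a::complex_algebra_1 set)"
  by (rule span_mult_left[OF span_mult_right[OF _ assms(2)] assms(3)]) (rule assms(1))

text \<open>Bidegree and weight are recorded together, so that one reordering argument yields both
  the homogeneous components and the weight components on which the functional vanishes.\<close>

definition mono_index :: "nat \<Rightarrow> nat \<Rightarrow> nat \<Rightarrow> (nat \<Rightarrow> int) \<Rightarrow> ((nat \<Rightarrow> nat) \<times> (nat \<Rightarrow> nat)) set" where
  "mono_index p a b f = {(r, s). r \<in> exponents p \<and> s \<in> exponents p \<and> sum r {1..p} = a \<and> sum s {1..p} = b \<and>
     (\<forall>i\<in>{1..p}. int (r i) - int (s i) = f i)}"

lemma sum_upd_Suc:
  fixes r :: "nat \<Rightarrow> nat"
  assumes "j \<in> {1..p}"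
  shows "sum (r(j := Suc (r j))) {1..p} = Suc (sum r {1..p})"
proof -
  have "sum (r(j := Suc (r j))) ({1..p} - {j}) = sum r ({1..p} - {j})"
    by (rule sum.cong) auto
  then show ?thesis using assms by (simp only: sum.remove[of "{1..p}" j] finite_atLeastAtMost) simp
qed

lemma sum_upd_pred:
  fixes r :: "nat \<Rightarrow> nat"
  assumes "j \<in> {1..p}" "r j > 0"
  shows "Suc (sum (r(j := r j - 1)) {1..p}) = sum r {1..p}"
  using sum_upd_Suc[OF assms(1), of "r(j := r j - 1)"] assms(2) by simp

context q_weyl
begin

text \<open>Letters are multiplied on from the left. The nontrivial letter is \<open>w j\<close>,
  for which \<open>w_mono_up_z\<close> trades a \<open>z j\<close> for \<open>Q (j - 1)\<close>; its
  summands \<open>z i * w i\<close> have weight zero and bidegree (1, 1), so the index set is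
  respected.\<close>

lemma word_val_in_span_zw:
  assumes "u \<in> words n"
  shows "word_val z w u \<in> complex_vector.span
     ((\<lambda>(r, s). mono_up n z r * mono_up n w s) ` mono_index n (zdeg u) (wdeg u) (word_weight u))"
proof -
  define M where "M u = (\<lambda>(r, s). mono_up n z r * mono_up n w s) ` mono_index n (zdeg u) (wdeg u) (word_weight u)" for u
  have MI: "c *\<^sub>C (mono_up n z r * mono_up n w s) \<in> complex_vector.span (M u)"
    if "r \<in> exponents n" "s \<in> exponents n" "sum r {1..n} = zdeg u" "sum s {1..n} = wdeg u"
      "\<And>i. i \<in> {1..n} \<Longrightarrow> int (r i) - int (s i) = word_weight u i" for r s u c
    using that by (intro complex_vector.span_scale complex_vector.span_base)
      (auto simp: M_def mono_index_def intro!: image_eqI[of _ _ "(r, s)"])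
  have main: "Free_Word gs \<in> words n \<Longrightarrow> word_val z w (Free_Word gs) \<in> complex_vector.span (M (Free_Word gs))" for gs
  proof (induction gs)
    case Nil
    show ?case using MI[of "\<lambda>_. 0" "\<lambda>_. 0" "Free_Word []" 1]
      by (simp add: exponents_def mono_up_zero scaleC_one flip: One_nat_def)
  next
    case (Cons g gs)
    then have IH: "word_val z w (Free_Word gs) \<in> complex_vector.span (M (Free_Word gs))" by simp
    show ?case
    proof (cases g)
      case (GZ j)
      have j: "j \<in> {1..n}" using Cons.prems GZ by simp
      have "z j * (mono_up n z r * mono_up n w s) \<in> complex_vector.span (M (Free_Word (g # gs)))"
        if "(r, s) \<in> mono_index n (zdeg (Free_Word gs)) (wdeg (Free_Word gs)) (word_weight (Free_Word gs))" for r s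
        unfolding mult.assoc[symmetric] zf.left_mult_mono_up[OF j order_refl] mult_scaleC_left
        using that j sum_upd_Suc[OF j, of r]
        by (intro MI) (auto simp: mono_index_def GZ exponents_upd)
      then show ?thesis
        by (simp only: word_val_Cons GZ gen.case) (rule span_mult_left[OF _ IH], auto simp: M_def[of "Free_Word gs"] GZ)
    next
      case (GW j)
      have j: "j \<in> {1..n}" using Cons.prems GW by simp
      have "w j * (mono_up n z r * mono_up n w s) \<in> complex_vector.span (M (Free_Word (g # gs)))"
        if rs: "(r, s) \<in> mono_index n (zdeg (Free_Word gs)) (wdeg (Free_Word gs)) (word_weight (Free_Word gs))" for r s
      proof -
        have 1: "c *\<^sub>C (mono_up n z r * (w j * mono_up n w s)) \<in> complex_vector.span (M (Free_Word (g # gs)))" for c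
          unfolding wf.left_mult_mono_up[OF j order_refl] mult_scaleC_right scaleC_scaleC
          using rs j sum_upd_Suc[OF j, of s]
          by (intro MI) (auto simp: mono_index_def GW exponents_upd)
        have 2: "c *\<^sub>C (mono_up n z (r(j := r j - 1)) * Q (j - 1) * mono_up n w s) \<in> complex_vector.span (M (Free_Word (g # gs)))"
          if "r j > 0" for c
        proof -
          have "mono_up n z (r(j := r j - 1)) * (z i * w i) * mono_up n w s \<in> complex_vector.span (M (Free_Word (g # gs)))"
            if "i \<in> {1..j-1}" for i
          proof -
            have i: "i \<in> {1..n}" "i \<noteq> j" using that j by auto
            have *: "mono_up n z (r(j := r j - 1)) * (z i * w i) * mono_up n w s
                = (mono_up n z (r(j := r j - 1)) * z i) * (w i * mono_up n w s)" by (simp add: mult.assoc)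
            have si: "sum (r(j := r j - 1, i := Suc (r i))) {1..n} = sum r {1..n}"
              using sum_upd_Suc[OF i(1), of "r(j := r j - 1)"] sum_upd_pred[of j n r, OF j \<open>r j > 0\<close>] i by simp
            show ?thesis
              unfolding * wf.left_mult_mono_up[OF i(1) order_refl] zf.right_mult_mono_up[OF i(1) order_refl]
                mult_scaleC_right scaleC_scaleC mult_scaleC_left
              using rs j sum_upd_Suc[OF i(1), of s] si i \<open>r j > 0\<close>
              by (intro MI) (auto simp: mono_index_def GW exponents_upd)
          qed
          then show ?thesis
            unfolding Qpoly_def sum_distrib_left sum_distrib_right
            by (intro complex_vector.span_scale complex_vector.span_sum)
        qed
        \<comment> \<open>For \<open>r j = 0\<close> the scalar in front is zero, which covers the
          case excluded in the previous step.\<close>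
        have 3: "((1 - q powi (2 * int (r j))) * c) *\<^sub>C (mono_up n z (r(j := r j - 1)) * Q (j - 1) * mono_up n w s)
            \<in> complex_vector.span (M (Free_Word (g # gs)))" for c
          using 2 by (cases "r j") (auto simp: complex_vector.span_zero)
        show ?thesis
          unfolding mult.assoc[symmetric] w_mono_up_z[OF j order_refl] distrib_right mult_scaleC_left
          by (intro complex_vector.span_add 3) (simp only: mult.assoc 1)
      qed
      then show ?thesis
        by (simp only: word_val_Cons GW gen.case) (rule span_mult_left[OF _ IH], auto simp: M_def[of "Free_Word gs"] GW)
    qed
  qed
  show ?thesis using main[of "letters u"] assms by (simp add: M_def)
qed

end

primrec swap_gen :: "gen \<Rightarrow> gen" where
  "swap_gen (GZ i) = GW i"
| "swap_gen (GW i) = GZ i"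

context q_weyl
begin

text \<open>The opposite order is the first one in the dual algebra. Exchanging the letters of a
  word changes its value there only by a nonzero scalar, exchanges the two degrees and negates the
  weight.\<close>

lemma word_val_in_span_wz:
  assumes "u \<in> words n"
  shows "word_val z w u \<in> complex_vector.span
     ((\<lambda>(s, r). mono_up n w s * mono_up n z r) ` mono_index n (wdeg u) (zdeg u) (\<lambda>i. - word_weight u i))"
proof -
  interpret d: q_weyl n "inverse q" zd z by (rule dual)
  let ?sw = "\<lambda>gs. Free_Word (map swap_gen gs)"
  have sw: "Free_Word gs \<in> words n \<Longrightarrow> ?sw gs \<in> words n \<and> zdeg (?sw gs) = wdeg (Free_Word gs) \<and>
     wdeg (?sw gs) = zdeg (Free_Word gs) \<and> word_weight (?sw gs) = (\<lambda>i. - word_weight (Free_Word gs) i) \<and>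
     (\<exists>c. c \<noteq> 0 \<and> word_val zd z (?sw gs) = c *\<^sub>C word_val z w (Free_Word gs))" for gs
  proof (induction gs)
    case Nil
    then show ?case by (auto simp: fun_eq_iff scaleC_one intro!: exI[of _ 1])
  next
    case (Cons g gs)
    then obtain c where c: "c \<noteq> 0" "word_val zd z (?sw gs) = c *\<^sub>C word_val z w (Free_Word gs)"
      by auto
    have "word_val zd z (?sw (g # gs)) = (case g of GZ i \<Rightarrow> c | GW i \<Rightarrow> q powi (- 2 * int i) * c) *\<^sub>C word_val z w (Free_Word (g # gs))"
      by (cases g) (simp_all add: word_val_Cons c zd_def scaleC_mult_simps mult.commute)
    moreover have "(case g of GZ i \<Rightarrow> c | GW i \<Rightarrow> q powi (- 2 * int i) * c) \<noteq> 0"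
      using c q0 by (cases g) auto
    ultimately have "\<exists>c. c \<noteq> 0 \<and> word_val zd z (?sw (g # gs)) = c *\<^sub>C word_val z w (Free_Word (g # gs))"
      by blast
    moreover have "?sw (g # gs) \<in> words n \<and> zdeg (?sw (g # gs)) = wdeg (Free_Word (g # gs)) \<and>
      wdeg (?sw (g # gs)) = zdeg (Free_Word (g # gs)) \<and>
      word_weight (?sw (g # gs)) = (\<lambda>i. - word_weight (Free_Word (g # gs)) i)"
      using Cons by (cases g) (simp_all add: fun_eq_iff)
    ultimately show ?case by blast
  qed
  obtain gs where gs: "u = Free_Word gs" by (cases u)
  obtain c where c: "c \<noteq> 0" "word_val zd z (?sw gs) = c *\<^sub>C word_val z w u"
    using sw[of gs] assms gs by auto
  have "word_val z w u = inverse c *\<^sub>C word_val zd z (?sw gs)"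
    using c by (simp add: scaleC_mult_simps)
  also have "\<dots> \<in> complex_vector.span
     ((\<lambda>(r, s). mono_up n zd r * mono_up n z s) ` mono_index n (wdeg u) (zdeg u) (\<lambda>i. - word_weight u i))"
    using d.word_val_in_span_zw[of "?sw gs"] sw[of gs] assms gs
    by (intro complex_vector.span_scale) simp
  also have "\<dots> \<subseteq> complex_vector.span
     ((\<lambda>(s, r). mono_up n w s * mono_up n z r) ` mono_index n (wdeg u) (zdeg u) (\<lambda>i. - word_weight u i))"
  proof (rule complex_vector.span_minimal)
    have "mono_up n zd r * mono_up n z s \<in> complex_vector.span
     ((\<lambda>(s, r). mono_up n w s * mono_up n z r) ` mono_index n (wdeg u) (zdeg u) (\<lambda>i. - word_weight u i))"
     if "(r, s) \<in> mono_index n (wdeg u) (zdeg u) (\<lambda>i. - word_weight u i)" for r s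
    proof -
      obtain d where "mono_up n zd r = d *\<^sub>C mono_up n w r" using mono_up_zd by blast
      then show ?thesis using that
        by (simp only: mult_scaleC_left)
          (intro complex_vector.span_scale complex_vector.span_base image_eqI[of _ _ "(r, s)"], auto)
    qed
    then show "(\<lambda>(r, s). mono_up n zd r * mono_up n z s) ` mono_index n (wdeg u) (zdeg u) (\<lambda>i. - word_weight u i)
      \<subseteq> complex_vector.span ((\<lambda>(s, r). mono_up n w s * mono_up n z r) `
         mono_index n (wdeg u) (zdeg u) (\<lambda>i. - word_weight u i))" by auto
  qed simp
  finally show ?thesis .
qed

end

section \<open>Linear independence of the monomials\<close>

text \<open>
  The algebra acts on functions on the lattice of integer vectors: \<open>w k\<close> shifts by the unit vector
  \<open>k\<close> up to a power of \<open>q\<close>, \<open>Q j\<close> is a multiplication operator depending on a free parameter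
  \<open>c j\<close> (with \<open>c 0 = 0\<close>), and \<open>z k = (Q k - Q (k - 1)) (w k)\<^sup>-\<^sup>1\<close>.
\<close>

definition q_weight :: "nat \<Rightarrow> complex \<Rightarrow> (nat \<Rightarrow> complex) \<Rightarrow> nat \<Rightarrow> (nat \<Rightarrow> int) \<Rightarrow> complex" where
  "q_weight n q c j l = c j * q powi (2 * (\<Sum>i\<in>{j<..n}. l i))"

fun shift_op :: "nat \<Rightarrow> complex \<Rightarrow> (nat \<Rightarrow> complex) \<Rightarrow> gen \<Rightarrow> ((nat \<Rightarrow> int) \<Rightarrow> complex) \<Rightarrow> (nat \<Rightarrow> int) \<Rightarrow> complex" where
  "shift_op n q c (GW k) f l = q powi (- (\<Sum>i\<in>{1..<k}. l i)) * f (l(k := l k + 1))"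
| "shift_op n q c (GZ k) f l =
     (q_weight n q c k l - q_weight n q c (k - 1) l) * q powi (\<Sum>i\<in>{1..<k}. l i) * f (l(k := l k - 1))"

definition word_op :: "nat \<Rightarrow> complex \<Rightarrow> (nat \<Rightarrow> complex) \<Rightarrow> gen free_word \<Rightarrow> ((nat \<Rightarrow> int) \<Rightarrow> complex) \<Rightarrow> (nat \<Rightarrow> int) \<Rightarrow> complex" where
  "word_op n q c u = foldr (shift_op n q c) (letters u)"

definition poly_op :: "nat \<Rightarrow> complex \<Rightarrow> (nat \<Rightarrow> complex) \<Rightarrow> free_poly \<Rightarrow> ((nat \<Rightarrow> int) \<Rightarrow> complex) \<Rightarrow> (nat \<Rightarrow> int) \<Rightarrow> complex" where
  "poly_op n q c p f l = (\<Sum>u\<in>Poly_Mapping.keys p. Poly_Mapping.lookup p u * word_op n q c u f l)"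

lemma word_op_plus: "word_op n q c (u + v) f = word_op n q c u (word_op n q c v f)"
  by (simp add: word_op_def plus_free_word_def)

lemma word_op_single: "word_op n q c (Free_Word [g]) f = shift_op n q c g f"
  by (simp add: word_op_def)

lemma word_op_zero [simp]: "word_op n q c 0 f = f"
  by (simp add: word_op_def zero_free_word_def)

lemma shift_op_sum:
  "shift_op n q c g (\<lambda>l. \<Sum>i\<in>S. a i * F i l) = (\<lambda>l. \<Sum>i\<in>S. a i * shift_op n q c g (F i) l)"
  by (cases g) (auto simp: fun_eq_iff sum_distrib_left intro!: sum.cong)

lemma word_op_sum:
  "word_op n q c u (\<lambda>l. \<Sum>i\<in>S. a i * F i l) = (\<lambda>l. \<Sum>i\<in>S. a i * word_op n q c u (F i) l)"
proof -
  have "foldr (shift_op n q c) gs (\<lambda>l. \<Sum>i\<in>S. a i * F i l)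
     = (\<lambda>l. \<Sum>i\<in>S. a i * foldr (shift_op n q c) gs (F i) l)" for gs
    by (induction gs) (simp_all add: shift_op_sum)
  then show ?thesis by (simp add: word_op_def)
qed

lemma poly_op_superset:
  "finite S \<Longrightarrow> Poly_Mapping.keys p \<subseteq> S \<Longrightarrow>
   poly_op n q c p f l = (\<Sum>u\<in>S. Poly_Mapping.lookup p u * word_op n q c u f l)"
  unfolding poly_op_def by (rule sum.mono_neutral_left) (auto simp: in_keys_iff)

lemma poly_op_single: "poly_op n q c (Poly_Mapping.single u a) f l = a * word_op n q c u f l"
  by (cases "a = 0") (simp_all add: poly_op_def)

lemma poly_op_add: "poly_op n q c (p + p') f l = poly_op n q c p f l + poly_op n q c p' f l"
  by (simp add: poly_op_superset[of "Poly_Mapping.keys p \<union> Poly_Mapping.keys p'"] keys_add lookup_add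
      distrib_right sum.distrib)

lemma poly_op_zero [simp]: "poly_op n q c 0 f l = 0"
  by (simp add: poly_op_def)

lemma poly_op_uminus: "poly_op n q c (- p) f l = - poly_op n q c p f l"
  by (simp add: poly_op_def sum_negf)

lemma poly_op_diff: "poly_op n q c (p - p') f l = poly_op n q c p f l - poly_op n q c p' f l"
  using poly_op_add[of n q c p "- p'" f l] by (simp add: poly_op_uminus)

lemma poly_op_sum: "poly_op n q c (sum F S) f l = (\<Sum>i\<in>S. poly_op n q c (F i) f l)"
  by (induction S rule: infinite_finite_induct) (simp_all add: poly_op_add)

lemma free_poly_times_eq:
  "p * p' = (\<Sum>u\<in>Poly_Mapping.keys p. \<Sum>v\<in>Poly_Mapping.keys p'.
     Poly_Mapping.single (u + v) (Poly_Mapping.lookup p u * Poly_Mapping.lookup p' v))" for p p' :: free_poly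
proof -
  have "p * p' = (\<Sum>u\<in>Poly_Mapping.keys p. Poly_Mapping.single u (Poly_Mapping.lookup p u)) *
    (\<Sum>v\<in>Poly_Mapping.keys p'. Poly_Mapping.single v (Poly_Mapping.lookup p' v))"
    by (simp only: sum_single_lookup)
  then show ?thesis by (simp only: sum_product mult_single)
qed

lemma word_op_const_zero [simp]: "word_op n q c u (\<lambda>_. 0) = (\<lambda>_. 0)"
  using word_op_sum[where S = "{}"] by simp

lemma poly_op_mult: "poly_op n q c (p * p') f l = poly_op n q c p (poly_op n q c p' f) l"
proof -
  have "poly_op n q c (p * p') f l = (\<Sum>u\<in>Poly_Mapping.keys p. \<Sum>v\<in>Poly_Mapping.keys p'.
     (Poly_Mapping.lookup p u * Poly_Mapping.lookup p' v) * word_op n q c (u + v) f l)"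
    by (simp only: free_poly_times_eq poly_op_sum poly_op_single)
  also have "\<dots> = poly_op n q c p (poly_op n q c p' f) l"
    unfolding poly_op_def[of n q c p', abs_def] word_op_sum poly_op_def[of n q c p]
    by (simp add: word_op_plus sum_distrib_left mult.assoc)
  finally show ?thesis .
qed

lemma poly_op_const: "poly_op n q c (free_const a) f l = a * f l"
  by (simp add: free_const_def poly_op_single)

lemma poly_op_gen: "poly_op n q c (free_gen g) f = shift_op n q c g f"
  by (rule ext) (simp add: free_gen_def poly_op_single word_op_single)

lemma sum_upd_other: "i \<notin> S \<Longrightarrow> sum (l(i := a)) S = sum l S"
  by (rule sum.cong) auto

lemma sum_upd_add: "finite S \<Longrightarrow> i \<in> S \<Longrightarrow> sum (l(i := l i + d)) S = sum l S + d"
  for l :: "nat \<Rightarrow> int"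
  by (simp add: sum.remove[of S i] sum_upd_other[of i "S - {i}"] del: fun_upd_apply) simp

lemma q_weight_upd:
  assumes "q \<noteq> 0"
  shows "q_weight n q c j (l(k := l k + d)) = (if k \<in> {j<..n} then q powi (2 * d) else 1) * q_weight n q c j l"
proof (cases "k \<in> {j<..n}")
  case True
  have "(\<Sum>i\<in>{j<..n}. (l(k := l k + d)) i) = (\<Sum>i\<in>{j<..n}. l i) + d"
    using sum_upd_add[of "{j<..n}" k l d] True by simp
  then show ?thesis unfolding q_weight_def using True assms
    by (simp add: power_int_add distrib_left del: fun_upd_apply)
next
  case False
  have "(\<Sum>i\<in>{j<..n}. (l(k := l k + d)) i) = (\<Sum>i\<in>{j<..n}. l i)"
    using sum_upd_other[of k "{j<..n}" l "l k + d"] False by simp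
  then show ?thesis unfolding q_weight_def by (simp only: False if_False mult_1)
qed

text \<open>A shift in coordinate \<open>k\<close> multiplies the operator of \<open>Q j\<close> by
  \<open>q^2\<close> or its inverse exactly when \<open>k\<close> lies in \<open>{j<..n}\<close>,
  just as \<open>Q j\<close> commutes with \<open>w k\<close> and \<open>z k\<close>. In the
  relation for \<open>w k * z k\<close> the sum of the \<open>z s * w s\<close> telescopes, and
  \<open>c 0 = 0\<close> makes it start from zero.\<close>

lemma poly_op_relator:
  assumes q: "q \<noteq> 0" and c: "c 0 = 0" and p: "p \<in> relators n q"
  shows "poly_op n q c p f l = 0"
proof -
  define X where "X k l = (\<Sum>i\<in>{1..<k}. l i)" for k and l :: "nat \<Rightarrow> int"
  have X_lt: "X k (l(i := l i + d)) = X k l + d" if "1 \<le> i" "i < k" for k i d and l :: "nat \<Rightarrow> int"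
    unfolding X_def using sum_upd_add[of "{1..<k}" i l d] that by simp
  have X_ge: "X k (l(i := a)) = X k l" if "k \<le> i" for k i a and l :: "nat \<Rightarrow> int"
    unfolding X_def using sum_upd_other[of i "{1..<k}" l a] that by simp
  let ?A = "q_weight n q c" let ?S = "shift_op n q c"
  have W: "?S (GW k) f l = q powi (- X k l) * f (l(k := l k + 1))" for k f l by (simp add: X_def)
  have Z: "?S (GZ k) f l = (?A k l - ?A (k - 1) l) * q powi (X k l) * f (l(k := l k - 1))" for k f l by (simp add: X_def)
  have X_lt': "X k (l(i := l i - 1)) = X k l - 1" if "1 \<le> i" "i < k" for k i and l :: "nat \<Rightarrow> int"
    using X_lt[OF that, of l "- 1"] by simp
  have Ap: "?A j (l(k := l k + 1)) = (if k \<in> {j<..n} then q * q else 1) * ?A j l" for j k l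
    using q_weight_upd[OF q, of n c j l k 1] by (simp only: power2_eq_square) (simp add: power2_eq_square)
  have Am: "?A j (l(k := l k - 1)) = (if k \<in> {j<..n} then inverse q * inverse q else 1) * ?A j l" for j k l
    using q_weight_upd[OF q, of n c j l k "- 1"] q by (simp add: power_int_minus power2_eq_square)
  have powi_sub: "q powi (a - 1) = q powi a * inverse q" "q powi (a + 1) = q powi a * q" "q powi (1 + a) = q * q powi a" for a
    using q by (simp_all add: power_int_diff power_int_add divide_inverse)
  note simps = W Z X_ge X_lt X_lt' Ap Am powi_sub
    X_lt[where d = 1, unfolded add.commute[of _ 1]] Ap[unfolded add.commute[of _ 1]]
  from p consider
    (zz) i j where "p = free_gen (GZ i) * free_gen (GZ j) - free_const q * free_gen (GZ j) * free_gen (GZ i)"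
      "1 \<le> i" "i < j" "j \<le> n" |
    (ww) i j where "p = free_gen (GW i) * free_gen (GW j) - free_const (inverse q) * free_gen (GW j) * free_gen (GW i)"
      "1 \<le> i" "i < j" "j \<le> n" |
    (wz) i j where "p = free_gen (GW j) * free_gen (GZ i) - free_const q * free_gen (GZ i) * free_gen (GW j)"
      "i \<in> {1..n}" "j \<in> {1..n}" "i \<noteq> j" |
    (wzk) k where "p = free_gen (GW k) * free_gen (GZ k) - (free_gen (GZ k) * free_gen (GW k) +
      free_const (1 - q\<^sup>2) * (\<Sum>s\<in>{1..<k}. free_gen (GZ s) * free_gen (GW s)))" "k \<in> {1..n}"
    unfolding relators_def Let_def by blast
  then show ?thesis
  proof cases
    case zz
    have "?S (GZ i) (?S (GZ j) f) l = q * ?S (GZ j) (?S (GZ i) f) l"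
    proof -
      have "\<not> j - 1 < i" "i - 1 < j" using zz(2,3) by auto
      then show ?thesis
        using zz(2-4) q by (simp add: simps fun_upd_twist[of i j] field_simps del: shift_op.simps One_nat_def)
    qed
    then show ?thesis by (simp add: zz(1) poly_op_diff poly_op_mult poly_op_const poly_op_gen del: shift_op.simps)
  next
    case ww
    have "?S (GW i) (?S (GW j) f) l = inverse q * ?S (GW j) (?S (GW i) f) l"
      using ww(2-4) q
      by (simp add: simps power_int_minus power_int_diff fun_upd_twist[of i j] field_simps del: shift_op.simps)
    then show ?thesis by (simp add: ww(1) poly_op_diff poly_op_mult poly_op_const poly_op_gen del: shift_op.simps)
  next
    case wz
    have "?S (GW j) (?S (GZ i) f) l = q * ?S (GZ i) (?S (GW j) f) l"
    proof -
      have "i < j \<longrightarrow> i - 1 < j" "j < i \<longrightarrow> \<not> i - 1 < j" by auto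
      then show ?thesis using wz(2-4) q
        by (cases "i < j") (simp_all add: simps power_int_minus power_int_diff fun_upd_twist[of i j] field_simps
            del: shift_op.simps One_nat_def)
    qed
    then show ?thesis by (simp add: wz(1) poly_op_diff poly_op_mult poly_op_const poly_op_gen del: shift_op.simps)
  next
    case wzk
    have zw: "?S (GZ s) (?S (GW s) f) l = (?A s l - ?A (s - 1) l) * f l" for s
      using q by (simp add: simps power_int_minus del: shift_op.simps)
    have "(\<Sum>s\<in>{1..<k}. ?S (GZ s) (?S (GW s) f) l) = ?A (k - 1) l * f l" if "k \<ge> 1" for k
      using that
    proof (induction k rule: dec_induct)
      case base
      show ?case using c by (simp add: q_weight_def)
    next
      case (step k)
      then show ?case by (simp add: zw algebra_simps del: shift_op.simps)
    qed
    then have s: "(\<Sum>s\<in>{1..<k}. ?S (GZ s) (?S (GW s) f) l) = ?A (k - 1) l * f l" using wzk(2) by simp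
    have "?S (GW k) (?S (GZ k) f) l = (?A k l - q\<^sup>2 * ?A (k - 1) l) * f l"
      using wzk(2) q by (simp add: simps power_int_minus power2_eq_square del: shift_op.simps)
    then show ?thesis
      by (simp add: wzk(1) poly_op_diff poly_op_add poly_op_sum poly_op_mult poly_op_const poly_op_gen s zw[of k]
         algebra_simps del: shift_op.simps One_nat_def)
  qed
qed

lemma poly_op_ideal:
  assumes "q \<noteq> 0" "c 0 = 0" "p \<in> ideal_gen (free_alg n) (relators n q)"
  shows "poly_op n q c p f l = 0"
  using assms(3)
proof (induction arbitrary: f l)
  case (mult_left a x)
  then have "poly_op n q c x f = (\<lambda>_. 0)" by auto
  then show ?case by (simp only: poly_op_mult) (simp add: poly_op_def)
qed (simp_all add: poly_op_relator assms poly_op_add poly_op_mult)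

text \<open>A relation in the algebra comes from the ideal, hence holds for the shift operators for
  every choice of parameters with \<open>c 0 = 0\<close>. This freedom in \<open>c\<close> is what
  independence is extracted from.\<close>

lemma word_val_relation_op:
  assumes pr: "presents n q z w" and q: "q \<noteq> 0" and c: "c 0 = 0"
    and S: "finite S" "\<And>i. i \<in> S \<Longrightarrow> u i \<in> words n" and rel: "(\<Sum>i\<in>S. a i *\<^sub>C word_val z w (u i)) = 0"
  shows "(\<Sum>i\<in>S. a i * word_op n q c (u i) f l) = 0"
proof -
  define p where "p = (\<Sum>i\<in>S. Poly_Mapping.single (u i) (a i))"
  have "Poly_Mapping.keys p \<subseteq> (\<Union>i\<in>S. Poly_Mapping.keys (Poly_Mapping.single (u i) (a i)))"
    unfolding p_def by (rule keys_sum)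
  then have "p \<in> free_alg n" using S(2) by (auto simp: free_alg_def split: if_splits)
  moreover have "eval_free z w p = 0" using rel by (simp add: p_def eval_free_sum eval_free_single)
  ultimately have "p \<in> ideal_gen (free_alg n) (relators n q)" using pr by (auto simp: presents_def)
  from poly_op_ideal[of q c p n f l, OF q c this] show ?thesis
    by (simp add: p_def poly_op_sum poly_op_single)
qed

definition mono_word :: "(nat \<Rightarrow> gen) \<Rightarrow> nat list \<Rightarrow> (nat \<Rightarrow> nat) \<Rightarrow> gen free_word" where
  "mono_word G ks r = Free_Word (concat (map (\<lambda>i. replicate (r i) (G i)) ks))"

lemma word_val_replicate: "word_val z w (Free_Word (replicate k g)) = (case g of GZ i \<Rightarrow> z i | GW i \<Rightarrow> w i) ^ k"
  by (simp add: word_val_def)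

lemma word_val_append: "word_val z w (Free_Word (xs @ ys)) = word_val z w (Free_Word xs) * word_val z w (Free_Word ys)"
  using word_val_plus[of z w "Free_Word xs" "Free_Word ys"] by (simp add: plus_free_word_def)

lemma word_val_mono_word:
  "word_val z w (mono_word G ks r) = prod_list (map (\<lambda>i. (case G i of GZ i \<Rightarrow> z i | GW i \<Rightarrow> w i) ^ r i) ks)"
  unfolding mono_word_def by (induction ks) (simp_all add: word_val_append word_val_replicate)

lemma word_val_mono_up_z: "word_val z w (mono_word GZ [1..<Suc n] r) = mono_up n z r"
  and word_val_mono_up_w: "word_val z w (mono_word GW [1..<Suc n] r) = mono_up n w r"
  and word_val_mono_down_z: "word_val z w (mono_word GZ (rev [1..<Suc n]) r) = mono_down n z r"
  by (simp_all add: word_val_mono_word mono_up_def mono_down_def)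

lemma mono_word_words: "(\<And>i. i \<in> set ks \<Longrightarrow> G i \<in> gens n) \<Longrightarrow> mono_word G ks r \<in> words n"
  by (auto simp: mono_word_def words_def)

definition shift_by :: "nat \<Rightarrow> (nat \<Rightarrow> nat) \<Rightarrow> int \<Rightarrow> (nat \<Rightarrow> int) \<Rightarrow> nat \<Rightarrow> int" where
  "shift_by m r e l i = (if i \<in> {1..m} then l i + e * int (r i) else l i)"

lemma shift_by_0 [simp]: "shift_by 0 r e l = l"
  by (auto simp: shift_by_def fun_eq_iff)

text \<open>The difference of two neighbouring weights is a power of \<open>q\<close> times
  \<open>c k - q powi (2 * l k) * c (k - 1)\<close>. Every application lowers \<open>l k\<close> by
  one and leaves the sums over the other coordinates unchanged.\<close>

lemma word_op_z_power:
  assumes "q \<noteq> 0" "k \<in> {1..n}"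
  shows "foldr (shift_op n q c) (replicate a (GZ k)) f l =
    (q powi (int a * (\<Sum>i\<in>{1..<k}. l i) + int a * (2 * (\<Sum>i\<in>{k<..n}. l i)))) *
    (\<Prod>j<a. c k - q powi (2 * (l k - int j)) * c (k - 1)) * f (l(k := l k - int a))"
proof (induction a arbitrary: l)
  case (Suc a)
  let ?l = "l(k := l k - 1)"
  let ?X = "\<Sum>i\<in>{1..<k}. l i" let ?Y = "\<Sum>i\<in>{k<..n}. l i"
  have X: "(\<Sum>i\<in>{1..<k}. ?l i) = ?X" and Y: "(\<Sum>i\<in>{k<..n}. ?l i) = ?Y"
    by (auto intro!: sum.cong)
  have "{k - 1<..n} = insert k {k<..n}" using assms by auto
  then have "(\<Sum>i\<in>{k - 1<..n}. l i) = l k + ?Y" by simp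
  then have A: "q_weight n q c k l - q_weight n q c (k - 1) l = q powi (2 * ?Y) * (c k - q powi (2 * l k) * c (k - 1))"
    using assms by (simp add: q_weight_def power_int_add distrib_left algebra_simps)
  have P: "(\<Prod>j<Suc a. c k - q powi (2 * (l k - int j)) * c (k - 1)) =
     (c k - q powi (2 * l k) * c (k - 1)) * (\<Prod>j<a. c k - q powi (2 * (?l k - int j)) * c (k - 1))"
    by (subst prod.lessThan_Suc_shift) (simp add: algebra_simps)
  have e: "q powi (int (Suc a) * ?X + int (Suc a) * (2 * ?Y)) = q powi (2 * ?Y) * q powi ?X * q powi (int a * ?X + int a * (2 * ?Y))"
    using assms by (simp add: algebra_simps flip: power_int_add)
  have "foldr (shift_op n q c) (replicate (Suc a) (GZ k)) f l
    = q powi (2 * ?Y) * (c k - q powi (2 * l k) * c (k - 1)) * q powi ?X * foldr (shift_op n q c) (replicate a (GZ k)) f ?l"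
    by (simp only: replicate_Suc foldr.simps o_apply shift_op.simps A)
  also have "\<dots> = q powi (int (Suc a) * ?X + int (Suc a) * (2 * ?Y)) *
    (\<Prod>j<Suc a. c k - q powi (2 * (l k - int j)) * c (k - 1)) * f (l(k := l k - int (Suc a)))"
    unfolding Suc X Y P e by (simp add: algebra_simps)
  finally show ?case .
qed simp

text \<open>The scalar \<open>U\<close> may depend on \<open>l\<close> and \<open>r\<close> but not
  on \<open>c\<close> or \<open>f\<close>: later the parameters vary while everything else is fixed,
  and only the displayed product is allowed to change.\<close>

lemma word_op_mono_z:
  assumes "q \<noteq> 0" "m \<le> n"
  shows "\<exists>U. U \<noteq> 0 \<and> (\<forall>c f. word_op n q c (mono_word GZ [1..<Suc m] r) f l =
     U * (\<Prod>k\<in>{1..m}. \<Prod>j<r k. c k - q powi (2 * (l k - int j)) * c (k - 1)) * f (shift_by m r (- 1) l))"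
  using assms(2)
proof (induction m)
  case 0
  then show ?case by (intro exI[of _ 1]) (simp add: mono_word_def word_op_def)
next
  case (Suc m)
  then obtain U where U: "U \<noteq> 0" "\<And>c f. word_op n q c (mono_word GZ [1..<Suc m] r) f l =
     U * (\<Prod>k\<in>{1..m}. \<Prod>j<r k. c k - q powi (2 * (l k - int j)) * c (k - 1)) * f (shift_by m r (- 1) l)"
    by auto
  let ?l = "shift_by m r (- 1) l"
  define V where "V = q powi (int (r (Suc m)) * (\<Sum>i\<in>{1..<Suc m}. ?l i) + int (r (Suc m)) * (2 * (\<Sum>i\<in>{Suc m<..n}. ?l i)))"
  have l: "?l (Suc m) = l (Suc m)" by (simp add: shift_by_def)
  have l2: "?l(Suc m := l (Suc m) - int (r (Suc m))) = shift_by (Suc m) r (- 1) l"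
    by (auto simp: shift_by_def fun_eq_iff)
  have "word_op n q c (mono_word GZ [1..<Suc (Suc m)] r) f l = (U * V) *
     (\<Prod>k\<in>{1..Suc m}. \<Prod>j<r k. c k - q powi (2 * (l k - int j)) * c (k - 1)) * f (shift_by (Suc m) r (- 1) l)" for c f
  proof -
    have "word_op n q c (mono_word GZ [1..<Suc (Suc m)] r) f l
      = word_op n q c (mono_word GZ [1..<Suc m] r) (foldr (shift_op n q c) (replicate (r (Suc m)) (GZ (Suc m))) f) l"
      by (simp add: mono_word_def word_op_def)
    also have "\<dots> = (U * V) * (\<Prod>k\<in>{1..Suc m}. \<Prod>j<r k. c k - q powi (2 * (l k - int j)) * c (k - 1)) * f (shift_by (Suc m) r (- 1) l)"
    proof -
      have k: "Suc m \<in> {1..n}" using Suc.prems by simp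
      have step: "foldr (shift_op n q c) (replicate (r (Suc m)) (GZ (Suc m))) f ?l =
         V * (\<Prod>j<r (Suc m). c (Suc m) - q powi (2 * (l (Suc m) - int j)) * c (Suc m - 1)) *
         f (shift_by (Suc m) r (- 1) l)"
        unfolding V_def using word_op_z_power[OF assms(1) k, of c "r (Suc m)" f ?l] by (simp only: l l2)
      show ?thesis
        unfolding U(2) step prod.nat_ivl_Suc'[OF le_add1[of 1 m, unfolded plus_1_eq_Suc]] by (simp only: mult_ac)
    qed
    finally show ?thesis .
  qed
  moreover have "U * V \<noteq> 0" using U assms(1) by (simp add: V_def)
  ultimately show ?case by blast
qed

lemma word_op_w_power:
  assumes "q \<noteq> 0" "k \<in> {1..n}"
  shows "foldr (shift_op n q c) (replicate a (GW k)) f l =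
    (q powi (- (int a * (\<Sum>i\<in>{1..<k}. l i)))) * f (l(k := l k + int a))"
proof (induction a arbitrary: l)
  case (Suc a)
  let ?l = "l(k := l k + 1)"
  let ?X = "\<Sum>i\<in>{1..<k}. l i"
  have X: "(\<Sum>i\<in>{1..<k}. ?l i) = ?X" by (auto intro!: sum.cong)
  have e: "q powi (- (int (Suc a) * ?X)) = q powi (- ?X) * q powi (- (int a * ?X))"
    using assms by (simp add: algebra_simps flip: power_int_add)
  have "foldr (shift_op n q c) (replicate (Suc a) (GW k)) f l
    = q powi (- ?X) * foldr (shift_op n q c) (replicate a (GW k)) f ?l"
    by (simp only: replicate_Suc foldr.simps o_apply shift_op.simps)
  also have "\<dots> = (q powi (- (int (Suc a) * ?X))) * f (l(k := l k + int (Suc a)))"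
    unfolding Suc X e by (simp add: algebra_simps)
  finally show ?case .
qed simp

lemma word_op_mono_w:
  assumes "q \<noteq> 0" "m \<le> n"
  shows "\<exists>U. U \<noteq> 0 \<and> (\<forall>c f. word_op n q c (mono_word GW [1..<Suc m] r) f l = U * f (shift_by m r 1 l))"
  using assms(2)
proof (induction m)
  case 0
  then show ?case by (intro exI[of _ 1]) (simp add: mono_word_def word_op_def)
next
  case (Suc m)
  then obtain U where U: "U \<noteq> 0" "\<And>c f. word_op n q c (mono_word GW [1..<Suc m] r) f l = U * f (shift_by m r 1 l)"
    by auto
  let ?l = "shift_by m r 1 l"
  define V where "V = q powi (- (int (r (Suc m)) * (\<Sum>i\<in>{1..<Suc m}. ?l i)))"
  have l: "?l (Suc m) = l (Suc m)" by (simp add: shift_by_def)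
  have l2: "?l(Suc m := l (Suc m) + int (r (Suc m))) = shift_by (Suc m) r 1 l"
    by (auto simp: shift_by_def fun_eq_iff)
  have "word_op n q c (mono_word GW [1..<Suc (Suc m)] r) f l = (U * V) * f (shift_by (Suc m) r 1 l)" for c f
  proof -
    have "word_op n q c (mono_word GW [1..<Suc (Suc m)] r) f l
      = word_op n q c (mono_word GW [1..<Suc m] r) (foldr (shift_op n q c) (replicate (r (Suc m)) (GW (Suc m))) f) l"
      by (simp add: mono_word_def word_op_def)
    also have "\<dots> = (U * V) * f (shift_by (Suc m) r 1 l)"
    proof -
      have k: "Suc m \<in> {1..n}" using Suc.prems by simp
      have step: "foldr (shift_op n q c) (replicate (r (Suc m)) (GW (Suc m))) f ?l = V * f (shift_by (Suc m) r 1 l)"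
        unfolding V_def using word_op_w_power[OF assms(1) k, of c "r (Suc m)" f ?l] by (simp only: l l2)
      show ?thesis unfolding U(2) step by (simp only: mult_ac)
    qed
    finally show ?thesis .
  qed
  moreover have "U * V \<noteq> 0" using U assms(1) by (simp add: V_def)
  ultimately show ?case by blast
qed

text \<open>Evaluating at \<open>c k = g k (r k) * c (k - 1)\<close> kills every product indexed by a vector that is not
  below \<open>r\<close> at the positions \<open>2, \<dots>, n\<close>, which makes the family triangular.\<close>

lemma product_family_independent:
  fixes b :: "(nat \<Rightarrow> nat) \<Rightarrow> complex" and g :: "nat \<Rightarrow> nat \<Rightarrow> complex"
  assumes n: "n \<ge> 1" and R: "finite R" "R \<subseteq> exponents n" and g: "\<And>k j. g k j \<noteq> 0" "\<And>k. inj (g k)"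
    and rel: "\<And>c. c 0 = 0 \<Longrightarrow> (\<Sum>r\<in>R. b r * (\<Prod>k\<in>{1..n}. \<Prod>j<r k. c k - g k j * c (k - 1))) = 0"
  shows "\<forall>r\<in>R. b r = 0"
proof (rule ccontr)
  assume "\<not> (\<forall>r\<in>R. b r = 0)"
  define N where "N r = (\<Sum>k\<in>{2..n}. r k)" for r :: "nat \<Rightarrow> nat"
  let ?R = "{r\<in>R. b r \<noteq> 0}"
  have "?R \<noteq> {}" using \<open>\<not> (\<forall>r\<in>R. b r = 0)\<close> by auto
  \<comment> \<open>The minimum is over the total exponent at the positions 2 to \<open>n\<close>.
    Position 1 is left out because it is resolved by a polynomial argument at the end.\<close>
  then obtain r0 where r0: "r0 \<in> ?R" and min: "\<And>r. r \<in> ?R \<Longrightarrow> N r0 \<le> N r"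
    using arg_min_if_finite[of ?R N] R(1)
    by (metis (no_types, lifting) finite_subset linorder_not_less mem_Collect_eq subsetI)
  define S where "S = {r\<in>?R. \<forall>k\<in>{2..n}. r k = r0 k}"
  have fS: "finite S" using R(1) by (simp add: S_def)
  define d where "d k = (\<Prod>i\<in>{2..k}. g i (r0 i))" for k
  have d0: "d k \<noteq> 0" for k using g(1) by (simp add: d_def)
  define V where "V = (\<Prod>k\<in>{2..n}. \<Prod>j<r0 k. (g k (r0 k) - g k j) * d (k - 1))"
  have V: "V \<noteq> 0"
    unfolding V_def using g(2) d0 by (auto simp: inj_eq)
  have split: "(\<Prod>k\<in>{1..n}. F k) = F 1 * (\<Prod>k\<in>{2..n}. F k)" for F :: "nat \<Rightarrow> complex"
    using n by (simp add: prod.atLeast_Suc_atMost numeral_2_eq_2)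
  have eq: "(\<Sum>r\<in>S. b r * u ^ r 1) = 0" if u: "u \<noteq> 0" for u
  proof -
    \<comment> \<open>The recursion only constrains the positions from 2 on; the value at 1 stays a
      free nonzero number \<open>u\<close>, since \<open>d 1\<close> is an empty product.\<close>
    define c where "c k = (if k = 0 then 0 else u * d k)" for k
    have ck: "c k - g k j * c (k - 1) = (g k (r0 k) - g k j) * (u * d (k - 1))" if k: "k \<in> {2..n}" for k j
    proof -
      obtain i where i: "k = Suc i" "i \<ge> 1" using k by (cases k) auto
      have "{2..Suc i} = insert (Suc i) {2..i}" using i by auto
      then have "d k = g k (r0 k) * d (k - 1)" by (simp add: d_def i)
      then show ?thesis using i by (simp add: c_def algebra_simps)
    qed
    have zero: "(\<Prod>k\<in>{1..n}. \<Prod>j<r k. c k - g k j * c (k - 1)) = 0" if r: "r \<in> ?R - S" for r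
    proof -
      \<comment> \<open>An index outside \<open>S\<close> that never exceeds \<open>r0\<close> would
        have a smaller total, contrary to minimality. Where it does exceed \<open>r0\<close>, the
        factor with \<open>j = r0 k\<close> occurs, and it is zero.\<close>
      have "\<exists>k\<in>{2..n}. r0 k < r k"
      proof (rule ccontr)
        assume a: "\<not> (\<exists>k\<in>{2..n}. r0 k < r k)"
        obtain k where k: "k \<in> {2..n}" "r k \<noteq> r0 k" using r by (auto simp: S_def)
        have "N r < N r0" unfolding N_def
          by (rule sum_strict_mono_ex1) (use a k in \<open>auto simp: not_less intro!: bexI[of _ k] le_neq_trans\<close>)
        then show False using min[of r] r by auto
      qed
      then obtain k where k: "k \<in> {2..n}" "r0 k < r k" by auto
      have "c k - g k (r0 k) * c (k - 1) = 0" using ck[OF k(1), of "r0 k"] by simp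
      then have "(\<Prod>j<r k. c k - g k j * c (k - 1)) = 0"
        by (rule prod_zero[OF finite_lessThan bexI]) (use k(2) in simp)
      then show ?thesis by (rule prod_zero[OF finite_atLeastAtMost bexI]) (use k(1) in simp)
    qed
    have val: "(\<Prod>k\<in>{1..n}. \<Prod>j<r k. c k - g k j * c (k - 1)) = u ^ N r0 * V * u ^ r 1" if r: "r \<in> S" for r
    proof -
      have "(\<Prod>k\<in>{2..n}. \<Prod>j<r k. c k - g k j * c (k - 1)) = (\<Prod>k\<in>{2..n}. \<Prod>j<r0 k. (g k (r0 k) - g k j) * (u * d (k - 1)))"
      proof (rule prod.cong[OF refl])
        fix k assume k: "k \<in> {2..n}"
        then have "r k = r0 k" using r by (simp add: S_def)
        then show "(\<Prod>j<r k. c k - g k j * c (k - 1)) = (\<Prod>j<r0 k. (g k (r0 k) - g k j) * (u * d (k - 1)))"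
          by (simp only: ck[OF k])
      qed
      also have "\<dots> = (\<Prod>k\<in>{2..n}. u ^ r0 k * (\<Prod>j<r0 k. (g k (r0 k) - g k j) * d (k - 1)))"
        by (intro prod.cong refl) (simp add: prod.distrib power_mult_distrib mult_ac)
      also have "\<dots> = u ^ N r0 * V"
        by (simp add: prod.distrib V_def N_def power_sum)
      finally show ?thesis
        unfolding split by (simp add: c_def d_def)
    qed
    have "0 = (\<Sum>r\<in>R. b r * (\<Prod>k\<in>{1..n}. \<Prod>j<r k. c k - g k j * c (k - 1)))"
      using rel[of c] by (simp add: c_def)
    also have "\<dots> = (\<Sum>r\<in>S. b r * (\<Prod>k\<in>{1..n}. \<Prod>j<r k. c k - g k j * c (k - 1)))"
      by (rule sum.mono_neutral_right) (use R(1) zero in \<open>auto simp: S_def\<close>)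
    also have "\<dots> = (\<Sum>r\<in>S. b r * (u ^ N r0 * V * u ^ r 1))"
      by (intro sum.cong refl) (simp only: val)
    also have "\<dots> = (u ^ N r0 * V) * (\<Sum>r\<in>S. b r * u ^ r 1)"
      by (simp add: sum_distrib_left mult_ac)
    finally show ?thesis using u V by simp
  qed
  \<comment> \<open>The indices in \<open>S\<close> differ only at position 1, so the surviving
    relation is a polynomial in \<open>u\<close> with distinct exponents and infinitely many
    roots.\<close>
  define P where "P = (\<Sum>r\<in>S. monom (b r) (r 1))"
  have "poly P u = 0" if "u \<noteq> 0" for u
    using eq[OF that] by (simp add: P_def poly_sum poly_monom)
  then have "UNIV - {0} \<subseteq> {u. poly P u = 0}" by auto
  moreover have "infinite (UNIV - {0::complex})" by (simp add: infinite_UNIV_char_0)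
  ultimately have "P = 0" using poly_roots_finite finite_subset by blast
  moreover have "coeff P (r0 1) = b r0"
  proof -
    have inj1: "r = r0" if "r \<in> S" "r 1 = r0 1" for r
    proof
      fix i
      have "r \<in> exponents n" "r0 \<in> exponents n" using that r0 R by (auto simp: S_def)
      then show "r i = r0 i"
        using that by (cases "i \<in> {2..n}"; cases "i = 1") (auto simp: S_def exponents_def)
    qed
    have "coeff P (r0 1) = (\<Sum>r\<in>S. if r = r0 then b r else 0)"
      unfolding P_def coeff_sum by (intro sum.cong refl) (use inj1 in \<open>auto\<close>)
    also have "\<dots> = b r0" using fS r0 by (simp add: S_def)
    finally show ?thesis .
  qed
  ultimately show False using r0 by simp
qed

lemma power_int_inj:
  fixes q :: complex
  assumes "q \<noteq> 0" "\<And>k. k > 0 \<Longrightarrow> q ^ k \<noteq> 1" "q powi a = q powi b"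
  shows "a = b"
proof -
  have *: "a \<le> b" if "q powi a = q powi b" for a b
  proof (rule ccontr)
    assume "\<not> a \<le> b"
    then have "q powi (a - b) = q ^ nat (a - b)" by (simp add: power_int_nonneg_exp)
    moreover have "q powi (a - b) = 1" using that assms(1) by (simp add: power_int_diff)
    ultimately show False using assms(2)[of "nat (a - b)"] \<open>\<not> a \<le> b\<close> by simp
  qed
  show ?thesis using *[OF assms(3)] *[OF assms(3)[symmetric]] by simp
qed

text \<open>Applying the operators to the indicator function of one lattice point and evaluating at
  the origin keeps only the monomials of one weight. For fixed weight \<open>s - r\<close> the pair
  is determined by \<open>r\<close>, which reduces the claim to
  \<open>product_family_independent\<close>; the numbers \<open>g\<close> may depend on the
  weight.\<close>

lemma monomials_independent_aux:
  fixes z w :: "nat \<Rightarrow> 'a::complex_algebra_1" and g :: "(nat \<Rightarrow> int) \<Rightarrow> nat \<Rightarrow> nat \<Rightarrow> complex"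
  assumes pr: "presents n q z w" and q: "q \<noteq> 0" and n: "n \<ge> 1"
    and S: "finite S" "S \<subseteq> exponents n \<times> exponents n"
    and u: "\<And>x. x \<in> S \<Longrightarrow> u x \<in> words n"
    and op: "\<And>r s. (r, s) \<in> S \<Longrightarrow> \<exists>U. U \<noteq> 0 \<and> (\<forall>c f. word_op n q c (u (r, s)) f (\<lambda>_. 0) =
       U * (\<Prod>k\<in>{1..n}. \<Prod>j<r k. c k - g (\<lambda>i. int (s i) - int (r i)) k j * c (k - 1)) * f (\<lambda>i. int (s i) - int (r i)))"
    and g: "\<And>\<nu> k j. g \<nu> k j \<noteq> 0" "\<And>\<nu> k. inj (g \<nu> k)"
    and rel: "(\<Sum>x\<in>S. a x *\<^sub>C word_val z w (u x)) = 0" and x: "x \<in> S"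
  shows "a x = 0"
proof -
  define wt :: "(nat \<Rightarrow> nat) \<times> (nat \<Rightarrow> nat) \<Rightarrow> nat \<Rightarrow> int"
    where "wt = (\<lambda>(r, s) i. int (s i) - int (r i))"
  define \<nu> where "\<nu> = wt x"
  define S' where "S' = {y\<in>S. wt y = \<nu>}"
  have "\<forall>y\<in>S. \<exists>U. U \<noteq> 0 \<and> (\<forall>c f. word_op n q c (u y) f (\<lambda>_. 0) =
       U * (\<Prod>k\<in>{1..n}. \<Prod>j<fst y k. c k - g (wt y) k j * c (k - 1)) * f (wt y))"
    using op by (auto simp: wt_def)
  from bchoice[OF this] obtain U where "\<forall>y\<in>S. U y \<noteq> 0 \<and> (\<forall>c f. word_op n q c (u y) f (\<lambda>_. 0) =
       U y * (\<Prod>k\<in>{1..n}. \<Prod>j<fst y k. c k - g (wt y) k j * c (k - 1)) * f (wt y))"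
    by (elim exE)
  then have U: "\<And>y. y \<in> S \<Longrightarrow> U y \<noteq> 0" "\<And>y c f. y \<in> S \<Longrightarrow> word_op n q c (u y) f (\<lambda>_. 0) =
       U y * (\<Prod>k\<in>{1..n}. \<Prod>j<fst y k. c k - g (wt y) k j * c (k - 1)) * f (wt y)"
    by simp_all
  have inj: "inj_on fst S'"
  proof (rule inj_onI)
    fix y y' assume y: "y \<in> S'" "y' \<in> S'" "fst y = fst y'"
    then have "wt y = wt y'" by (simp add: S'_def)
    then have "int (snd y i) = int (snd y' i)" for i
      using y(3) by (auto simp: wt_def fun_eq_iff split: prod.splits)
    then show "y = y'" using y(3) by (auto simp: prod_eq_iff)
  qed
  have "(\<Sum>r\<in>fst ` S'. (a (the_inv_into S' fst r) * U (the_inv_into S' fst r)) *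
      (\<Prod>k\<in>{1..n}. \<Prod>j<r k. c k - g \<nu> k j * c (k - 1))) = 0" if c: "c 0 = 0" for c
  proof -
    have 0: "(\<Sum>y\<in>S. a y * word_op n q c (u y) (\<lambda>l. if l = \<nu> then 1 else 0) (\<lambda>_. 0)) = 0"
      by (rule word_val_relation_op[of n q z w c S u a, OF pr q c S(1) u rel])
    have 1: "(\<Sum>y\<in>S. a y * word_op n q c (u y) (\<lambda>l. if l = \<nu> then 1 else 0) (\<lambda>_. 0))
       = (\<Sum>y\<in>S'. (a y * U y) * (\<Prod>k\<in>{1..n}. \<Prod>j<fst y k. c k - g \<nu> k j * c (k - 1)))"
      unfolding S'_def by (rule sum.mono_neutral_cong_right) (use S(1) U(2) in auto)
    have *: "(\<Sum>y\<in>S'. (a y * U y) * (\<Prod>k\<in>{1..n}. \<Prod>j<fst y k. c k - g \<nu> k j * c (k - 1))) = 0"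
      using 0 unfolding 1 .
    let ?P = "\<lambda>r. \<Prod>k\<in>{1..n}. \<Prod>j<r k. c k - g \<nu> k j * c (k - 1)"
    let ?F = "\<lambda>r. (a (the_inv_into S' fst r) * U (the_inv_into S' fst r)) * ?P r"
    have "sum ?F (fst ` S') = (\<Sum>y\<in>S'. ?F (fst y))"
      by (rule sum.reindex[OF inj, unfolded o_def])
    also have "(\<Sum>y\<in>S'. ?F (fst y)) = (\<Sum>y\<in>S'. (a y * U y) * ?P (fst y))"
    proof (rule sum.cong[OF refl])
      fix y assume "y \<in> S'"
      then have "the_inv_into S' fst (fst y) = y" by (rule the_inv_into_f_f[OF inj])
      then show "?F (fst y) = (a y * U y) * ?P (fst y)" by (simp only:)
    qed
    finally show ?thesis using * by (rule trans)
  qed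
  then have "\<forall>r\<in>fst ` S'. a (the_inv_into S' fst r) * U (the_inv_into S' fst r) = 0"
  proof (intro product_family_independent[OF n, where g = "g \<nu>"])
    show "finite (fst ` S')" "fst ` S' \<subseteq> exponents n" using S by (auto simp: S'_def)
    show "g \<nu> k j \<noteq> 0" "inj (g \<nu> k)" for k j by (rule g)+
  qed
  moreover have "x \<in> S'" using x by (simp add: S'_def \<nu>_def)
  ultimately have "a x * U x = 0" by (simp add: the_inv_into_f_f[OF inj])
  then show ?thesis using U(1)[OF x] by simp
qed

lemma shift_by_zero: "r \<in> exponents n \<Longrightarrow> shift_by n r e l = (\<lambda>i. l i + e * int (r i))"
  by (auto simp: shift_by_def exponents_def fun_eq_iff)

lemma monomials_zw_independent:
  fixes z w :: "nat \<Rightarrow> 'a::complex_algebra_1"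
  assumes pr: "presents n q z w" and q: "q \<noteq> 0" "\<And>k. k > 0 \<Longrightarrow> q ^ k \<noteq> 1" and n: "n \<ge> 1"
    and S: "finite S" "S \<subseteq> exponents n \<times> exponents n"
    and rel: "(\<Sum>(r, s)\<in>S. a (r, s) *\<^sub>C (mono_up n z r * mono_up n w s)) = 0" and x: "x \<in> S"
  shows "a x = 0"
proof (rule monomials_independent_aux[where g = "\<lambda>_ _ j. q powi (2 * (0 - int j))"
      and u = "\<lambda>(r, s). mono_word GZ [1..<Suc n] r + mono_word GW [1..<Suc n] s", OF pr q(1) n S])
  fix r s assume "(r, s) \<in> S"
  then have rs: "r \<in> exponents n" "s \<in> exponents n" using S by auto
  let ?u = "\<lambda>(r, s). mono_word GZ [1..<Suc n] r + mono_word GW [1..<Suc n] s"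
  obtain U where U: "U \<noteq> 0" "\<And>c f. word_op n q c (mono_word GZ [1..<Suc n] r) f (\<lambda>_. 0) =
     U * (\<Prod>k\<in>{1..n}. \<Prod>j<r k. c k - q powi (2 * (0 - int j)) * c (k - 1)) * f (shift_by n r (- 1) (\<lambda>_. 0))"
    using word_op_mono_z[OF q(1) order_refl, of n r "\<lambda>_. 0"] by blast
  obtain V where V: "V \<noteq> 0" "\<And>c f. word_op n q c (mono_word GW [1..<Suc n] s) f (shift_by n r (- 1) (\<lambda>_. 0)) =
     V * f (shift_by n s 1 (shift_by n r (- 1) (\<lambda>_. 0)))"
    using word_op_mono_w[OF q(1) order_refl, of n s "shift_by n r (- 1) (\<lambda>_. 0)"] by blast
  have e: "shift_by n s 1 (shift_by n r (- 1) (\<lambda>_. 0)) = (\<lambda>i. int (s i) - int (r i))"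
    by (simp add: shift_by_zero rs)
  show "\<exists>U. U \<noteq> 0 \<and> (\<forall>c f. word_op n q c (?u (r, s)) f (\<lambda>_. 0) =
       U * (\<Prod>k\<in>{1..n}. \<Prod>j<r k. c k - q powi (2 * (0 - int j)) * c (k - 1)) * f (\<lambda>i. int (s i) - int (r i)))"
    using U(1) V(1) by (intro exI[of _ "U * V"]) (simp only: split_conv word_op_plus U(2) V(2) e, simp add: mult_ac)
next
  show "inj (\<lambda>j. q powi (2 * (0 - int j)))"
    by (rule injI) (use power_int_inj[OF q] in force)
  show "(\<Sum>x\<in>S. a x *\<^sub>C word_val z w (case x of (r, s) \<Rightarrow> mono_word GZ [1..<Suc n] r + mono_word GW [1..<Suc n] s)) = 0"
    using rel by (simp only: word_val_plus word_val_mono_up_z word_val_mono_up_w split_def prod.collapse)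
qed (use q x in \<open>auto intro!: mono_word_words\<close>)

lemma monomials_wz_independent:
  fixes z w :: "nat \<Rightarrow> 'a::complex_algebra_1"
  assumes pr: "presents n q z w" and q: "q \<noteq> 0" "\<And>k. k > 0 \<Longrightarrow> q ^ k \<noteq> 1" and n: "n \<ge> 1"
    and S: "finite S" "S \<subseteq> exponents n \<times> exponents n"
    and rel: "(\<Sum>(r, s)\<in>S. a (r, s) *\<^sub>C (mono_up n w s * mono_up n z r)) = 0" and x: "x \<in> S"
  shows "a x = 0"
proof (rule monomials_independent_aux[where g = "\<lambda>\<nu> k j. q powi (2 * (\<nu> k + 1 + int j))"
      and u = "\<lambda>(r, s). mono_word GW [1..<Suc n] s + mono_word GZ [1..<Suc n] r", OF pr q(1) n S])
  fix r s assume "(r, s) \<in> S"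
  then have rs: "r \<in> exponents n" "s \<in> exponents n" using S by auto
  let ?u = "\<lambda>(r, s). mono_word GW [1..<Suc n] s + mono_word GZ [1..<Suc n] r"
  let ?l = "shift_by n s 1 (\<lambda>_. 0)"
  obtain U where U: "U \<noteq> 0" "\<And>c f. word_op n q c (mono_word GZ [1..<Suc n] r) f ?l =
     U * (\<Prod>k\<in>{1..n}. \<Prod>j<r k. c k - q powi (2 * (?l k - int j)) * c (k - 1)) * f (shift_by n r (- 1) ?l)"
    using word_op_mono_z[OF q(1) order_refl, of n r ?l] by blast
  obtain V where V: "V \<noteq> 0" "\<And>c f. word_op n q c (mono_word GW [1..<Suc n] s) f (\<lambda>_. 0) = V * f ?l"
    using word_op_mono_w[OF q(1) order_refl, of n s "\<lambda>_. 0"] by blast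
  have e: "shift_by n r (- 1) ?l = (\<lambda>i. int (s i) - int (r i))"
    by (simp add: shift_by_zero rs)
  \<comment> \<open>Here the \<open>z\<close>-operators act at the lattice point \<open>s\<close>,
    so the factors involve \<open>s k - j\<close>. Reversing the product over \<open>j < r k\<close>
    expresses them through the weight \<open>s k - r k\<close>, as the auxiliary lemma
    requires.\<close>
  have P: "(\<Prod>j<r k. c k - q powi (2 * (?l k - int j)) * c (k - 1)) =
    (\<Prod>j<r k. c k - q powi (2 * ((int (s k) - int (r k)) + 1 + int j)) * c (k - 1))" for c :: "nat \<Rightarrow> complex" and k
    unfolding prod.nat_diff_reindex[of "\<lambda>j. c k - q powi (2 * (?l k - int j)) * c (k - 1)", symmetric]
    by (intro prod.cong refl) (simp add: shift_by_zero rs of_nat_diff algebra_simps)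
  show "\<exists>U. U \<noteq> 0 \<and> (\<forall>c f. word_op n q c (?u (r, s)) f (\<lambda>_. 0) =
       U * (\<Prod>k\<in>{1..n}. \<Prod>j<r k. c k - q powi (2 * ((int (s k) - int (r k)) + 1 + int j)) * c (k - 1)) * f (\<lambda>i. int (s i) - int (r i)))"
    using U(1) V(1) by (intro exI[of _ "V * U"]) (simp only: split_conv word_op_plus U(2) V(2) e P, simp add: mult_ac)
next
  show "inj (\<lambda>j. q powi (2 * (\<nu> k + 1 + int j)))" for \<nu> :: "nat \<Rightarrow> int" and k
    by (rule injI) (use power_int_inj[OF q] in force)
  show "(\<Sum>x\<in>S. a x *\<^sub>C word_val z w (case x of (r, s) \<Rightarrow> mono_word GW [1..<Suc n] s + mono_word GZ [1..<Suc n] r)) = 0"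
    using rel by (simp only: word_val_plus word_val_mono_up_z word_val_mono_up_w split_def prod.collapse)
qed (use q x in \<open>auto intro!: mono_word_words\<close>)

section \<open>The difference operators\<close>

abbreviation clinear :: "('a::complex_algebra_1 \<Rightarrow> 'b::complex_algebra_1) \<Rightarrow> bool" where
  "clinear \<equiv> Vector_Spaces.linear scaleC scaleC"

lemma clinear_iff: "clinear f \<longleftrightarrow> (\<forall>x y. f (x + y) = f x + f y) \<and> (\<forall>c x. f (c *\<^sub>C x) = c *\<^sub>C f x)"
  unfolding Vector_Spaces.linear_iff
  by (auto intro: complex_vector.vector_space_axioms)

lemma clinear_add: "clinear f \<Longrightarrow> f (x + y) = f x + f y"
  and clinear_scale: "clinear f \<Longrightarrow> f (c *\<^sub>C x) = c *\<^sub>C f x"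
  by (simp_all add: clinear_iff)

lemma clinear_diff: "clinear f \<Longrightarrow> f (x - y) = f x - f y"
  using clinear_add[of f "x - y" y] by simp

lemma clinear_0: "clinear f \<Longrightarrow> f 0 = 0"
  using clinear_scale[of f 0 0] by simp

lemma clinear_sum: "clinear f \<Longrightarrow> f (sum g S) = (\<Sum>i\<in>S. f (g i))"
  by (induction S rule: infinite_finite_induct) (simp_all add: clinear_0 clinear_add)

lemma clinear_id: "clinear (\<lambda>x. x)"
  and clinear_zero: "clinear (\<lambda>x. 0)"
  by (simp_all add: clinear_iff)

lemma clinear_mult_left: "clinear f \<Longrightarrow> clinear (\<lambda>x. a * f x)"
  and clinear_mult_right: "clinear f \<Longrightarrow> clinear (\<lambda>x. f x * a)"
  and clinear_scaleC: "clinear f \<Longrightarrow> clinear (\<lambda>x. c *\<^sub>C f x)"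
  and clinear_plus: "clinear f \<Longrightarrow> clinear g \<Longrightarrow> clinear (\<lambda>x. f x + g x)"
  and clinear_comp: "clinear h \<Longrightarrow> clinear f \<Longrightarrow> clinear (\<lambda>x. h (f x))"
  by (simp_all add: clinear_iff distrib_left distrib_right scaleC_mult_simps scaleC_add_right add_ac mult.commute)

lemma clinear_setsum: "(\<And>i. i \<in> S \<Longrightarrow> clinear (f i)) \<Longrightarrow> clinear (\<lambda>x. \<Sum>i\<in>S. f i x)"
  by (simp add: clinear_iff sum.distrib scaleC_sum_right)

lemmas clinear_intros = clinear_id clinear_zero clinear_mult_left clinear_mult_right clinear_scaleC
  clinear_plus clinear_setsum

lemma clinear_eq_on_span:
  "clinear f \<Longrightarrow> clinear g \<Longrightarrow> (\<And>b. b \<in> B \<Longrightarrow> f b = g b) \<Longrightarrow> x \<in> complex_vector.span B \<Longrightarrow> f x = g x"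
  using complex_vector_pair.linear_eq_on[of f g x B] by blast

lemma clinear_maps_span:
  assumes "clinear f" "\<And>b. b \<in> B \<Longrightarrow> f b \<in> complex_vector.span C" "x \<in> complex_vector.span B"
  shows "f x \<in> complex_vector.span C"
  using assms(3)
  by (induction rule: complex_vector.span_induct_alt)
     (simp_all add: clinear_0 clinear_add clinear_scale assms complex_vector.span_zero complex_vector.span_add
       complex_vector.span_scale)

text \<open>Stated for indexed families rather than sets, so that it includes injectivity and lets
  coefficients be compared index by index.\<close>

definition family_independent :: "('i \<Rightarrow> 'a::complex_algebra_1) \<Rightarrow> 'i set \<Rightarrow> bool" where
  "family_independent b E \<longleftrightarrow>
     (\<forall>S a. finite S \<and> S \<subseteq> E \<and> (\<Sum>x\<in>S. a x *\<^sub>C b x) = 0 \<longrightarrow> (\<forall>x\<in>S. a x = 0))"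

lemma family_independentD:
  "family_independent b E \<Longrightarrow> finite S \<Longrightarrow> S \<subseteq> E \<Longrightarrow> (\<Sum>x\<in>S. a x *\<^sub>C b x) = 0 \<Longrightarrow> x \<in> S \<Longrightarrow> a x = 0"
  unfolding family_independent_def by blast

lemma family_independent_inj:
  assumes "family_independent b E"
  shows "inj_on b E"
proof (rule inj_onI, rule ccontr)
  fix x y assume xy: "x \<in> E" "y \<in> E" "b x = b y" "x \<noteq> y"
  have "(\<Sum>t\<in>{x, y}. (if t = x then 1 else - 1) *\<^sub>C b t) = 0"
    using xy by (simp add: scaleC_one)
  from family_independentD[OF assms _ _ this, of x] xy show False by simp
qed

lemma family_independent_independent:
  assumes "family_independent b E"
  shows "complex_vector.independent (b ` E)"
  unfolding complex_vector.independent_explicit_module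
proof (intro allI impI)
  fix T u v assume T: "finite T" "T \<subseteq> b ` E" "(\<Sum>v\<in>T. u v *\<^sub>C v) = 0" "v \<in> T"
  obtain S where S: "S \<subseteq> E" "finite S" "T = b ` S" using finite_subset_image[OF T(1,2)] by blast
  have inj: "inj_on b S" using family_independent_inj[OF assms] S(1) inj_on_subset by blast
  have "(\<Sum>x\<in>S. u (b x) *\<^sub>C b x) = 0"
    using T(3) by (simp add: S(3) sum.reindex[OF inj])
  from family_independentD[OF assms S(2,1) this] show "u v = 0" using T(4) S(3) by blast
qed

text \<open>Source of all maps that are built by prescribing values on monomials: the difference
  operators, the coefficient operators and the functional.\<close>

lemma ex_clinear_on_family:
  fixes b :: "'i \<Rightarrow> 'a::complex_algebra_1" and f :: "'i \<Rightarrow> 'b::complex_algebra_1"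
  assumes "family_independent b E"
  shows "\<exists>D. clinear D \<and> (\<forall>x\<in>E. D (b x) = f x)"
proof -
  have inj: "inj_on b E" by (rule family_independent_inj[OF assms])
  have "\<exists>D. clinear D \<and> (\<forall>v\<in>b ` E. D v = f (the_inv_into E b v))"
    by (rule complex_vector_pair.linear_independent_extend[OF family_independent_independent[OF assms]])
  then obtain D where "clinear D" "\<forall>v\<in>b ` E. D v = f (the_inv_into E b v)"
    by (elim exE conjE)
  then show ?thesis using the_inv_into_f_f[OF inj] by (intro exI[of _ D]) auto
qed

lemma hom_polys_eq: "hom_polys p z w a b = complex_vector.span (word_val z w ` {u \<in> words p. zdeg u = a \<and> wdeg u = b})"
  unfolding hom_polys_def zdeg_def wdeg_def by simp

definition sub_alg :: "nat \<Rightarrow> (nat \<Rightarrow> 'a::complex_algebra_1) \<Rightarrow> (nat \<Rightarrow> 'a) \<Rightarrow> 'a set" where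
  "sub_alg p z w = complex_vector.span (word_val z w ` words p)"

lemma hom_polys_subset_sub_alg: "hom_polys p z w a b \<subseteq> sub_alg p z w"
  unfolding hom_polys_eq sub_alg_def by (intro complex_vector.span_mono) auto

lemma sub_alg_mult: "x \<in> sub_alg p z w \<Longrightarrow> y \<in> sub_alg p z w \<Longrightarrow> x * y \<in> sub_alg p z w"
  unfolding sub_alg_def
  by (rule span_mult) (auto simp flip: word_val_plus intro!: complex_vector.span_base imageI)

lemma hom_polys_mult:
  "x \<in> hom_polys p z w a b \<Longrightarrow> y \<in> hom_polys p z w a' b' \<Longrightarrow> x * y \<in> hom_polys p z w (a + a') (b + b')"
  unfolding hom_polys_eq
  by (rule span_mult) (auto simp flip: word_val_plus intro!: complex_vector.span_base imageI)

lemma sub_alg_mono: "p \<le> m \<Longrightarrow> sub_alg p z w \<subseteq> sub_alg m z w"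
  unfolding sub_alg_def using words_mono[of p m] by (intro complex_vector.span_mono) auto

lemma hom_polys_mono: "p \<le> m \<Longrightarrow> hom_polys p z w a b \<subseteq> hom_polys m z w a b"
  unfolding hom_polys_eq using words_mono[of p m] by (intro complex_vector.span_mono) auto

lemma hom_polys_one: "1 \<in> hom_polys p z w 0 0"
  unfolding hom_polys_eq by (rule complex_vector.span_base) (auto intro!: image_eqI[of _ _ "Free_Word []"])

lemma hom_polys_z: "i \<in> {1..p} \<Longrightarrow> z i \<in> hom_polys p z w 1 0"
  unfolding hom_polys_eq
  by (rule complex_vector.span_base) (auto intro!: image_eqI[of _ _ "Free_Word [GZ i]"] simp: word_val_Cons)

lemma hom_polys_w: "i \<in> {1..p} \<Longrightarrow> w i \<in> hom_polys p z w 0 1"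
  unfolding hom_polys_eq
  by (rule complex_vector.span_base) (auto intro!: image_eqI[of _ _ "Free_Word [GW i]"] simp: word_val_Cons)

lemma hom_polys_scale: "x \<in> hom_polys p z w a b \<Longrightarrow> c *\<^sub>C x \<in> hom_polys p z w a b"
  and hom_polys_sum: "(\<And>i. i \<in> S \<Longrightarrow> f i \<in> hom_polys p z w a b) \<Longrightarrow> sum f S \<in> hom_polys p z w a b"
  unfolding hom_polys_def
  by (simp_all add: complex_vector.span_scale complex_vector.span_sum)

lemma hom_polys_power: "x \<in> hom_polys p z w a b \<Longrightarrow> x ^ k \<in> hom_polys p z w (k * a) (k * b)"
  by (induction k) (auto simp: hom_polys_one dest: hom_polys_mult)

lemma hom_polys_mono_up_z: "mono_up p z r \<in> hom_polys p z w (sum r {1..p}) 0"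
proof -
  have "mono_up m z r \<in> hom_polys p z w (sum r {1..m}) 0" if "m \<le> p" for m
    using that
  proof (induction m)
    case (Suc m)
    then have "mono_up m z r * z (Suc m) ^ r (Suc m) \<in> hom_polys p z w (sum r {1..m} + r (Suc m) * 1) (0 + r (Suc m) * 0)"
      by (intro hom_polys_mult hom_polys_power hom_polys_z) auto
    then show ?case by (simp add: mono_up_Suc)
  qed (simp add: hom_polys_one)
  then show ?thesis by simp
qed

lemma hom_polys_mono_up_w: "mono_up p w r \<in> hom_polys p z w 0 (sum r {1..p})"
proof -
  have "mono_up m w r \<in> hom_polys p z w 0 (sum r {1..m})" if "m \<le> p" for m
    using that
  proof (induction m)
    case (Suc m)
    then have "mono_up m w r * w (Suc m) ^ r (Suc m) \<in> hom_polys p z w (0 + r (Suc m) * 0) (sum r {1..m} + r (Suc m) * 1)"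
      by (intro hom_polys_mult hom_polys_power hom_polys_w) auto
    then show ?case by (simp add: mono_up_Suc)
  qed (simp add: hom_polys_one)
  then show ?thesis by simp
qed

lemma hom_polys_Q:
  assumes "j \<le> p"
  shows "Qpoly z w j \<in> hom_polys p z w 1 1"
  unfolding Qpoly_def
proof (rule hom_polys_sum)
  fix i assume "i \<in> {1..j}"
  then have "z i * w i \<in> hom_polys p z w (1 + 0) (0 + 1)"
    using assms by (intro hom_polys_mult hom_polys_z hom_polys_w) auto
  then show "z i * w i \<in> hom_polys p z w 1 1" by simp
qed

definition zw_monos :: "nat \<Rightarrow> (nat \<Rightarrow> 'a::complex_algebra_1) \<Rightarrow> (nat \<Rightarrow> 'a) \<Rightarrow> nat \<Rightarrow> nat \<Rightarrow> 'a set" where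
  "zw_monos p z w a b = {mono_up p z r * mono_up p w s | r s. sum r {1..p} = a \<and> sum s {1..p} = b}"

context q_weyl
begin

lemma hom_polys_zw: "hom_polys n z w a b = complex_vector.span (zw_monos n z w a b)"
proof
  show "hom_polys n z w a b \<subseteq> complex_vector.span (zw_monos n z w a b)"
    unfolding hom_polys_eq
  proof (rule complex_vector.span_minimal)
    have "word_val z w u \<in> complex_vector.span (zw_monos n z w (zdeg u) (wdeg u))" if "u \<in> words n" for u
      using word_val_in_span_zw[OF that] by (rule subsetD[OF complex_vector.span_mono, rotated])
        (auto simp: mono_index_def zw_monos_def)
    then show "word_val z w ` {u \<in> words n. zdeg u = a \<and> wdeg u = b} \<subseteq> complex_vector.span (zw_monos n z w a b)"
      by auto
  qed simp
  show "complex_vector.span (zw_monos n z w a b) \<subseteq> hom_polys n z w a b"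
  proof (rule complex_vector.span_minimal)
    show "zw_monos n z w a b \<subseteq> hom_polys n z w a b"
      using hom_polys_mult[OF hom_polys_mono_up_z hom_polys_mono_up_w] by (auto simp: zw_monos_def)
    show "complex_vector.subspace (hom_polys n z w a b)" unfolding hom_polys_def by simp
  qed
qed

lemma hom_polys_wz: "hom_polys n z w a b = complex_vector.span (zw_monos n w z b a)"
proof
  show "hom_polys n z w a b \<subseteq> complex_vector.span (zw_monos n w z b a)"
    unfolding hom_polys_eq
  proof (rule complex_vector.span_minimal)
    have "word_val z w u \<in> complex_vector.span (zw_monos n w z (wdeg u) (zdeg u))" if "u \<in> words n" for u
      using word_val_in_span_wz[OF that] by (rule subsetD[OF complex_vector.span_mono, rotated])
        (auto simp: mono_index_def zw_monos_def)
    then show "word_val z w ` {u \<in> words n. zdeg u = a \<and> wdeg u = b} \<subseteq> complex_vector.span (zw_monos n w z b a)"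
      by auto
  qed simp
  show "complex_vector.span (zw_monos n w z b a) \<subseteq> hom_polys n z w a b"
  proof (rule complex_vector.span_minimal)
    show "zw_monos n w z b a \<subseteq> hom_polys n z w a b"
      using hom_polys_mult[OF hom_polys_mono_up_w hom_polys_mono_up_z] by (auto simp: zw_monos_def)
    show "complex_vector.subspace (hom_polys n z w a b)" unfolding hom_polys_def by simp
  qed
qed

lemma sub_alg_zw: "sub_alg n z w \<subseteq> complex_vector.span (\<Union>a b. zw_monos n z w a b)"
  unfolding sub_alg_def
proof (rule complex_vector.span_minimal)
  show "word_val z w ` words n \<subseteq> complex_vector.span (\<Union>a b. zw_monos n z w a b)"
  proof
    fix x assume "x \<in> word_val z w ` words n"
    then obtain u where u: "u \<in> words n" "x = word_val z w u" by auto
    then have "x \<in> hom_polys n z w (zdeg u) (wdeg u)"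
      unfolding hom_polys_eq by (auto intro: complex_vector.span_base)
    then show "x \<in> complex_vector.span (\<Union>a b. zw_monos n z w a b)"
      unfolding hom_polys_zw by (rule subsetD[OF complex_vector.span_mono, rotated]) auto
  qed
qed simp

lemma sub_alg_wz: "sub_alg n z w \<subseteq> complex_vector.span (\<Union>a b. zw_monos n w z b a)"
  unfolding sub_alg_def
proof (rule complex_vector.span_minimal)
  show "word_val z w ` words n \<subseteq> complex_vector.span (\<Union>a b. zw_monos n w z b a)"
  proof
    fix x assume "x \<in> word_val z w ` words n"
    then obtain u where u: "u \<in> words n" "x = word_val z w u" by auto
    then have "x \<in> hom_polys n z w (zdeg u) (wdeg u)"
      unfolding hom_polys_eq by (auto intro: complex_vector.span_base)
    then show "x \<in> complex_vector.span (\<Union>a b. zw_monos n w z b a)"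
      unfolding hom_polys_wz by (rule subsetD[OF complex_vector.span_mono, rotated]) auto
  qed
qed simp

end

lemma qnum_0 [simp]: "qnum q 0 = 0"
  by (simp add: qnum_def)

lemma qnum_inverse: "qnum (inverse q) a = qnum q a"
proof -
  have "qnum (inverse q) a = (- (q powi a - q powi (- a))) / (- (q - inverse q))"
    by (simp add: qnum_def power_int_inverse power_int_minus)
  also have "\<dots> = qnum q a" unfolding qnum_def by (rule minus_divide_divide)
  finally show ?thesis .
qed

text \<open>A property in place of the description \<open>pd\<close>, so that one operator can have
  it for several numbers of variables. The exponents are arbitrary functions; the monomials see only
  their values on \<open>{1..n}\<close>.\<close>

definition is_pd :: "nat \<Rightarrow> complex \<Rightarrow> (nat \<Rightarrow> 'a::complex_algebra_1) \<Rightarrow> (nat \<Rightarrow> 'a) \<Rightarrow> nat \<Rightarrow> ('a \<Rightarrow> 'a) \<Rightarrow> bool" where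
  "is_pd n q z w i D \<longleftrightarrow> clinear D \<and>
     (\<forall>r s. D (mono_up n z r * mono_up n w s) =
        (q powi (\<Sum>k\<in>{i<..n}. int (r k)) * qnum q (int (r i))) *\<^sub>C
          (mono_up n z (r(i := r i - 1)) * mono_up n w s))"

definition is_pd_bar :: "nat \<Rightarrow> complex \<Rightarrow> (nat \<Rightarrow> 'a::complex_algebra_1) \<Rightarrow> (nat \<Rightarrow> 'a) \<Rightarrow> nat \<Rightarrow> ('a \<Rightarrow> 'a) \<Rightarrow> bool" where
  "is_pd_bar n q z w i D \<longleftrightarrow> clinear D \<and>
     (\<forall>r s. D (mono_up n w r * mono_up n z s) =
        (q powi (- (\<Sum>k\<in>{i<..n}. int (r k))) * qnum q (int (r i))) *\<^sub>C
          (mono_up n w (r(i := r i - 1)) * mono_up n z s))"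

text \<open>Monomials in fewer variables are those with zero exponents beyond \<open>p\<close>, and
  these add nothing to the tail sum. Hence the derivatives are not chosen anew for each
  \<open>p\<close>.\<close>

lemma is_pd_mono:
  assumes "is_pd n q z w i D" "p \<le> n" "i \<in> {1..p}"
  shows "is_pd p q z w i D"
  unfolding is_pd_def
proof (intro conjI allI)
  show "clinear D" using assms(1) by (simp add: is_pd_def)
  fix r s :: "nat \<Rightarrow> nat"
  have *: "mono_up p x r = mono_up n x (cut p r)" for x :: "nat \<Rightarrow> 'a" and r
    using mono_up_exponents[OF assms(2) cut_exponents, of x r] by simp
  have "mono_up n z ((cut p r)(i := cut p r i - 1)) = mono_up p z (r(i := r i - 1))"
    unfolding *[of z "r(i := r i - 1)"] by (rule mono_up_cong) (use assms(3) in \<open>auto simp: cut_def\<close>)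
  moreover have "(\<Sum>k\<in>{i<..n}. int (cut p r k)) = (\<Sum>k\<in>{i<..p}. int (r k))"
    by (rule sum.mono_neutral_cong_right) (use assms in \<open>auto simp: cut_def\<close>)
  moreover have "cut p r i = r i" using assms(3) by (simp add: cut_def)
  ultimately show "D (mono_up p z r * mono_up p w s) =
        (q powi (\<Sum>k\<in>{i<..p}. int (r k)) * qnum q (int (r i))) *\<^sub>C (mono_up p z (r(i := r i - 1)) * mono_up p w s)"
    using assms(1) unfolding is_pd_def * by metis
qed

lemma is_pd_bar_mono:
  assumes "is_pd_bar n q z w i D" "p \<le> n" "i \<in> {1..p}"
  shows "is_pd_bar p q z w i D"
proof -
  have "is_pd p (inverse q) w z i D"
    by (rule is_pd_mono[OF _ assms(2,3)])
      (use assms(1) in \<open>simp add: is_pd_def is_pd_bar_def power_int_minus power_int_inverse qnum_inverse\<close>)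
  then show ?thesis by (simp add: is_pd_def is_pd_bar_def power_int_minus power_int_inverse qnum_inverse)
qed

context q_weyl
begin

lemma q2_neq_1: "q\<^sup>2 \<noteq> 1"
  using not_root[of 2] by simp

lemma q_minus_inverse: "q - inverse q \<noteq> 0"
proof
  assume "q - inverse q = 0"
  then have "q * q = q * inverse q" by simp
  then show False using q2_neq_1 q0 by (simp add: power2_eq_square)
qed

text \<open>These are the coefficient identities of \<open>pd_Q_mono\<close> for the summands with
  \<open>j = i\<close> and with \<open>j < i\<close>.\<close>

lemma qnum_Suc: "qnum q (a + 1) = q * qnum q a + q powi (- a)"
  "inverse q * qnum q a = q * qnum q a + q powi (- a) * (1 - q powi (2 * a))"
proof -
  define x y where "x = q powi a" and "y = q powi (- a)"
  have e: "q powi (a + 1) = q * x" "q powi (- (a + 1)) = y * inverse q" "q powi (2 * a) = x * x" "x * y = 1"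
    using power_int_add[of q a 1] power_int_add[of q "- a" "- 1"] power_int_add[of q a a] power_int_add[of q a "- a"] q0
    by (simp_all add: x_def y_def power_int_minus)
  define d where "d = q - inverse q"
  have d: "d \<noteq> 0" unfolding d_def by (rule q_minus_inverse)
  have qa: "qnum q a = (x - y) / d" by (simp add: qnum_def x_def y_def d_def)
  have "qnum q (a + 1) = (q * x - y * inverse q) / d" by (simp only: qnum_def e(1,2) d_def)
  also have "q * x - y * inverse q = q * (x - y) + y * d" by (simp add: d_def algebra_simps)
  also have "(q * (x - y) + y * d) / d = q * ((x - y) / d) + y" using d by (simp add: add_divide_distrib)
  finally show "qnum q (a + 1) = q * qnum q a + q powi (- a)" by (simp add: qa y_def)
  have "y * (1 - x * x) = y - (x * y) * x" by (simp add: algebra_simps)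
  then have "y * (1 - x * x) = - d * ((x - y) / d)" using e(4) d by simp
  then have "q * ((x - y) / d) + y * (1 - x * x) = (q - d) * ((x - y) / d)"
    by (simp only: left_diff_distrib) simp
  then show "inverse q * qnum q a = q * qnum q a + q powi (- a) * (1 - q powi (2 * a))"
    by (simp add: qa e(3) d_def flip: y_def)
qed

lemma qnum_add: "qnum q (a + b) = q powi b * qnum q a + q powi (- a) * qnum q b"
proof -
  define x y u v where "x = q powi a" and "y = q powi (- a)" and "u = q powi b" and "v = q powi (- b)"
  have "q powi (a + b) = x * u" "q powi (- (a + b)) = y * v"
    using power_int_add[of q a b] power_int_add[of q "- a" "- b"] q0 by (simp_all add: x_def y_def u_def v_def)
  then have "qnum q (a + b) = (x * u - y * v) / (q - inverse q)" by (simp only: qnum_def)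
  also have "\<dots> = u * ((x - y) / (q - inverse q)) + y * ((u - v) / (q - inverse q))"
    by (simp add: algebra_simps flip: add_divide_distrib diff_divide_distrib)
  finally show ?thesis by (simp only: qnum_def x_def y_def u_def v_def)
qed

lemma qnum_neq_0: "a \<noteq> 0 \<Longrightarrow> qnum q a \<noteq> 0"
proof
  assume "a \<noteq> 0" "qnum q a = 0"
  then have "q powi a = q powi (- a)" using q_minus_inverse by (simp add: qnum_def)
  then have "a = - a" using power_int_inj[OF q0 not_root] by blast
  then show False using \<open>a \<noteq> 0\<close> by simp
qed

lemma Q_mono_up_z: "q_commute 1 (Q n) (mono_up n z r)"
  using q_commute_mono_up[of n 1 "Q n" z r] Q_z_ge by simp

lemma Q_mono_up_w: "q_commute 1 (Q n) (mono_up n w r)"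
  using q_commute_mono_up[of n 1 "Q n" w r] Q_w_ge by simp

text \<open>Twisted Leibniz rule for \<open>Q n\<close>. As \<open>Q n\<close> commutes with the
  \<open>z\<close>-part, it can be inserted between the two halves; the product then expands into
  ordered monomials, and both sides are compared summand by summand according to
  \<open>j < i\<close>, \<open>j = i\<close> and \<open>j > i\<close>.\<close>

lemma pd_Q_mono:
  assumes D: "is_pd n q z w i D" and i: "i \<in> {1..n}"
  shows "D (Q n * (mono_up n z r * mono_up n w s)) =
    q *\<^sub>C (Q n * D (mono_up n z r * mono_up n w s))
    + (q powi (- (\<Sum>k\<in>{1..n}. int (r k)))) *\<^sub>C (w i * (mono_up n z r * mono_up n w s))"
proof -
  have lin: "clinear D" using D by (simp add: is_pd_def)
  have DM: "D (mono_up n z r * mono_up n w s) =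
        (q powi (\<Sum>k\<in>{i<..n}. int (r k)) * qnum q (int (r i))) *\<^sub>C
          (mono_up n z (r(i := r i - 1)) * mono_up n w s)" for r s
    using D by (simp add: is_pd_def)
  have Dw: "D (mono_up n z r * (w j * mono_up n w s)) =
      (q powi (\<Sum>k\<in>{i<..n}. int (r k)) * qnum q (int (r i))) *\<^sub>C
          (mono_up n z (r(i := r i - 1)) * (w j * mono_up n w s))" if "j \<in> {1..n}" for j r
    unfolding wf.left_mult_mono_up[OF that order_refl] mult_scaleC_right clinear_scale[OF lin] DM
    by (simp add: scaleC_scaleC mult.commute)
  define R where "R S = (\<Sum>k\<in>S. int (r k))" for S
  have Rsplit: "R {1..n} = R {1..<i} + int (r i) + R {i<..n}"
  proof -
    have "{1..n} = {1..<i} \<union> ({i} \<union> {i<..n})" using i by auto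
    moreover have "R ({1..<i} \<union> ({i} \<union> {i<..n})) = R {1..<i} + (int (r i) + R {i<..n})"
      unfolding R_def by (subst sum.union_disjoint, auto)+
    ultimately show ?thesis by simp
  qed
  have "Q n * (mono_up n z r * mono_up n w s) = mono_up n z r * Q n * mono_up n w s"
    using Q_mono_up_z[of r] by (simp add: q_commute_def scaleC_one mult.assoc flip: mult.assoc[of "Q n" "mono_up n z r"])
  also have "\<dots> = (\<Sum>j\<in>{1..n}. (mono_up n z r * z j) * (w j * mono_up n w s))"
    by (simp add: Qpoly_def sum_distrib_left sum_distrib_right mult.assoc)
  also have "\<dots> = (\<Sum>j\<in>{1..n}. (q powi (- R {j<..n})) *\<^sub>C (mono_up n z (r(j := Suc (r j))) * (w j * mono_up n w s)))"
    by (intro sum.cong refl) (simp only: zf.right_mult_mono_up[OF _ order_refl] mult_scaleC_left R_def)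
  finally have L: "D (Q n * (mono_up n z r * mono_up n w s)) =
     (\<Sum>j\<in>{1..n}. (q powi (- R {j<..n})) *\<^sub>C D (mono_up n z (r(j := Suc (r j))) * (w j * mono_up n w s)))"
    by (simp only: clinear_sum[OF lin] clinear_scale[OF lin])
  \<comment> \<open>The part with \<open>Q (i - 1)\<close> spreads over the summands with
    \<open>j < i\<close>, where it corrects the factor \<open>q\<close> in front of the q-number to
    \<open>inverse q\<close>.\<close>
  have W: "w i * (mono_up n z r * mono_up n w s) =
    (q powi (R {1..<i} + R {i<..n})) *\<^sub>C (mono_up n z r * (w i * mono_up n w s))
    + ((1 - q powi (2 * int (r i))) * q powi (R {1..<i} + 2 * R {i<..n}))
      *\<^sub>C (\<Sum>j\<in>{1..<i}. mono_up n z (r(i := r i - 1)) * z j * (w j * mono_up n w s))"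
  proof -
    have "{1..i - 1} = {1..<i}" by auto
    then have Q: "mono_up n z (r(i := r i - 1)) * Q (i - 1) * mono_up n w s =
       (\<Sum>j\<in>{1..<i}. mono_up n z (r(i := r i - 1)) * z j * (w j * mono_up n w s))"
      by (simp add: Qpoly_def sum_distrib_left sum_distrib_right mult.assoc)
    show ?thesis
      unfolding mult.assoc[symmetric, of "w i"] w_mono_up_z[OF i order_refl] distrib_right mult_scaleC_left R_def[symmetric] Q
      by (simp only: mult.assoc)
  qed
  show ?thesis
  \<comment> \<open>The comparison below uses common elements \<open>y j\<close> containing
    \<open>z i\<close> to the power \<open>r i - 1\<close>, so the exponent zero is treated
    apart.\<close>
  proof (cases "r i = 0")
    case True
    have "(q powi (- R {j<..n})) *\<^sub>C D (mono_up n z (r(j := Suc (r j))) * (w j * mono_up n w s)) =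
      (if j = i then mono_up n z r * (w i * mono_up n w s) else 0)" if j: "j \<in> {1..n}" for j
    proof (cases "j = i")
      case jT: True
      have "(\<Sum>k\<in>{i<..n}. int ((r(i := Suc (r i))) k)) = R {i<..n}"
        unfolding R_def by (rule sum.cong) auto
      moreover have "r(i := 0) = r" using True by auto
      moreover have "qnum q 1 = 1" using q_minus_inverse by (simp add: qnum_def)
      ultimately show ?thesis
        unfolding jT Dw[OF i] using True q0 by (simp add: scaleC_scaleC scaleC_one flip: power_int_add)
    next
      case False
      then show ?thesis unfolding Dw[OF j] using True by simp
    qed
    then have "D (Q n * (mono_up n z r * mono_up n w s)) = mono_up n z r * (w i * mono_up n w s)"
      unfolding L using i by (simp add: sum.delta)
    moreover have "- R {1..n} + (R {1..<i} + R {i<..n}) = 0" using Rsplit True by simp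
    then have "q powi (- R {1..n}) * q powi (R {1..<i} + R {i<..n}) = 1"
      using q0 by (metis power_int_0_right power_int_add)
    ultimately show ?thesis
      unfolding W DM using True by (simp add: scaleC_scaleC scaleC_one flip: R_def)
  next
    case False
    define y where "y j = mono_up n z (r(i := r i - 1)) * z j * (w j * mono_up n w s)" for j
    have zr: "mono_up n z ((r(j := Suc (r j)))(i := (r(j := Suc (r j))) i - 1)) =
       (q powi (R {j<..n} - (if j < i then 1 else 0))) *\<^sub>C (mono_up n z (r(i := r i - 1)) * z j)" if j: "j \<in> {1..n}" for j
    proof -
      have e1: "(r(j := Suc (r j)))(i := (r(j := Suc (r j))) i - 1) = (r(i := r i - 1))(j := Suc ((r(i := r i - 1)) j))"
        using False by (auto simp: fun_eq_iff)
      have e2: "(\<Sum>k\<in>{j<..n}. int ((r(i := r i - 1)) k)) = R {j<..n} - (if j < i then 1 else 0)"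
      proof (cases "j < i")
        case True
        then have ij: "i \<in> {j<..n}" using i by auto
        have "(\<Sum>k\<in>{j<..n} - {i}. int ((r(i := r i - 1)) k)) = (\<Sum>k\<in>{j<..n} - {i}. int (r k))"
          by (rule sum.cong) auto
        then show ?thesis unfolding R_def using True False
          by (simp add: sum.remove[OF _ ij] of_nat_diff)
      next
        case False
        then show ?thesis unfolding R_def by (auto intro!: sum.cong)
      qed
      have "mono_up n z (r(i := r i - 1)) * z j = (q powi (- (R {j<..n} - (if j < i then 1 else 0)))) *\<^sub>C
         mono_up n z ((r(i := r i - 1))(j := Suc ((r(i := r i - 1)) j)))"
        using zf.right_mult_mono_up[OF j order_refl, of "r(i := r i - 1)"] unfolding e2 .
      then show ?thesis unfolding e1 using q0
        by (simp add: scaleC_scaleC scaleC_one flip: power_int_add)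
    qed
    have Dj: "(q powi (- R {j<..n})) *\<^sub>C D (mono_up n z (r(j := Suc (r j))) * (w j * mono_up n w s)) =
       (q powi (R {i<..n}) * (if j < i then inverse q * qnum q (int (r i)) else if j = i then qnum q (int (r i) + 1)
          else q * qnum q (int (r i)))) *\<^sub>C y j" if j: "j \<in> {1..n}" for j
    proof -
      have e3: "(\<Sum>k\<in>{i<..n}. int ((r(j := Suc (r j))) k)) = R {i<..n} + (if i < j then 1 else 0)"
      proof (cases "i < j")
        case True
        then have ij: "j \<in> {i<..n}" using j by auto
        have "(\<Sum>k\<in>{i<..n} - {j}. int ((r(j := Suc (r j))) k)) = (\<Sum>k\<in>{i<..n} - {j}. int (r k))"
          by (rule sum.cong) auto
        then show ?thesis unfolding R_def using True by (simp add: sum.remove[OF _ ij])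
      next
        case False
        then show ?thesis unfolding R_def by (auto intro!: sum.cong)
      qed
      have e4: "q powi (- R {j<..n}) * (q powi (R {i<..n} + (if i < j then 1 else 0)) * c * q powi (R {j<..n} - (if j < i then 1 else 0)))
         = q powi (R {i<..n}) * ((if i < j then q else if j < i then inverse q else 1) * c)" for c
        using q0 by (auto simp: power_int_add power_int_diff power_int_minus divide_inverse)
      show ?thesis
        unfolding Dw[OF j] zr[OF j] e3 mult_scaleC_left scaleC_scaleC e4 y_def
        by (cases "j = i") (auto simp: mult_ac add.commute)
    qed
    have yi: "mono_up n z r * (w i * mono_up n w s) = (q powi (R {i<..n})) *\<^sub>C y i"
      using zr[OF i] False by (simp add: y_def mult_scaleC_left fun_upd_idem)
    have T1: "q *\<^sub>C (Q n * D (mono_up n z r * mono_up n w s)) =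
       (\<Sum>j\<in>{1..n}. (q powi (R {i<..n}) * (q * qnum q (int (r i)))) *\<^sub>C y j)"
    proof -
      have "Q n * (mono_up n z (r(i := r i - 1)) * mono_up n w s) = mono_up n z (r(i := r i - 1)) * Q n * mono_up n w s"
        using Q_mono_up_z[of "r(i := r i - 1)"]
        by (simp add: q_commute_def scaleC_one mult.assoc flip: mult.assoc[of "Q n" "mono_up n z _"])
      also have "\<dots> = sum y {1..n}"
        by (simp add: Qpoly_def y_def sum_distrib_left sum_distrib_right mult.assoc)
      finally show ?thesis
        unfolding DM by (simp add: mult_scaleC_right scaleC_scaleC R_def scaleC_sum_right mult_ac)
    qed
    have T2: "(q powi (- R {1..n})) *\<^sub>C (w i * (mono_up n z r * mono_up n w s)) =
       (\<Sum>j\<in>{1..n}. (q powi (R {i<..n}) * (if j < i then q powi (- int (r i)) * (1 - q powi (2 * int (r i)))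
          else if j = i then q powi (- int (r i)) else 0)) *\<^sub>C y j)"
    proof -
      have p1: "q powi (- R {1..n}) * q powi (R {1..<i} + R {i<..n}) * q powi (R {i<..n}) = q powi (R {i<..n}) * q powi (- int (r i))"
        unfolding power_int_add[OF disjI1[OF q0], symmetric]
        by (rule arg_cong[where f = "power_int q"]) (use Rsplit in linarith)
      have p2: "q powi (- R {1..n}) * ((1 - q powi (2 * int (r i))) * q powi (R {1..<i} + 2 * R {i<..n})) =
         q powi (R {i<..n}) * (q powi (- int (r i)) * (1 - q powi (2 * int (r i))))"
      proof -
        have *: "q powi (- R {1..n}) * q powi (R {1..<i} + 2 * R {i<..n}) = q powi (R {i<..n}) * q powi (- int (r i))"
          unfolding power_int_add[OF disjI1[OF q0], symmetric]
          by (rule arg_cong[where f = "power_int q"]) (use Rsplit in linarith)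
        show ?thesis unfolding mult.left_commute[of "q powi (- R {1..n})"] * by (simp only: mult_ac)
      qed
      define F where "F j = (q powi (R {i<..n}) * (if j < i then q powi (- int (r i)) * (1 - q powi (2 * int (r i)))
          else if j = i then q powi (- int (r i)) else 0)) *\<^sub>C y j" for j
      have "{1..n} = {1..<i} \<union> ({i} \<union> {i<..n})" using i by auto
      moreover have "sum F ({1..<i} \<union> ({i} \<union> {i<..n})) = sum F {1..<i} + (F i + sum F {i<..n})"
        by (subst sum.union_disjoint, auto)+
      moreover have "sum F {i<..n} = 0" by (rule sum.neutral) (auto simp: F_def)
      moreover have "sum F {1..<i} = (\<Sum>j\<in>{1..<i}. (q powi (R {i<..n}) * (q powi (- int (r i)) * (1 - q powi (2 * int (r i))))) *\<^sub>C y j)"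
        by (rule sum.cong) (auto simp: F_def)
      ultimately have "sum F {1..n}
         = (\<Sum>j\<in>{1..<i}. (q powi (R {i<..n}) * (q powi (- int (r i)) * (1 - q powi (2 * int (r i))))) *\<^sub>C y j)
            + (q powi (R {i<..n}) * q powi (- int (r i))) *\<^sub>C y i"
        by (simp add: F_def)
      moreover have "(q powi (- R {1..n})) *\<^sub>C (w i * (mono_up n z r * mono_up n w s)) =
         (q powi (- R {1..n}) * q powi (R {1..<i} + R {i<..n}) * q powi (R {i<..n})) *\<^sub>C y i
         + (q powi (- R {1..n}) * ((1 - q powi (2 * int (r i))) * q powi (R {1..<i} + 2 * R {i<..n}))) *\<^sub>C sum y {1..<i}"
        unfolding W yi y_def[symmetric] by (simp only: scaleC_add_right scaleC_scaleC mult.assoc)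
      ultimately show ?thesis unfolding p1 p2 F_def[symmetric] by (simp add: scaleC_sum_right scaleC_scaleC)
    qed
    show ?thesis
      unfolding L R_def[symmetric] T1 T2 sum.distrib[symmetric]
    proof (rule sum.cong[OF refl])
      fix j assume j: "j \<in> {1..n}"
      let ?a = "q powi (R {i<..n})"
      have "(if j < i then inverse q * qnum q (int (r i)) else if j = i then qnum q (int (r i) + 1) else q * qnum q (int (r i)))
        = q * qnum q (int (r i)) + (if j < i then q powi (- int (r i)) * (1 - q powi (2 * int (r i)))
          else if j = i then q powi (- int (r i)) else 0)"
        using qnum_Suc[of "int (r i)"] by auto
      then show "(q powi (- R {j<..n})) *\<^sub>C D (mono_up n z (r(j := Suc (r j))) * (w j * mono_up n w s)) =
        (?a * (q * qnum q (int (r i)))) *\<^sub>C y j +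
        (?a * (if j < i then q powi (- int (r i)) * (1 - q powi (2 * int (r i)))
          else if j = i then q powi (- int (r i)) else 0)) *\<^sub>C y j"
        unfolding Dj[OF j] by (simp only: distrib_left scaleC_add_left)
    qed
  qed
qed

end

section \<open>The q-Laplace operator\<close>

context q_weyl
begin

text \<open>The scalar in \<open>pd_Q_mono\<close> depends on the monomial only through its
  \<open>z\<close>-degree, so the rule extends linearly to homogeneous elements.\<close>

lemma pd_Q:
  assumes "is_pd n q z w i D" "i \<in> {1..n}" "x \<in> hom_polys n z w a b"
  shows "D (Q n * x) = q *\<^sub>C (Q n * D x) + (q powi (- int a)) *\<^sub>C (w i * x)"
proof -
  have lin: "clinear D" using assms(1) by (simp add: is_pd_def)
  show ?thesis
  proof (rule clinear_eq_on_span[of "\<lambda>x. D (Q n * x)" "\<lambda>x. q *\<^sub>C (Q n * D x) + (q powi (- int a)) *\<^sub>C (w i * x)" "zw_monos n z w a b"])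
    show "x \<in> complex_vector.span (zw_monos n z w a b)" using assms(3) by (simp add: hom_polys_zw)
    fix y assume "y \<in> zw_monos n z w a b"
    then obtain r s where y: "y = mono_up n z r * mono_up n w s" "sum r {1..n} = a"
      by (auto simp: zw_monos_def)
    show "D (Q n * y) = q *\<^sub>C (Q n * D y) + (q powi (- int a)) *\<^sub>C (w i * y)"
      using pd_Q_mono[OF assms(1,2), of r s] unfolding y(1) y(2)[symmetric] of_nat_sum .
  qed (intro clinear_intros lin clinear_comp[OF lin])+
qed

lemma mono_up_zd_eq: "mono_up m zd r = (\<Prod>k\<in>{1..m}. (q powi (- 2 * int k)) ^ r k) *\<^sub>C mono_up m w r"
  unfolding zd_def[abs_def] by (rule mono_up_scale)

lemma hom_polys_dual: "hom_polys n z w a b \<subseteq> hom_polys n zd z b a"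
proof -
  interpret d: q_weyl n "inverse q" zd z by (rule dual)
  show ?thesis unfolding hom_polys_wz d.hom_polys_zw
  proof (rule complex_vector.span_minimal)
    have "mono_up n w r * mono_up n z s \<in> complex_vector.span (zw_monos n zd z b a)"
      if rs: "sum r {1..n} = b" "sum s {1..n} = a" for r s
    proof -
      obtain c where c: "c \<noteq> 0" "mono_up n zd r = c *\<^sub>C mono_up n w r" using mono_up_zd by blast
      then have "mono_up n w r * mono_up n z s = inverse c *\<^sub>C (mono_up n zd r * mono_up n z s)"
        by (simp add: scaleC_mult_simps)
      also have "\<dots> \<in> complex_vector.span (zw_monos n zd z b a)"
        using rs by (intro complex_vector.span_scale complex_vector.span_base) (auto simp: zw_monos_def)
      finally show ?thesis .
    qed
    then show "zw_monos n w z b a \<subseteq> complex_vector.span (zw_monos n zd z b a)"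
      by (auto simp: zw_monos_def)
  qed simp
qed

text \<open>Lowering the exponent of \<open>zd i\<close> also removes a scalar
  \<open>q^(-2i)\<close>; the factor in front of \<open>D\<close> restores it.\<close>

lemma pd_bar_dual:
  assumes D: "is_pd_bar n q z w i D" and i: "i \<in> {1..n}"
  shows "is_pd n (inverse q) zd z i (\<lambda>x. (q powi (2 * int i)) *\<^sub>C D x)"
  unfolding is_pd_def
proof (intro conjI allI)
  have lin: "clinear D" using D by (simp add: is_pd_bar_def)
  then show "clinear (\<lambda>x. (q powi (2 * int i)) *\<^sub>C D x)" by (rule clinear_scaleC)
  fix r s
  define c where "c r = (\<Prod>k\<in>{1..n}. (q powi (- 2 * int k)) ^ r k)" for r :: "nat \<Rightarrow> nat"
  have zd: "mono_up n zd r = c r *\<^sub>C mono_up n w r" for r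
    unfolding c_def by (rule mono_up_zd_eq)
  have DM: "D (mono_up n w r * mono_up n z s) =
        (q powi (- (\<Sum>k\<in>{i<..n}. int (r k))) * qnum q (int (r i))) *\<^sub>C
          (mono_up n w (r(i := r i - 1)) * mono_up n z s)"
    using D by (simp add: is_pd_bar_def)
  show "q powi (2 * int i) *\<^sub>C D (mono_up n zd r * mono_up n z s) =
       (inverse q powi (\<Sum>k\<in>{i<..n}. int (r k)) * qnum (inverse q) (int (r i))) *\<^sub>C
       (mono_up n zd (r(i := r i - 1)) * mono_up n z s)"
  proof (cases "r i = 0")
    case True
    then show ?thesis by (simp add: zd mult_scaleC_left clinear_scale[OF lin] DM)
  next
    case False
    have "(\<Prod>k\<in>{1..n} - {i}. (q powi (- 2 * int k)) ^ (r(i := r i - 1)) k) = (\<Prod>k\<in>{1..n} - {i}. (q powi (- 2 * int k)) ^ r k)"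
      by (rule prod.cong) auto
    moreover have "(q powi (- 2 * int i)) ^ r i = q powi (- 2 * int i) * (q powi (- 2 * int i)) ^ (r i - 1)"
      using False by (cases "r i") auto
    ultimately have "c r = q powi (- 2 * int i) * c (r(i := r i - 1))"
      unfolding c_def prod.remove[OF finite_atLeastAtMost i] by simp
    then have c: "q powi (2 * int i) * c r = c (r(i := r i - 1))"
      using q0 by (simp add: power_int_minus)
    have "q powi (2 * int i) *\<^sub>C D (mono_up n zd r * mono_up n z s) =
       ((q powi (2 * int i) * c r) * (q powi (- (\<Sum>k\<in>{i<..n}. int (r k))) * qnum q (int (r i)))) *\<^sub>C
          (mono_up n w (r(i := r i - 1)) * mono_up n z s)"
      by (simp only: zd mult_scaleC_left clinear_scale[OF lin] DM scaleC_scaleC mult.assoc)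
    then show ?thesis
      unfolding c zd mult_scaleC_left scaleC_scaleC qnum_inverse power_int_inverse power_int_minus
      by (simp add: mult.commute)
  qed
qed

text \<open>This is \<open>pd_Q\<close> in the dual algebra. The exponent \<open>2n - 2i\<close>
  collects the rescaling of the derivative by \<open>q^(2i)\<close> and of \<open>Q n\<close> by
  \<open>q^(-2n)\<close>.\<close>

lemma pd_bar_Q:
  assumes D: "is_pd_bar n q z w i D" and i: "i \<in> {1..n}" and x: "x \<in> hom_polys n z w a b"
  shows "D (Q n * x) = inverse q *\<^sub>C (Q n * D x) + (q powi (int b + 2 * int n - 2 * int i)) *\<^sub>C (z i * x)"
proof -
  have lin: "clinear D" using D by (simp add: is_pd_bar_def)
  interpret d: q_weyl n "inverse q" zd z by (rule dual)
  have "q powi (2 * int i) *\<^sub>C D (d.Q n * x) = inverse q *\<^sub>C (d.Q n * (q powi (2 * int i) *\<^sub>C D x))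
     + (inverse q powi (- int b)) *\<^sub>C (z i * x)"
    using d.pd_Q[OF pd_bar_dual[OF D i] i subsetD[OF hom_polys_dual x]] .
  then have "(q powi (2 * int i) * q powi (- 2 * int n)) *\<^sub>C D (Q n * x) =
     (inverse q * (q powi (2 * int i) * q powi (- 2 * int n))) *\<^sub>C (Q n * D x) + (q powi (int b)) *\<^sub>C (z i * x)"
    by (simp only: Qpoly_dual[OF order_refl] clinear_scale[OF lin] mult_scaleC_left mult_scaleC_right scaleC_scaleC
        power_int_inverse power_int_minus inverse_inverse_eq mult_ac)
  then have "(q powi (2 * int n - 2 * int i)) *\<^sub>C ((q powi (2 * int i) * q powi (- 2 * int n)) *\<^sub>C D (Q n * x)) =
     (q powi (2 * int n - 2 * int i)) *\<^sub>C
     ((inverse q * (q powi (2 * int i) * q powi (- 2 * int n))) *\<^sub>C (Q n * D x) + (q powi (int b)) *\<^sub>C (z i * x))"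
    by (simp only:)
  moreover have e: "q powi (2 * int n - 2 * int i) * (q powi (2 * int i) * q powi (- 2 * int n)) = 1"
    using q0 by (simp flip: power_int_add)
  moreover have "q powi (2 * int n - 2 * int i) * (inverse q * (q powi (2 * int i) * q powi (- 2 * int n))) = inverse q"
    unfolding mult.left_commute[of _ "inverse q"] e by simp
  moreover have "q powi (2 * int n - 2 * int i) * q powi (int b) = q powi (int b + 2 * int n - 2 * int i)"
    unfolding power_int_add[OF disjI1[OF q0], symmetric] by (rule arg_cong[where f = "power_int q"]) simp
  ultimately show ?thesis by (simp only: scaleC_add_right scaleC_scaleC scaleC_one)
qed

text \<open>A q-analogue of adding up exponents. The weights are those that reordering produces in
  the Euler identities, and \<open>qnum_add\<close> peels off the last exponent.\<close>

lemma qnum_sum: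
  fixes m :: nat and r :: "nat \<Rightarrow> nat"
  shows
  "(\<Sum>i\<in>{1..m}. q powi ((\<Sum>k\<in>{1..<i}. int (r k)) - (\<Sum>k\<in>{i<..m}. int (r k))) * qnum q (int (r i)))
    = qnum q (\<Sum>k\<in>{1..m}. int (r k))"
proof (induction m)
  case (Suc m)
  have "q powi ((\<Sum>k\<in>{1..<i}. int (r k)) - (\<Sum>k\<in>{i<..Suc m}. int (r k))) * qnum q (int (r i)) =
     q powi (- int (r (Suc m))) * (q powi ((\<Sum>k\<in>{1..<i}. int (r k)) - (\<Sum>k\<in>{i<..m}. int (r k))) * qnum q (int (r i)))"
    if "i \<in> {1..m}" for i
  proof -
    have "{i<..Suc m} = insert (Suc m) {i<..m}" using that by auto
    then have "(\<Sum>k\<in>{1..<i}. int (r k)) - (\<Sum>k\<in>{i<..Suc m}. int (r k)) =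
      - int (r (Suc m)) + ((\<Sum>k\<in>{1..<i}. int (r k)) - (\<Sum>k\<in>{i<..m}. int (r k)))" by simp
    then show ?thesis using q0 by (simp only: power_int_add mult.assoc simp_thms)
  qed
  then have "(\<Sum>i\<in>{1..m}. q powi ((\<Sum>k\<in>{1..<i}. int (r k)) - (\<Sum>k\<in>{i<..Suc m}. int (r k))) * qnum q (int (r i)))
    = q powi (- int (r (Suc m))) * qnum q (\<Sum>k\<in>{1..m}. int (r k))"
    unfolding Suc[symmetric] sum_distrib_left by (intro sum.cong) auto
  moreover have "{1..<Suc m} = {1..m}" by auto
  ultimately show ?case
    using qnum_add[of "int (r (Suc m))" "\<Sum>k\<in>{1..m}. int (r k)"]
    by (simp add: add.commute del: sum.op_ivl_Suc)
qed simp

lemma qnum_sum':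
  fixes m :: nat and r :: "nat \<Rightarrow> nat"
  shows
  "(\<Sum>i\<in>{1..m}. q powi ((\<Sum>k\<in>{i<..m}. int (r k)) - (\<Sum>k\<in>{1..<i}. int (r k))) * qnum q (int (r i)))
    = qnum q (\<Sum>k\<in>{1..m}. int (r k))"
proof -
  interpret d: q_weyl n "inverse q" zd z by (rule dual)
  have "inverse q powi (a - b) = q powi (b - a)" for a b
    using power_int_minus[of q "a - b"] by (simp add: power_int_inverse)
  then show ?thesis using d.qnum_sum[where m = m and r = r] by (simp add: qnum_inverse)
qed

text \<open>A q-Euler identity: multiplying by \<open>w i\<close> on the left restores the monomial
  that the derivative has lowered, and the scalars add up by \<open>qnum_sum\<close>.\<close>

lemma euler_pd_bar:
  assumes D: "\<And>i. i \<in> {1..n} \<Longrightarrow> is_pd_bar n q z w i (D i)" and x: "x \<in> hom_polys n z w a b"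
  shows "(\<Sum>i\<in>{1..n}. w i * D i x) = qnum q (int b) *\<^sub>C x"
proof (rule clinear_eq_on_span[of "\<lambda>x. \<Sum>i\<in>{1..n}. w i * D i x" "\<lambda>x. qnum q (int b) *\<^sub>C x" "zw_monos n w z b a"])
  show "x \<in> complex_vector.span (zw_monos n w z b a)" using x by (simp add: hom_polys_wz)
  show "clinear (\<lambda>x. \<Sum>i\<in>{1..n}. w i * D i x)"
    using D by (intro clinear_setsum clinear_mult_left) (auto simp: is_pd_bar_def)
  show "clinear (\<lambda>x. qnum q (int b) *\<^sub>C x)" by (intro clinear_intros)
  fix y assume "y \<in> zw_monos n w z b a"
  then obtain r s where y: "y = mono_up n w r * mono_up n z s" "sum r {1..n} = b"
    by (auto simp: zw_monos_def)
  have "w i * D i y = (q powi ((\<Sum>k\<in>{1..<i}. int (r k)) - (\<Sum>k\<in>{i<..n}. int (r k))) * qnum q (int (r i))) *\<^sub>C y"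
    if i: "i \<in> {1..n}" for i
  proof -
    have "D i y = (q powi (- (\<Sum>k\<in>{i<..n}. int (r k))) * qnum q (int (r i))) *\<^sub>C (mono_up n w (r(i := r i - 1)) * mono_up n z s)"
      using D[OF i] by (simp add: is_pd_bar_def y)
    moreover have "w i * mono_up n w (r(i := r i - 1)) = (q powi (\<Sum>k\<in>{1..<i}. int (r k))) *\<^sub>C mono_up n w r" if "r i \<noteq> 0"
    proof -
      have "(\<Sum>k\<in>{1..<i}. int ((r(i := r i - 1)) k)) = (\<Sum>k\<in>{1..<i}. int (r k))" by (rule sum.cong) auto
      moreover have "(r(i := r i - 1))(i := Suc ((r(i := r i - 1)) i)) = r" using that by auto
      ultimately show ?thesis
        using wf.left_mult_mono_up[OF i order_refl, of "r(i := r i - 1)"] by (simp only: power_int_inverse power_int_minus inverse_inverse_eq)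
    qed
    moreover have "q powi (A - B) = q powi A * q powi (- B)" for A B
      using q0 by (simp flip: power_int_add)
    ultimately show ?thesis
      by (cases "r i = 0") (simp_all add: mult_scaleC_right scaleC_scaleC y(1) mult_scaleC_left mult_ac flip: mult.assoc[of "w i"])
  qed
  then show "(\<Sum>i\<in>{1..n}. w i * D i y) = qnum q (int b) *\<^sub>C y"
    unfolding y(2)[symmetric] of_nat_sum qnum_sum[symmetric] complex_vector.scale_sum_left
    by (intro sum.cong) auto
qed

text \<open>Here the variable is multiplied on before differentiating, so every exponent enters
  increased by one. This is how the number of variables \<open>n\<close> joins the degree.\<close>

lemma euler_pd:
  assumes D: "\<And>i. i \<in> {1..n} \<Longrightarrow> is_pd n q z w i (D i)" and x: "x \<in> hom_polys n z w a b"
  shows "(\<Sum>i\<in>{1..n}. (q powi (2 * int n - 2 * int i)) *\<^sub>C D i (z i * x)) = (q powi (int n - 1) * qnum q (int (a + n))) *\<^sub>C x"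
proof (rule clinear_eq_on_span[of "\<lambda>x. \<Sum>i\<in>{1..n}. (q powi (2 * int n - 2 * int i)) *\<^sub>C D i (z i * x)"
      "\<lambda>x. (q powi (int n - 1) * qnum q (int (a + n))) *\<^sub>C x" "zw_monos n z w a b"])
  show "x \<in> complex_vector.span (zw_monos n z w a b)" using x by (simp add: hom_polys_zw)
  show "clinear (\<lambda>x. \<Sum>i\<in>{1..n}. (q powi (2 * int n - 2 * int i)) *\<^sub>C D i (z i * x))"
  proof (intro clinear_setsum clinear_scaleC)
    fix i assume "i \<in> {1..n}"
    then have "clinear (D i)" using D by (simp add: is_pd_def)
    then show "clinear (\<lambda>x. D i (z i * x))" by (rule clinear_comp[OF _ clinear_mult_left[OF clinear_id]])
  qed
  show "clinear (\<lambda>x. (q powi (int n - 1) * qnum q (int (a + n))) *\<^sub>C x)" by (intro clinear_intros)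
  fix y assume "y \<in> zw_monos n z w a b"
  then obtain r s where y: "y = mono_up n z r * mono_up n w s" "sum r {1..n} = a"
    by (auto simp: zw_monos_def)
  define r' where "r' k = r k + 1" for k
  have "(q powi (2 * int n - 2 * int i)) *\<^sub>C D i (z i * y) =
      (q powi (int n - 1) * (q powi ((\<Sum>k\<in>{i<..n}. int (r' k)) - (\<Sum>k\<in>{1..<i}. int (r' k))) * qnum q (int (r' i)))) *\<^sub>C y"
    if i: "i \<in> {1..n}" for i
  proof -
    have lin: "clinear (D i)" using D[OF i] by (simp add: is_pd_def)
    have s1: "(\<Sum>k\<in>{i<..n}. int ((r(i := Suc (r i))) k)) = (\<Sum>k\<in>{i<..n}. int (r k))" by (rule sum.cong) auto
    have "D i (z i * y) = (q powi (- (\<Sum>k\<in>{1..<i}. int (r k)))) *\<^sub>C D i (mono_up n z (r(i := Suc (r i))) * mono_up n w s)"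
      unfolding y mult.assoc[symmetric] zf.left_mult_mono_up[OF i order_refl] mult_scaleC_left clinear_scale[OF lin] ..
    also have "D i (mono_up n z (r(i := Suc (r i))) * mono_up n w s) =
      (q powi (\<Sum>k\<in>{i<..n}. int (r k)) * qnum q (int (r' i))) *\<^sub>C y"
      using D[OF i] unfolding is_pd_def by (simp only: s1 y r'_def) (simp add: fun_upd_idem)
    finally have "(q powi (2 * int n - 2 * int i)) *\<^sub>C D i (z i * y) =
      ((q powi (2 * int n - 2 * int i) * q powi (- (\<Sum>k\<in>{1..<i}. int (r k))) * q powi (\<Sum>k\<in>{i<..n}. int (r k))) * qnum q (int (r' i))) *\<^sub>C y"
      by (simp only: scaleC_scaleC mult.assoc)
    also have "q powi (2 * int n - 2 * int i) * q powi (- (\<Sum>k\<in>{1..<i}. int (r k))) * q powi (\<Sum>k\<in>{i<..n}. int (r k))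
      = q powi (int n - 1) * q powi ((\<Sum>k\<in>{i<..n}. int (r' k)) - (\<Sum>k\<in>{1..<i}. int (r' k)))"
      unfolding power_int_add[OF disjI1[OF q0], symmetric]
      by (rule arg_cong[where f = "power_int q"]) (use i in \<open>simp add: r'_def sum.distrib of_nat_diff\<close>)
    finally show ?thesis by (simp only: mult.assoc)
  qed
  moreover have "int (a + n) = (\<Sum>k\<in>{1..n}. int (r' k))"
    unfolding y(2)[symmetric] by (simp add: r'_def sum.distrib)
  ultimately show "(\<Sum>i\<in>{1..n}. (q powi (2 * int n - 2 * int i)) *\<^sub>C D i (z i * y)) = (q powi (int n - 1) * qnum q (int (a + n))) *\<^sub>C y"
    by (simp only: qnum_sum'[symmetric] sum_distrib_left complex_vector.scale_sum_left cong: sum.cong)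
qed

lemma pd_bar_hom:
  assumes D: "is_pd_bar n q z w i D" and i: "i \<in> {1..n}" and x: "x \<in> hom_polys n z w a b"
  shows "D x \<in> hom_polys n z w a (b - 1)"
  unfolding hom_polys_wz
proof (rule clinear_maps_span[of D "zw_monos n w z b a"])
  show "x \<in> complex_vector.span (zw_monos n w z b a)" using x by (simp add: hom_polys_wz)
  show "clinear D" using D by (simp add: is_pd_bar_def)
  fix y assume "y \<in> zw_monos n w z b a"
  then obtain r s where y: "y = mono_up n w r * mono_up n z s" "sum r {1..n} = b" "sum s {1..n} = a"
    by (auto simp: zw_monos_def)
  have "D y = (q powi (- (\<Sum>k\<in>{i<..n}. int (r k))) * qnum q (int (r i))) *\<^sub>C (mono_up n w (r(i := r i - 1)) * mono_up n z s)"
    using D by (simp add: is_pd_bar_def y)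
  moreover have "mono_up n w (r(i := r i - 1)) * mono_up n z s \<in> zw_monos n w z (b - 1) a" if "r i > 0"
    unfolding zw_monos_def using sum_upd_pred[of i n r, OF i that] y(2,3) by fastforce
  ultimately show "D y \<in> complex_vector.span (zw_monos n w z (b - 1) a)"
    by (cases "r i = 0") (simp_all add: complex_vector.span_zero complex_vector.span_scale complex_vector.span_base)
qed

lemma sub_alg_eq_zw: "sub_alg n z w = complex_vector.span (\<Union>a b. zw_monos n z w a b)"
proof
  show "complex_vector.span (\<Union>a b. zw_monos n z w a b) \<subseteq> sub_alg n z w"
  proof (rule complex_vector.span_minimal)
    have "zw_monos n z w a b \<subseteq> sub_alg n z w" for a b
      using complex_vector.span_superset[of "zw_monos n z w a b"] hom_polys_subset_sub_alg[of n z w a b]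
      by (auto simp: hom_polys_zw)
    then show "(\<Union>a b. zw_monos n z w a b) \<subseteq> sub_alg n z w" by blast
  qed (simp add: sub_alg_def)
qed (rule sub_alg_zw)

lemma sub_alg_eq_wz: "sub_alg n z w = complex_vector.span (\<Union>a b. zw_monos n w z a b)"
proof -
  have swap: "(\<Union>a b. zw_monos n w z a b) = (\<Union>a b. zw_monos n w z b a)" by blast
  show ?thesis unfolding swap
  proof
  show "complex_vector.span (\<Union>a b. zw_monos n w z b a) \<subseteq> sub_alg n z w"
  proof (rule complex_vector.span_minimal)
    have "zw_monos n w z b a \<subseteq> sub_alg n z w" for a b
      using complex_vector.span_superset[of "zw_monos n w z b a"] hom_polys_subset_sub_alg[of n z w a b]
      by (auto simp: hom_polys_wz)
    then show "(\<Union>a b. zw_monos n w z b a) \<subseteq> sub_alg n z w" by blast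
  qed (simp add: sub_alg_def)
qed (rule sub_alg_wz)
qed

lemma pd_bar_sub_alg:
  assumes "is_pd_bar n q z w i D" "i \<in> {1..n}" "x \<in> sub_alg n z w"
  shows "D x \<in> sub_alg n z w"
proof -
  have x: "x \<in> complex_vector.span (word_val z w ` words n)" using assms(3) by (simp add: sub_alg_def)
  have lin: "clinear D" using assms(1) by (simp add: is_pd_bar_def)
  have "D (word_val z w u) \<in> sub_alg n z w" if "u \<in> words n" for u
  proof -
    have "word_val z w u \<in> hom_polys n z w (zdeg u) (wdeg u)"
      using that unfolding hom_polys_eq by (auto intro: complex_vector.span_base)
    from pd_bar_hom[OF assms(1,2) this] show ?thesis using hom_polys_subset_sub_alg by blast
  qed
  then show ?thesis unfolding sub_alg_def
    by (intro clinear_maps_span[OF lin _ x]) (auto simp: sub_alg_def)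
qed

end

lemma is_pd_bar_iff: "is_pd_bar n q z w i D \<longleftrightarrow> is_pd n (inverse q) w z i D"
  by (simp add: is_pd_def is_pd_bar_def power_int_minus power_int_inverse qnum_inverse)

section \<open>Derivatives of products with a power of the last variable\<close>

context
  fixes m :: nat and q e :: complex and z w :: "nat \<Rightarrow> 'a::complex_algebra_1" and i :: nat and D :: "'a \<Rightarrow> 'a"
  assumes D: "is_pd (Suc m) q z w i D"
begin

lemma is_pd_lin: "clinear D"
  using D by (simp add: is_pd_def)

text \<open>The commutation factor \<open>e\<close> is a parameter because the lemma serves twice:
  for \<open>d i\<close>, and for \<open>db i\<close> with \<open>z\<close>, \<open>w\<close>
  exchanged and \<open>q\<close> inverted.\<close>

lemma is_pd_mult_z:
  assumes q: "q \<noteq> 0" and i: "i \<in> {1..m}"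
    and e: "e \<noteq> 0" "\<And>j. j \<in> {1..m} \<Longrightarrow> q_commute e (z (Suc m)) (w j)"
    and x: "x \<in> complex_vector.span (\<Union>a b. zw_monos m z w a b)"
  shows "D (x * z (Suc m) ^ k) = q ^ k *\<^sub>C (D x * z (Suc m) ^ k)"
proof (rule clinear_eq_on_span[of "\<lambda>x. D (x * z (Suc m) ^ k)" "\<lambda>x. q ^ k *\<^sub>C (D x * z (Suc m) ^ k)", OF _ _ _ x])
  show "clinear (\<lambda>x. D (x * z (Suc m) ^ k))" "clinear (\<lambda>x. q ^ k *\<^sub>C (D x * z (Suc m) ^ k))"
    by (intro clinear_intros is_pd_lin clinear_comp[OF is_pd_lin])+
  fix y assume "y \<in> (\<Union>a b. zw_monos m z w a b)"
  then obtain r s where y: "y = mono_up m z r * mono_up m w s" by (auto simp: zw_monos_def)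
  define E where "E = (e ^ k) powi (\<Sum>j\<in>{1..m}. int (s j))"
  have E: "E \<noteq> 0" using e(1) by (simp add: E_def)
  have comm: "mono_up m w s * z (Suc m) ^ k = inverse E *\<^sub>C (z (Suc m) ^ k * mono_up m w s)"
  proof -
    have "q_commute E (z (Suc m) ^ k) (mono_up m w s)"
      unfolding E_def using e by (intro q_commute_mono_up q_commute_power_left) auto
    from q_commute_sym[OF this E] show ?thesis by (simp add: q_commute_def)
  qed
  have up: "mono_up m z r * mono_up m w s * z (Suc m) ^ k =
     inverse E *\<^sub>C (mono_up (Suc m) z (r(Suc m := k)) * mono_up (Suc m) w (s(Suc m := 0)))" for r
    by (simp only: mult.assoc comm mult_scaleC_right mono_up_Suc_upd power_0 mult_1_right)
  have s1: "(\<Sum>j\<in>{i<..Suc m}. int ((r(Suc m := k)) j)) = (\<Sum>j\<in>{i<..m}. int (r j)) + int k"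
  proof -
    have "{i<..Suc m} = insert (Suc m) {i<..m}" using i by auto
    then show ?thesis by (auto intro!: sum.cong)
  qed
  have t: "(r(Suc m := k))(i := (r(Suc m := k)) i - 1) = (r(i := r i - 1))(Suc m := k)"
    using i by (auto simp: fun_eq_iff)
  have ri: "(r(Suc m := k)) i = r i" using i by auto
  have Dm: "D (mono_up m z r * mono_up m w s) = (q powi (\<Sum>k\<in>{i<..m}. int (r k)) * qnum q (int (r i))) *\<^sub>C
          (mono_up m z (r(i := r i - 1)) * mono_up m w s)"
    using is_pd_mono[OF D _ i] by (simp add: is_pd_def)
  have "D (y * z (Suc m) ^ k) = inverse E *\<^sub>C D (mono_up (Suc m) z (r(Suc m := k)) * mono_up (Suc m) w (s(Suc m := 0)))"
    unfolding y up clinear_scale[OF is_pd_lin] ..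
  also have "D (mono_up (Suc m) z (r(Suc m := k)) * mono_up (Suc m) w (s(Suc m := 0))) =
     (q powi ((\<Sum>j\<in>{i<..m}. int (r j)) + int k) * qnum q (int (r i))) *\<^sub>C
       (mono_up (Suc m) z ((r(i := r i - 1))(Suc m := k)) * mono_up (Suc m) w (s(Suc m := 0)))"
  proof -
    have "D (mono_up (Suc m) z (r(Suc m := k)) * mono_up (Suc m) w (s(Suc m := 0))) =
     (q powi (\<Sum>j\<in>{i<..Suc m}. int ((r(Suc m := k)) j)) * qnum q (int ((r(Suc m := k)) i))) *\<^sub>C
       (mono_up (Suc m) z ((r(Suc m := k))(i := (r(Suc m := k)) i - 1)) * mono_up (Suc m) w (s(Suc m := 0)))"
      using D by (simp add: is_pd_def)
    then show ?thesis unfolding s1 t unfolding ri .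
  qed
  also have "inverse E *\<^sub>C \<dots> = (q powi ((\<Sum>j\<in>{i<..m}. int (r j)) + int k) * qnum q (int (r i))) *\<^sub>C
     (mono_up m z (r(i := r i - 1)) * mono_up m w s * z (Suc m) ^ k)"
    by (simp only: up scaleC_scaleC mult.commute)
  also have "\<dots> = q ^ k *\<^sub>C (D y * z (Suc m) ^ k)"
    unfolding y Dm mult_scaleC_left scaleC_scaleC using q by (simp add: power_int_add mult_ac)
  finally show "D (y * z (Suc m) ^ k) = q ^ k *\<^sub>C (D y * z (Suc m) ^ k)" .
qed

lemma is_pd_mult_w:
  assumes i: "i \<in> {1..Suc m}" and x: "x \<in> complex_vector.span (\<Union>a b. zw_monos m z w a b)"
  shows "D (x * w (Suc m) ^ k) = (if i = Suc m then 0 else D x * w (Suc m) ^ k)"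
proof (rule clinear_eq_on_span[of "\<lambda>x. D (x * w (Suc m) ^ k)"
      "\<lambda>x. if i = Suc m then 0 else D x * w (Suc m) ^ k", OF _ _ _ x])
  show "clinear (\<lambda>x. D (x * w (Suc m) ^ k))"
    by (intro clinear_intros is_pd_lin clinear_comp[OF is_pd_lin])+
  show "clinear (\<lambda>x. if i = Suc m then 0 else D x * w (Suc m) ^ k)"
    by (cases "i = Suc m") (auto intro!: clinear_intros is_pd_lin)
  fix y assume "y \<in> (\<Union>a b. zw_monos m z w a b)"
  then obtain r s where y: "y = mono_up m z r * mono_up m w s" by (auto simp: zw_monos_def)
  have up: "mono_up m z r * mono_up m w s * w (Suc m) ^ k = mono_up (Suc m) z (r(Suc m := 0)) * mono_up (Suc m) w (s(Suc m := k))" for r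
    by (simp only: mult.assoc mono_up_Suc_upd power_0 mult_1_right)
  have DM: "D (mono_up (Suc m) z (r(Suc m := 0)) * mono_up (Suc m) w (s(Suc m := k))) =
     (q powi (\<Sum>j\<in>{i<..Suc m}. int ((r(Suc m := 0)) j)) * qnum q (int ((r(Suc m := 0)) i))) *\<^sub>C
       (mono_up (Suc m) z ((r(Suc m := 0))(i := (r(Suc m := 0)) i - 1)) * mono_up (Suc m) w (s(Suc m := k)))"
    using D by (simp add: is_pd_def)
  show "D (y * w (Suc m) ^ k) = (if i = Suc m then 0 else D y * w (Suc m) ^ k)"
  proof (cases "i = Suc m")
    case True
    then show ?thesis unfolding y up DM by simp
  next
    case False
    then have i': "i \<in> {1..m}" using i by auto
    have "D (mono_up m z r * mono_up m w s) = (q powi (\<Sum>k\<in>{i<..m}. int (r k)) * qnum q (int (r i))) *\<^sub>C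
            (mono_up m z (r(i := r i - 1)) * mono_up m w s)"
      using is_pd_mono[OF D _ i'] by (simp add: is_pd_def)
    moreover have "(\<Sum>j\<in>{i<..Suc m}. int ((r(Suc m := 0)) j)) = (\<Sum>j\<in>{i<..m}. int (r j))"
      by (rule sum.mono_neutral_cong_right) auto
    moreover have "(r(Suc m := 0))(i := (r(Suc m := 0)) i - 1) = (r(i := r i - 1))(Suc m := 0)"
      using False by (auto simp: fun_eq_iff)
    moreover have "(r(Suc m := 0)) i = r i" using False by auto
    ultimately show ?thesis unfolding y up DM using False
      by (simp only: mult_scaleC_left up if_False simp_thms)
  qed
qed

text \<open>Only the shape of the result matters: an element without the last pair times a lower
  power. With the roles exchanged, the derivative of the other kind then annihilates it by
  \<open>is_pd_mult_w\<close>.\<close>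

lemma is_pd_last_mult_z:
  assumes i: "i = Suc m" and e: "e \<noteq> 0" "\<And>j. j \<in> {1..m} \<Longrightarrow> q_commute e (z (Suc m)) (w j)"
    and x: "x \<in> complex_vector.span (\<Union>a b. zw_monos m z w a b)"
  shows "D (x * z (Suc m) ^ k) \<in> (\<lambda>y. y * z (Suc m) ^ (k - 1)) ` complex_vector.span (\<Union>a b. zw_monos m z w a b)"
  using x
proof (induction rule: complex_vector.span_induct_alt)
  case base
  show ?case using clinear_0[OF is_pd_lin] complex_vector.span_zero by (auto intro!: image_eqI[of _ _ 0])
next
  case (step c y x)
  then obtain r s where y: "y = mono_up m z r * mono_up m w s" by (auto simp: zw_monos_def)
  obtain x' where x': "D (x * z (Suc m) ^ k) = x' * z (Suc m) ^ (k - 1)"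
    "x' \<in> complex_vector.span (\<Union>a b. zw_monos m z w a b)" using step by auto
  define E where "E k = (e ^ k) powi (\<Sum>j\<in>{1..m}. int (s j))" for k
  have E: "E k \<noteq> 0" for k using e(1) by (simp add: E_def)
  have comm: "q_commute (E k) (z (Suc m) ^ k) (mono_up m w s)" for k
    unfolding E_def using e by (intro q_commute_mono_up q_commute_power_left) auto
  have "mono_up m w s * z (Suc m) ^ k = inverse (E k) *\<^sub>C (z (Suc m) ^ k * mono_up m w s)"
    using q_commute_sym[OF comm E] by (simp add: q_commute_def)
  then have up: "y * z (Suc m) ^ k =
     inverse (E k) *\<^sub>C (mono_up (Suc m) z (r(Suc m := k)) * mono_up (Suc m) w (s(Suc m := 0)))"
    unfolding y by (simp only: mult.assoc mult_scaleC_right mono_up_Suc_upd power_0 mult_1_right)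
  have "D (mono_up (Suc m) z (r(Suc m := k)) * mono_up (Suc m) w (s(Suc m := 0))) =
     (q powi (\<Sum>j\<in>{i<..Suc m}. int ((r(Suc m := k)) j)) * qnum q (int ((r(Suc m := k)) i))) *\<^sub>C
       (mono_up (Suc m) z ((r(Suc m := k))(i := (r(Suc m := k)) i - 1)) * mono_up (Suc m) w (s(Suc m := 0)))"
    using D by (simp add: is_pd_def)
  then have F: "D (mono_up (Suc m) z (r(Suc m := k)) * mono_up (Suc m) w (s(Suc m := 0))) =
     qnum q (int k) *\<^sub>C (mono_up m z r * (z (Suc m) ^ (k - 1) * mono_up m w s))"
    unfolding i by (simp add: mono_up_Suc_upd mult.assoc)
  have G: "z (Suc m) ^ (k - 1) * mono_up m w s = E (k - 1) *\<^sub>C (mono_up m w s * z (Suc m) ^ (k - 1))"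
    using comm[of "k - 1"] by (simp add: q_commute_def)
  have Dy: "D (y * z (Suc m) ^ k) = (inverse (E k) * (qnum q (int k) * E (k - 1))) *\<^sub>C (y * z (Suc m) ^ (k - 1))"
    unfolding up clinear_scale[OF is_pd_lin] F G unfolding y by (simp only: mult_scaleC_right scaleC_scaleC mult.assoc)
  have "D ((c *\<^sub>C y + x) * z (Suc m) ^ k) =
     ((c * (inverse (E k) * (qnum q (int k) * E (k - 1)))) *\<^sub>C y + x') * z (Suc m) ^ (k - 1)"
    by (simp only: distrib_right mult_scaleC_left clinear_add[OF is_pd_lin] clinear_scale[OF is_pd_lin] Dy x' scaleC_scaleC)
  moreover have "(c * (inverse (E k) * (qnum q (int k) * E (k - 1)))) *\<^sub>C y + x' \<in> complex_vector.span (\<Union>a b. zw_monos m z w a b)"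
    using step(1) x'(2) by (intro complex_vector.span_add complex_vector.span_scale) (auto intro: complex_vector.span_base)
  ultimately show ?case by (intro image_eqI)
qed

end

text \<open>The operators are parameters, so that \<open>q_weyl_ops_mono\<close> keeps the same
  \<open>d\<close> and \<open>db\<close> when variables are dropped.\<close>

locale q_weyl_ops = q_weyl +
  fixes d db :: "nat \<Rightarrow> 'a \<Rightarrow> 'a"
  assumes d: "i \<in> {1..n} \<Longrightarrow> is_pd n q z w i (d i)"
    and db: "i \<in> {1..n} \<Longrightarrow> is_pd_bar n q z w i (db i)"
begin

lemma q_weyl_ops_mono: "p \<le> n \<Longrightarrow> q_weyl_ops p q z w d db"
  using q_weyl_mono[of p] is_pd_mono[OF d] is_pd_bar_mono[OF db]
  by (simp add: q_weyl_ops_def q_weyl_ops_axioms_def)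

definition Lap :: "nat \<Rightarrow> 'a \<Rightarrow> 'a" where
  "Lap p x = (\<Sum>i\<in>{1..p}. d i (db i x))"

lemma clinear_d: "i \<in> {1..n} \<Longrightarrow> clinear (d i)"
  using d by (simp add: is_pd_def)

lemma clinear_db: "i \<in> {1..n} \<Longrightarrow> clinear (db i)"
  using db by (simp add: is_pd_bar_def)

lemma clinear_Lap: "p \<le> n \<Longrightarrow> clinear (Lap p)"
  unfolding Lap_def[abs_def] by (intro clinear_setsum clinear_comp[OF clinear_d clinear_db]) auto

text \<open>Applying the two Leibniz rules in turn leaves, besides \<open>Q n * Lap n x\<close>, the
  two Euler sums. Their q-numbers of \<open>b\<close> and of \<open>a + n\<close> combine by
  \<open>qnum_add\<close> into the one of \<open>a + b + n\<close>.\<close>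

lemma Lap_Q:
  assumes x: "x \<in> hom_polys n z w a b"
  shows "Lap n (Q n * x) = Q n * Lap n x + (q powi (int n - 1) * qnum q (int (a + b + n))) *\<^sub>C x"
proof -
  have "d i (db i (Q n * x)) = Q n * d i (db i x) + (inverse q * q powi (- int a)) *\<^sub>C (w i * db i x)
     + q powi (int b) *\<^sub>C ((q powi (2 * int n - 2 * int i)) *\<^sub>C d i (z i * x))" if i: "i \<in> {1..n}" for i
  proof -
    have "d i (db i (Q n * x)) = inverse q *\<^sub>C d i (Q n * db i x) + (q powi (int b + (2 * int n - 2 * int i))) *\<^sub>C d i (z i * x)"
      unfolding pd_bar_Q[OF db[OF i] i x] clinear_add[OF clinear_d[OF i]] clinear_scale[OF clinear_d[OF i]]
      by (simp only: add_diff_eq)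
    also have "d i (Q n * db i x) = q *\<^sub>C (Q n * d i (db i x)) + (q powi (- int a)) *\<^sub>C (w i * db i x)"
      by (rule pd_Q[OF d[OF i] i pd_bar_hom[OF db[OF i] i x]])
    also have "q powi (int b + (2 * int n - 2 * int i)) = q powi (int b) * q powi (2 * int n - 2 * int i)"
      by (rule power_int_add[OF disjI1[OF q0]])
    finally show ?thesis using q0 by (simp add: scaleC_add_right scaleC_scaleC scaleC_one)
  qed
  then have "Lap n (Q n * x) = Q n * Lap n x + (inverse q * q powi (- int a)) *\<^sub>C (\<Sum>i\<in>{1..n}. w i * db i x)
     + q powi (int b) *\<^sub>C (\<Sum>i\<in>{1..n}. (q powi (2 * int n - 2 * int i)) *\<^sub>C d i (z i * x))"
    unfolding Lap_def scaleC_sum_right sum_distrib_left sum.distrib[symmetric] by (intro sum.cong) auto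
  also have "(\<Sum>i\<in>{1..n}. w i * db i x) = qnum q (int b) *\<^sub>C x"
    by (rule euler_pd_bar[OF db x])
  also have "(\<Sum>i\<in>{1..n}. (q powi (2 * int n - 2 * int i)) *\<^sub>C d i (z i * x)) = (q powi (int n - 1) * qnum q (int (a + n))) *\<^sub>C x"
    by (rule euler_pd[OF d x])
  finally have L: "Lap n (Q n * x) = Q n * Lap n x + ((inverse q * q powi (- int a)) * qnum q (int b)
     + q powi (int b) * (q powi (int n - 1) * qnum q (int (a + n)))) *\<^sub>C x"
    by (simp only: scaleC_scaleC add.assoc scaleC_add_left)
  have e1: "inverse q * q powi (- int a) = q powi (int n - 1) * q powi (- int (a + n))"
  proof -
    have "inverse q * q powi (- int a) = q powi (- 1) * q powi (- int a)" by simp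
    also have "\<dots> = q powi (int n - 1) * q powi (- int (a + n))"
      unfolding power_int_add[OF disjI1[OF q0], symmetric] by (rule arg_cong[where f = "power_int q"]) simp
    finally show ?thesis .
  qed
  have "(inverse q * q powi (- int a)) * qnum q (int b) + q powi (int b) * (q powi (int n - 1) * qnum q (int (a + n)))
      = q powi (int n - 1) * qnum q (int (a + n) + int b)"
    unfolding e1 qnum_add by (simp add: distrib_left mult_ac)
  moreover have "int (a + n) + int b = int (a + b + n)" by simp
  ultimately show ?thesis unfolding L by (simp only:)
qed

end

text \<open>The last summand of \<open>Lap n\<close> vanishes on both kinds of products. Against
  \<open>z n ^ k\<close> the operator \<open>db n\<close> finds no \<open>w n\<close>; against
  \<open>w n ^ k\<close> it leaves a lower power of \<open>w n\<close>, which \<open>d n\<close>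
  kills. The other summands only pick up scalars.\<close>

lemma (in q_weyl_ops) Lap_mult_last:
  assumes n: "n = Suc m" and x: "x \<in> sub_alg m z w"
  shows "Lap n (x * z n ^ k) = q ^ k *\<^sub>C (Lap m x * z n ^ k)"
    and "Lap n (x * w n ^ k) = inverse q ^ k *\<^sub>C (Lap m x * w n ^ k)"
proof -
  interpret m: q_weyl_ops m q z w d db by (rule q_weyl_ops_mono) (simp add: n)
  have szw: "x \<in> complex_vector.span (\<Union>a b. zw_monos m z w a b)" if "x \<in> sub_alg m z w" for x
    using that m.sub_alg_eq_zw by simp
  have swz: "x \<in> complex_vector.span (\<Union>a b. zw_monos m w z a b)" if "x \<in> sub_alg m z w" for x
    using that m.sub_alg_eq_wz by simp
  have dS: "is_pd (Suc m) q z w i (d i)" if "i \<in> {1..Suc m}" for i using d that n by simp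
  have dbS: "is_pd (Suc m) (inverse q) w z i (db i)" if "i \<in> {1..Suc m}" for i
    using db[of i] that n by (simp add: is_pd_bar_iff)
  have zc: "q_commute (inverse q) (z (Suc m)) (w j)" if "j \<in> {1..m}" for j
    using q_commute_sym[OF wz[of "Suc m" j]] that n q0 by simp
  have wc: "q_commute q (w (Suc m)) (z j)" if "j \<in> {1..m}" for j
    using wz[of j "Suc m"] that n by simp
  have iq: "inverse q \<noteq> 0" using q0 by simp
  have dbx: "db i x \<in> sub_alg m z w" if "i \<in> {1..m}" for i
    by (rule m.pd_bar_sub_alg[OF m.db that x]) (use that in simp)
  have split: "Lap (Suc m) y = Lap m y + d (Suc m) (db (Suc m) y)" for y
    by (simp add: Lap_def)
  have "Lap m (x * z (Suc m) ^ k) = q ^ k *\<^sub>C (Lap m x * z (Suc m) ^ k)"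
    unfolding Lap_def sum_distrib_right scaleC_sum_right
  proof (rule sum.cong[OF refl])
    fix i assume i: "i \<in> {1..m}"
    then have iS: "i \<in> {1..Suc m}" by simp
    have "db i (x * z (Suc m) ^ k) = db i x * z (Suc m) ^ k"
      using is_pd_mult_w[OF dbS[OF iS] iS swz[OF x]] i by simp
    then show "d i (db i (x * z (Suc m) ^ k)) = q ^ k *\<^sub>C (d i (db i x) * z (Suc m) ^ k)"
      using is_pd_mult_z[OF dS[OF iS] q0 i iq zc szw[OF dbx[OF i]]] by simp
  qed
  moreover have "db (Suc m) (x * z (Suc m) ^ k) = 0"
    using is_pd_mult_w[OF dbS _ swz[OF x], of "Suc m"] by simp
  ultimately show "Lap n (x * z n ^ k) = q ^ k *\<^sub>C (Lap m x * z n ^ k)"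
    unfolding n split by (simp add: clinear_0[OF is_pd_lin[OF dS]])
  have "Lap m (x * w (Suc m) ^ k) = inverse q ^ k *\<^sub>C (Lap m x * w (Suc m) ^ k)"
    unfolding Lap_def sum_distrib_right scaleC_sum_right
  proof (rule sum.cong[OF refl])
    fix i assume i: "i \<in> {1..m}"
    then have iS: "i \<in> {1..Suc m}" by simp
    have "db i (x * w (Suc m) ^ k) = inverse q ^ k *\<^sub>C (db i x * w (Suc m) ^ k)"
      using is_pd_mult_z[OF dbS[OF iS] iq i q0 wc swz[OF x]] by simp
    moreover have "d i (db i x * w (Suc m) ^ k) = d i (db i x) * w (Suc m) ^ k"
      using is_pd_mult_w[OF dS[OF iS] iS szw[OF dbx[OF i]]] i by simp
    ultimately show "d i (db i (x * w (Suc m) ^ k)) = inverse q ^ k *\<^sub>C (d i (db i x) * w (Suc m) ^ k)"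
      by (simp only: clinear_scale[OF is_pd_lin[OF dS[OF iS]]])
  qed
  moreover have "d (Suc m) (db (Suc m) (x * w (Suc m) ^ k)) = 0"
  proof -
    have S: "Suc m \<in> {1..Suc m}" by simp
    obtain y where y: "db (Suc m) (x * w (Suc m) ^ k) = y * w (Suc m) ^ (k - 1)"
      "y \<in> complex_vector.span (\<Union>a b. zw_monos m w z a b)"
      using is_pd_last_mult_z[OF dbS[OF S] refl q0 wc swz[OF x], of k] by auto
    have "y \<in> sub_alg m z w" using y(2) m.sub_alg_eq_wz by simp
    then show ?thesis unfolding y(1) using is_pd_mult_w[OF dS[OF S] S szw] by simp
  qed
  ultimately show "Lap n (x * w n ^ k) = inverse q ^ k *\<^sub>C (Lap m x * w n ^ k)"
    unfolding n split by simp
qed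

section \<open>Bases of harmonic polynomials\<close>

context q_weyl
begin

lemma Q_central: "x \<in> sub_alg n z w \<Longrightarrow> q_commute 1 (Q n) x"
proof -
  assume x: "x \<in> sub_alg n z w"
  have *: "Free_Word gs \<in> words n \<Longrightarrow> q_commute 1 (Q n) (word_val z w (Free_Word gs))" for gs
  proof (induction gs)
    case (Cons g gs)
    then have "q_commute 1 (Q n) (case g of GZ i \<Rightarrow> z i | GW i \<Rightarrow> w i)"
      by (cases g) (auto intro!: Q_z_ge Q_w_ge)
    then show ?case unfolding word_val_Cons using Cons by (intro q_commute_mult_right'[of 1]) auto
  qed simp
  have "q_commute 1 (Q n) (word_val z w u)" if "u \<in> words n" for u
    using *[of "letters u"] that by simp
  then show ?thesis
    by (intro q_commute_span_right[OF _ x[unfolded sub_alg_def]]) auto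
qed

lemma Q_comm: "x \<in> sub_alg n z w \<Longrightarrow> Q n * x = x * Q n"
  using Q_central by (simp add: q_commute_def scaleC_one)

lemma last_hom:
  assumes n: "n = Suc m" and x: "x \<in> hom_polys m z w a b"
  shows "q_commute (inverse q ^ (a + b)) (z n) x" "q_commute (q ^ (a + b)) (w n) x"
proof -
  have *: "Free_Word gs \<in> words m \<Longrightarrow>
     q_commute (inverse q ^ (zdeg (Free_Word gs) + wdeg (Free_Word gs))) (z n) (word_val z w (Free_Word gs)) \<and>
     q_commute (q ^ (zdeg (Free_Word gs) + wdeg (Free_Word gs))) (w n) (word_val z w (Free_Word gs))" for gs
  proof (induction gs)
    case (Cons g gs)
    have "q_commute (inverse q) (z n) (case g of GZ i \<Rightarrow> z i | GW i \<Rightarrow> w i)"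
      using Cons.prems n q_commute_sym[OF wz[of n]] q0 by (cases g) (auto intro!: zz')
    moreover have "q_commute q (w n) (case g of GZ i \<Rightarrow> z i | GW i \<Rightarrow> w i)"
      using Cons.prems n by (cases g) (auto intro!: ww' wz)
    ultimately show ?case unfolding word_val_Cons using Cons
      by (cases g) (auto intro!: q_commute_mult_right')
  qed simp
  have "q_commute (inverse q ^ (zdeg u + wdeg u)) (z n) (word_val z w u)"
    "q_commute (q ^ (zdeg u + wdeg u)) (w n) (word_val z w u)" if "u \<in> words m" for u
    using *[of "letters u"] that by simp_all
  then show "q_commute (inverse q ^ (a + b)) (z n) x" "q_commute (q ^ (a + b)) (w n) x"
    by (auto intro: q_commute_span_right[OF _ x[unfolded hom_polys_eq]])
qed

lemma last_hom_power:
  assumes n: "n = Suc m" and x: "x \<in> hom_polys m z w a b"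
  shows "z n ^ r * x = (inverse q ^ (a + b)) ^ r *\<^sub>C (x * z n ^ r)" "w n ^ r * x = (q ^ (a + b)) ^ r *\<^sub>C (x * w n ^ r)"
  using q_commute_power_left[OF last_hom(1)[OF n x], of r] q_commute_power_left[OF last_hom(2)[OF n x], of r]
  by (simp_all add: q_commute_def)

lemma z_Q_last: "n = Suc m \<Longrightarrow> z n ^ r * Q m = (inverse q ^ 2) ^ r *\<^sub>C (Q m * z n ^ r)"
  using last_hom_power(1)[of m "Q m" 1 1 r] hom_polys_Q[of m m z w] by (simp add: power2_eq_square)

text \<open>Closes the induction for powers of \<open>Q n\<close>: the first term on the right is
  the coefficient accumulated after \<open>i\<close> steps, the second is the increment from
  \<open>Lap_Q\<close>. Multiplied by the square of \<open>q - inverse q\<close> it becomes an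
  identity of powers of \<open>q\<close>.\<close>

lemma qnum_product:
  "qnum q (i + 1) * qnum q (e + i) = qnum q i * qnum q (e + i - 1) + qnum q (e + 2 * i)"
proof -
  define d where "d = q - inverse q"
  have d: "d \<noteq> 0" unfolding d_def by (rule q_minus_inverse)
  have qd: "d * qnum q a = q powi a - q powi (- a)" for a
    using d by (simp add: qnum_def d_def)
  have pr: "d * d * (qnum q a * qnum q b) = q powi (a + b) + q powi (- a - b) - q powi (a - b) - q powi (b - a)" for a b
  proof -
    have "d * d * (qnum q a * qnum q b) = (d * qnum q a) * (d * qnum q b)" by (simp add: mult_ac)
    also have "\<dots> = q powi a * q powi b + q powi (- a) * q powi (- b) - q powi a * q powi (- b) - q powi b * q powi (- a)"
      unfolding qd by (simp add: algebra_simps)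
    also have "\<dots> = q powi (a + b) + q powi (- a + - b) - q powi (a + - b) - q powi (b + - a)"
      by (simp only: power_int_add[OF disjI1[OF q0]])
    finally show ?thesis by simp
  qed
  have m: "d * d * qnum q k = q powi (k + 1) + q powi (- k - 1) - q powi (k - 1) - q powi (1 - k)" for k
  proof -
    have "d * d * qnum q k = d * (q powi k - q powi (- k))" using qd[of k] by (simp add: mult.assoc)
    also have "\<dots> = q powi k * q powi 1 + q powi (- k) * q powi (- 1) - q powi k * q powi (- 1) - q powi 1 * q powi (- k)"
      by (simp add: d_def algebra_simps)
    also have "\<dots> = q powi (k + 1) + q powi (- k + - 1) - q powi (k + - 1) - q powi (1 + - k)"
      by (simp only: power_int_add[OF disjI1[OF q0]])
    finally show ?thesis by simp
  qed
  have "d * d * (qnum q (i + 1) * qnum q (e + i)) = d * d * (qnum q i * qnum q (e + i - 1) + qnum q (e + 2 * i))"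
  proof -
    have e: "i + 1 + (e + i) = e + 2 * i + 1" "- (i + 1) - (e + i) = - (e + 2 * i) - 1" "i + 1 - (e + i) = 1 - e"
      "e + i - (i + 1) = e - 1" "i + (e + i - 1) = e + 2 * i - 1" "- i - (e + i - 1) = 1 - (e + 2 * i)"
      "i - (e + i - 1) = 1 - e" "e + i - 1 - i = e - 1" by simp_all
    show ?thesis unfolding distrib_left pr m e by simp
  qed
  then show ?thesis using d by simp
qed

end

text \<open>Coefficients of the terminating series: \<open>N\<close> is the degree, \<open>r\<close> the difference of the two degrees
  and \<open>\<beta> = b + b' + p - 1\<close>.\<close>

definition phi_coeff :: "complex \<Rightarrow> nat \<Rightarrow> nat \<Rightarrow> nat \<Rightarrow> nat \<Rightarrow> complex" where
  "phi_coeff q N r \<beta> k = phi21_coeff (q powi (- 2 * int N)) (q ^ (2 * (N + r + \<beta>))) (q ^ (2 * \<beta>)) (q\<^sup>2) k * (q\<^sup>2) ^ k"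

lemma qpoch_Suc: "qpoch a t (Suc k) = qpoch a t k * (1 - a * t ^ k)"
  by (simp add: qpoch_def mult.commute)

lemma qpoch_0 [simp]: "qpoch a t 0 = 1"
  by (simp add: qpoch_def)

lemma phi_coeff_0 [simp]: "phi_coeff q N r \<beta> 0 = 1"
  by (simp add: phi_coeff_def phi21_coeff_def)

context q_weyl
begin

text \<open>Translates the q-shifted factorials of the series into the q-numbers that the Laplacian
  produces.\<close>

lemma one_minus_power: "1 - q powi (2 * a) = - (q powi a) * ((q - inverse q) * qnum q a)"
proof -
  have 1: "(q - inverse q) * qnum q a = q powi a - q powi (- a)"
    using q_minus_inverse by (simp add: qnum_def)
  have 2: "q powi (2 * a) = q powi a * q powi a" and 3: "q powi a * q powi (- a) = 1"
    using power_int_add[of q a a] power_int_add[of q a "- a"] q0 by simp_all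
  show ?thesis unfolding 1 2 using 3 by (simp add: right_diff_distrib)
qed

text \<open>Ratio of consecutive terms of the series, cleared of denominators. The q-numbers on the
  left are those of \<open>Lap_block\<close> at \<open>Suc k\<close>, those on the right belong to
  \<open>Lap_Q_power\<close> for the summand \<open>k\<close>.\<close>

lemma phi_coeff_Suc:
  assumes "\<beta> \<ge> 1"
  shows "phi_coeff q N r \<beta> (Suc k) * (qnum q (int k + 1) * qnum q (int \<beta> + int k)) =
    - (q powi (int r + 1)) * (qnum q (int N - int k) * qnum q (int N + int r + int \<beta> + int k)) * phi_coeff q N r \<beta> k"
proof -
  define d where "d = q - inverse q"
  have d: "d \<noteq> 0" unfolding d_def by (rule q_minus_inverse)
  let ?f = "\<lambda>a. - (q powi a) * (d * qnum q a)"
  have f: "1 - q powi (2 * a) = ?f a" for a unfolding d_def by (rule one_minus_power)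
  have f0: "1 - q powi (2 * a) \<noteq> 0" if "a \<noteq> 0" for a
    unfolding f using qnum_neq_0[OF that] d q0 by simp
  have p1: "1 - q powi (- 2 * int N) * (q\<^sup>2) ^ k = 1 - q powi (2 * (int k - int N))"
  proof -
    have "q powi (- 2 * int N) * q powi (2 * int k) = q powi (2 * (int k - int N))"
      unfolding power_int_add[OF disjI1[OF q0], symmetric] by (rule arg_cong[where f = "power_int q"]) simp
    then show ?thesis by (simp add: power_int_mult)
  qed
  have p2: "1 - q ^ (2 * l) * (q\<^sup>2) ^ k = 1 - q powi (2 * (int l + int k))" for l
  proof -
    have "q powi (2 * int l) * q powi (2 * int k) = q powi (2 * (int l + int k))"
      unfolding power_int_add[OF disjI1[OF q0], symmetric] by (rule arg_cong[where f = "power_int q"]) simp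
    then show ?thesis by (simp add: power_int_mult power_mult)
  qed
  have p3: "1 - q\<^sup>2 * (q\<^sup>2) ^ k = 1 - q powi (2 * (int k + 1))"
    using p2[of 1] by (simp only: mult_1_right of_nat_1 add.commute)
  have "phi_coeff q N r \<beta> (Suc k) * ((1 - q powi (2 * (int \<beta> + int k))) * (1 - q powi (2 * (int k + 1)))) =
    q\<^sup>2 * ((1 - q powi (2 * (int k - int N))) * (1 - q powi (2 * (int (N + r + \<beta>) + int k)))) * phi_coeff q N r \<beta> k"
  proof -
    have nz: "1 - q powi (2 * (int \<beta> + int k)) \<noteq> 0" "1 - q powi (2 * (int k + 1)) \<noteq> 0"
      using f0[of "int \<beta> + int k"] f0[of "int k + 1"] assms by auto
    have *: "(A * x * (B * y)) / (C * u * (D * v)) * (t * T) * (u * v) = t * (x * y) * ((A * B) / (C * D) * T)"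
      if "u \<noteq> 0" "v \<noteq> 0" for A B C D x y u v t T :: complex
      using that by (simp add: field_simps)
    show ?thesis
      unfolding phi_coeff_def phi21_coeff_def qpoch_Suc p1 p2 p3 power_Suc
      by (rule *) (use nz in auto)
  qed
  then have "phi_coeff q N r \<beta> (Suc k) * (?f (int \<beta> + int k) * ?f (int k + 1)) =
    q\<^sup>2 * (?f (int k - int N) * ?f (int (N + r + \<beta>) + int k)) * phi_coeff q N r \<beta> k"
    by (simp only: f)
  moreover have "qnum q (int k - int N) = - qnum q (int N - int k)"
    by (simp add: qnum_def diff_divide_distrib)
  ultimately have "(phi_coeff q N r \<beta> (Suc k) * (qnum q (int k + 1) * qnum q (int \<beta> + int k))) * ((q powi (int \<beta> + int k) * q powi (int k + 1)) * (d * d)) =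
    - (qnum q (int N - int k) * qnum q (int (N + r + \<beta>) + int k)) * phi_coeff q N r \<beta> k * ((q\<^sup>2 * (q powi (int k - int N) * q powi (int (N + r + \<beta>) + int k))) * (d * d))"
    by (simp add: mult_ac)
  also have "q\<^sup>2 * (q powi (int k - int N) * q powi (int (N + r + \<beta>) + int k)) = q powi (int r + 1) * (q powi (int \<beta> + int k) * q powi (int k + 1))"
  proof -
    have "q\<^sup>2 = q powi 2" by simp
    then show ?thesis unfolding power_int_add[OF disjI1[OF q0], symmetric]
      by (simp only: power_int_add[OF disjI1[OF q0], symmetric]) (rule arg_cong[where f = "power_int q"], simp)
  qed
  finally have eq: "(phi_coeff q N r \<beta> (Suc k) * (qnum q (int k + 1) * qnum q (int \<beta> + int k))) * ((q powi (int \<beta> + int k) * q powi (int k + 1)) * (d * d)) =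
    (- (q powi (int r + 1)) * (qnum q (int N - int k) * qnum q (int (N + r + \<beta>) + int k)) * phi_coeff q N r \<beta> k) * ((q powi (int \<beta> + int k) * q powi (int k + 1)) * (d * d))"
    by (simp add: mult_ac)
  have nz: "(q powi (int \<beta> + int k) * q powi (int k + 1)) * (d * d) \<noteq> 0" using d q0 by simp
  show ?thesis using eq unfolding mult_right_cancel[OF nz] of_nat_add .
qed

text \<open>Applied at \<open>k = N\<close>: a nonzero top coefficient allows solving for the top
  block when the products are shown to span.\<close>

lemma phi_coeff_neq_0:
  assumes "\<beta> \<ge> 1" "k \<le> N"
  shows "phi_coeff q N r \<beta> k \<noteq> 0"
  using assms(2)
proof (induction k)
  case (Suc k)
  have "phi_coeff q N r \<beta> k \<noteq> 0" "qnum q (int N - int k) \<noteq> 0" "qnum q (int N + int r + int \<beta> + int k) \<noteq> 0"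
    using Suc assms(1) by (auto intro!: qnum_neq_0)
  then have "- (q powi (int r + 1)) * (qnum q (int N - int k) * qnum q (int N + int r + int \<beta> + int k)) * phi_coeff q N r \<beta> k \<noteq> 0"
    using q0 by simp
  then show ?case using phi_coeff_Suc[OF assms(1), of N r k] by force
qed simp

text \<open>\<open>sg\<close> distinguishes the two cases of the definition of \<open>t\<close>.\<close>

definition block :: "bool \<Rightarrow> nat \<Rightarrow> nat \<Rightarrow> 'a \<Rightarrow> 'a" where
  "block sg r k y = (if sg then z n ^ r * (Q (n - 1) ^ k * y) else Q (n - 1) ^ k * (w n ^ r * y))"

text \<open>Forgets the normalisation of \<open>t_poly\<close> except that it is nonzero, and merges
  its two cases. Since \<open>N + r\<close> is the larger of the two differences, the upper
  parameter is \<open>N + r\<close> plus \<open>b + b' + n - 1\<close> in either case.\<close>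

lemma t_poly_mult:
  assumes n: "n \<ge> 2" and ab: "b \<le> a" "b' \<le> a'"
    and sg: "sg \<longleftrightarrow> a - b \<ge> a' - b'"
    and N: "N = min (a - b) (a' - b')" and r: "r = max (a - b) (a' - b') - N"
  shows "\<exists>C. C \<noteq> 0 \<and> (\<forall>y. t_poly q z w n a a' b b' * y =
     C *\<^sub>C (\<Sum>k\<le>N. phi_coeff q N r (b + b' + n - 1) k *\<^sub>C (Q n ^ (N - k) * block sg r k y)))"
proof -
  \<comment> \<open>All exponents of \<open>q\<close> that occur in the factors are negative, and
    \<open>q\<close> is not a root of unity.\<close>
  have nz: "qpoch (q powi e) (q\<^sup>2) j \<noteq> 0" if e: "e + 2 * int j \<le> 0" for e j
    unfolding qpoch_def
  proof
    assume "(\<Prod>i<j. 1 - q powi e * (q\<^sup>2) ^ i) = 0"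
    then obtain i where i: "i < j" "1 - q powi e * (q\<^sup>2) ^ i = 0" by auto
    have "q powi e * (q\<^sup>2) ^ i = q powi (e + 2 * int i)"
      using q0 by (simp add: power_int_add power_int_mult)
    then have "q powi (e + 2 * int i) = q powi 0" using i(2) by simp
    then have "e + 2 * int i = 0" using power_int_inj[OF q0 not_root] by blast
    then show False using i(1) e by simp
  qed
  show ?thesis
  proof (cases "a - b \<ge> a' - b'")
    case True
    have N': "a' - b' = N" and r': "(a - b) - (a' - b') = r" using True N r by auto
    have ba: "a + b' + n - 1 = N + r + (b + b' + n - 1)" using True N r ab n by auto
    have zQ: "z n ^ r * Q n ^ j = Q n ^ j * z n ^ r" for j
      using q_commute_power_left[OF q_commute_power_right[OF Q_z_ge[of n n], of r], of j] n by (simp add: q_commute_def scaleC_one)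
    define C where "C = q powi (- 2 * int (a - b) * int (a' - b'))
         * qpoch (q powi (- 2 * int a' - 2 * int b - 2 * int n + 4)) (q\<^sup>2) (a' - b')
         / qpoch (q powi (- 2 * int a - 2 * int a' - 2 * int n + 4)) (q\<^sup>2) (a' - b')"
    have "qpoch (q powi (- 2 * int a' - 2 * int b - 2 * int n + 4)) (q\<^sup>2) (a' - b') \<noteq> 0"
      "qpoch (q powi (- 2 * int a - 2 * int a' - 2 * int n + 4)) (q\<^sup>2) (a' - b') \<noteq> 0"
      by (rule nz, use ab n in simp)+
    then have "C \<noteq> 0" unfolding C_def using q0 by simp
    moreover have "t_poly q z w n a a' b b' * y =
       C *\<^sub>C (\<Sum>k\<le>N. phi_coeff q N r (b + b' + n - 1) k *\<^sub>C (Q n ^ (N - k) * block sg r k y))" for y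
    proof -
      have "t_poly q z w n a a' b b' = C *\<^sub>C (z n ^ r * Qphi q z w n N (q ^ (2 * (N + r + (b + b' + n - 1)))) (q ^ (2 * (b + b' + n - 1))))"
        unfolding t_poly_def C_def using True by (simp only: if_True r') (simp only: N' ba)
      then show ?thesis
        unfolding Qphi_def phi_coeff_def block_def using sg True
        by (simp add: mult_scaleC_left sum_distrib_left sum_distrib_right mult_scaleC_right zQ mult.assoc
            flip: mult.assoc[of "z n ^ r" "Q n ^ _"])
    qed
    ultimately show ?thesis by blast
  next
    case False
    have N': "a - b = N" and r': "(a' - b') - (a - b) = r" using False N r by auto
    have ba: "a' + b + n - 1 = N + r + (b + b' + n - 1)" using False N r ab n by auto
    define C where "C = q powi (- 2 * int (a - b) * int (a' - b'))
         * qpoch (q powi (- 2 * int a - 2 * int b' - 2 * int n + 4)) (q\<^sup>2) (a - b)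
         / qpoch (q powi (- 2 * int a - 2 * int a' - 2 * int n + 4)) (q\<^sup>2) (a - b)"
    have "qpoch (q powi (- 2 * int a - 2 * int b' - 2 * int n + 4)) (q\<^sup>2) (a - b) \<noteq> 0"
      "qpoch (q powi (- 2 * int a - 2 * int a' - 2 * int n + 4)) (q\<^sup>2) (a - b) \<noteq> 0"
      by (rule nz, use ab n in simp)+
    then have "C \<noteq> 0" unfolding C_def using q0 by simp
    moreover have "t_poly q z w n a a' b b' * y =
       C *\<^sub>C (\<Sum>k\<le>N. phi_coeff q N r (b + b' + n - 1) k *\<^sub>C (Q n ^ (N - k) * block sg r k y))" for y
    proof -
      have "t_poly q z w n a a' b b' = C *\<^sub>C (Qphi q z w n N (q ^ (2 * (N + r + (b + b' + n - 1)))) (q ^ (2 * (b + b' + n - 1))) * w n ^ r)"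
        unfolding t_poly_def C_def using False by (simp only: if_False r') (simp only: N' ba)
      then show ?thesis
        unfolding Qphi_def phi_coeff_def block_def using sg False
        by (simp add: mult_scaleC_left sum_distrib_left sum_distrib_right mult_scaleC_right mult.assoc)
    qed
    ultimately show ?thesis by blast
  qed
qed

end

context q_weyl_ops
begin

lemma Lap_Q_power:
  assumes x: "x \<in> hom_polys n z w a b"
  shows "Lap n (Q n ^ i * x) = Q n ^ i * Lap n x +
    (q powi (int n - 1) * (qnum q (int i) * qnum q (int (a + b + n) + int i - 1))) *\<^sub>C (Q n ^ (i - 1) * x)"
proof (induction i)
  case (Suc i)
  have "Q n ^ i \<in> hom_polys n z w i i"
    using hom_polys_power[OF hom_polys_Q[of n n z w], of i] by simp
  from hom_polys_mult[OF this x] have "Q n ^ i * x \<in> hom_polys n z w (i + a) (i + b)" .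
  from Lap_Q[OF this] have "Lap n (Q n ^ Suc i * x) = Q n * Lap n (Q n ^ i * x) +
     (q powi (int n - 1) * qnum q (int (a + b + n) + 2 * int i)) *\<^sub>C (Q n ^ i * x)"
    by (simp add: mult.assoc algebra_simps)
  also have "Q n * Lap n (Q n ^ i * x) = Q n ^ Suc i * Lap n x +
    (q powi (int n - 1) * (qnum q (int i) * qnum q (int (a + b + n) + int i - 1))) *\<^sub>C (Q n ^ i * x)"
    unfolding Suc distrib_left mult_scaleC_right by (cases i) (simp_all add: mult.assoc)
  also have "\<dots> + (q powi (int n - 1) * qnum q (int (a + b + n) + 2 * int i)) *\<^sub>C (Q n ^ i * x) =
    Q n ^ Suc i * Lap n x + (q powi (int n - 1) * (qnum q (int i + 1) * qnum q (int (a + b + n) + int i))) *\<^sub>C (Q n ^ i * x)"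
    unfolding qnum_product by (simp only: distrib_left scaleC_add_left add.assoc)
  finally show ?case by (simp add: algebra_simps)
qed simp

end

locale q_weyl_step = q_weyl_ops +
  fixes m
  assumes n_eq: "n = Suc m"
begin

sublocale m: q_weyl_ops m q z w d db
  by (rule q_weyl_ops_mono) (simp add: n_eq)

lemma block_simps: "block True r k y = z n ^ r * (Q m ^ k * y)" "block False r k y = Q m ^ k * (w n ^ r * y)"
proof -
  have "n - 1 = m" using n_eq by simp
  then show "block True r k y = z n ^ r * (Q m ^ k * y)" "block False r k y = Q m ^ k * (w n ^ r * y)"
    by (simp_all only: block_def if_True if_False)
qed

lemma hom_m: "x \<in> hom_polys m z w a b \<Longrightarrow> x \<in> hom_polys n z w a b"
  using hom_polys_mono[of m n z w] n_eq by auto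

lemma hom_m_sub: "x \<in> hom_polys m z w a b \<Longrightarrow> x \<in> sub_alg m z w"
  using hom_polys_subset_sub_alg by blast

lemma hom_Q_power_m: "Q m ^ k \<in> hom_polys m z w k k"
  using hom_polys_power[OF hom_polys_Q[of m m z w], of k] by simp

lemma hom_Q_power: "Q n ^ k \<in> hom_polys n z w k k"
  using hom_polys_power[OF hom_polys_Q[of n n z w], of k] by simp

lemma hom_z_power: "z n ^ r \<in> hom_polys n z w r 0"
  using hom_polys_power[OF hom_polys_z[of n n z w], of r] n_eq by simp

lemma hom_w_power: "w n ^ r \<in> hom_polys n z w 0 r"
  using hom_polys_power[OF hom_polys_w[of n n w z], of r] n_eq by simp

lemma block_hom:
  assumes "y \<in> hom_polys m z w b b'"
  shows "block sg r k y \<in> hom_polys n z w (b + k + (if sg then r else 0)) (b' + k + (if sg then 0 else r))"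
proof (cases sg)
  case True
  have "z n ^ r * (Q m ^ k * y) \<in> hom_polys n z w (r + (k + b)) (0 + (k + b'))"
    by (intro hom_polys_mult hom_z_power hom_m hom_Q_power_m assms)
  then show ?thesis using True by (simp add: block_simps add_ac)
next
  case False
  have "Q m ^ k * (w n ^ r * y) \<in> hom_polys n z w (k + (0 + b)) (k + (r + b'))"
    by (intro hom_polys_mult hom_w_power hom_m hom_Q_power_m assms)
  then show ?thesis using False by (simp add: block_simps add_ac)
qed

text \<open>Both shapes give the same net factor \<open>q^(-r)\<close>. For \<open>z\<close> it is
  the product of moving \<open>z n ^ r\<close> to the right, of \<open>Lap_mult_last\<close>, and of
  moving back past an element whose total degree has dropped by 2. For \<open>w\<close> the
  reordering scalar does not depend on the power of \<open>Q m\<close> and cancels.\<close>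

lemma Lap_block:
  assumes y: "y \<in> hom_polys m z w b b'" "Lap m y = 0"
  shows "Lap n (block sg r k y) =
    (q powi (int n - 2 - int r) * (qnum q (int k) * qnum q (int (b + b' + m) + int k - 1))) *\<^sub>C block sg r (k - 1) y"
proof -
  define \<kappa> where "\<kappa> = q powi (int m - 1) * (qnum q (int k) * qnum q (int (b + b' + m) + int k - 1))"
  have L: "Lap m (Q m ^ k * y) = \<kappa> *\<^sub>C (Q m ^ (k - 1) * y)"
    using m.Lap_Q_power[OF y(1), of k] y(2) by (simp add: \<kappa>_def)
  have Qy: "Q m ^ j * y \<in> hom_polys m z w (j + b) (j + b')" for j
    by (intro hom_polys_mult hom_Q_power_m y)
  have e: "q powi (int n - 2 - int r) * (qnum q (int k) * qnum q (int (b + b' + m) + int k - 1)) = inverse q ^ r * \<kappa>"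
  proof -
    have "inverse q ^ r * q powi (int m - 1) = q powi (- int r) * q powi (int m - 1)"
      by (simp add: power_int_minus power_inverse)
    also have "\<dots> = q powi (int n - 2 - int r)"
      unfolding power_int_add[OF disjI1[OF q0], symmetric] by (rule arg_cong[where f = "power_int q"]) (simp add: n_eq)
    finally show ?thesis unfolding \<kappa>_def by (simp only: mult.assoc[symmetric])
  qed
  show ?thesis
  proof (cases sg)
    case True
    show ?thesis
    proof (cases "k = 0")
      case k: True
      have "Lap m (Q m ^ k * y) = 0" using y k by simp
      then have "Lap n (z n ^ r * (Q m ^ k * y)) = 0"
        unfolding last_hom_power(1)[OF n_eq Qy]
        by (simp add: clinear_scale[OF clinear_Lap] Lap_mult_last[OF n_eq hom_m_sub[OF Qy]])
      then show ?thesis using True k by (simp add: block_simps)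
    next
      case k: False
      define D where "D = b + b' + 2 * (k - 1)"
      have D: "k + b + (k + b') = D + 2" "k - 1 + b + (k - 1 + b') = D" using k by (auto simp: D_def)
      have "Lap n (z n ^ r * (Q m ^ k * y)) = ((inverse q ^ (D + 2)) ^ r * q ^ r * \<kappa>) *\<^sub>C (Q m ^ (k - 1) * y * z n ^ r)"
        unfolding last_hom_power(1)[OF n_eq Qy] D
        by (simp add: clinear_scale[OF clinear_Lap] Lap_mult_last[OF n_eq hom_m_sub[OF Qy]] L mult_scaleC_left scaleC_scaleC)
      also have "(inverse q ^ (D + 2)) ^ r * q ^ r * \<kappa> = (inverse q ^ r * \<kappa>) * (inverse q ^ D) ^ r"
      proof -
        have "inverse q ^ (D + 2) * q = inverse q * inverse q ^ D" using q0 by (simp add: power2_eq_square)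
        then have "(inverse q ^ (D + 2)) ^ r * q ^ r = inverse q ^ r * (inverse q ^ D) ^ r"
          by (simp only: power_mult_distrib[symmetric])
        then show ?thesis by (simp only: mult_ac)
      qed
      also have "\<dots> *\<^sub>C (Q m ^ (k - 1) * y * z n ^ r) = (inverse q ^ r * \<kappa>) *\<^sub>C (z n ^ r * (Q m ^ (k - 1) * y))"
        unfolding last_hom_power(1)[OF n_eq Qy[of "k - 1"]] D by (simp only: scaleC_scaleC)
      finally show ?thesis unfolding e using True by (simp add: block_simps)
    qed
  next
    case False
    have wy: "Q m ^ j * (w n ^ r * y) = (q ^ (b + b')) ^ r *\<^sub>C ((Q m ^ j * y) * w n ^ r)" for j
      unfolding last_hom_power(2)[OF n_eq y(1)] by (simp add: mult_scaleC_right mult.assoc)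
    have "Lap n (Q m ^ k * (w n ^ r * y)) = (inverse q ^ r * \<kappa>) *\<^sub>C (Q m ^ (k - 1) * (w n ^ r * y))"
      unfolding wy
      by (simp add: clinear_scale[OF clinear_Lap] Lap_mult_last[OF n_eq hom_m_sub[OF Qy]] L mult_scaleC_left scaleC_scaleC mult.commute)
    then show ?thesis unfolding e using False by (simp add: block_simps)
  qed
qed

lemma t_harmonic:
  assumes m: "m \<ge> 1" and ab: "b \<le> a" "b' \<le> a'" and y: "y \<in> hom_polys m z w b b'" "Lap m y = 0"
  shows "Lap n (t_poly q z w n a a' b b' * y) = 0"
proof -
  define sg where "sg \<longleftrightarrow> a - b \<ge> a' - b'"
  define N where "N = min (a - b) (a' - b')"
  define r where "r = max (a - b) (a' - b') - N"
  define \<beta> where "\<beta> = b + b' + n - 1"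
  obtain C where C: "t_poly q z w n a a' b b' * y = C *\<^sub>C (\<Sum>k\<le>N. phi_coeff q N r \<beta> k *\<^sub>C (Q n ^ (N - k) * block sg r k y))"
    using t_poly_mult[OF _ ab sg_def N_def r_def] m n_eq \<beta>_def by auto
  let ?c = "phi_coeff q N r \<beta>" let ?B = "\<lambda>k. block sg r k y"
  define \<gamma> where "\<gamma> k = q powi (int n - 2 - int r) * (qnum q (int k) * qnum q (int (b + b' + m) + int k - 1))" for k
  define \<kappa> where "\<kappa> k = q powi (int n - 1) * (qnum q (int (N - k)) * qnum q (int (b + b' + 2 * k + r + n) + int (N - k) - 1))" for k
  have L: "Lap n (Q n ^ (N - k) * ?B k) = \<gamma> k *\<^sub>C (Q n ^ (N - k) * ?B (k - 1)) + \<kappa> k *\<^sub>C (Q n ^ (N - k - 1) * ?B k)" for k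
  proof -
    have e: "b + k + (if sg then r else 0) + (b' + k + (if sg then 0 else r)) + n = b + b' + 2 * k + r + n" by simp
    show ?thesis
      unfolding Lap_Q_power[OF block_hom[OF y(1)]] e Lap_block[OF y] \<gamma>_def \<kappa>_def by (simp only: mult_scaleC_right)
  qed
  \<comment> \<open>Re-indexing makes both parts of \<open>L\<close> combinations of the same
    elements: what the summand \<open>Suc k\<close> contributes through its block meets what the
    summand \<open>k\<close> contributes through its power of \<open>Q n\<close>.\<close>
  have z1: "(\<Sum>k\<le>N. (?c k * \<gamma> k) *\<^sub>C (Q n ^ (N - k) * ?B (k - 1))) = (\<Sum>k<N. (?c (Suc k) * \<gamma> (Suc k)) *\<^sub>C (Q n ^ (N - k - 1) * ?B k))"
    by (subst sum.atMost_shift) (simp add: \<gamma>_def)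
  have z2: "(\<Sum>k\<le>N. (?c k * \<kappa> k) *\<^sub>C (Q n ^ (N - k - 1) * ?B k)) = (\<Sum>k<N. (?c k * \<kappa> k) *\<^sub>C (Q n ^ (N - k - 1) * ?B k))"
    by (cases N) (auto simp: lessThan_Suc_atMost \<kappa>_def)
  have z3: "?c (Suc k) * \<gamma> (Suc k) + ?c k * \<kappa> k = 0" if "k < N" for k
  proof -
    have e1: "int (Suc k) = int k + 1" "int (b + b' + m) + (int k + 1) - 1 = int \<beta> + int k"
      using m n_eq by (auto simp: \<beta>_def)
    have e2: "int (N - k) = int N - int k" "int (b + b' + 2 * k + r + n) + (int N - int k) - 1 = int N + int r + int \<beta> + int k"
      using that n_eq by (auto simp: \<beta>_def)
    have "\<beta> \<ge> 1" using m n_eq by (simp add: \<beta>_def)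
    note S = phi_coeff_Suc[OF this, of N r k]
    have "?c (Suc k) * \<gamma> (Suc k) = q powi (int n - 2 - int r) * (?c (Suc k) * (qnum q (int k + 1) * qnum q (int \<beta> + int k)))"
      unfolding \<gamma>_def e1 by (simp only: mult_ac)
    also have "\<dots> = - (q powi (int n - 2 - int r) * q powi (int r + 1)) * (qnum q (int N - int k) * qnum q (int N + int r + int \<beta> + int k)) * ?c k"
      unfolding S by (simp add: mult_ac)
    also have "q powi (int n - 2 - int r) * q powi (int r + 1) = q powi (int n - 1)"
      unfolding power_int_add[OF disjI1[OF q0], symmetric] by (rule arg_cong[where f = "power_int q"]) simp
    finally show ?thesis unfolding \<kappa>_def e2 by (simp add: mult_ac)
  qed
  have "Lap n (\<Sum>k\<le>N. ?c k *\<^sub>C (Q n ^ (N - k) * ?B k)) =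
    (\<Sum>k\<le>N. (?c k * \<gamma> k) *\<^sub>C (Q n ^ (N - k) * ?B (k - 1))) + (\<Sum>k\<le>N. (?c k * \<kappa> k) *\<^sub>C (Q n ^ (N - k - 1) * ?B k))"
    by (simp only: clinear_sum[OF clinear_Lap[OF order_refl]] clinear_scale[OF clinear_Lap[OF order_refl]] L scaleC_add_right scaleC_scaleC sum.distrib)
  also have "\<dots> = (\<Sum>k<N. (?c (Suc k) * \<gamma> (Suc k) + ?c k * \<kappa> k) *\<^sub>C (Q n ^ (N - k - 1) * ?B k))"
    unfolding z1 z2 by (simp only: scaleC_add_left sum.distrib)
  also have "\<dots> = 0" using z3 by (intro sum.neutral) auto
  finally show ?thesis unfolding C clinear_scale[OF clinear_Lap[OF order_refl]] by simp
qed

text \<open>Strictness in both exponents at once suits \<open>Q n\<close>, which raises them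
  together up to terms of this kind.\<close>

definition lower :: "nat \<Rightarrow> nat \<Rightarrow> 'a set" where
  "lower K L = complex_vector.span {c * z n ^ k * w n ^ l | c k l. c \<in> sub_alg m z w \<and> k < K \<and> l < L}"

lemma lower_base: "c \<in> sub_alg m z w \<Longrightarrow> k < K \<Longrightarrow> l < L \<Longrightarrow> c * z n ^ k * w n ^ l \<in> lower K L"
  unfolding lower_def by (rule complex_vector.span_base) blast

lemma lower_mono: "K \<le> K' \<Longrightarrow> L \<le> L' \<Longrightarrow> lower K L \<subseteq> lower K' L'"
  unfolding lower_def by (rule complex_vector.span_mono) (blast intro: less_le_trans)

lemma lower_closed:
  "x \<in> lower K L \<Longrightarrow> y \<in> lower K L \<Longrightarrow> x + y \<in> lower K L"
  "x \<in> lower K L \<Longrightarrow> c *\<^sub>C x \<in> lower K L" "0 \<in> lower K L"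
  unfolding lower_def by (auto intro: complex_vector.span_add complex_vector.span_scale complex_vector.span_zero)

lemma sub_alg_scale: "x \<in> sub_alg p z w \<Longrightarrow> c *\<^sub>C x \<in> sub_alg p z w"
  unfolding sub_alg_def by (rule complex_vector.span_scale)

lemma sub_alg_n: "x \<in> sub_alg m z w \<Longrightarrow> x \<in> sub_alg n z w"
  using sub_alg_mono[of m n z w] n_eq by auto

text \<open>The central \<open>Q n\<close> is moved between the powers of \<open>z n\<close> and
  \<open>w n\<close>. There its part \<open>z n * w n\<close> raises both exponents, and its part
  \<open>Q m\<close> is absorbed into the coefficient.\<close>

lemma Q_mult_monomial:
  assumes "c \<in> sub_alg m z w"
  shows "Q n * (c * z n ^ k * w n ^ l) =
    c * z n ^ Suc k * w n ^ Suc l + ((inverse q ^ 2) ^ k *\<^sub>C (c * Q m)) * z n ^ k * w n ^ l"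
proof -
  have zk: "z n ^ k \<in> sub_alg n z w" using hom_z_power hom_polys_subset_sub_alg by blast
  have Qn: "Q n = Q m + z n * w n" using z_mult_w[of n] n_eq by simp
  have "Q n * (c * z n ^ k * w n ^ l) = c * (z n ^ k * Q n) * w n ^ l"
    using Q_comm[OF sub_alg_n[OF assms]] Q_comm[OF zk] by (simp add: mult.assoc flip: mult.assoc[of "Q n"])
  also have "z n ^ k * Q n = (inverse q ^ 2) ^ k *\<^sub>C (Q m * z n ^ k) + z n ^ Suc k * w n"
    unfolding Qn distrib_left z_Q_last[OF n_eq] by (simp add: mult.assoc power_Suc2 del: power_Suc)
  finally show ?thesis
    by (simp add: distrib_left distrib_right mult_scaleC_left mult_scaleC_right mult.assoc power_commutes)
qed

lemma Q_mult_lower: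
  assumes "x \<in> lower K L"
  shows "Q n * x \<in> lower (Suc K) (Suc L)"
  unfolding lower_def
proof (rule span_mult_left[OF _ assms[unfolded lower_def]])
  fix y assume "y \<in> {c * z n ^ k * w n ^ l | c k l. c \<in> sub_alg m z w \<and> k < K \<and> l < L}"
  then obtain c k l where y: "y = c * z n ^ k * w n ^ l" "c \<in> sub_alg m z w" "k < K" "l < L" by auto
  have "c * Q m \<in> sub_alg m z w"
    using y(2) hom_m_sub[OF hom_polys_Q[of m m z w]] by (intro sub_alg_mult) auto
  then show "Q n * y \<in> complex_vector.span {c * z n ^ k * w n ^ l | c k l. c \<in> sub_alg m z w \<and> k < Suc K \<and> l < Suc L}"
    unfolding y(1) Q_mult_monomial[OF y(2)] lower_def[symmetric]
    using y by (intro lower_closed lower_base sub_alg_scale) auto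
qed

lemma Q_power_monomial:
  assumes "c \<in> sub_alg m z w"
  shows "Q n ^ i * (c * z n ^ k * w n ^ l) - c * z n ^ (k + i) * w n ^ (l + i) \<in> lower (k + i) (l + i)"
proof (induction i)
  case (Suc i)
  let ?x = "c * z n ^ (k + i) * w n ^ (l + i)"
  have "c * Q m \<in> sub_alg m z w"
    using assms hom_m_sub[OF hom_polys_Q[of m m z w]] by (intro sub_alg_mult) auto
  then have "Q n * ?x - c * z n ^ (k + Suc i) * w n ^ (l + Suc i) \<in> lower (k + Suc i) (l + Suc i)"
    unfolding Q_mult_monomial[OF assms] by (simp add: lower_base sub_alg_scale)
  moreover have "Q n * (Q n ^ i * (c * z n ^ k * w n ^ l) - ?x) \<in> lower (k + Suc i) (l + Suc i)"
    using Q_mult_lower[OF Suc] by simp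
  ultimately have "Q n * (Q n ^ i * (c * z n ^ k * w n ^ l) - ?x) + (Q n * ?x - c * z n ^ (k + Suc i) * w n ^ (l + Suc i)) \<in> lower (k + Suc i) (l + Suc i)"
    by (intro lower_closed)
  then show ?case by (simp add: right_diff_distrib mult.assoc)
qed (simp add: lower_closed)

lemma block_monomial:
  assumes y: "y \<in> hom_polys m z w b b'"
  shows "block sg r k y = ((if sg then (inverse q ^ (k + b + (k + b'))) ^ r else (q ^ (b + b')) ^ r) *\<^sub>C (Q m ^ k * y))
     * z n ^ (if sg then r else 0) * w n ^ (if sg then 0 else r)"
proof (cases sg)
  case True
  have "Q m ^ k * y \<in> hom_polys m z w (k + b) (k + b')" by (intro hom_polys_mult hom_Q_power_m y)
  from last_hom_power(1)[OF n_eq this] True show ?thesis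
    by (simp add: block_simps mult_scaleC_left)
next
  case False
  then show ?thesis using last_hom_power(2)[OF n_eq y]
    by (simp add: block_simps mult_scaleC_left mult_scaleC_right mult.assoc)
qed

text \<open>Only the summand \<open>k = 0\<close> reaches the full exponents, since every
  \<open>Q m\<close> in a block costs one of each. The scalar \<open>u\<close> is the same for all
  \<open>y\<close> of the bidegree, so leading terms of linear combinations can be compared.\<close>

lemma t_leading:
  assumes m: "m \<ge> 1" and ab: "b \<le> a" "b' \<le> a'"
  shows "\<exists>u. u \<noteq> 0 \<and> (\<forall>y\<in>hom_polys m z w b b'.
    t_poly q z w n a a' b b' * y - u *\<^sub>C (y * z n ^ (a - b) * w n ^ (a' - b')) \<in> lower (a - b) (a' - b'))"
proof -
  define sg where "sg \<longleftrightarrow> a - b \<ge> a' - b'"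
  define N where "N = min (a - b) (a' - b')"
  define r where "r = max (a - b) (a' - b') - N"
  define \<beta> where "\<beta> = b + b' + n - 1"
  obtain C where C: "C \<noteq> 0" "\<And>y. t_poly q z w n a a' b b' * y = C *\<^sub>C (\<Sum>k\<le>N. phi_coeff q N r \<beta> k *\<^sub>C (Q n ^ (N - k) * block sg r k y))"
    using t_poly_mult[OF _ ab sg_def N_def r_def] m n_eq \<beta>_def by auto
  define k0 l0 where "k0 = (if sg then r else 0)" and "l0 = (if sg then 0 else r)"
  have KL: "k0 + N = a - b" "l0 + N = a' - b'"
    by (auto simp: k0_def l0_def sg_def N_def r_def)
  define v where "v k = (if sg then (inverse q ^ (k + b + (k + b'))) ^ r else (q ^ (b + b')) ^ r)" for k
  have v0: "v 0 \<noteq> 0" using q0 by (simp add: v_def)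
  have "t_poly q z w n a a' b b' * y - (C * v 0) *\<^sub>C (y * z n ^ (a - b) * w n ^ (a' - b')) \<in> lower (a - b) (a' - b')"
    if y: "y \<in> hom_polys m z w b b'" for y
  proof -
    have c: "v k *\<^sub>C (Q m ^ k * y) \<in> sub_alg m z w" for k
      by (intro sub_alg_scale sub_alg_mult hom_m_sub[OF hom_Q_power_m] hom_m_sub[OF y])
    have lo: "Q n ^ (N - k) * block sg r k y - (if k = 0 then v 0 *\<^sub>C y * z n ^ (a - b) * w n ^ (a' - b') else 0) \<in> lower (a - b) (a' - b')"
      if k: "k \<le> N" for k
    proof -
      let ?M = "(v k *\<^sub>C (Q m ^ k * y)) * z n ^ (k0 + (N - k)) * w n ^ (l0 + (N - k))"
      have 1: "Q n ^ (N - k) * block sg r k y - ?M \<in> lower (k0 + (N - k)) (l0 + (N - k))"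
        using Q_power_monomial[OF c, of "N - k" k k0 l0]
        unfolding block_monomial[OF y] v_def[symmetric] k0_def[symmetric] l0_def[symmetric] .
      have 2: "lower (k0 + (N - k)) (l0 + (N - k)) \<subseteq> lower (a - b) (a' - b')"
        by (rule lower_mono) (use KL in auto)
      show ?thesis
      proof (cases "k = 0")
        case True
        then show ?thesis using 1 2 KL by auto
      next
        case False
        then have "?M \<in> lower (a - b) (a' - b')" using c k KL by (intro lower_base) auto
        then have "(Q n ^ (N - k) * block sg r k y - ?M) + ?M \<in> lower (a - b) (a' - b')"
          using 1 2 by (intro lower_closed) auto
        then show ?thesis using False by simp
      qed
    qed
    have "C *\<^sub>C (\<Sum>k\<le>N. phi_coeff q N r \<beta> k *\<^sub>C (Q n ^ (N - k) * block sg r k y -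
       (if k = 0 then v 0 *\<^sub>C y * z n ^ (a - b) * w n ^ (a' - b') else 0))) \<in> lower (a - b) (a' - b')"
      unfolding lower_def
      by (intro complex_vector.span_scale complex_vector.span_sum lo[unfolded lower_def]) simp
    also have "C *\<^sub>C (\<Sum>k\<le>N. phi_coeff q N r \<beta> k *\<^sub>C (Q n ^ (N - k) * block sg r k y -
       (if k = 0 then v 0 *\<^sub>C y * z n ^ (a - b) * w n ^ (a' - b') else 0))) =
       t_poly q z w n a a' b b' * y - C *\<^sub>C (\<Sum>k\<le>N. phi_coeff q N r \<beta> k *\<^sub>C (if k = 0 then v 0 *\<^sub>C y * z n ^ (a - b) * w n ^ (a' - b') else 0))"
      by (simp only: C(2) scaleC_diff_right sum_subtractf)
    also have "(\<Sum>k\<le>N. phi_coeff q N r \<beta> k *\<^sub>C (if k = 0 then v 0 *\<^sub>C y * z n ^ (a - b) * w n ^ (a' - b') else 0))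
      = v 0 *\<^sub>C (y * z n ^ (a - b) * w n ^ (a' - b'))"
      by (simp add: if_distrib[of "\<lambda>x. _ *\<^sub>C x"] sum.delta scaleC_one mult_scaleC_left cong: if_cong)
    finally show ?thesis by (simp only: scaleC_scaleC)
  qed
  then show ?thesis using C(1) v0 by (intro exI[of _ "C * v 0"]) auto
qed

end

lemma clinear_if: "clinear f \<Longrightarrow> clinear g \<Longrightarrow> clinear (\<lambda>x. if b then f x else g x)"
  by (cases b) simp_all

text \<open>Freeness of the ordered monomials, kept apart from the relations. The other order is
  expressed by exchanging the arguments, as \<open>zw_free n w z\<close>.\<close>

definition zw_free :: "nat \<Rightarrow> (nat \<Rightarrow> 'a::complex_algebra_1) \<Rightarrow> (nat \<Rightarrow> 'a) \<Rightarrow> bool" where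
  "zw_free n z w \<longleftrightarrow> family_independent (\<lambda>(r, s). mono_up n z r * mono_up n w s) (exponents n \<times> exponents n)"

lemma zw_free_mono:
  assumes "p \<le> n" "zw_free n z w"
  shows "zw_free p z w"
  unfolding zw_free_def family_independent_def
proof (intro allI impI)
  fix S a assume S: "finite S \<and> S \<subseteq> exponents p \<times> exponents p \<and>
    (\<Sum>x\<in>S. a x *\<^sub>C (case x of (r, s) \<Rightarrow> mono_up p z r * mono_up p w s)) = 0"
  have eq: "(\<Sum>x\<in>S. a x *\<^sub>C (case x of (r, s) \<Rightarrow> mono_up n z r * mono_up n w s)) =
    (\<Sum>x\<in>S. a x *\<^sub>C (case x of (r, s) \<Rightarrow> mono_up p z r * mono_up p w s))"
  proof (rule sum.cong[OF refl])
    fix x assume "x \<in> S"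
    then obtain r s where "x = (r, s)" "r \<in> exponents p" "s \<in> exponents p" using S by blast
    then show "a x *\<^sub>C (case x of (r, s) \<Rightarrow> mono_up n z r * mono_up n w s) =
      a x *\<^sub>C (case x of (r, s) \<Rightarrow> mono_up p z r * mono_up p w s)"
      by (simp add: mono_up_exponents[OF assms(1)])
  qed
  have "S \<subseteq> exponents n \<times> exponents n" using S exponents_mono[OF assms(1)] by blast
  then show "\<forall>x\<in>S. a x = 0"
    using family_independentD[OF assms(2)[unfolded zw_free_def], of S a] S eq by auto
qed

context q_weyl_step
begin

text \<open>Extracts the coefficient of \<open>z n ^ K * w n ^ L\<close>, with values in the algebra
  of the first \<open>m\<close> pairs. It is prescribed on ordered monomials, where \<open>E\<close>
  undoes the moving of \<open>z n ^ k\<close> past the lower \<open>w\<close>-monomial.\<close>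

lemma coefficient_operator:
  assumes "zw_free n z w"
  shows "\<exists>P. clinear P \<and> (\<forall>c\<in>sub_alg m z w. \<forall>k l. P (c * z n ^ k * w n ^ l) = (if k = K \<and> l = L then c else 0))"
proof -
  define E where "E k s = (inverse q ^ k) powi (\<Sum>j\<in>{1..m}. int (s j))" for k and s :: "nat \<Rightarrow> nat"
  have E: "E k s \<noteq> 0" for k s using q0 by (simp add: E_def)
  define F where "F = (\<lambda>(r, s). if r n = K \<and> s n = L then E K s *\<^sub>C (mono_up m z r * mono_up m w s) else 0)"
  obtain P where P: "clinear P" "\<And>x. x \<in> exponents n \<times> exponents n \<Longrightarrow> P (case x of (r, s) \<Rightarrow> mono_up n z r * mono_up n w s) = F x"
    using ex_clinear_on_family[OF assms[unfolded zw_free_def], of F] by blast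
  have main: "P (mono_up m z r * mono_up m w s * z n ^ k * w n ^ l) =
     (if k = K \<and> l = L then mono_up m z r * mono_up m w s else 0)" for r s k l
  proof -
    have "q_commute (inverse q) (z n) (w j)" if "j \<in> {1..m}" for j
      using q_commute_sym[OF wz[of n j]] that n_eq q0 by simp
    then have "q_commute (E k s) (z n ^ k) (mono_up m w s)"
      unfolding E_def using q0 by (intro q_commute_mono_up q_commute_power_left) auto
    from q_commute_sym[OF this E] have comm: "mono_up m w s * z n ^ k = inverse (E k s) *\<^sub>C (z n ^ k * mono_up m w s)"
      by (simp add: q_commute_def)
    let ?r = "(cut m r)(n := k)" and ?s = "(cut m s)(n := l)"
    have "mono_up m z r * mono_up m w s * z n ^ k * w n ^ l = mono_up m z r * (mono_up m w s * z n ^ k) * w n ^ l"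
      by (simp only: mult.assoc)
    also have "\<dots> = inverse (E k s) *\<^sub>C (mono_up n z ?r * mono_up n w ?s)"
      unfolding n_eq mono_up_Suc_upd(2) mono_up_cut comm[unfolded n_eq]
      by (simp only: mult.assoc mult_scaleC_right mult_scaleC_left)
    finally have eq: "mono_up m z r * mono_up m w s * z n ^ k * w n ^ l = inverse (E k s) *\<^sub>C (mono_up n z ?r * mono_up n w ?s)" .
    have ex: "(cut m r)(n := k) \<in> exponents n" for r k
      using n_eq by (auto simp: exponents_def cut_def)
    have mn: "m < n" using n_eq by simp
    have "E k ?s = E k s" for k
      unfolding E_def by (rule arg_cong[where f = "power_int _"], rule sum.cong) (auto simp: cut_def n_eq)
    then have "F (?r, ?s) = (if k = K \<and> l = L then E k s *\<^sub>C (mono_up m z r * mono_up m w s) else 0)"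
      by (simp only: F_def split_conv mono_up_upd[OF mn] mono_up_cut fun_upd_same) auto
    then have "P (mono_up n z ?r * mono_up n w ?s) = (if k = K \<and> l = L then E k s *\<^sub>C (mono_up m z r * mono_up m w s) else 0)"
      using P(2)[of "(?r, ?s)"] ex by simp
    then show ?thesis unfolding eq clinear_scale[OF P(1)] using E by (simp add: scaleC_mult_simps)
  qed
  have "P (c * z n ^ k * w n ^ l) = (if k = K \<and> l = L then c else 0)" if c: "c \<in> sub_alg m z w" for c k l
  proof (rule clinear_eq_on_span[of "\<lambda>c. P (c * z n ^ k * w n ^ l)" "\<lambda>c. if k = K \<and> l = L then c else 0"])
    show "c \<in> complex_vector.span (\<Union>a b. zw_monos m z w a b)" using c m.sub_alg_eq_zw by simp
    show "clinear (\<lambda>c. P (c * z n ^ k * w n ^ l))"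
      by (rule clinear_comp[OF P(1) clinear_mult_right[OF clinear_mult_right[OF clinear_id]]])
    show "clinear (\<lambda>c. if k = K \<and> l = L then c else (0::'a))"
      by (intro clinear_if clinear_id clinear_zero)
    fix y assume "y \<in> (\<Union>a b. zw_monos m z w a b)"
    then show "P (y * z n ^ k * w n ^ l) = (if k = K \<and> l = L then y else 0)"
      unfolding zw_monos_def using main by blast
  qed
  then show ?thesis using P(1) by blast
qed

end

text \<open>The third clause spans all homogeneous elements, not only the harmonic ones, because
  this is what passes from \<open>m\<close> to \<open>n\<close>. The kernel is identified afterwards
  in \<open>harmonic_family_kernel\<close>.\<close>

definition (in q_weyl_ops) harmonic_family :: "(nat \<Rightarrow> nat \<Rightarrow> 'i set) \<Rightarrow> ('i \<Rightarrow> 'a) \<Rightarrow> bool" where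
  "harmonic_family I \<xi> \<longleftrightarrow>
     (\<forall>b b'. \<forall>i\<in>I b b'. \<xi> i \<in> hom_polys n z w b b' \<and> Lap n (\<xi> i) = 0) \<and>
     (\<forall>b b'. family_independent \<xi> (I b b')) \<and>
     (\<forall>a a'. hom_polys n z w a a' \<subseteq>
        complex_vector.span {Q n ^ k * \<xi> i | k i. k \<le> a \<and> k \<le> a' \<and> i \<in> I (a - k) (a' - k)})"

section \<open>Adjoining one pair of variables to a harmonic family\<close>

context q_weyl_step
begin

context
  fixes I :: "nat \<Rightarrow> nat \<Rightarrow> 'i set" and \<xi> :: "'i \<Rightarrow> 'a"
    and J :: "nat \<Rightarrow> nat \<Rightarrow> 'j set" and \<xi>' :: "'j \<Rightarrow> 'a" and f f' :: "'j \<Rightarrow> nat" and g :: "'j \<Rightarrow> 'i"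
  assumes m1: "m \<ge> 1" and free: "zw_free n z w"
    and harm: "m.harmonic_family I \<xi>"
    and J: "\<And>a a' j. j \<in> J a a' \<Longrightarrow> f j \<le> a \<and> f' j \<le> a' \<and> g j \<in> I (f j) (f' j)"
    and J_inj: "\<And>a a'. inj_on (\<lambda>j. (f j, f' j, g j)) (J a a')"
    and J_surj: "\<And>a a' b b' i. b \<le> a \<Longrightarrow> b' \<le> a' \<Longrightarrow> i \<in> I b b' \<Longrightarrow> \<exists>j\<in>J a a'. f j = b \<and> f' j = b' \<and> g j = i"
    and \<xi>': "\<And>a a' j. j \<in> J a a' \<Longrightarrow> \<xi>' j = t_poly q z w n a a' (f j) (f' j) * \<xi> (g j)"
begin

lemma \<xi>_hom: "i \<in> I b b' \<Longrightarrow> \<xi> i \<in> hom_polys m z w b b'"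
  and \<xi>_Lap: "i \<in> I b b' \<Longrightarrow> Lap m (\<xi> i) = 0"
  and \<xi>_indep: "family_independent \<xi> (I b b')"
  and \<xi>_span: "hom_polys m z w a a' \<subseteq> complex_vector.span {Q m ^ k * \<xi> i | k i. k \<le> a \<and> k \<le> a' \<and> i \<in> I (a - k) (a' - k)}"
  using harm unfolding m.harmonic_family_def by blast+

lemma t_hom:
  assumes "b \<le> a" "b' \<le> a'" "y \<in> hom_polys m z w b b'"
  shows "t_poly q z w n a a' b b' * y \<in> hom_polys n z w a a'"
proof -
  define sg where "sg \<longleftrightarrow> a - b \<ge> a' - b'"
  define N where "N = min (a - b) (a' - b')"
  define r where "r = max (a - b) (a' - b') - N"
  obtain C where C: "t_poly q z w n a a' b b' * y =
     C *\<^sub>C (\<Sum>k\<le>N. phi_coeff q N r (b + b' + n - 1) k *\<^sub>C (Q n ^ (N - k) * block sg r k y))"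
    using t_poly_mult[OF _ assms(1,2) sg_def N_def r_def] m1 n_eq by auto
  have "Q n ^ (N - k) * block sg r k y \<in> hom_polys n z w a a'" if "k \<le> N" for k
  proof -
    have "N - k + (b + k + (if sg then r else 0)) = a" "N - k + (b' + k + (if sg then 0 else r)) = a'"
      using that assms(1,2) by (auto simp: sg_def N_def r_def)
    then show ?thesis using hom_polys_mult[OF hom_Q_power[of "N - k"] block_hom[OF assms(3), of sg r k]] by simp
  qed
  then show ?thesis unfolding C by (intro hom_polys_scale hom_polys_sum) auto
qed

lemma \<xi>'_hom: "j \<in> J a a' \<Longrightarrow> \<xi>' j \<in> hom_polys n z w a a'"
  using J[of j a a'] \<xi>'[of j a a'] t_hom[of "f j" a "f' j" a'] \<xi>_hom[of "g j"] by simp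

lemma \<xi>'_Lap: "j \<in> J a a' \<Longrightarrow> Lap n (\<xi>' j) = 0"
proof -
  assume j: "j \<in> J a a'"
  then have *: "f j \<le> a" "f' j \<le> a'" "g j \<in> I (f j) (f' j)" using J by blast+
  show ?thesis unfolding \<xi>'[OF j] by (rule t_harmonic[OF m1 *(1,2) \<xi>_hom[OF *(3)] \<xi>_Lap[OF *(3)]])
qed

lemma operator_lower:
  assumes P: "clinear P" "\<And>c k l. c \<in> sub_alg m z w \<Longrightarrow> P (c * z n ^ k * w n ^ l) = (if k = K \<and> l = L then c else 0)"
    and x: "x \<in> lower K' L'" and KL: "\<not> (K < K' \<and> L < L')"
  shows "P x = 0"
proof (rule clinear_eq_on_span[OF P(1) clinear_zero _ x[unfolded lower_def]])
  fix y assume "y \<in> {c * z n ^ k * w n ^ l | c k l. c \<in> sub_alg m z w \<and> k < K' \<and> l < L'}"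
  then obtain c k l where "y = c * z n ^ k * w n ^ l" "c \<in> sub_alg m z w" "k < K'" "l < L'" by auto
  then show "P y = 0" using P(2) KL by auto
qed

text \<open>Among the indices with nonzero coefficient one is chosen with minimal
  \<open>f j + f' j\<close>. No other index has both leading exponents strictly larger, so the
  coefficient operator at these exponents sees only indices with the same lower bidegree and returns
  a relation between the \<open>\<xi> i\<close>.\<close>

lemma \<xi>'_indep: "family_independent \<xi>' (J a a')"
  unfolding family_independent_def
proof (intro allI impI, rule ccontr)
  fix S c assume S: "finite S \<and> S \<subseteq> J a a' \<and> (\<Sum>j\<in>S. c j *\<^sub>C \<xi>' j) = 0"
  define T where "T = {j\<in>S. c j \<noteq> 0}"
  assume "\<not> (\<forall>j\<in>S. c j = 0)"
  then have "T \<noteq> {}" "finite T" using S by (auto simp: T_def)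
  then obtain j0 where j0: "j0 \<in> T" and min: "\<And>j. j \<in> T \<Longrightarrow> f j0 + f' j0 \<le> f j + f' j"
    using arg_min_if_finite[of T "\<lambda>j. f j + f' j"] by (metis not_le)
  have TJ: "j \<in> J a a'" if "j \<in> T" for j using that S by (auto simp: T_def)
  define b b' where "b = f j0" and "b' = f' j0"
  have b: "b \<le> a" "b' \<le> a'" using J[OF TJ[OF j0]] by (auto simp: b_def b'_def)
  obtain P where P: "clinear P" "\<And>c k l. c \<in> sub_alg m z w \<Longrightarrow>
     P (c * z n ^ k * w n ^ l) = (if k = a - b \<and> l = a' - b' then c else 0)"
    using coefficient_operator[OF free, of "a - b" "a' - b'"] by blast
  obtain u where u: "u \<noteq> 0" "\<And>y. y \<in> hom_polys m z w b b' \<Longrightarrow>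
      t_poly q z w n a a' b b' * y - u *\<^sub>C (y * z n ^ (a - b) * w n ^ (a' - b')) \<in> lower (a - b) (a' - b')"
    using t_leading[OF m1 b] by blast
  have Pj: "P (\<xi>' j) = (if f j = b \<and> f' j = b' then u *\<^sub>C \<xi> (g j) else 0)" if j: "j \<in> T" for j
  proof -
    note Jj = J[OF TJ[OF j]]
    have y: "\<xi> (g j) \<in> hom_polys m z w (f j) (f' j)" using \<xi>_hom Jj by blast
    obtain v where v: "v = u \<or> \<not> (f j = b \<and> f' j = b')"
       "\<xi>' j - v *\<^sub>C (\<xi> (g j) * z n ^ (a - f j) * w n ^ (a' - f' j)) \<in> lower (a - f j) (a' - f' j)"
      using u(2)[of "\<xi> (g j)"] y t_leading[OF m1, of "f j" a "f' j" a'] Jj \<xi>'[OF TJ[OF j]]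
      by (cases "f j = b \<and> f' j = b'") auto
    have "\<not> (a - b < a - f j \<and> a' - b' < a' - f' j)"
      using min[OF j] by (auto simp: b_def b'_def)
    from operator_lower[OF P v(2) this] have "P (\<xi>' j) = v *\<^sub>C P (\<xi> (g j) * z n ^ (a - f j) * w n ^ (a' - f' j))"
      using clinear_add[OF P(1), of "\<xi>' j - v *\<^sub>C (\<xi> (g j) * z n ^ (a - f j) * w n ^ (a' - f' j))"
          "v *\<^sub>C (\<xi> (g j) * z n ^ (a - f j) * w n ^ (a' - f' j))"] by (simp add: clinear_scale[OF P(1)])
    also have "\<dots> = (if f j = b \<and> f' j = b' then u *\<^sub>C \<xi> (g j) else 0)"
      using v(1) Jj b by (auto simp: P(2)[OF hom_m_sub[OF y]])
    finally show ?thesis .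
  qed
  define T0 where "T0 = {j\<in>T. f j = b \<and> f' j = b'}"
  have "(\<Sum>j\<in>S. c j *\<^sub>C \<xi>' j) = (\<Sum>j\<in>T. c j *\<^sub>C \<xi>' j)"
    by (rule sum.mono_neutral_right) (use S in \<open>auto simp: T_def\<close>)
  then have "P (\<Sum>j\<in>T. c j *\<^sub>C \<xi>' j) = 0" using S clinear_0[OF P(1)] by simp
  then have "(\<Sum>j\<in>T. c j *\<^sub>C (if f j = b \<and> f' j = b' then u *\<^sub>C \<xi> (g j) else 0)) = 0"
    by (simp add: clinear_sum[OF P(1)] clinear_scale[OF P(1)] Pj cong: sum.cong)
  moreover have "(\<Sum>j\<in>T. c j *\<^sub>C (if f j = b \<and> f' j = b' then u *\<^sub>C \<xi> (g j) else 0)) = (\<Sum>j\<in>T0. (c j * u) *\<^sub>C \<xi> (g j))"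
    by (rule sum.mono_neutral_cong_right) (use \<open>finite T\<close> in \<open>auto simp: T0_def scaleC_scaleC\<close>)
  ultimately have rel: "(\<Sum>j\<in>T0. (c j * u) *\<^sub>C \<xi> (g j)) = 0" by simp
  have T0J: "T0 \<subseteq> J a a'" using TJ by (auto simp: T0_def)
  have ginj: "inj_on g T0"
  proof (rule inj_onI)
    fix x y assume xy: "x \<in> T0" "y \<in> T0" "g x = g y"
    then show "x = y" using T0J by (intro inj_onD[OF J_inj[of a a']]) (auto simp: T0_def)
  qed
  have "(\<Sum>i\<in>g ` T0. (c (the_inv_into T0 g i) * u) *\<^sub>C \<xi> i) = (\<Sum>j\<in>T0. (c j * u) *\<^sub>C \<xi> (g j))"
    by (subst sum.reindex[OF ginj]) (rule sum.cong, auto simp: the_inv_into_f_f[OF ginj])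
  then have rel': "(\<Sum>i\<in>g ` T0. (c (the_inv_into T0 g i) * u) *\<^sub>C \<xi> i) = 0" using rel by simp
  have j0T: "j0 \<in> T0" using j0 by (simp add: T0_def b_def b'_def)
  have fin: "finite (g ` T0)" using \<open>finite T\<close> by (simp add: T0_def)
  have sub: "g ` T0 \<subseteq> I b b'" using J T0J by (fastforce simp: T0_def)
  from family_independentD[OF \<xi>_indep fin sub rel', of "g j0"] have "c j0 * u = 0"
    using j0T by (simp add: the_inv_into_f_f[OF ginj])
  then show False using u(1) j0 by (simp add: T_def)
qed

definition gen_set :: "nat \<Rightarrow> nat \<Rightarrow> 'a set" where
  "gen_set a a' = complex_vector.span {Q n ^ k * \<xi>' j | k j. k \<le> a \<and> k \<le> a' \<and> j \<in> J (a - k) (a' - k)}"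

lemma gen_set_Q: "x \<in> gen_set a a' \<Longrightarrow> Q n * x \<in> gen_set (Suc a) (Suc a')"
proof -
  assume x: "x \<in> gen_set a a'"
  show ?thesis unfolding gen_set_def
  proof (rule span_mult_left[OF _ x[unfolded gen_set_def]])
    fix y assume "y \<in> {Q n ^ k * \<xi>' j | k j. k \<le> a \<and> k \<le> a' \<and> j \<in> J (a - k) (a' - k)}"
    then obtain k j where "y = Q n ^ k * \<xi>' j" "k \<le> a" "k \<le> a'" "j \<in> J (a - k) (a' - k)" by auto
    then have "Q n * y = Q n ^ Suc k * \<xi>' j" "Suc k \<le> Suc a" "Suc k \<le> Suc a'" "j \<in> J (Suc a - Suc k) (Suc a' - Suc k)"
      by (auto simp: mult.assoc)
    then show "Q n * y \<in> complex_vector.span {Q n ^ k * \<xi>' j | k j. k \<le> Suc a \<and> k \<le> Suc a' \<and> j \<in> J (Suc a - k) (Suc a' - k)}"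
      by (intro complex_vector.span_base) blast
  qed
qed

lemma gen_set_Q_power: "x \<in> gen_set a a' \<Longrightarrow> Q n ^ i * x \<in> gen_set (a + i) (a' + i)"
  by (induction i) (auto simp: mult.assoc dest: gen_set_Q)

lemma gen_set_closed:
  "x \<in> gen_set a a' \<Longrightarrow> c *\<^sub>C x \<in> gen_set a a'"
  "x \<in> gen_set a a' \<Longrightarrow> y \<in> gen_set a a' \<Longrightarrow> x - y \<in> gen_set a a'"
  "x \<in> gen_set a a' \<Longrightarrow> y \<in> gen_set a a' \<Longrightarrow> x + y \<in> gen_set a a'"
  "(\<And>s. s \<in> S \<Longrightarrow> h s \<in> gen_set a a') \<Longrightarrow> sum h S \<in> gen_set a a'"
  unfolding gen_set_def
  by (auto intro: complex_vector.span_scale complex_vector.span_diff complex_vector.span_add complex_vector.span_sum)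

text \<open>In the product of \<open>t_poly\<close> with \<open>\<xi> i\<close> the block of index
  \<open>N\<close> carries no \<open>Q n\<close>, and the others are powers of \<open>Q n\<close>
  times smaller blocks. The top coefficient is nonzero, so the top block can be solved for. The
  condition on \<open>sg\<close> and \<open>r\<close> makes \<open>sg\<close> agree with the case
  distinction in \<open>t_poly\<close> when the two differences are equal.\<close>

lemma block_in_gen_set:
  assumes i: "i \<in> I b b'" and sr: "sg \<or> r > 0"
  shows "block sg r k (\<xi> i) \<in> gen_set (b + k + (if sg then r else 0)) (b' + k + (if sg then 0 else r))"
proof (induction k rule: less_induct)
  case (less N)
  define a a' where "a = b + N + (if sg then r else 0)" and "a' = b' + N + (if sg then 0 else r)"
  have ab: "b \<le> a" "b' \<le> a'" by (auto simp: a_def a'_def)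
  have sg: "sg \<longleftrightarrow> a - b \<ge> a' - b'" and N: "N = min (a - b) (a' - b')" and r: "r = max (a - b) (a' - b') - N"
    using sr by (auto simp: a_def a'_def)
  obtain C where C: "C \<noteq> 0" "t_poly q z w n a a' b b' * \<xi> i =
     C *\<^sub>C (\<Sum>k\<le>N. phi_coeff q N r (b + b' + n - 1) k *\<^sub>C (Q n ^ (N - k) * block sg r k (\<xi> i)))"
    using t_poly_mult[OF _ ab sg N r] m1 n_eq by auto
  let ?c = "phi_coeff q N r (b + b' + n - 1)"
  define X where "X = (\<Sum>k<N. ?c k *\<^sub>C (Q n ^ (N - k) * block sg r k (\<xi> i)))"
  have "{..N} = insert N {..<N}" by auto
  then have S: "(\<Sum>k\<le>N. ?c k *\<^sub>C (Q n ^ (N - k) * block sg r k (\<xi> i))) = ?c N *\<^sub>C block sg r N (\<xi> i) + X"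
    by (simp add: X_def)
  have cN: "?c N \<noteq> 0" using m1 n_eq by (intro phi_coeff_neq_0) auto
  have "X \<in> gen_set a a'" unfolding X_def
  proof (intro gen_set_closed)
    fix k assume "k \<in> {..<N}"
    then have k: "k < N" by simp
    have "b + k + (if sg then r else 0) + (N - k) = a" "b' + k + (if sg then 0 else r) + (N - k) = a'"
      using k by (auto simp: a_def a'_def)
    then show "Q n ^ (N - k) * block sg r k (\<xi> i) \<in> gen_set a a'" using gen_set_Q_power[OF less[OF k], of "N - k"] by simp
  qed
  moreover have "t_poly q z w n a a' b b' * \<xi> i \<in> gen_set a a'"
  proof -
    obtain j where "j \<in> J a a'" "f j = b" "f' j = b'" "g j = i" using J_surj[OF ab i] by blast
    then have "Q n ^ 0 * \<xi>' j \<in> gen_set a a'" "\<xi>' j = t_poly q z w n a a' b b' * \<xi> i"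
      unfolding gen_set_def using \<xi>'[of j a a'] by (fastforce intro: complex_vector.span_base)+
    then show ?thesis by simp
  qed
  ultimately have "inverse (?c N) *\<^sub>C (inverse C *\<^sub>C (t_poly q z w n a a' b b' * \<xi> i) - X) \<in> gen_set a a'"
    by (intro gen_set_closed)
  moreover have "inverse (?c N) *\<^sub>C (inverse C *\<^sub>C (t_poly q z w n a a' b b' * \<xi> i) - X) = block sg r N (\<xi> i)"
    unfolding C(2) S using C(1) cN by (simp add: scaleC_mult_simps)
  ultimately show ?case by (simp add: a_def a'_def)
qed

text \<open>Expanding \<open>y\<close> in elements \<open>Q m ^ k * \<xi> i\<close> turns its zeroth
  block into higher blocks of the \<open>\<xi> i\<close>.\<close>

lemma block_zero_in_gen_set:
  assumes y: "y \<in> hom_polys m z w b b'" and sr: "sg \<or> r > 0"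
  shows "block sg r 0 y \<in> gen_set (b + (if sg then r else 0)) (b' + (if sg then 0 else r))"
proof -
  let ?G = "gen_set (b + (if sg then r else 0)) (b' + (if sg then 0 else r))"
  define B where "B = {Q m ^ k * \<xi> i | k i. k \<le> b \<and> k \<le> b' \<and> i \<in> I (b - k) (b' - k)}"
  have yB: "y \<in> complex_vector.span B" using y \<xi>_span unfolding B_def by blast
  have base: "(if sg then z n ^ r else w n ^ r) * x \<in> ?G" if x: "x \<in> B" for x
  proof -
    obtain k i where x: "x = Q m ^ k * \<xi> i" "k \<le> b" "k \<le> b'" "i \<in> I (b - k) (b' - k)" using x by (auto simp: B_def)
    have G: "block sg r k (\<xi> i) \<in> ?G" using block_in_gen_set[OF x(4) sr, of k] x(2,3) by (simp add: add.commute)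
    show ?thesis
    proof (cases sg)
      case True
      then show ?thesis using G by (simp add: block_simps x(1))
    next
      case False
      have "w n ^ r * Q m ^ k = (q ^ (k + k)) ^ r *\<^sub>C (Q m ^ k * w n ^ r)"
        by (rule last_hom_power(2)[OF n_eq hom_Q_power_m])
      then have "w n ^ r * x = (q ^ (k + k)) ^ r *\<^sub>C block False r k (\<xi> i)"
        by (simp add: block_simps x(1) mult_scaleC_left mult.assoc flip: mult.assoc[of "w n ^ r"])
      then show ?thesis using G False by (simp add: gen_set_closed)
    qed
  qed
  have "(if sg then z n ^ r else w n ^ r) * y \<in> ?G"
    unfolding gen_set_def by (rule span_mult_left[OF _ yB]) (use base in \<open>simp add: gen_set_def\<close>)
  then show ?thesis by (cases sg) (simp_all add: block_simps)
qed

text \<open>While both exponents are positive, one \<open>z n\<close> and one \<open>w n\<close> are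
  traded for \<open>Q n\<close> minus a multiple of \<open>Q m\<close> in the coefficient, which
  lowers \<open>k\<close>. When one exponent is zero, the monomial is a block up to a
  scalar.\<close>

lemma monomial_in_gen_set:
  assumes "c \<in> hom_polys m z w b b'"
  shows "c * z n ^ k * w n ^ l \<in> gen_set (b + k) (b' + l)"
  using assms
proof (induction k arbitrary: c b b' l)
  case 0
  have "block (l = 0) l 0 c \<in> gen_set (b + (if l = 0 then l else 0)) (b' + (if l = 0 then 0 else l))"
    by (rule block_zero_in_gen_set[OF 0]) auto
  then have "w n ^ l * c \<in> gen_set b (b' + l)" by (cases "l = 0") (simp_all add: block_simps)
  then have "inverse ((q ^ (b + b')) ^ l) *\<^sub>C (w n ^ l * c) \<in> gen_set b (b' + l)" by (rule gen_set_closed)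
  moreover have "inverse ((q ^ (b + b')) ^ l) *\<^sub>C (w n ^ l * c) = c * w n ^ l"
    unfolding last_hom_power(2)[OF n_eq 0] using q0 by (simp add: scaleC_mult_simps)
  ultimately show ?case by simp
next
  case (Suc k)
  show ?case
  proof (cases l)
    case 0
    have "block True (Suc k) 0 c \<in> gen_set (b + Suc k) b'"
      using block_zero_in_gen_set[OF Suc.prems, of True "Suc k"] by simp
    then have "inverse ((inverse q ^ (b + b')) ^ Suc k) *\<^sub>C (z n ^ Suc k * c) \<in> gen_set (b + Suc k) b'"
      by (intro gen_set_closed) (simp add: block_simps)
    moreover have "inverse ((inverse q ^ (b + b')) ^ Suc k) *\<^sub>C (z n ^ Suc k * c) = c * z n ^ Suc k"
      unfolding last_hom_power(1)[OF n_eq Suc.prems] using q0 by (simp add: scaleC_mult_simps del: power_Suc)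
    ultimately show ?thesis using 0 by simp
  next
    case (Suc l')
    have 1: "Q n * (c * z n ^ k * w n ^ l') \<in> gen_set (b + Suc k) (b' + Suc l')"
      using gen_set_Q[OF Suc.IH[OF Suc.prems, of l']] by simp
    have "c * Q m \<in> hom_polys m z w (b + 1) (b' + 1)"
      by (intro hom_polys_mult Suc.prems hom_polys_Q) simp
    from Suc.IH[OF this, of l'] have "(c * Q m) * z n ^ k * w n ^ l' \<in> gen_set (b + Suc k) (b' + Suc l')" by simp
    then have "Q n * (c * z n ^ k * w n ^ l') - (inverse q ^ 2) ^ k *\<^sub>C ((c * Q m) * z n ^ k * w n ^ l') \<in> gen_set (b + Suc k) (b' + Suc l')"
      by (intro gen_set_closed 1)
    then show ?thesis unfolding Q_mult_monomial[OF hom_m_sub[OF Suc.prems]] Suc by (simp add: mult_scaleC_left)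
  qed
qed

lemma hom_subset_gen_set: "hom_polys n z w a a' \<subseteq> gen_set a a'"
  unfolding hom_polys_zw gen_set_def
proof (rule complex_vector.span_minimal)
  show "zw_monos n z w a a' \<subseteq> complex_vector.span {Q n ^ k * \<xi>' j | k j. k \<le> a \<and> k \<le> a' \<and> j \<in> J (a - k) (a' - k)}"
    unfolding gen_set_def[symmetric]
  proof
    fix x assume "x \<in> zw_monos n z w a a'"
    then obtain r s where x: "x = mono_up n z r * mono_up n w s" "sum r {1..n} = a" "sum s {1..n} = a'"
      by (auto simp: zw_monos_def)
    have "mono_up m w s \<in> hom_polys m z w 0 (sum s {1..m})" by (rule hom_polys_mono_up_w)
    from last_hom_power(1)[OF n_eq this] have comm: "z n ^ r n * mono_up m w s = (inverse q ^ (0 + sum s {1..m})) ^ r n *\<^sub>C (mono_up m w s * z n ^ r n)" .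
    have "mono_up m z r * mono_up m w s \<in> hom_polys m z w (sum r {1..m} + 0) (0 + sum s {1..m})"
      by (intro hom_polys_mult hom_polys_mono_up_z hom_polys_mono_up_w)
    from monomial_in_gen_set[OF this, of "r n" "s n"]
    have "mono_up m z r * mono_up m w s * z n ^ r n * w n ^ s n \<in> gen_set a a'"
      using x(2,3) by (simp add: n_eq)
    then have "((inverse q ^ (0 + sum s {1..m})) ^ r n) *\<^sub>C (mono_up m z r * mono_up m w s * z n ^ r n * w n ^ s n) \<in> gen_set a a'"
      by (rule gen_set_closed)
    also have "((inverse q ^ (0 + sum s {1..m})) ^ r n) *\<^sub>C (mono_up m z r * mono_up m w s * z n ^ r n * w n ^ s n)
       = mono_up m z r * (z n ^ r n * mono_up m w s) * w n ^ s n"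
      unfolding comm by (simp only: mult_scaleC_left mult_scaleC_right mult.assoc)
    also have "\<dots> = x" unfolding x(1) by (simp only: n_eq mono_up_Suc mult.assoc)
    finally show "x \<in> gen_set a a'" .
  qed
qed simp

text \<open>The maps \<open>f\<close>, \<open>f'\<close>, \<open>g\<close> send an index to the
  bidegree and the index of its truncation. They are abstract because the step from one to two pairs
  starts from integers, while all later ones start from patterns.\<close>

lemma harmonic_family_step: "harmonic_family J \<xi>'"
  unfolding harmonic_family_def
  using \<xi>'_hom \<xi>'_Lap \<xi>'_indep hom_subset_gen_set unfolding gen_set_def by blast

end

end

section \<open>From the spanning family to the kernel of the Laplacian\<close>

context q_weyl_ops
begin

text \<open>Each application strips off one \<open>Q n\<close> and multiplies by a product of two
  q-numbers, which is nonzero as long as a factor \<open>Q n\<close> is left and zero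
  afterwards.\<close>

lemma Lap_iterate:
  assumes n: "n \<ge> 2" and y: "y \<in> hom_polys n z w b b'" "Lap n y = 0"
  shows "\<exists>C. (j \<le> k \<longrightarrow> C \<noteq> 0) \<and> (k < j \<longrightarrow> C = 0) \<and> (Lap n ^^ j) (Q n ^ k * y) = C *\<^sub>C (Q n ^ (k - j) * y)"
proof (induction j)
  case 0
  show ?case by (rule exI[of _ 1]) (simp add: scaleC_one)
next
  case (Suc j)
  then obtain C where C: "j \<le> k \<longrightarrow> C \<noteq> 0" "k < j \<longrightarrow> C = 0" "(Lap n ^^ j) (Q n ^ k * y) = C *\<^sub>C (Q n ^ (k - j) * y)"
    by blast
  define \<kappa> where "\<kappa> = q powi (int n - 1) * (qnum q (int (k - j)) * qnum q (int (b + b' + n) + int (k - j) - 1))"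
  have "(Lap n ^^ Suc j) (Q n ^ k * y) = (C * \<kappa>) *\<^sub>C (Q n ^ (k - Suc j) * y)"
    using Lap_Q_power[OF y(1), of "k - j"] y(2)
    by (simp add: C(3) clinear_scale[OF clinear_Lap] \<kappa>_def scaleC_scaleC)
  moreover have "\<kappa> \<noteq> 0" if "Suc j \<le> k"
    using that n q0 qnum_neq_0[of "int (k - j)"] qnum_neq_0[of "int (b + b' + n) + int (k - j) - 1"] by (simp add: \<kappa>_def)
  moreover have "C * \<kappa> = 0" if "k < Suc j" using C(2) that by (cases "k = j") (auto simp: \<kappa>_def)
  ultimately show ?case using C(1) by (intro exI[of _ "C * \<kappa>"]) auto
qed

text \<open>Iterating the Laplacian as often as the top power of \<open>Q n\<close> isolates the top
  component up to a nonzero scalar. That component must vanish, and induction removes the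
  others.\<close>

lemma harmonic_combination:
  assumes n: "n \<ge> 2" and y: "\<And>k. k \<le> K \<Longrightarrow> y k \<in> hom_polys n z w (b k) (b' k) \<and> Lap n (y k) = 0"
    and x: "Lap n (\<Sum>k\<le>K. Q n ^ k * y k) = 0"
  shows "(\<Sum>k\<le>K. Q n ^ k * y k) = y 0"
  using y x
proof (induction K)
  case (Suc K)
  have lin: "clinear (Lap n ^^ j)" for j
  proof (induction j)
    case 0
    show ?case using clinear_id by (simp add: id_def)
  next
    case (Suc j)
    show ?case using clinear_comp[OF clinear_Lap[OF order_refl] Suc] by (simp add: o_def)
  qed
  let ?x = "\<Sum>k\<le>Suc K. Q n ^ k * y k"
  have "(Lap n ^^ Suc K) ?x = 0"
    using Suc.prems(2) clinear_0[OF lin] by (simp only: funpow_Suc_right o_apply)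
  moreover have "(Lap n ^^ Suc K) (Q n ^ k * y k) = 0" if "k \<le> K" for k
    using Lap_iterate[OF n, of "y k" "b k" "b' k" "Suc K" k] Suc.prems(1)[of k] that by auto
  moreover obtain C where "C \<noteq> 0" "(Lap n ^^ Suc K) (Q n ^ Suc K * y (Suc K)) = C *\<^sub>C y (Suc K)"
    using Lap_iterate[OF n, of "y (Suc K)" "b (Suc K)" "b' (Suc K)" "Suc K" "Suc K"] Suc.prems(1)[of "Suc K"] by auto
  ultimately have "y (Suc K) = 0"
    by (simp add: clinear_sum[OF lin] clinear_add[OF lin] del: funpow.simps)
  then show ?case using Suc by simp
qed simp

lemma harmonic_family_kernel:
  assumes n: "n \<ge> 2" and h: "harmonic_family I \<xi>"
  shows "{x \<in> hom_polys n z w a a'. Lap n x = 0} = complex_vector.span (\<xi> ` I a a')"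
proof
  have hom: "y \<in> hom_polys n z w b b'" and ker: "Lap n y = 0" if "y \<in> complex_vector.span (\<xi> ` I b b')" for y b b'
  proof -
    have "\<xi> ` I b b' \<subseteq> hom_polys n z w b b'" using h by (auto simp: harmonic_family_def)
    then have "complex_vector.span (\<xi> ` I b b') \<subseteq> hom_polys n z w b b'"
      unfolding hom_polys_def by (intro complex_vector.span_minimal) auto
    then show "y \<in> hom_polys n z w b b'" using that by blast
    show "Lap n y = 0"
      by (rule clinear_eq_on_span[OF clinear_Lap[OF order_refl] clinear_zero _ that]) (use h in \<open>auto simp: harmonic_family_def\<close>)
  qed
  show "complex_vector.span (\<xi> ` I a a') \<subseteq> {x \<in> hom_polys n z w a a'. Lap n x = 0}" using hom ker by blast
  show "{x \<in> hom_polys n z w a a'. Lap n x = 0} \<subseteq> complex_vector.span (\<xi> ` I a a')"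
  proof
    fix x assume x: "x \<in> {x \<in> hom_polys n z w a a'. Lap n x = 0}"
    define K where "K = min a a'"
    have "x \<in> complex_vector.span {Q n ^ k * \<xi> i | k i. k \<le> a \<and> k \<le> a' \<and> i \<in> I (a - k) (a' - k)}"
      using h x unfolding harmonic_family_def by blast
    \<comment> \<open>The spanning elements are grouped by their power of \<open>Q n\<close>, which
      gives one harmonic component for each \<open>k\<close>.\<close>
    then have "\<exists>y. (\<forall>k\<le>K. y k \<in> complex_vector.span (\<xi> ` I (a - k) (a' - k))) \<and> x = (\<Sum>k\<le>K. Q n ^ k * y k)"
    proof (induction rule: complex_vector.span_induct_alt)
      case base
      show ?case by (intro exI[of _ "\<lambda>_. 0"]) (simp add: complex_vector.span_zero)
    next
      case (step c v x)
      then obtain k i where v: "v = Q n ^ k * \<xi> i" "k \<le> K" "i \<in> I (a - k) (a' - k)" by (auto simp: K_def)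
      obtain y where y: "\<And>k. k \<le> K \<Longrightarrow> y k \<in> complex_vector.span (\<xi> ` I (a - k) (a' - k))" "x = (\<Sum>k\<le>K. Q n ^ k * y k)"
        using step by blast
      have kK: "k \<in> {..K}" using v(2) by simp
      have "(\<Sum>j\<in>{..K} - {k}. Q n ^ j * (y(k := c *\<^sub>C \<xi> i + y k)) j) = (\<Sum>j\<in>{..K} - {k}. Q n ^ j * y j)"
        by (rule sum.cong) auto
      then have "c *\<^sub>C v + x = (\<Sum>j\<le>K. Q n ^ j * (y(k := c *\<^sub>C \<xi> i + y k)) j)"
        unfolding y(2) v(1) sum.remove[OF finite_atMost kK] by (simp add: distrib_left mult_scaleC_right add.assoc)
      moreover have "(y(k := c *\<^sub>C \<xi> i + y k)) j \<in> complex_vector.span (\<xi> ` I (a - j) (a' - j))" if "j \<le> K" for j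
        using y(1)[OF that] v(3) by (auto intro!: complex_vector.span_add complex_vector.span_scale intro: complex_vector.span_base)
      ultimately show ?case by blast
    qed
    then obtain y where y: "\<And>k. k \<le> K \<Longrightarrow> y k \<in> complex_vector.span (\<xi> ` I (a - k) (a' - k))" "x = (\<Sum>k\<le>K. Q n ^ k * y k)"
      by blast
    have "x = y 0" unfolding y(2)
    proof (rule harmonic_combination[OF n, of K y "\<lambda>k. a - k" "\<lambda>k. a' - k"])
      show "y k \<in> hom_polys n z w (a - k) (a' - k) \<and> Lap n (y k) = 0" if "k \<le> K" for k
        using hom[OF y(1)[OF that]] ker[OF y(1)[OF that]] by blast
      show "Lap n (\<Sum>k\<le>K. Q n ^ k * y k) = 0" using x y(2) by simp
    qed
    then show "x \<in> complex_vector.span (\<xi> ` I a a')" using y(1)[of 0] by simp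
  qed
qed

text \<open>With one pair, \<open>w 1 * z 1\<close> and \<open>z 1 * w 1\<close> both equal
  \<open>Q 1\<close>, so a monomial is a power of \<open>Q 1\<close> times a pure power. Harmonicity
  comes from viewing one pair as an extension of none, where the Laplacian is an empty sum.\<close>

lemma harmonic_family_one:
  assumes n: "n = 1" and free: "zw_free n z w"
  shows "harmonic_family (\<lambda>b b'. {c. b = nat c \<and> b' = nat (- c)}) (t_one z w)"
proof -
  interpret s: q_weyl_step n q z w d db 0 by unfold_locales (simp add: n)
  have 1: "1 \<in> hom_polys 0 z w 0 0" "1 \<in> sub_alg 0 z w"
    using hom_polys_one hom_polys_subset_sub_alg by blast+
  have "Lap n (1 * z n ^ k) = 0" "Lap n (1 * w n ^ k) = 0" for k
    using Lap_mult_last[OF s.n_eq 1(2), of k] by (simp_all add: Lap_def[of 0])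
  then have L: "Lap n (t_one z w c) = 0" for c by (simp add: t_one_def n)
  have H: "t_one z w c \<in> hom_polys n z w (nat c) (nat (- c))" for c
    using s.hom_z_power[of "nat c"] s.hom_w_power[of "nat (- c)"] by (simp add: t_one_def n)
  have nz: "t_one z w c \<noteq> 0" for c
  proof
    assume "t_one z w c = 0"
    define r s :: "nat \<Rightarrow> nat" where "r = (\<lambda>_. 0)(1 := nat c)" and "s = (\<lambda>_. 0)(1 := nat (- c))"
    have "mono_up n z r * mono_up n w s = t_one z w c"
      unfolding n One_nat_def mono_up_Suc by (simp add: r_def s_def t_one_def)
    then have "(\<Sum>x\<in>{(r, s)}. 1 *\<^sub>C (case x of (r, s) \<Rightarrow> mono_up n z r * mono_up n w s)) = 0"
      using \<open>t_one z w c = 0\<close> by simp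
    from family_independentD[OF free[unfolded zw_free_def] _ _ this, of "(r, s)"] show False
      by (simp add: exponents_def r_def s_def n)
  qed
  have comm: "w 1 * z 1 ^ k = z 1 ^ k * w 1" for k
    using w_power_z[of 1 k] n by simp
  have P: "z 1 ^ k * w 1 ^ l = Q n ^ min k l * t_one z w (int k - int l)" for k l
  proof (induction k arbitrary: l)
    case 0
    show ?case by (cases "l = 0") (simp_all add: t_one_def)
  next
    case (Suc k)
    show ?case
    proof (cases l)
      case 0
      then show ?thesis by (simp add: t_one_def nat_add_distrib flip: power_Suc)
    next
      case (Suc l')
      have "z 1 ^ Suc k * w 1 ^ Suc l' = z 1 * (z 1 ^ k * w 1) * w 1 ^ l'" by (simp add: mult.assoc)
      also have "\<dots> = (z 1 * w 1) * (z 1 ^ k * w 1 ^ l')" unfolding comm[symmetric] by (simp only: mult.assoc)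
      also have "z 1 * w 1 = Q n" by (simp add: n Qpoly_def)
      finally show ?thesis unfolding Suc.IH by (simp add: Suc mult.assoc)
    qed
  qed
  show ?thesis unfolding harmonic_family_def
  proof (intro conjI allI ballI)
    show "t_one z w c \<in> hom_polys n z w b b'" if "c \<in> {c. b = nat c \<and> b' = nat (- c)}" for c b b' using H[of c] that by simp
    show "Lap n (t_one z w c) = 0" for c by (rule L)
    show "family_independent (t_one z w) {c. b = nat c \<and> b' = nat (- c)}" for b b'
      unfolding family_independent_def
    proof (intro allI impI ballI)
      fix S and a :: "int \<Rightarrow> complex" and c assume S: "finite S \<and> S \<subseteq> {c. b = nat c \<and> b' = nat (- c)} \<and> (\<Sum>x\<in>S. a x *\<^sub>C t_one z w x) = 0" "c \<in> S"
      have "x = int b - int b'" if "x \<in> S" for x using S(1) that by auto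
      then have "S = {c}" using S(2) by (metis insert_absorb insert_subset singletonI subsetI subset_singletonD insertE all_not_in_conv)
      then show "a c = 0" using S(1) nz by simp
    qed
    show "hom_polys n z w a a' \<subseteq> complex_vector.span
        {Q n ^ k * t_one z w c | k c. k \<le> a \<and> k \<le> a' \<and> c \<in> {c. a - k = nat c \<and> a' - k = nat (- c)}}" for a a'
      unfolding hom_polys_zw
    proof (rule complex_vector.span_mono, rule subsetI)
      fix x assume "x \<in> zw_monos n z w a a'"
      then obtain r s where "x = mono_up n z r * mono_up n w s" "sum r {1..n} = a" "sum s {1..n} = a'"
        by (auto simp: zw_monos_def)
      then have "x = z 1 ^ a * w 1 ^ a'" unfolding n One_nat_def mono_up_Suc by simp
      then have "x = Q n ^ min a a' * t_one z w (int a - int a')" using P by simp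
      moreover have "a - min a a' = nat (int a - int a')" "a' - min a a' = nat (- (int a - int a'))" by auto
      ultimately show "x \<in> {Q n ^ k * t_one z w c | k c. k \<le> a \<and> k \<le> a' \<and> c \<in> {c. a - k = nat c \<and> a' - k = nat (- c)}}"
        by (intro CollectI exI[of _ "min a a'"] exI[of _ "int a - int a'"]) auto
    qed
  qed
qed

end

text \<open>At most one of \<open>nat c\<close> and \<open>nat (- c)\<close> is nonzero, so both
  cases of \<open>t_two\<close> are instances of one \<open>t_poly\<close>. Level 2 thereby becomes
  an ordinary step over the integers \<open>c\<close>.\<close>

lemma Xi_two: "Xi 2 q z w (M, M', c) = t_poly q z w 2 (M 2) (M' 2) (nat c) (nat (- c)) * t_one z w c"
  by (simp add: Xi_def t_two_def)

lemma Xi_Suc: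
  assumes m: "m \<ge> 2"
  shows "Xi (Suc m) q z w (M, M', c) = t_poly q z w (Suc m) (M (Suc m)) (M' (Suc m)) (M m) (M' m) *
    Xi m q z w (restrict M {2..m}, restrict M' {2..m}, c)"
proof -
  have "rev [3..<Suc (Suc m)] = Suc m # rev [3..<Suc m]" using m by simp
  moreover have "map (\<lambda>p. t_poly q z w p (restrict M {2..m} p) (restrict M' {2..m} p) (restrict M {2..m} (p - 1)) (restrict M' {2..m} (p - 1))) (rev [3..<Suc m])
    = map (\<lambda>p. t_poly q z w p (M p) (M' p) (M (p - 1)) (M' (p - 1))) (rev [3..<Suc m])"
    by (rule map_cong) auto
  moreover have "restrict M {2..m} 2 = M 2" "restrict M' {2..m} 2 = M' 2" using m by auto
  ultimately show ?thesis unfolding Xi_def split_conv by (simp only: list.map prod_list.Cons mult.assoc diff_Suc_1)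
qed

lemma patterns_two: "patterns 2 a a' = {(M, M', c). M \<in> extensional {2} \<and> M' \<in> extensional {2} \<and> M 2 = a \<and> M' 2 = a' \<and> c \<le> int a \<and> - int a' \<le> c}"
  by (auto simp: patterns_def)

text \<open>Truncation has to restrict the sequences, since patterns are extensional on their own
  index range.\<close>

lemma patterns_restrict:
  assumes "m \<ge> 2" "(M, M', c) \<in> patterns (Suc m) a a'"
  shows "M m \<le> a" "M' m \<le> a'" "(restrict M {2..m}, restrict M' {2..m}, c) \<in> patterns m (M m) (M' m)"
  using assms by (auto simp: patterns_def)

lemma patterns_extend:
  assumes "m \<ge> 2" "(M, M', c) \<in> patterns m b b'" "b \<le> a" "b' \<le> a'"
  shows "(M(Suc m := a), M'(Suc m := a'), c) \<in> patterns (Suc m) a a'"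
    "restrict (M(Suc m := a)) {2..m} = M" "restrict (M'(Suc m := a')) {2..m} = M'"
  using assms by (auto simp: patterns_def extensional_def fun_eq_iff less_Suc_eq)

lemma patterns_inj:
  assumes "m \<ge> 2" "(M, M', c) \<in> patterns (Suc m) a a'" "(N, N', c') \<in> patterns (Suc m) a a'"
    "restrict M {2..m} = restrict N {2..m}" "restrict M' {2..m} = restrict N' {2..m}" "c = c'"
  shows "(M, M', c) = (N, N', c')"
proof -
  have "M i = N i \<and> M' i = N' i" for i
  proof -
    consider "i \<in> {2..m}" | "i = Suc m" | "i \<notin> {2..Suc m}" by fastforce
    then show ?thesis
    proof cases
      case 1
      then show ?thesis using fun_cong[OF assms(4), of i] fun_cong[OF assms(5), of i] by simp
    qed (use assms(2,3) in \<open>auto simp: patterns_def extensional_def\<close>)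
  qed
  then show ?thesis using assms(6) by (simp add: fun_eq_iff)
qed

lemma patterns_two_inj:
  "inj_on (\<lambda>j. (case j of (M, M', c) \<Rightarrow> nat c, case j of (M, M', c) \<Rightarrow> nat (- c), case j of (M, M', c) \<Rightarrow> c)) (patterns 2 a a')"
  by (auto simp: inj_on_def patterns_two extensional_def fun_eq_iff) metis+

lemma patterns_truncate:
  assumes "m \<ge> 2" "j \<in> patterns (Suc m) a a'"
  shows "(case j of (M, M', c) \<Rightarrow> M m) \<le> a \<and> (case j of (M, M', c) \<Rightarrow> M' m) \<le> a' \<and>
    (case j of (M, M', c) \<Rightarrow> (restrict M {2..m}, restrict M' {2..m}, c)) \<in> patterns m (case j of (M, M', c) \<Rightarrow> M m) (case j of (M, M', c) \<Rightarrow> M' m)"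
  using patterns_restrict[OF assms(1)] assms(2) by (cases j) auto

lemma patterns_truncate_inj:
  assumes "m \<ge> 2"
  shows "inj_on (\<lambda>j. (case j of (M, M', c) \<Rightarrow> M m, case j of (M, M', c) \<Rightarrow> M' m,
   case j of (M, M', c) \<Rightarrow> (restrict M {2..m}, restrict M' {2..m}, c))) (patterns (Suc m) a a')"
proof (rule inj_onI)
  fix x y assume xy: "x \<in> patterns (Suc m) a a'" "y \<in> patterns (Suc m) a a'"
    "(case x of (M, M', c) \<Rightarrow> M m, case x of (M, M', c) \<Rightarrow> M' m, case x of (M, M', c) \<Rightarrow> (restrict M {2..m}, restrict M' {2..m}, c)) =
     (case y of (M, M', c) \<Rightarrow> M m, case y of (M, M', c) \<Rightarrow> M' m, case y of (M, M', c) \<Rightarrow> (restrict M {2..m}, restrict M' {2..m}, c))"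
  obtain M M' c N N' c' where "x = (M, M', c)" "y = (N, N', c')" by (metis prod_cases3)
  then show "x = y" using patterns_inj[OF assms, of M M' c a a' N N' c'] xy by simp
qed

lemma Xi_truncate:
  assumes "m \<ge> 2" "j \<in> patterns (Suc m) a a'"
  shows "Xi (Suc m) q z w j = t_poly q z w (Suc m) a a' (case j of (M, M', c) \<Rightarrow> M m) (case j of (M, M', c) \<Rightarrow> M' m) *
    Xi m q z w (case j of (M, M', c) \<Rightarrow> (restrict M {2..m}, restrict M' {2..m}, c))"
  using assms(2) by (cases j) (auto simp: Xi_Suc[OF assms(1)] patterns_def)

lemma (in q_weyl_ops) harmonic_family_Xi:
  assumes "n \<ge> 2" "zw_free n z w"
  shows "harmonic_family (patterns n) (Xi n q z w)"
  \<comment> \<open>The locale facts are chained in to become part of the induction: the number of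
    variables varies while \<open>d\<close> and \<open>db\<close> stay fixed.\<close>
  using assms q_weyl_ops_axioms
proof (induction n rule: dec_induct)
  case base
  interpret p: q_weyl_ops 2 q z w d db by (rule base)
  interpret s: q_weyl_step 2 q z w d db 1 by unfold_locales simp
  have fr1: "zw_free 1 z w" by (rule zw_free_mono[OF _ base(1)]) simp
  note I = s.m.harmonic_family_one[OF refl fr1]
  show ?case
  proof (rule s.harmonic_family_step[OF _ base(1) I, where f = "\<lambda>(M, M', c). nat c" and f' = "\<lambda>(M, M', c). nat (- c)" and g = "\<lambda>(M, M', c). c"])
    show "\<exists>j\<in>patterns 2 a a'. (case j of (M, M', c) \<Rightarrow> nat c) = b \<and> (case j of (M, M', c) \<Rightarrow> nat (- c)) = b' \<and> (case j of (M, M', c) \<Rightarrow> c) = i"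
      if "b \<le> a" "b' \<le> a'" "i \<in> {c. b = nat c \<and> b' = nat (- c)}" for a a' b b' i
      using that by (intro bexI[of _ "(\<lambda>x\<in>{2}. a, \<lambda>x\<in>{2}. a', i)"]) (auto simp: patterns_two)
  qed (rule patterns_two_inj | force simp: patterns_two Xi_two)+
next
  case (step m)
  interpret p: q_weyl_ops "Suc m" q z w d db by (rule step)
  interpret s: q_weyl_step "Suc m" q z w d db m by unfold_locales simp
  have fr: "zw_free m z w" by (rule zw_free_mono[OF _ step(4)]) simp
  note I = step.IH[OF fr s.m.q_weyl_ops_axioms]
  show ?case
  proof (rule s.harmonic_family_step[OF _ step(4) I, where f = "\<lambda>(M, M', c). M m" and f' = "\<lambda>(M, M', c). M' m"
        and g = "\<lambda>(M, M', c). (restrict M {2..m}, restrict M' {2..m}, c)"])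
    show "m \<ge> 1" using step by simp
    show "\<exists>j\<in>patterns (Suc m) a a'. (case j of (M, M', c) \<Rightarrow> M m) = b \<and> (case j of (M, M', c) \<Rightarrow> M' m) = b' \<and>
       (case j of (M, M', c) \<Rightarrow> (restrict M {2..m}, restrict M' {2..m}, c)) = i"
      if "b \<le> a" "b' \<le> a'" "i \<in> patterns m b b'" for a a' b b' i
    proof -
      obtain M M' c where i: "i = (M, M', c)" by (metis prod_cases3)
      note e = patterns_extend[OF step(1) that(3)[unfolded i] that(1,2)]
      have "M m = b" "M' m = b'" using that(3) by (auto simp: i patterns_def)
      then show ?thesis using e by (intro bexI[OF _ e(1)]) (simp add: i)
    qed
  qed (rule patterns_truncate_inj[OF step(1)] | rule patterns_truncate[OF step(1)], assumption | rule Xi_truncate[OF step(1)], assumption)+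
qed

section \<open>Realising the abstract operators by \<open>pd\<close> and
  \<open>pd_bar\<close>\<close>

lemma ex_is_pd:
  assumes "zw_free n z w" "i \<in> {1..n}"
  shows "\<exists>D. is_pd n q z w i D"
proof -
  obtain D where D: "clinear D" "\<And>x. x \<in> exponents n \<times> exponents n \<Longrightarrow> D (case x of (r, s) \<Rightarrow> mono_up n z r * mono_up n w s) =
    (case x of (r, s) \<Rightarrow> (q powi (\<Sum>k\<in>{i<..n}. int (r k)) * qnum q (int (r i))) *\<^sub>C
          (mono_up n z (r(i := r i - 1)) * mono_up n w s))"
    using ex_clinear_on_family[OF assms(1)[unfolded zw_free_def], of "\<lambda>(r, s). (q powi (\<Sum>k\<in>{i<..n}. int (r k)) * qnum q (int (r i))) *\<^sub>C
          (mono_up n z (r(i := r i - 1)) * mono_up n w s)"] by blast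
  have "D (mono_up n z r * mono_up n w s) = (q powi (\<Sum>k\<in>{i<..n}. int (r k)) * qnum q (int (r i))) *\<^sub>C
          (mono_up n z (r(i := r i - 1)) * mono_up n w s)" for r s
  proof -
    have "mono_up n z ((cut n r)(i := cut n r i - 1)) = mono_up n z (r(i := r i - 1))"
      by (rule mono_up_cong) (use assms(2) in \<open>auto simp: cut_def\<close>)
    moreover have "(\<Sum>k\<in>{i<..n}. int (cut n r k)) = (\<Sum>k\<in>{i<..n}. int (r k))"
      by (rule sum.cong) (auto simp: cut_def)
    moreover have "cut n r i = r i" using assms(2) by (simp add: cut_def)
    ultimately show ?thesis using D(2)[of "(cut n r, cut n s)"] by simp
  qed
  then show ?thesis using D(1) unfolding is_pd_def by blast
qed

lemma is_pd_unique:
  assumes "is_pd n q z w i D" "is_pd n q z w i D'" "complex_vector.span (\<Union>a b. zw_monos n z w a b) = UNIV"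
  shows "D = D'"
proof
  fix x
  have "x \<in> complex_vector.span (\<Union>a b. zw_monos n z w a b)" using assms(3) by simp
  then show "D x = D' x"
    by (rule clinear_eq_on_span[rotated 3]) (use assms(1,2) in \<open>auto simp: is_pd_def zw_monos_def\<close>)
qed

text \<open>The definite description is legitimate because the ordered monomials are independent,
  which gives existence, and span, which gives uniqueness.\<close>

lemma is_pd_pd:
  assumes "zw_free n z w" "i \<in> {1..n}" "complex_vector.span (\<Union>a b. zw_monos n z w a b) = UNIV"
  shows "is_pd n q z w i (pd n q z w i)"
proof -
  have "pd n q z w i = (THE D. is_pd n q z w i D)"
    unfolding pd_def is_pd_def by (simp flip: of_nat_sum)
  then show ?thesis
    using ex_is_pd[OF assms(1,2), of q] is_pd_unique[OF _ _ assms(3)] by (metis theI)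
qed

lemma is_pd_bar_pd_bar:
  assumes "zw_free n w z" "i \<in> {1..n}" "complex_vector.span (\<Union>a b. zw_monos n w z a b) = UNIV"
  shows "is_pd_bar n q z w i (pd_bar n q z w i)"
proof -
  have "pd_bar n q z w i = (THE D. is_pd_bar n q z w i D)"
    unfolding pd_bar_def is_pd_bar_def by (simp flip: of_nat_sum)
  then show ?thesis
    using ex_is_pd[OF assms(1,2), of "inverse q"] is_pd_unique[OF _ _ assms(3)] unfolding is_pd_bar_iff by (metis theI)
qed

lemma presents_sub_alg:
  assumes "presents n q z w"
  shows "sub_alg n z w = UNIV"
proof -
  have "x \<in> sub_alg n z w" for x
  proof -
    obtain p where p: "p \<in> free_alg n" "x = eval_free z w p"
      using assms unfolding presents_def by (metis UNIV_I imageE)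
    show ?thesis unfolding p(2) eval_free_def sub_alg_def
      using p(1) by (intro complex_vector.span_sum complex_vector.span_scale complex_vector.span_base) (auto simp: free_alg_def)
  qed
  then show ?thesis by auto
qed

lemma presents_zw_free:
  assumes "presents n q z w" "q \<noteq> 0" "\<forall>k>0. q ^ k \<noteq> 1" "n \<ge> 1"
  shows "zw_free n z w" "zw_free n w z"
proof -
  have q: "\<And>k. k > 0 \<Longrightarrow> q ^ k \<noteq> 1" using assms(3) by blast
  show "zw_free n z w" unfolding zw_free_def family_independent_def
  proof (intro allI impI ballI)
    fix S a x assume S: "finite S \<and> S \<subseteq> exponents n \<times> exponents n \<and>
      (\<Sum>x\<in>S. a x *\<^sub>C (case x of (r, s) \<Rightarrow> mono_up n z r * mono_up n w s)) = 0" "x \<in> S"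
    then have "(\<Sum>(r, s)\<in>S. a (r, s) *\<^sub>C (mono_up n z r * mono_up n w s)) = 0"
      by (simp add: split_def)
    then show "a x = 0" using monomials_zw_independent[OF assms(1,2) q assms(4), of S a x] S by blast
  qed
  show "zw_free n w z" unfolding zw_free_def family_independent_def
  proof (intro allI impI ballI)
    fix S a x assume S: "finite S \<and> S \<subseteq> exponents n \<times> exponents n \<and>
      (\<Sum>x\<in>S. a x *\<^sub>C (case x of (r, s) \<Rightarrow> mono_up n w r * mono_up n z s)) = 0" "x \<in> S"
    have inj: "inj_on prod.swap S" by (auto simp: inj_on_def)
    have "(\<Sum>(r, s)\<in>prod.swap ` S. (a \<circ> prod.swap) (r, s) *\<^sub>C (mono_up n w s * mono_up n z r)) = 0"
      using S by (simp add: sum.reindex[OF inj] split_def)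
    moreover have "prod.swap ` S \<subseteq> exponents n \<times> exponents n" using S by auto
    ultimately show "a x = 0"
      using monomials_wz_independent[OF assms(1,2) q assms(4) _ _ _ imageI[of x S prod.swap], of "a \<circ> prod.swap"] S by simp
  qed
qed

lemma presents_q_weyl_ops:
  assumes "presents n q z w" "q \<noteq> 0" "\<forall>k>0. q ^ k \<noteq> 1" "n \<ge> 1"
  shows "q_weyl_ops n q z w (pd n q z w) (pd_bar n q z w)"
proof -
  interpret q_weyl n q z w by (rule presents_q_weyl[OF assms(1-3)])
  note free = presents_zw_free[OF assms]
  show ?thesis
    by unfold_locales
      (use is_pd_pd[OF free(1)] is_pd_bar_pd_bar[OF free(2)] presents_sub_alg[OF assms(1)] sub_alg_eq_zw sub_alg_eq_wz in auto)
qed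

theorem Xi_basis:
  fixes z w :: "nat \<Rightarrow> 'a::complex_algebra_1"
  assumes "n \<ge> 2" "q \<noteq> 0" "\<forall>k>0. q ^ k \<noteq> 1" "presents n q z w"
  shows "inj_on (Xi n q z w) (patterns n m m')"
    and "complex_vector.independent (Xi n q z w ` patterns n m m')"
    and "complex_vector.span (Xi n q z w ` patterns n m m') = q_harmonics n q z w m m'"
proof -
  have n1: "n \<ge> 1" using assms(1) by simp
  interpret q_weyl_ops n q z w "pd n q z w" "pd_bar n q z w" by (rule presents_q_weyl_ops[OF assms(4,2,3) n1])
  have h: "harmonic_family (patterns n) (Xi n q z w)"
    by (rule harmonic_family_Xi[OF assms(1) presents_zw_free(1)[OF assms(4,2,3) n1]])
  then have ind: "family_independent (Xi n q z w) (patterns n m m')" by (simp add: harmonic_family_def)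
  then show "inj_on (Xi n q z w) (patterns n m m')" "complex_vector.independent (Xi n q z w ` patterns n m m')"
    by (rule family_independent_inj, rule family_independent_independent)
  have "Lap n = q_laplace n q z w" by (simp add: fun_eq_iff Lap_def q_laplace_def)
  then show "complex_vector.span (Xi n q z w ` patterns n m m') = q_harmonics n q z w m m'"
    using harmonic_family_kernel[OF assms(1) h, of m m'] by (simp add: q_harmonics_def)
qed

section \<open>Orthogonality of the little q-Jacobi polynomials\<close>

lemma qpoch_add: "qpoch a t (i + j) = qpoch a t i * qpoch (a * t ^ i) t j"
  by (induction j) (simp_all add: qpoch_Suc power_add mult.assoc)

context q_weyl
begin

lemma qpoch_pos_neq_0: "e \<ge> 1 \<Longrightarrow> qpoch ((q\<^sup>2) ^ e) (q\<^sup>2) s \<noteq> 0"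
  using not_root by (auto simp: qpoch_def simp flip: power_mult power_add)

lemma qpoch_base_neq_0: "qpoch (q\<^sup>2) (q\<^sup>2) s \<noteq> 0"
  using qpoch_pos_neq_0[of 1 s] by simp

lemma one_minus_neq_0: "e \<ge> 1 \<Longrightarrow> 1 - (q\<^sup>2) ^ e \<noteq> 0"
  using not_root[of "2 * e"] by (simp add: power_mult)

text \<open>Finite q-binomial theorem with base \<open>q^2\<close>. The inner recursion
  \<open>rec\<close> is the q-Pascal rule for the coefficients.\<close>

lemma q_binomial:
  "(\<Sum>k\<le>N. qpoch (inverse (q\<^sup>2) ^ N) (q\<^sup>2) k / qpoch (q\<^sup>2) (q\<^sup>2) k * y ^ k) = (\<Prod>s<N. 1 - inverse (q\<^sup>2) ^ Suc s * y)"
proof (induction N)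
  case (Suc N)
  define t where "t = q\<^sup>2"
  define g where "g N k = qpoch (inverse t ^ N) t k / qpoch t t k" for N k
  have t0: "t \<noteq> 0" using q0 by (simp add: t_def)
  have g0: "g M 0 = 1" for M by (simp add: g_def)
  have rec: "g (Suc N) (Suc k) = g N (Suc k) - inverse t ^ Suc N * g N k" for k
  proof -
    have d: "qpoch t t k \<noteq> 0" "1 - t * t ^ k \<noteq> 0"
      using qpoch_base_neq_0[of k] one_minus_neq_0[of "Suc k"] by (simp_all add: t_def)
    have e: "inverse t ^ Suc N * t ^ 1 = inverse t ^ N" using t0 by simp
    have "qpoch (inverse t ^ Suc N) t (1 + k) = (1 - inverse t ^ Suc N) * qpoch (inverse t ^ N) t k"
      unfolding qpoch_add e by (simp add: qpoch_Suc)
    then have "g (Suc N) (Suc k) = (1 - inverse t ^ Suc N) * g N k / (1 - t * t ^ k)"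
      using d by (simp add: g_def qpoch_Suc)
    moreover have "g N (Suc k) = (1 - inverse t ^ N * t ^ k) * g N k / (1 - t * t ^ k)"
      using d by (simp add: g_def qpoch_Suc)
    moreover have "1 - inverse t ^ Suc N = (1 - inverse t ^ N * t ^ k) - inverse t ^ Suc N * (1 - t * t ^ k)"
      using t0 by (simp add: right_diff_distrib)
    moreover have "(A - B * E) * x / E = A * x / E - B * x" if "E \<noteq> 0" for A B E x :: complex
      using that by (simp add: field_simps)
    ultimately show ?thesis using d(2) by presburger
  qed
  have top: "g N (Suc N) = 0"
    using t0 by (simp add: g_def qpoch_Suc power_inverse)
  have "(\<Sum>k\<le>Suc N. g (Suc N) k * y ^ k) = 1 + (\<Sum>k\<le>N. (g N (Suc k) - inverse t ^ Suc N * g N k) * y ^ Suc k)"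
    by (simp add: sum.atMost_Suc_shift g0 rec del: sum.atMost_Suc)
  also have "\<dots> = (1 + (\<Sum>k\<le>N. g N (Suc k) * y ^ Suc k)) - inverse t ^ Suc N * y * (\<Sum>k\<le>N. g N k * y ^ k)"
    by (simp add: algebra_simps sum_subtractf sum_distrib_left)
  also have "1 + (\<Sum>k\<le>N. g N (Suc k) * y ^ Suc k) = (\<Sum>k\<le>Suc N. g N k * y ^ k)"
    by (simp add: sum.atMost_Suc_shift g0 del: sum.atMost_Suc)
  also have "\<dots> = (\<Sum>k\<le>N. g N k * y ^ k)" by (simp add: top)
  finally have "(\<Sum>k\<le>Suc N. g (Suc N) k * y ^ k) = (\<Sum>k\<le>N. g N k * y ^ k) * (1 - inverse t ^ Suc N * y)"
    by (simp add: algebra_simps)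
  then show ?case using Suc by (simp add: g_def t_def)
qed simp

text \<open>At \<open>y = q^(2(j+1))\<close> with \<open>j < N\<close> the product in
  \<open>q_binomial\<close> has a zero factor, so these weights annihilate the powers of
  \<open>q^(2k)\<close> up to \<open>N - 1\<close>, hence every product of fewer than
  \<open>N\<close> linear factors in \<open>q^(2k)\<close>. The extra power \<open>j\<close> lets
  the induction expand one factor at a time.\<close>

lemma q_binomial_orthogonal:
  assumes "j + M < N"
  shows "(\<Sum>k\<le>N. qpoch (inverse (q\<^sup>2) ^ N) (q\<^sup>2) k / qpoch (q\<^sup>2) (q\<^sup>2) k * (q\<^sup>2) ^ k *
    ((q\<^sup>2) ^ k) ^ j * (\<Prod>s<M. 1 - c s * (q\<^sup>2) ^ k)) = 0"
  using assms
proof (induction M arbitrary: j)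
  case 0
  have "(\<Sum>k\<le>N. qpoch (inverse (q\<^sup>2) ^ N) (q\<^sup>2) k / qpoch (q\<^sup>2) (q\<^sup>2) k * ((q\<^sup>2) ^ Suc j) ^ k) = 0"
    unfolding q_binomial using 0 q0 by (auto intro!: bexI[of _ j] simp flip: power_mult power_Suc simp: power_inverse)
  moreover have "((q\<^sup>2) ^ Suc j) ^ k = (q\<^sup>2) ^ k * ((q\<^sup>2) ^ k) ^ j" for k
    by (simp only: power_mult[symmetric] power_add[symmetric]) (simp add: algebra_simps)
  ultimately show ?case by (simp only: lessThan_0 prod.empty mult_1_right mult.assoc)
next
  case (Suc M)
  let ?g = "\<lambda>k. qpoch (inverse (q\<^sup>2) ^ N) (q\<^sup>2) k / qpoch (q\<^sup>2) (q\<^sup>2) k * (q\<^sup>2) ^ k"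
  let ?P = "\<lambda>k. \<Prod>s<M. 1 - c s * (q\<^sup>2) ^ k"
  have alg: "G * J * (P * (1 - d * x)) = G * J * P - d * (G * (x * J) * P)" for G J P d x :: complex
    by (simp add: algebra_simps)
  have "?g k * ((q\<^sup>2) ^ k) ^ j * (\<Prod>s<Suc M. 1 - c s * (q\<^sup>2) ^ k) =
    ?g k * ((q\<^sup>2) ^ k) ^ j * ?P k - c M * (?g k * ((q\<^sup>2) ^ k) ^ Suc j * ?P k)" for k
    by (simp only: prod.lessThan_Suc power_Suc alg)
  then show ?case
    using Suc.IH[of j] Suc.IH[of "Suc j"] Suc.prems by (simp only: sum_subtractf sum_distrib_left[symmetric]) simp
qed

text \<open>The quotient of the two \<open>k\<close>-dependent factorials with bases
  \<open>q^(2(N+r+\<beta>))\<close> and \<open>q^(2\<beta>)\<close> is, up to a constant, a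
  factorial of length \<open>N + r\<close> starting at exponent \<open>\<beta> + k\<close>. It
  contains the given denominator as a subproduct because \<open>i < N\<close>, and what remains is a
  product of \<open>N - 1\<close> factors linear in \<open>q^(2k)\<close>.\<close>

lemma phi_coeff_orthogonal:
  assumes "i < N" "\<beta> \<ge> 1"
  shows "(\<Sum>k\<le>N. phi_coeff q N r \<beta> k / qpoch ((q\<^sup>2) ^ (k + i + \<beta>)) (q\<^sup>2) (Suc r)) = 0"
proof -
  define t where "t = q\<^sup>2"
  \<comment> \<open>These are the remaining factors: \<open>i\<close> of them below the cancelled
    run of length \<open>Suc r\<close>, the others above it.\<close>
  define c where "c s = (if s < i then t ^ (\<beta> + s) else t ^ (\<beta> + Suc r + s))" for s
  let ?g = "\<lambda>k. qpoch (inverse t ^ N) t k / qpoch t t k * t ^ k"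
  have nz: "e \<ge> 1 \<Longrightarrow> qpoch (t ^ e) t s \<noteq> 0" for e s unfolding t_def by (rule qpoch_pos_neq_0)
  have *: "phi_coeff q N r \<beta> k / qpoch (t ^ (k + i + \<beta>)) t (Suc r) =
     inverse (qpoch (t ^ \<beta>) t (N + r)) * (?g k * (t ^ k) ^ 0 * (\<Prod>s<N - 1. 1 - c s * t ^ k))" for k
  proof -
    obtain M where M: "N = i + Suc M" using assms(1) less_imp_Suc_add by auto
    have P: "(\<Prod>s<N - 1. 1 - c s * t ^ k) = qpoch (t ^ (\<beta> + k)) t i * qpoch (t ^ (\<beta> + k + i + Suc r)) t M"
    proof -
      have "(\<Prod>s<i + M'. 1 - c s * t ^ k) = qpoch (t ^ (\<beta> + k)) t i * qpoch (t ^ (\<beta> + k + i + Suc r)) t M'" for M'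
      proof (induction M')
        case 0
        then show ?case by (simp add: qpoch_def c_def power_add mult_ac)
      next
        case (Suc M')
        then show ?case by (simp add: qpoch_Suc c_def power_add mult_ac)
      qed
      then show ?thesis using M by simp
    qed
    have "qpoch (t ^ (\<beta> + k)) t (N + r) = qpoch (t ^ (\<beta> + k)) t (i + (Suc r + M))" using M by (simp add: ac_simps)
    also have "\<dots> = qpoch (t ^ (\<beta> + k)) t i * (qpoch (t ^ (k + i + \<beta>)) t (Suc r) * qpoch (t ^ (\<beta> + k + i + Suc r)) t M)"
      unfolding qpoch_add by (simp only: power_add[symmetric] add.assoc add.commute add.left_commute)
    finally have 1: "qpoch (t ^ (\<beta> + k)) t (N + r) = qpoch (t ^ (k + i + \<beta>)) t (Suc r) * (\<Prod>s<N - 1. 1 - c s * t ^ k)"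
      unfolding P by (simp only: mult_ac)
    have 2: "qpoch (t ^ \<beta>) t (N + r) * qpoch (t ^ (N + r + \<beta>)) t k = qpoch (t ^ \<beta>) t k * qpoch (t ^ (\<beta> + k)) t (N + r)"
      using qpoch_add[of "t ^ \<beta>" t "N + r" k] qpoch_add[of "t ^ \<beta>" t k "N + r"]
      by (simp only: power_add[symmetric] add.commute add.left_commute)
    have "- 2 * int N = - int (2 * N)" by simp
    then have e: "q powi (- 2 * int N) = inverse t ^ N" "q ^ (2 * x) = t ^ x" for x
      by (simp_all only: power_int_minus power_int_of_nat t_def power_inverse power_mult)
    have "qpoch (t ^ (N + r + \<beta>)) t k = qpoch (t ^ \<beta>) t k * (qpoch (t ^ (k + i + \<beta>)) t (Suc r) * (\<Prod>s<N - 1. 1 - c s * t ^ k)) / qpoch (t ^ \<beta>) t (N + r)"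
      using 2 nz[of \<beta> "N + r"] assms(2) by (simp add: 1 eq_divide_eq mult.commute)
    then show ?thesis
      unfolding phi_coeff_def phi21_coeff_def e t_def[symmetric]
      using nz[of \<beta> k] nz[of "k + i + \<beta>" "Suc r"] assms(2) by (simp add: divide_inverse mult_ac)
  qed
  show ?thesis unfolding t_def[symmetric] * sum_distrib_left[symmetric]
    using q_binomial_orthogonal[of 0 "N - 1" N c] assms(1) unfolding t_def by simp
qed

end

section \<open>The invariant functional\<close>

definition sphere_weight :: "nat \<Rightarrow> complex \<Rightarrow> (nat \<Rightarrow> nat) \<Rightarrow> complex" where
  "sphere_weight p t \<mu> = (\<Prod>i = 1..p. qpoch t t (\<mu> i)) * qpoch t t (p - 1) / qpoch t t ((\<Sum>i = 1..p. \<mu> i) + p - 1)"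

lemma sphere_weight_cong: "(\<And>i. i \<in> {1..p} \<Longrightarrow> r i = s i) \<Longrightarrow> sphere_weight p t r = sphere_weight p t s"
  unfolding sphere_weight_def by (metis (no_types, lifting) prod.cong sum.cong)

text \<open>Each summand is a difference of consecutive powers of \<open>t\<close> whose exponents
  are the tail sums of \<open>r i + 1\<close>.\<close>

lemma telescope_weights:
  fixes t :: complex
  shows "(\<Sum>k = 1..p. t ^ (p - k) * t ^ (\<Sum>i\<in>{k<..p}. r i) * (1 - t ^ Suc (r k))) = 1 - t ^ ((\<Sum>i = 1..p. r i) + p)"
proof (induction p)
  case (Suc p)
  let ?F = "\<lambda>p k. t ^ (p - k) * t ^ (\<Sum>i\<in>{k<..p}. r i) * (1 - t ^ Suc (r k))"
  have "?F (Suc p) k = t ^ Suc (r (Suc p)) * ?F p k" if "k \<in> {1..p}" for k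
  proof -
    have "{k<..Suc p} = insert (Suc p) {k<..p}" "Suc p - k = Suc (p - k)" using that by auto
    then have "t ^ (Suc p - k) * t ^ (\<Sum>i\<in>{k<..Suc p}. r i) = t ^ Suc (r (Suc p)) * (t ^ (p - k) * t ^ (\<Sum>i\<in>{k<..p}. r i))"
      by (simp add: power_add)
    then show ?thesis by (simp only: mult.assoc)
  qed
  then have "(\<Sum>k = 1..p. ?F (Suc p) k) = t ^ Suc (r (Suc p)) * (1 - t ^ ((\<Sum>i = 1..p. r i) + p))"
    unfolding Suc[symmetric] sum_distrib_left by (rule sum.cong[OF refl])
  then have "(\<Sum>k = 1..Suc p. ?F (Suc p) k) =
     t ^ Suc (r (Suc p)) * (1 - t ^ ((\<Sum>i = 1..p. r i) + p)) + (1 - t ^ Suc (r (Suc p)))"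
    by (simp only: sum.nat_ivl_Suc') simp
  also have "\<dots> = 1 - t ^ ((\<Sum>i = 1..Suc p. r i) + Suc p)"
    by (simp add: right_diff_distrib power_add mult_ac)
  finally show ?case .
qed simp

text \<open>The functional takes its values in the scalar multiples of \<open>1\<close>, so that it is a linear
  operator of the algebra.\<close>

definition is_integral :: "nat \<Rightarrow> complex \<Rightarrow> (nat \<Rightarrow> 'a::complex_algebra_1) \<Rightarrow> (nat \<Rightarrow> 'a) \<Rightarrow> ('a \<Rightarrow> 'a) \<Rightarrow> bool" where
  "is_integral p q z w H \<longleftrightarrow> clinear H \<and> (\<forall>r s. H (mono_up p w r * mono_down p z s) =
     (if \<forall>i\<in>{1..p}. r i = s i then sphere_weight p (q\<^sup>2) r else 0) *\<^sub>C 1)"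

context q_weyl
begin

text \<open>Iterating \<open>Q p = w p * z p + q^2 Q (p - 1)\<close> writes \<open>Q p\<close> in
  the order of factors on which the functional is prescribed.\<close>

lemma Q_wz: "p \<le> n \<Longrightarrow> Q p = (\<Sum>k = 1..p. (q\<^sup>2) ^ (p - k) *\<^sub>C (w k * z k))"
proof (induction p)
  case (Suc p)
  have "Q (Suc p) = w (Suc p) * z (Suc p) + q\<^sup>2 *\<^sub>C Q p"
    using w_mult_z[of "Suc p"] Suc.prems by simp
  also have "q\<^sup>2 *\<^sub>C Q p = (\<Sum>k = 1..p. (q\<^sup>2) ^ (Suc p - k) *\<^sub>C (w k * z k))"
    unfolding Suc.IH[OF Suc_leD[OF Suc.prems]] scaleC_sum_right
    by (rule sum.cong) (auto simp: scaleC_scaleC Suc_diff_le)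
  finally show ?case by (simp add: scaleC_one add.commute)
qed simp

text \<open>The scalars \<open>d s\<close> convert between the ascending basis and the descending
  \<open>z\<close>-monomials of the defining formula; \<open>cut\<close> makes the values depend
  only on the exponents in range.\<close>

lemma ex_integral:
  assumes "zw_free n w z"
  shows "\<exists>H. is_integral n q z w H"
proof -
  have "\<exists>d. \<forall>s. d s \<noteq> 0 \<and> mono_down n z s = d s *\<^sub>C mono_up n z s"
    using zf.mono_down_eq_mono_up[OF order_refl] by (intro choice) blast
  then obtain d where d: "\<And>s. d s \<noteq> 0" "\<And>s. mono_down n z s = d s *\<^sub>C mono_up n z s" by blast
  define F where "F = (\<lambda>(r, s). (if r = s then sphere_weight n (q\<^sup>2) r / d s else 0) *\<^sub>C (1 :: 'a))"
  obtain H where H: "clinear H" "\<And>x. x \<in> exponents n \<times> exponents n \<Longrightarrow> H (case x of (r, s) \<Rightarrow> mono_up n w r * mono_up n z s) = F x"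
    using ex_clinear_on_family[OF assms[unfolded zw_free_def], of F] by blast
  have "H (mono_up n w r * mono_down n z s) = (if \<forall>i\<in>{1..n}. r i = s i then sphere_weight n (q\<^sup>2) r else 0) *\<^sub>C 1" for r s
  proof -
    have "mono_down n z s = mono_down n z (cut n s)" by (rule mono_down_cong) (simp add: cut_def)
    then have "mono_up n w r * mono_down n z s = d (cut n s) *\<^sub>C (mono_up n w (cut n r) * mono_up n z (cut n s))"
      unfolding d(2)[of "cut n s"] by (simp add: mult_scaleC_right)
    then have "H (mono_up n w r * mono_down n z s) = d (cut n s) *\<^sub>C F (cut n r, cut n s)"
      using H(2)[of "(cut n r, cut n s)"] by (simp only: clinear_scale[OF H(1)]) simp
    moreover have "cut n r = cut n s \<longleftrightarrow> (\<forall>i\<in>{1..n}. r i = s i)" by (auto simp: cut_def fun_eq_iff)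
    moreover have "sphere_weight n (q\<^sup>2) (cut n r) = sphere_weight n (q\<^sup>2) r"
      by (rule sphere_weight_cong) (simp add: cut_def)
    ultimately show ?thesis using d(1)[of "cut n s"] by (simp add: F_def scaleC_scaleC)
  qed
  then show ?thesis using H(1) unfolding is_integral_def by blast
qed

lemma span_wz_down:
  assumes "mono_up n w r * mono_down n z s \<in> complex_vector.span B"
  shows "mono_up n w r * mono_up n z s \<in> complex_vector.span B"
proof -
  obtain d where d: "d \<noteq> 0" "mono_down n z s = d *\<^sub>C mono_up n z s"
    using zf.mono_down_eq_mono_up[OF order_refl] by blast
  have "inverse d *\<^sub>C (mono_up n w r * mono_down n z s) \<in> complex_vector.span B"
    by (intro complex_vector.span_scale assms)
  then show ?thesis using d by (simp add: scaleC_mult_simps)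
qed

lemma sub_alg_wz_down: "sub_alg n z w = complex_vector.span {mono_up n w r * mono_down n z s | r s. True}"
proof
  show "sub_alg n z w \<subseteq> complex_vector.span {mono_up n w r * mono_down n z s | r s. True}"
    unfolding sub_alg_eq_wz zw_monos_def
    by (rule complex_vector.span_minimal[OF _ complex_vector.subspace_span])
      (clarify, rule span_wz_down, rule complex_vector.span_base, blast)
  have "mono_up n w r * mono_down n z s \<in> sub_alg n z w" for r s
  proof -
    obtain d where "mono_down n z s = d *\<^sub>C mono_up n z s"
      using zf.mono_down_eq_mono_up[OF order_refl] by blast
    moreover have "d *\<^sub>C (mono_up n w r * mono_up n z s) \<in> sub_alg n z w"
      unfolding sub_alg_eq_wz zw_monos_def by (intro complex_vector.span_scale complex_vector.span_base) blast
    ultimately show ?thesis by (simp add: mult_scaleC_right)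
  qed
  then show "complex_vector.span {mono_up n w r * mono_down n z s | r s. True} \<subseteq> sub_alg n z w"
    by (subst sub_alg_def, intro complex_vector.span_minimal) (auto simp: sub_alg_def)
qed

lemma hom_polys_wz_down:
  "hom_polys n z w a b \<subseteq> complex_vector.span {mono_up n w r * mono_down n z s | r s. sum r {1..n} = b \<and> sum s {1..n} = a}"
  unfolding hom_polys_wz zw_monos_def
  by (rule complex_vector.span_minimal[OF _ complex_vector.subspace_span])
    (clarify, rule span_wz_down, rule complex_vector.span_base, blast)

text \<open>\<open>Q n\<close> is inserted between the two halves, so each term raises the same
  exponent on both sides and does not change whether \<open>r\<close> and \<open>s\<close>
  agree.\<close>

lemma Q_mult_wz_down:
  "Q n * (mono_up n w r * mono_down n z s) = (\<Sum>k = 1..n.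
     ((q\<^sup>2) ^ (n - k) * (q ^ (\<Sum>i\<in>{k<..n}. r i) * q ^ (\<Sum>i\<in>{k<..n}. s i))) *\<^sub>C
       (mono_up n w (r(k := Suc (r k))) * mono_down n z (s(k := Suc (s k)))))"
proof -
  have "Q n * (mono_up n w r * mono_down n z s) = mono_up n w r * Q n * mono_down n z s"
    using Q_mono_up_w[of r] by (simp add: q_commute_def scaleC_one flip: mult.assoc)
  also have "\<dots> = (\<Sum>k = 1..n. (q\<^sup>2) ^ (n - k) *\<^sub>C ((mono_up n w r * w k) * (z k * mono_down n z s)))"
    unfolding Q_wz[OF order_refl]
    by (simp add: sum_distrib_left sum_distrib_right mult_scaleC_left mult_scaleC_right mult.assoc)
  also have "\<dots> = (\<Sum>k = 1..n. ((q\<^sup>2) ^ (n - k) * (q ^ (\<Sum>i\<in>{k<..n}. r i) * q ^ (\<Sum>i\<in>{k<..n}. s i))) *\<^sub>C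
       (mono_up n w (r(k := Suc (r k))) * mono_down n z (s(k := Suc (s k)))))"
  proof (rule sum.cong[OF refl])
    fix k assume k: "k \<in> {1..n}"
    have "mono_up n w r * w k = q ^ (\<Sum>i\<in>{k<..n}. r i) *\<^sub>C mono_up n w (r(k := Suc (r k)))"
      using wf.right_mult_mono_up[OF k order_refl, of r] by (simp add: power_int_minus power_inverse flip: of_nat_sum)
    moreover have "z k * mono_down n z s = q ^ (\<Sum>i\<in>{k<..n}. s i) *\<^sub>C mono_down n z (s(k := Suc (s k)))"
      using zf.left_mult_mono_down[OF k order_refl, of s] by (simp flip: of_nat_sum)
    ultimately show "(q\<^sup>2) ^ (n - k) *\<^sub>C ((mono_up n w r * w k) * (z k * mono_down n z s)) =
      ((q\<^sup>2) ^ (n - k) * (q ^ (\<Sum>i\<in>{k<..n}. r i) * q ^ (\<Sum>i\<in>{k<..n}. s i))) *\<^sub>C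
       (mono_up n w (r(k := Suc (r k))) * mono_down n z (s(k := Suc (s k))))"
      by (simp only: mult_scaleC_left mult_scaleC_right scaleC_scaleC mult_ac)
  qed
  finally show ?thesis .
qed

lemma sphere_weight_upd:
  assumes "k \<in> {1..n}"
  shows "sphere_weight n (q\<^sup>2) (r(k := Suc (r k))) =
    sphere_weight n (q\<^sup>2) r * (1 - (q\<^sup>2) ^ Suc (r k)) / (1 - (q\<^sup>2) ^ (sum r {1..n} + n))"
proof -
  define t where "t = q\<^sup>2"
  have P: "(\<Prod>i = 1..n. qpoch t t ((r(k := Suc (r k))) i)) = (\<Prod>i = 1..n. qpoch t t (r i)) * (1 - t ^ Suc (r k))"
  proof -
    have "(\<Prod>i\<in>{1..n} - {k}. qpoch t t ((r(k := Suc (r k))) i)) = (\<Prod>i\<in>{1..n} - {k}. qpoch t t (r i))"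
      by (rule prod.cong) auto
    then show ?thesis by (simp only: prod.remove[OF finite_atLeastAtMost assms] fun_upd_same qpoch_Suc power_Suc mult_ac)
  qed
  have s: "(\<Sum>i = 1..n. (r(k := Suc (r k))) i) + n - 1 = Suc (sum r {1..n} + n - 1)" "Suc (sum r {1..n} + n - 1) = sum r {1..n} + n"
    using sum_upd_Suc[OF assms, of r] assms by simp_all
  then have "qpoch t t ((\<Sum>i = 1..n. (r(k := Suc (r k))) i) + n - 1) = qpoch t t (sum r {1..n} + n - 1) * (1 - t ^ (sum r {1..n} + n))"
    by (metis qpoch_Suc power_Suc)
  then show ?thesis unfolding sphere_weight_def t_def[symmetric] P by simp
qed

text \<open>Raising exponent \<open>k\<close> multiplies the weight by
  \<open>1 - q^(2(r k + 1))\<close> over a denominator common to all \<open>k\<close>; by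
  \<open>telescope_weights\<close> the numerators add up to that denominator. This identity makes
  the functional descend to the sphere.\<close>

lemma integral_Q:
  assumes n: "n \<ge> 1" and H: "is_integral n q z w H" and x: "x \<in> sub_alg n z w"
  shows "H (Q n * x) = H x"
proof (rule clinear_eq_on_span[of "\<lambda>x. H (Q n * x)" H])
  show H_lin: "clinear H" using H by (simp add: is_integral_def)
  then show "clinear (\<lambda>x. H (Q n * x))" by (rule clinear_comp[OF _ clinear_mult_left[OF clinear_id]])
  show "x \<in> complex_vector.span {mono_up n w r * mono_down n z s | r s. True}" using x sub_alg_wz_down by simp
  fix y assume "y \<in> {mono_up n w r * mono_down n z s | r s. True}"
  then obtain r s where y: "y = mono_up n w r * mono_down n z s" by blast
  have Hm: "H (mono_up n w r * mono_down n z s) = (if \<forall>i\<in>{1..n}. r i = s i then sphere_weight n (q\<^sup>2) r else 0) *\<^sub>C 1" for r s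
    using H by (simp add: is_integral_def)
  define V where "V = sphere_weight n (q\<^sup>2) r"
  define D where "D = 1 - (q\<^sup>2) ^ (sum r {1..n} + n)"
  have D: "D \<noteq> 0" unfolding D_def using n by (intro one_minus_neq_0) simp
  show "H (Q n * y) = H y"
  proof (cases "\<forall>i\<in>{1..n}. r i = s i")
    case True
    have "H (Q n * y) = (\<Sum>k = 1..n. ((q\<^sup>2) ^ (n - k) * (q\<^sup>2) ^ (\<Sum>i\<in>{k<..n}. r i) * (1 - (q\<^sup>2) ^ Suc (r k)) * (V / D)) *\<^sub>C 1)"
      unfolding y Q_mult_wz_down clinear_sum[OF H_lin] clinear_scale[OF H_lin]
    proof (rule sum.cong[OF refl])
      fix k assume k: "k \<in> {1..n}"
      have "(\<Sum>i\<in>{k<..n}. s i) = (\<Sum>i\<in>{k<..n}. r i)" by (rule sum.cong) (use True in auto)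
      then have e: "q ^ (\<Sum>i\<in>{k<..n}. r i) * q ^ (\<Sum>i\<in>{k<..n}. s i) = (q\<^sup>2) ^ (\<Sum>i\<in>{k<..n}. r i)"
        by (simp add: power2_eq_square power_mult_distrib)
      have "H (mono_up n w (r(k := Suc (r k))) * mono_down n z (s(k := Suc (s k)))) = (V * (1 - (q\<^sup>2) ^ Suc (r k)) / D) *\<^sub>C 1"
        unfolding Hm sphere_weight_upd[OF k] V_def D_def using True k by simp
      then show "((q\<^sup>2) ^ (n - k) * (q ^ (\<Sum>i\<in>{k<..n}. r i) * q ^ (\<Sum>i\<in>{k<..n}. s i))) *\<^sub>C
         H (mono_up n w (r(k := Suc (r k))) * mono_down n z (s(k := Suc (s k)))) =
         ((q\<^sup>2) ^ (n - k) * (q\<^sup>2) ^ (\<Sum>i\<in>{k<..n}. r i) * (1 - (q\<^sup>2) ^ Suc (r k)) * (V / D)) *\<^sub>C 1"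
        by (simp add: e scaleC_scaleC mult_ac)
    qed
    also have "\<dots> = ((1 - (q\<^sup>2) ^ (sum r {1..n} + n)) * (V / D)) *\<^sub>C 1"
      by (simp only: complex_vector.scale_sum_left[symmetric] sum_distrib_right[symmetric] telescope_weights)
    also have "\<dots> = H y" using D True by (simp add: y Hm V_def D_def)
    finally show ?thesis .
  next
    case False
    then obtain i where i: "i \<in> {1..n}" "r i \<noteq> s i" by blast
    then have "\<not> (\<forall>j\<in>{1..n}. (r(k := Suc (r k))) j = (s(k := Suc (s k))) j)" for k
      by (auto intro!: bexI[of _ i])
    then show ?thesis using False unfolding y Q_mult_wz_down clinear_sum[OF H_lin] clinear_scale[OF H_lin]
      by (simp only: Hm if_False complex_vector.scale_zero_left complex_vector.scale_zero_right sum.neutral_const)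
  qed
qed

lemma integral_Q_power:
  assumes "n \<ge> 1" "is_integral n q z w H" "x \<in> sub_alg n z w"
  shows "H (Q n ^ k * x) = H x"
proof (induction k)
  case (Suc k)
  have "Q n ^ k \<in> hom_polys n z w k k"
    using hom_polys_power[OF hom_polys_Q[of n n z w], of k] by simp
  then have "Q n ^ k \<in> sub_alg n z w" using hom_polys_subset_sub_alg by blast
  from integral_Q[OF assms(1,2) sub_alg_mult[OF this assms(3)]] show ?case using Suc by (simp add: mult.assoc)
qed simp

lemma integral_weight:
  assumes H: "is_integral n q z w H" and u: "u \<in> words n" and i: "i \<in> {1..n}" "word_weight u i \<noteq> 0"
  shows "H (word_val z w u) = 0"
proof (rule clinear_eq_on_span[of H "\<lambda>x. 0", OF _ clinear_zero _ word_val_in_span_wz[OF u]])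
  show H_lin: "clinear H" using H by (simp add: is_integral_def)
  fix y assume "y \<in> (\<lambda>(s, r). mono_up n w s * mono_up n z r) ` mono_index n (wdeg u) (zdeg u) (\<lambda>i. - word_weight u i)"
  then obtain s r where y: "y = mono_up n w s * mono_up n z r" and "int (s i) - int (r i) = - word_weight u i"
    using i(1) by (auto simp: mono_index_def)
  then have ne: "\<not> (\<forall>i\<in>{1..n}. s i = r i)" using i by (intro notI) auto
  obtain d where d: "d \<noteq> 0" "mono_down n z r = d *\<^sub>C mono_up n z r"
    using zf.mono_down_eq_mono_up[OF order_refl] by blast
  have "H (mono_up n w s * mono_down n z r) = 0"
    using H ne unfolding is_integral_def by (simp only: if_False complex_vector.scale_zero_left)
  then have "d *\<^sub>C H y = 0" unfolding d(2) mult_scaleC_right y clinear_scale[OF H_lin] .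
  then show "H y = 0" using d(1) by simp
qed

end

text \<open>Off the diagonal both sides vanish. On the diagonal a last exponent zero leaves the
  product over the exponents unchanged, so the quotient of the two weights depends only on the
  degree \<open>b\<close>.\<close>

lemma (in q_weyl_step) integral_restrict:
  assumes m: "m \<ge> 1" and H: "is_integral n q z w H" and H': "is_integral m q z w H'" and y: "y \<in> hom_polys m z w b b'"
  shows "H y = ((1 - (q\<^sup>2) ^ m) / (1 - (q\<^sup>2) ^ (b + m))) *\<^sub>C H' y"
proof (rule clinear_eq_on_span[of H "\<lambda>y. ((1 - (q\<^sup>2) ^ m) / (1 - (q\<^sup>2) ^ (b + m))) *\<^sub>C H' y"])
  show "clinear H" "clinear (\<lambda>y. ((1 - (q\<^sup>2) ^ m) / (1 - (q\<^sup>2) ^ (b + m))) *\<^sub>C H' y)"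
    using H H' by (auto simp: is_integral_def intro: clinear_scaleC)
  show "y \<in> complex_vector.span {mono_up m w r * mono_down m z s | r s. sum r {1..m} = b' \<and> sum s {1..m} = b}"
    using y m.hom_polys_wz_down by blast
  fix x assume "x \<in> {mono_up m w r * mono_down m z s | r s. sum r {1..m} = b' \<and> sum s {1..m} = b}"
  then obtain r s where x: "x = mono_up m w r * mono_down m z s" "sum r {1..m} = b'" "sum s {1..m} = b" by blast
  have "x = mono_up n w (r(n := 0)) * mono_down n z (s(n := 0))"
    unfolding n_eq x(1) mono_up_Suc_upd(2) mono_down_Suc_upd(2) by simp
  then have 1: "H x = (if \<forall>i\<in>{1..n}. (r(n := 0)) i = (s(n := 0)) i then sphere_weight n (q\<^sup>2) (r(n := 0)) else 0) *\<^sub>C 1"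
    using H unfolding is_integral_def by blast
  have 2: "(\<forall>i\<in>{1..n}. (r(n := 0)) i = (s(n := 0)) i) \<longleftrightarrow> (\<forall>i\<in>{1..m}. r i = s i)"
    by (auto simp: n_eq)
  have 3: "H' x = (if \<forall>i\<in>{1..m}. r i = s i then sphere_weight m (q\<^sup>2) r else 0) *\<^sub>C 1"
    using H' unfolding is_integral_def x(1) by blast
  show "H x = ((1 - (q\<^sup>2) ^ m) / (1 - (q\<^sup>2) ^ (b + m))) *\<^sub>C H' x"
  proof (cases "\<forall>i\<in>{1..m}. r i = s i")
    case True
    define t where "t = q\<^sup>2"
    have "sum r {1..m} = sum s {1..m}" by (rule sum.cong) (use True in auto)
    then have b: "sum r {1..m} = b" using x by simp
    have P: "(\<Prod>i = 1..n. qpoch t t ((r(n := 0)) i)) = (\<Prod>i = 1..m. qpoch t t (r i))"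
      unfolding n_eq by simp
    have S: "(\<Sum>i = 1..n. (r(n := 0)) i) = b" using b unfolding n_eq by simp
    obtain l where l: "m = Suc l" using m by (cases m) auto
    have nz: "qpoch t t j \<noteq> 0" "1 - t ^ Suc j \<noteq> 0" for j
      using qpoch_base_neq_0 one_minus_neq_0[of "Suc j"] unfolding t_def by auto
    have "sphere_weight n t (r(n := 0)) = (\<Prod>i = 1..m. qpoch t t (r i)) * qpoch t t (Suc l) / qpoch t t (Suc (b + l))"
      unfolding sphere_weight_def P S by (simp add: n_eq l)
    also have "\<dots> = (1 - t ^ m) / (1 - t ^ (b + m)) * sphere_weight m t r"
      unfolding sphere_weight_def b by (simp add: l qpoch_Suc divide_inverse mult_ac)
    finally show ?thesis using True unfolding 1 2 3 t_def by (simp add: scaleC_scaleC)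
  next
    case False
    show ?thesis unfolding 1 2 3 if_not_P[OF False] by simp
  qed
qed

section \<open>The involution\<close>

definition is_star :: "nat \<Rightarrow> (nat \<Rightarrow> 'a::complex_algebra_1) \<Rightarrow> (nat \<Rightarrow> 'a) \<Rightarrow> ('a \<Rightarrow> 'a) \<Rightarrow> bool" where
  "is_star n z w S \<longleftrightarrow> (\<forall>x y. S (x + y) = S x + S y) \<and> (\<forall>c x. S (c *\<^sub>C x) = cnj c *\<^sub>C S x) \<and>
     (\<forall>x y. S (x * y) = S y * S x) \<and> (\<forall>x. S (S x) = x) \<and>
     (\<forall>i\<in>{1..n}. S (z i) = w i \<and> S (w i) = z i)"

text \<open>Only one coordinate of the weight is tracked: blocks are separated by the last variable,
  in which all elements of the smaller algebra have weight zero.\<close>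

definition weight_space :: "nat \<Rightarrow> (nat \<Rightarrow> 'a::complex_algebra_1) \<Rightarrow> (nat \<Rightarrow> 'a) \<Rightarrow> nat \<Rightarrow> int \<Rightarrow> 'a set" where
  "weight_space p z w i e = complex_vector.span (word_val z w ` {u \<in> words p. word_weight u i = e})"

lemma weight_space_mult:
  "x \<in> weight_space p z w i e \<Longrightarrow> y \<in> weight_space p z w i e' \<Longrightarrow> x * y \<in> weight_space p z w i (e + e')"
  unfolding weight_space_def
  by (rule span_mult) (auto simp flip: word_val_plus intro!: complex_vector.span_base imageI)

lemma weight_space_one: "1 \<in> weight_space p z w i 0"
  unfolding weight_space_def by (rule complex_vector.span_base, rule image_eqI[of _ _ "0"]) auto

lemma weight_space_power: "x \<in> weight_space p z w i e \<Longrightarrow> x ^ k \<in> weight_space p z w i (int k * e)"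
proof (induction k)
  case (Suc k)
  from weight_space_mult[OF Suc.prems Suc.IH[OF Suc.prems]] show ?case by (simp add: algebra_simps)
qed (simp add: weight_space_one)

lemma weight_space_z: "i \<in> {1..p} \<Longrightarrow> z i \<in> weight_space p z w i 1"
  and weight_space_w: "i \<in> {1..p} \<Longrightarrow> w i \<in> weight_space p z w i (- 1)"
  unfolding weight_space_def
  by (rule complex_vector.span_base, rule image_eqI[of _ _ "Free_Word [GZ i]"]; simp add: word_val_Cons)
     (rule complex_vector.span_base, rule image_eqI[of _ _ "Free_Word [GW i]"]; simp add: word_val_Cons)

lemma sub_alg_weight_space: "sub_alg m z w \<subseteq> weight_space (Suc m) z w (Suc m) 0"
proof -
  have "u \<in> words (Suc m) \<and> word_weight u (Suc m) = 0" if "u \<in> words m" for u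
  proof -
    have "GZ (Suc m) \<notin> set (letters u)" "GW (Suc m) \<notin> set (letters u)"
      using that by (auto simp: words_def gens_def)
    then show ?thesis using that words_mono[of m "Suc m"] by (auto simp: word_weight_def count_list_0_iff)
  qed
  then show ?thesis unfolding sub_alg_def weight_space_def by (intro complex_vector.span_mono) auto
qed

context
  fixes n :: nat and z w :: "nat \<Rightarrow> 'a::complex_algebra_1" and S :: "'a \<Rightarrow> 'a"
  assumes star: "is_star n z w S"
begin

lemma star_add: "S (x + y) = S x + S y" and star_scale: "S (c *\<^sub>C x) = cnj c *\<^sub>C S x"
  and star_mult: "S (x * y) = S y * S x" and star_star: "S (S x) = x"
  and star_z: "i \<in> {1..n} \<Longrightarrow> S (z i) = w i" and star_w: "i \<in> {1..n} \<Longrightarrow> S (w i) = z i"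
  using star unfolding is_star_def by blast+

lemma star_zero: "S 0 = 0"
  using star_scale[of 0 0] by simp

lemma star_one: "S 1 = 1"
  using star_mult[of "S 1" 1] by (simp add: star_star)

lemma star_power: "S (x ^ k) = S x ^ k"
  by (induction k) (simp_all add: star_one star_mult power_commutes)

lemma star_sum: "S (sum f A) = (\<Sum>i\<in>A. S (f i))"
  by (induction A rule: infinite_finite_induct) (simp_all add: star_zero star_add)

lemma star_Qpoly: "p \<le> n \<Longrightarrow> S (Qpoly z w p) = Qpoly z w p"
  unfolding Qpoly_def star_sum by (rule sum.cong) (simp_all add: star_mult star_z star_w)

lemma star_span:
  assumes "\<And>b. b \<in> B \<Longrightarrow> S b \<in> complex_vector.span C" "x \<in> complex_vector.span B"
  shows "S x \<in> complex_vector.span C"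
  using assms(2)
  by (induction rule: complex_vector.span_induct_alt)
     (simp_all add: star_zero star_add star_scale assms(1) complex_vector.span_zero complex_vector.span_add
       complex_vector.span_scale)

lemma star_word:
  assumes p: "p \<le> n"
  shows "Free_Word gs \<in> words p \<Longrightarrow> \<exists>v\<in>words p. S (word_val z w (Free_Word gs)) = word_val z w v \<and>
    zdeg v = wdeg (Free_Word gs) \<and> wdeg v = zdeg (Free_Word gs) \<and> (\<forall>i. word_weight v i = - word_weight (Free_Word gs) i)"
proof (induction gs)
  case Nil
  then show ?case by (intro bexI[of _ 0]) (simp_all add: star_one)
next
  case (Cons g gs)
  then obtain v where v: "v \<in> words p" "S (word_val z w (Free_Word gs)) = word_val z w v" "zdeg v = wdeg (Free_Word gs)"
    "wdeg v = zdeg (Free_Word gs)" "\<And>i. word_weight v i = - word_weight (Free_Word gs) i" by auto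
  show ?case
  proof (cases g)
    case (GZ j)
    then show ?thesis using Cons.prems v p
      by (intro bexI[of _ "v + Free_Word [GW j]"]) (simp_all add: word_val_Cons word_val_plus star_mult star_z)
  next
    case (GW j)
    then show ?thesis using Cons.prems v p
      by (intro bexI[of _ "v + Free_Word [GZ j]"]) (simp_all add: word_val_Cons word_val_plus star_mult star_w)
  qed
qed

lemma star_word_val:
  assumes "p \<le> n" "u \<in> words p"
  obtains v where "v \<in> words p" "S (word_val z w u) = word_val z w v"
    "zdeg v = wdeg u" "wdeg v = zdeg u" "\<forall>i. word_weight v i = - word_weight u i"
  using star_word[OF assms(1), of "letters u"] assms(2) by auto

lemma star_hom_polys:
  assumes "p \<le> n" "x \<in> hom_polys p z w a b"
  shows "S x \<in> hom_polys p z w b a"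
  using assms(2) unfolding hom_polys_eq
proof (rule star_span[rotated])
  fix y assume "y \<in> word_val z w ` {u \<in> words p. zdeg u = a \<and> wdeg u = b}"
  then obtain u where u: "u \<in> words p" "y = word_val z w u" "zdeg u = a" "wdeg u = b" by blast
  show "S y \<in> complex_vector.span (word_val z w ` {u \<in> words p. zdeg u = b \<and> wdeg u = a})"
  proof -
    obtain v where v: "v \<in> words p" "S (word_val z w u) = word_val z w v" "zdeg v = wdeg u" "wdeg v = zdeg u"
      "\<forall>i. word_weight v i = - word_weight u i" using star_word_val[OF assms(1) u(1)] .
    show ?thesis unfolding u(2) v(2)
      by (intro complex_vector.span_base imageI) (use u v in simp)
  qed
qed

lemma star_weight_space:
  assumes "p \<le> n" "x \<in> weight_space p z w i e"
  shows "S x \<in> weight_space p z w i (- e)"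
  using assms(2) unfolding weight_space_def
proof (rule star_span[rotated])
  fix y assume "y \<in> word_val z w ` {u \<in> words p. word_weight u i = e}"
  then obtain u where u: "u \<in> words p" "y = word_val z w u" "word_weight u i = e" by blast
  show "S y \<in> complex_vector.span (word_val z w ` {u \<in> words p. word_weight u i = - e})"
  proof -
    obtain v where v: "v \<in> words p" "S (word_val z w u) = word_val z w v" "zdeg v = wdeg u" "wdeg v = zdeg u"
      "\<forall>i. word_weight v i = - word_weight u i" using star_word_val[OF assms(1) u(1)] .
    show ?thesis unfolding u(2) v(2)
      by (intro complex_vector.span_base imageI) (use u v in simp)
  qed
qed

end

lemma (in q_weyl) integral_weight_space:
  assumes H: "is_integral n q z w H" and x: "x \<in> weight_space n z w i e" and i: "i \<in> {1..n}" "e \<noteq> 0"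
  shows "H x = 0"
proof (rule clinear_eq_on_span[of H "\<lambda>x. 0", OF _ clinear_zero _ x[unfolded weight_space_def]])
  show "clinear H" using H by (simp add: is_integral_def)
  fix y assume "y \<in> word_val z w ` {u \<in> words n. word_weight u i = e}"
  then show "H y = 0" using integral_weight[OF H _ i(1)] i(2) by auto
qed

lemma cnj_phi_coeff:
  assumes "cnj q = q"
  shows "cnj (phi_coeff q N r \<beta> k) = phi_coeff q N r \<beta> k"
  by (simp only: phi_coeff_def phi21_coeff_def qpoch_def complex_cnj_mult complex_cnj_divide complex_cnj_power
    complex_cnj_power_int cnj_prod complex_cnj_diff complex_cnj_one assms)

section \<open>Orthogonality\<close>

text \<open>The weight of a block in the last coordinate. The arguments \<open>True 0\<close> and
  \<open>False 0\<close> give the same value and, by \<open>block_weight_eq\<close>, the same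
  block.\<close>

definition block_weight :: "bool \<Rightarrow> nat \<Rightarrow> int" where
  "block_weight sg r = (if sg then int r else - int r)"

text \<open>\<open>H\<close> and \<open>H'\<close> are the functionals for \<open>n\<close> and for
  \<open>m\<close> pairs; the moments below express the first through the second.\<close>

locale q_weyl_orth = q_weyl_step +
  fixes S H H'
  assumes m1: "m \<ge> 1" and q_real: "cnj q = q" and star: "is_star n z w S"
    and H: "is_integral n q z w H" and H': "is_integral m q z w H'"
begin

lemma H_lin: "clinear H" and H'_lin: "clinear H'"
  using H H' by (simp_all add: is_integral_def)

lemma sub_m_n: "x \<in> sub_alg m z w \<Longrightarrow> x \<in> sub_alg n z w"
  using sub_alg_mono[of m n z w] n_eq by auto

lemma star_sub_m: "x \<in> hom_polys m z w b b' \<Longrightarrow> S x \<in> hom_polys m z w b' b"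
  using star_hom_polys[OF star] n_eq by simp

lemma Q_power_comm_m: "x \<in> sub_alg m z w \<Longrightarrow> x * Q m ^ k = Q m ^ k * x"
proof -
  assume "x \<in> sub_alg m z w"
  from q_commute_power_left[OF m.Q_central[OF this], of k] show ?thesis by (simp add: q_commute_def scaleC_one)
qed

lemma H_Q: "x \<in> sub_alg n z w \<Longrightarrow> H (Q n * x) = H x"
  using integral_Q[OF _ H] n_eq by simp

lemma in_sub:
  "Q m ^ k \<in> sub_alg n z w" "z n ^ r \<in> sub_alg n z w" "w n ^ r \<in> sub_alg n z w" "Q m ^ k \<in> sub_alg m z w" "Q n ^ k \<in> sub_alg n z w"
  using hom_Q_power_m hom_z_power hom_w_power hom_Q_power hom_polys_subset_sub_alg sub_m_n by blast+

lemma wz_last: "w n * z n = Q n - q\<^sup>2 *\<^sub>C Q m" and zw_last: "z n * w n = Q n - Q m"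
  using w_mult_z[of n] z_mult_w[of n] n_eq by simp_all

definition P where "P s e = qpoch ((q\<^sup>2) ^ e) (q\<^sup>2) (Suc s)"

text \<open>Splitting off the last or the first factor puts two neighbouring denominators over a
  common one, which is what the moment recursions need.\<close>

lemma P_Suc:
  assumes "e \<ge> 1"
  shows "inverse (P s e) = (1 - (q\<^sup>2) ^ (e + Suc s)) * inverse (P (Suc s) e)"
    "inverse (P s (Suc e)) = (1 - (q\<^sup>2) ^ e) * inverse (P (Suc s) e)"
proof -
  have 1: "P (Suc s) e = P s e * (1 - (q\<^sup>2) ^ (e + Suc s))"
    unfolding P_def qpoch_Suc[of _ _ "Suc s"] power_add by simp
  have "P (Suc s) e = qpoch ((q\<^sup>2) ^ e) (q\<^sup>2) (1 + Suc s)" by (simp add: P_def)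
  also have "\<dots> = (1 - (q\<^sup>2) ^ e) * P s (Suc e)"
    unfolding qpoch_add P_def by (simp add: qpoch_def mult.commute)
  finally have 2: "P (Suc s) e = (1 - (q\<^sup>2) ^ e) * P s (Suc e)" .
  show "inverse (P s e) = (1 - (q\<^sup>2) ^ (e + Suc s)) * inverse (P (Suc s) e)"
    unfolding 1 using one_minus_neq_0[of "e + Suc s"] by simp
  show "inverse (P s (Suc e)) = (1 - (q\<^sup>2) ^ e) * inverse (P (Suc s) e)"
    unfolding 2 using one_minus_neq_0[OF assms] by simp
qed

text \<open>Passing to \<open>m\<close> pairs records the degree \<open>i + b\<close>, after which
  \<open>H'\<close> no longer sees the power of \<open>Q m\<close>.\<close>

lemma moment_base:
  assumes Z: "Z \<in> hom_polys m z w b b'"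
  shows "H (Q m ^ i * Z) = ((1 - (q\<^sup>2) ^ m) * inverse (P 0 (i + (b + m)))) *\<^sub>C H' Z"
proof -
  have "Q m ^ i * Z \<in> hom_polys m z w (i + b) (i + b')" by (intro hom_polys_mult hom_Q_power_m Z)
  from integral_restrict[OF m1 H H' this] show ?thesis
    using m.integral_Q_power[OF m1 H' hom_m_sub[OF Z], of i] by (simp add: P_def qpoch_Suc divide_inverse add.assoc)
qed

text \<open>The innermost \<open>w n * Z * z n\<close> is a multiple of
  \<open>Z * (Q n - q^2 Q m)\<close>; under \<open>H\<close> the factor \<open>Q n\<close>
  disappears and \<open>Q m\<close> raises \<open>i\<close>. With \<open>t = q^2\<close> the
  recursion closes because \<open>(1 - t^(e+s+1)) - t^(s+1) (1 - t^e) = 1 - t^(s+1)\<close> is free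
  of \<open>i\<close>.\<close>

lemma moment_w:
  assumes Z: "Z \<in> hom_polys m z w b b'"
  shows "\<exists>c. \<forall>i. H (Q m ^ i * (w n ^ s * Z * z n ^ s)) = (c * inverse (P s (i + (b + m)))) *\<^sub>C H' Z"
proof (induction s)
  case 0
  then show ?case using moment_base[OF Z] by auto
next
  case (Suc s)
  then obtain c where c: "\<And>i. H (Q m ^ i * (w n ^ s * Z * z n ^ s)) = (c * inverse (P s (i + (b + m)))) *\<^sub>C H' Z" by blast
  define X where "X = w n ^ s * Z * z n ^ s"
  have Zs: "Z \<in> sub_alg m z w" by (rule hom_m_sub[OF Z])
  have X: "X \<in> sub_alg n z w" unfolding X_def by (intro sub_alg_mult in_sub sub_m_n Zs)
  have wZ: "w n * Z = q ^ (b + b') *\<^sub>C (Z * w n)" using last_hom(2)[OF n_eq Z] by (simp add: q_commute_def)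
  have QX: "w n ^ s * (Z * Q n) * z n ^ s = Q n * X"
  proof -
    have "w n ^ s * (Z * Q n) * z n ^ s = (w n ^ s * Z) * Q n * z n ^ s" by (simp only: mult.assoc)
    also have "(w n ^ s * Z) * Q n = Q n * (w n ^ s * Z)" by (rule Q_comm[symmetric]) (intro sub_alg_mult in_sub sub_m_n Zs)
    finally show ?thesis by (simp only: X_def mult.assoc)
  qed
  have QmX: "w n ^ s * (Z * Q m) * z n ^ s = (q\<^sup>2) ^ s *\<^sub>C (Q m * X)"
  proof -
    have "w n ^ s * Q m = (q\<^sup>2) ^ s *\<^sub>C (Q m * w n ^ s)"
      using q_commute_power_left[OF w_Q_less[of m n], of s] n_eq by (simp add: q_commute_def)
    moreover have "w n ^ s * (Z * Q m) * z n ^ s = w n ^ s * Q m * Z * z n ^ s"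
      using Q_power_comm_m[OF Zs, of 1] by (simp only: power_one_right mult.assoc)
    ultimately show ?thesis by (simp only: X_def mult_scaleC_left mult.assoc)
  qed
  have "w n ^ Suc s * Z * z n ^ Suc s = w n ^ s * (w n * Z * z n) * z n ^ s"
    by (simp only: power_Suc2[of "w n"] power_Suc[of "z n"] mult.assoc)
  also have "w n * Z * z n = q ^ (b + b') *\<^sub>C (Z * Q n - q\<^sup>2 *\<^sub>C (Z * Q m))"
    unfolding wZ mult_scaleC_left mult.assoc wz_last by (simp add: right_diff_distrib mult_scaleC_right)
  also have "w n ^ s * \<dots> * z n ^ s = q ^ (b + b') *\<^sub>C (Q n * X - ((q\<^sup>2) ^ Suc s) *\<^sub>C (Q m * X))"
    using QX QmX by (simp add: mult_scaleC_left mult_scaleC_right right_diff_distrib left_diff_distrib scaleC_scaleC)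
  finally have eq: "w n ^ Suc s * Z * z n ^ Suc s = q ^ (b + b') *\<^sub>C (Q n * X - ((q\<^sup>2) ^ Suc s) *\<^sub>C (Q m * X))" .
  have "H (Q m ^ i * (w n ^ Suc s * Z * z n ^ Suc s)) =
     (q ^ (b + b') * c * (1 - (q\<^sup>2) ^ Suc s) * inverse (P (Suc s) (i + (b + m)))) *\<^sub>C H' Z" for i
  proof -
    have "Q m ^ i * (Q n * X) = Q n * (Q m ^ i * X)"
      using Q_comm[OF in_sub(1)[of i]] by (simp flip: mult.assoc)
    then have "Q m ^ i * (w n ^ Suc s * Z * z n ^ Suc s) =
       q ^ (b + b') *\<^sub>C (Q n * (Q m ^ i * X) - ((q\<^sup>2) ^ Suc s) *\<^sub>C (Q m ^ Suc i * X))"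
      unfolding eq mult_scaleC_right right_diff_distrib by (simp only: power_Suc2 mult.assoc)
    then have "H (Q m ^ i * (w n ^ Suc s * Z * z n ^ Suc s)) =
       q ^ (b + b') *\<^sub>C (H (Q m ^ i * X) - ((q\<^sup>2) ^ Suc s) *\<^sub>C H (Q m ^ Suc i * X))"
      using H_Q[OF sub_alg_mult[OF in_sub(1) X], of i]
      by (simp only: clinear_scale[OF H_lin] clinear_diff[OF H_lin])
    also have "\<dots> = (q ^ (b + b') * (c * inverse (P s (i + (b + m))) - (q\<^sup>2) ^ Suc s * (c * inverse (P s (Suc i + (b + m)))))) *\<^sub>C H' Z"
      unfolding c[folded X_def] by (simp only: scaleC_scaleC complex_vector.scale_left_diff_distrib scaleC_diff_right mult.assoc right_diff_distrib)
    also have "c * inverse (P s (i + (b + m))) - (q\<^sup>2) ^ Suc s * (c * inverse (P s (Suc i + (b + m)))) =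
       c * (1 - (q\<^sup>2) ^ Suc s) * inverse (P (Suc s) (i + (b + m)))"
    proof -
      have "i + (b + m) \<ge> 1" using m1 by simp
      note p = P_Suc[OF this, of s]
      show ?thesis unfolding add_Suc p by (simp only: power_add) (simp add: algebra_simps)
    qed
    finally show ?thesis by (simp only: mult.assoc)
  qed
  then show ?case by blast
qed

text \<open>The inner factor is now \<open>Q n - Q m\<close>, and the difference of neighbouring
  terms carries \<open>t^e\<close> with \<open>t = q^2\<close> and \<open>e = i + b + m\<close>. Its
  part \<open>t^i\<close> is cancelled by the scalar from moving \<open>z n\<close> past
  \<open>Q m ^ i * Z\<close>.\<close>

lemma moment_z:
  assumes Z: "Z \<in> hom_polys m z w b b'"
  shows "\<exists>c. \<forall>i. H (z n ^ s * (Q m ^ i * Z) * w n ^ s) = (c * inverse (P s (i + (b + m)))) *\<^sub>C H' Z"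
proof (induction s)
  case 0
  then show ?case using moment_base[OF Z] by auto
next
  case (Suc s)
  then obtain c where c: "\<And>i. H (z n ^ s * (Q m ^ i * Z) * w n ^ s) = (c * inverse (P s (i + (b + m)))) *\<^sub>C H' Z" by blast
  have Zs: "Z \<in> sub_alg m z w" by (rule hom_m_sub[OF Z])
  have "H (z n ^ Suc s * (Q m ^ i * Z) * w n ^ Suc s) =
     (inverse q ^ (b + b') * (q\<^sup>2) ^ (b + m) * c * (1 - (q\<^sup>2) ^ Suc s) * inverse (P (Suc s) (i + (b + m)))) *\<^sub>C H' Z" for i
  proof -
    define Y where "Y = Q m ^ i * Z"
    define D where "D = i + b + (i + b')"
    have Y: "Y \<in> hom_polys m z w (i + b) (i + b')" unfolding Y_def by (intro hom_polys_mult hom_Q_power_m Z)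
    have Ys: "Y \<in> sub_alg m z w" by (rule hom_m_sub[OF Y])
    have zY: "z n * Y = inverse q ^ D *\<^sub>C (Y * z n)" using last_hom(1)[OF n_eq Y] by (simp add: q_commute_def D_def)
    have zyw: "z n ^ s * Y * w n ^ s \<in> sub_alg n z w" by (intro sub_alg_mult in_sub sub_m_n Ys)
    have QX: "z n ^ s * (Y * Q n) * w n ^ s = Q n * (z n ^ s * Y * w n ^ s)"
    proof -
      have "z n ^ s * (Y * Q n) * w n ^ s = (z n ^ s * Y) * Q n * w n ^ s" by (simp only: mult.assoc)
      also have "(z n ^ s * Y) * Q n = Q n * (z n ^ s * Y)" by (rule Q_comm[symmetric]) (intro sub_alg_mult in_sub sub_m_n Ys)
      finally show ?thesis by (simp only: mult.assoc)
    qed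
    have YQ: "Y * Q m = Q m ^ Suc i * Z"
      using Q_power_comm_m[OF Ys, of 1] by (simp add: Y_def mult.assoc)
    have "z n ^ Suc s * Y * w n ^ Suc s = z n ^ s * (z n * Y * w n) * w n ^ s"
      by (simp only: power_Suc2[of "z n"] power_Suc[of "w n"] mult.assoc)
    also have "z n * Y * w n = inverse q ^ D *\<^sub>C (Y * Q n - Y * Q m)"
      unfolding zY mult_scaleC_left mult.assoc zw_last by (simp add: right_diff_distrib)
    also have "z n ^ s * \<dots> * w n ^ s = inverse q ^ D *\<^sub>C (Q n * (z n ^ s * Y * w n ^ s) - z n ^ s * (Q m ^ Suc i * Z) * w n ^ s)"
      using QX unfolding YQ by (simp add: mult_scaleC_left mult_scaleC_right right_diff_distrib left_diff_distrib)
    finally have "H (z n ^ Suc s * Y * w n ^ Suc s) =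
      inverse q ^ D *\<^sub>C (H (z n ^ s * Y * w n ^ s) - H (z n ^ s * (Q m ^ Suc i * Z) * w n ^ s))"
      using H_Q[OF zyw] by (simp only: clinear_scale[OF H_lin] clinear_diff[OF H_lin])
    also have "\<dots> = (inverse q ^ D * (c * inverse (P s (i + (b + m))) - c * inverse (P s (Suc i + (b + m))))) *\<^sub>C H' Z"
      unfolding Y_def c by (simp only: scaleC_scaleC complex_vector.scale_left_diff_distrib scaleC_diff_right mult.assoc right_diff_distrib)
    also have "c * inverse (P s (i + (b + m))) - c * inverse (P s (Suc i + (b + m))) =
       (q\<^sup>2) ^ i * ((q\<^sup>2) ^ (b + m) * c * (1 - (q\<^sup>2) ^ Suc s) * inverse (P (Suc s) (i + (b + m))))"
    proof -
      have "i + (b + m) \<ge> 1" using m1 by simp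
      note p = P_Suc[OF this, of s]
      show ?thesis unfolding add_Suc p by (simp only: power_add) (simp add: algebra_simps)
    qed
    also have "inverse q ^ D * ((q\<^sup>2) ^ i * X) = inverse q ^ (b + b') * X" for X
    proof -
      have "inverse q ^ D = inverse q ^ (b + b') * inverse ((q\<^sup>2) ^ i)"
        by (simp add: D_def power_add power_inverse power_mult power2_eq_square power_mult_distrib)
      then show ?thesis using q0 by simp
    qed
    finally show ?thesis unfolding Y_def by (simp only: mult.assoc)
  qed
  then show ?case by blast
qed

lemma star_block:
  "S (block True r k y) = S y * Q m ^ k * w n ^ r" "S (block False r k y) = S y * z n ^ r * Q m ^ k"
proof -
  have n: "n \<in> {1..n}" "m \<le> n" using n_eq by auto
  show "S (block True r k y) = S y * Q m ^ k * w n ^ r" "S (block False r k y) = S y * z n ^ r * Q m ^ k"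
    by (simp_all only: block_simps star_mult[OF star] star_power[OF star] star_z[OF star n(1)] star_w[OF star n(1)]
      star_Qpoly[OF star n(2)] mult.assoc)
qed

text \<open>The indices enter only through \<open>k + l\<close>, because \<open>Q m\<close> commutes
  with the elements between its two powers. The blocks thus pair like the powers of a variable under
  a moment functional.\<close>

lemma block_pair:
  assumes Y: "Y \<in> hom_polys m z w b b'" and Y': "Y' \<in> hom_polys m z w e e'"
  shows "\<exists>c. \<forall>k l. H (block sg r k Y * S (block sg r l Y')) = (c * inverse (P r (k + l + (b + e' + m)))) *\<^sub>C H' (Y * S Y')"
proof -
  define Z where "Z = Y * S Y'"
  have Z: "Z \<in> hom_polys m z w (b + e') (b' + e)" unfolding Z_def by (intro hom_polys_mult Y star_sub_m Y')
  have Zs: "Z \<in> sub_alg m z w" by (rule hom_m_sub[OF Z])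
  show ?thesis
  proof (cases sg)
    case True
    obtain c where c: "\<And>i. H (z n ^ r * (Q m ^ i * Z) * w n ^ r) = (c * inverse (P r (i + (b + e' + m)))) *\<^sub>C H' Z"
      using moment_z[OF Z] by blast
    have "block True r k Y * S (block True r l Y') = z n ^ r * (Q m ^ (k + l) * Z) * w n ^ r" for k l
    proof -
      have "block True r k Y * S (block True r l Y') = z n ^ r * (Q m ^ k * (Z * Q m ^ l)) * w n ^ r"
        unfolding star_block by (simp only: block_simps Z_def mult.assoc)
      then show ?thesis unfolding Q_power_comm_m[OF Zs] by (simp only: power_add mult.assoc)
    qed
    then show ?thesis using True c unfolding Z_def by auto
  next
    case False
    obtain c where c: "\<And>i. H (Q m ^ i * (w n ^ r * Z * z n ^ r)) = (c * inverse (P r (i + (b + e' + m)))) *\<^sub>C H' Z"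
      using moment_w[OF Z] by blast
    have qz: "q_commute ((q\<^sup>2) ^ r) (Q m) (z n ^ r)" and qw: "q_commute (inverse ((q\<^sup>2) ^ r)) (Q m) (w n ^ r)"
      using q_commute_power_right[OF Q_z_less[of m n], of r] q_commute_sym[OF q_commute_power_left[OF w_Q_less[of m n], of r]] n_eq q0
      by simp_all
    have "q_commute 1 (Q m) (w n ^ r * Z * z n ^ r)"
      by (rule q_commute_mult_right'[OF q_commute_mult_right[OF qw m.Q_central[OF Zs]] qz]) (use q0 in simp)
    from q_commute_power_left[OF this] have comm: "w n ^ r * Z * z n ^ r * Q m ^ l = Q m ^ l * (w n ^ r * Z * z n ^ r)" for l
      by (simp add: q_commute_def scaleC_one)
    have "block False r k Y * S (block False r l Y') = Q m ^ (k + l) * (w n ^ r * Z * z n ^ r)" for k l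
    proof -
      have "block False r k Y * S (block False r l Y') = Q m ^ k * (w n ^ r * Z * z n ^ r * Q m ^ l)"
        unfolding star_block by (simp only: block_simps Z_def mult.assoc)
      then show ?thesis unfolding comm by (simp only: power_add mult.assoc)
    qed
    then show ?thesis using False c unfolding Z_def by auto
  qed
qed

lemma block_weight_space:
  assumes "Y \<in> sub_alg m z w"
  shows "block sg r k Y \<in> weight_space n z w n (block_weight sg r)"
proof -
  have sub: "x \<in> weight_space n z w n 0" if "x \<in> sub_alg m z w" for x
    using sub_alg_weight_space[of m z w] that n_eq by auto
  have zr: "z n ^ r \<in> weight_space n z w n (int r)" and wr: "w n ^ r \<in> weight_space n z w n (- int r)"
    using weight_space_power[OF weight_space_z[of n n z w], of r] weight_space_power[OF weight_space_w[of n n w z], of r] n_eq by simp_all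
  show ?thesis
  proof (cases sg)
    case True
    have "z n ^ r * (Q m ^ k * Y) \<in> weight_space n z w n (int r + (0 + 0))"
      by (intro weight_space_mult zr sub in_sub assms)
    then show ?thesis using True by (simp add: block_simps block_weight_def)
  next
    case False
    have "Q m ^ k * (w n ^ r * Y) \<in> weight_space n z w n (0 + (- int r + 0))"
      by (intro weight_space_mult wr sub in_sub assms)
    then show ?thesis using False by (simp add: block_simps block_weight_def)
  qed
qed

lemma block_pair_weight:
  assumes "Y \<in> sub_alg m z w" "Y' \<in> sub_alg m z w" "block_weight sg r \<noteq> block_weight sg' r'"
  shows "H (block sg r k Y * S (block sg' r' l Y')) = 0"
  by (rule integral_weight_space[OF H weight_space_mult[OF block_weight_space[OF assms(1)]
        star_weight_space[OF star order_refl block_weight_space[OF assms(2)]]]])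
     (use assms(3) n_eq in auto)

lemma block_weight_eq:
  assumes "block_weight sg r = block_weight sg' r'"
  shows "r = r'" "block sg' r' k y = block sg r k y"
proof -
  show r: "r = r'" using assms by (auto simp: block_weight_def split: if_splits)
  have "block True 0 k y = block False 0 k y" by (simp add: block_simps)
  moreover have "sg = sg' \<or> r = 0" using assms by (auto simp: block_weight_def split: if_splits)
  ultimately show "block sg' r' k y = block sg r k y" using r by (cases sg; cases sg') auto
qed

definition block_sum :: "bool \<Rightarrow> nat \<Rightarrow> nat \<Rightarrow> nat \<Rightarrow> 'a \<Rightarrow> 'a" where
  "block_sum sg N r \<beta> Y = (\<Sum>k\<le>N. phi_coeff q N r \<beta> k *\<^sub>C (Q n ^ (N - k) * block sg r k Y))"

text \<open>\<open>Q n\<close> is central, self-adjoint and invisible to \<open>H\<close>, so its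
  powers drop out and only the pairings of blocks remain.\<close>

lemma block_sum_pair:
  assumes "Y \<in> hom_polys m z w b b'" "Y' \<in> hom_polys m z w e e'"
  shows "H (block_sum sg N r \<beta> Y * S (block_sum sg' N' r' \<beta>' Y')) =
    (\<Sum>k\<le>N. \<Sum>l\<le>N'. (phi_coeff q N r \<beta> k * phi_coeff q N' r' \<beta>' l) *\<^sub>C H (block sg r k Y * S (block sg' r' l Y')))"
proof -
  have sQ: "S (Q n) = Q n" by (rule star_Qpoly[OF star order_refl])
  have "S (block_sum sg' N' r' \<beta>' Y') = (\<Sum>l\<le>N'. phi_coeff q N' r' \<beta>' l *\<^sub>C (S (block sg' r' l Y') * Q n ^ (N' - l)))"
    by (simp only: block_sum_def star_sum[OF star] star_scale[OF star] star_mult[OF star] star_power[OF star] sQ cnj_phi_coeff[OF q_real])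
  then have "H (block_sum sg N r \<beta> Y * S (block_sum sg' N' r' \<beta>' Y')) =
    (\<Sum>k\<le>N. \<Sum>l\<le>N'. (phi_coeff q N r \<beta> k * phi_coeff q N' r' \<beta>' l) *\<^sub>C
       H (Q n ^ (N - k) * block sg r k Y * (S (block sg' r' l Y') * Q n ^ (N' - l))))"
    by (simp only: block_sum_def sum_product clinear_sum[OF H_lin] mult_scaleC_left mult_scaleC_right scaleC_scaleC clinear_scale[OF H_lin])
       (simp only: mult.commute[of "phi_coeff q N r \<beta> _"])
  moreover have "H (Q n ^ (N - k) * block sg r k Y * (S (block sg' r' l Y') * Q n ^ (N' - l))) = H (block sg r k Y * S (block sg' r' l Y'))" for k l
  proof -
    define B where "B = block sg r k Y * S (block sg' r' l Y')"
    have "block sg r k Y \<in> sub_alg n z w" "S (block sg' r' l Y') \<in> sub_alg n z w"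
      using block_hom[OF assms(1)] star_hom_polys[OF star order_refl block_hom[OF assms(2)]] hom_polys_subset_sub_alg by blast+
    then have B: "B \<in> sub_alg n z w" unfolding B_def by (rule sub_alg_mult)
    have "Q n ^ j * B = B * Q n ^ j" for j
      using q_commute_power_left[OF Q_central[OF B], of j] by (simp add: q_commute_def scaleC_one)
    then have "Q n ^ (N - k) * block sg r k Y * (S (block sg' r' l Y') * Q n ^ (N' - l)) = Q n ^ (N - k) * (Q n ^ (N' - l) * B)"
      by (simp only: B_def mult.assoc)
    then show ?thesis
      using integral_Q_power[OF _ H B] integral_Q_power[OF _ H sub_alg_mult[OF in_sub(5) B]] n_eq by (simp add: B_def)
  qed
  ultimately show ?thesis by simp
qed

lemma block_sum_orthogonal:
  assumes Y: "Y \<in> hom_polys m z w b b'" and Y': "Y' \<in> hom_polys m z w e e'"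
    and cases: "block_weight sg r = block_weight sg' r' \<Longrightarrow>
      H' (Y * S Y') = 0 \<or> (N \<noteq> N' \<and> \<beta> = b + e' + m \<and> \<beta>' = b + e' + m)"
  shows "H (block_sum sg N r \<beta> Y * S (block_sum sg' N' r' \<beta>' Y')) = 0"
proof (cases "block_weight sg r = block_weight sg' r'")
  case False
  then show ?thesis
    unfolding block_sum_pair[OF Y Y'] by (simp add: block_pair_weight[OF hom_m_sub[OF Y] hom_m_sub[OF Y']])
next
  case True
  note eq = block_weight_eq[OF True]
  obtain c where c: "\<And>k l. H (block sg r k Y * S (block sg r l Y')) = (c * inverse (P r (k + l + (b + e' + m)))) *\<^sub>C H' (Y * S Y')"
    using block_pair[OF Y Y'] by blast
  define f where "f k l = phi_coeff q N r \<beta> k * phi_coeff q N' r \<beta>' l * (c * inverse (P r (k + l + (b + e' + m))))" for k l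
  have "H (block_sum sg N r \<beta> Y * S (block_sum sg' N' r' \<beta>' Y')) = (\<Sum>k\<le>N. \<Sum>l\<le>N'. f k l) *\<^sub>C H' (Y * S Y')"
    unfolding block_sum_pair[OF Y Y'] eq(2) unfolding c eq(1)[symmetric] f_def
    by (simp only: scaleC_scaleC complex_vector.scale_sum_left)
  moreover have "(\<Sum>k\<le>N. \<Sum>l\<le>N'. f k l) = 0" if h: "N \<noteq> N'" "\<beta> = b + e' + m" "\<beta>' = b + e' + m"
  proof -
    have \<beta>: "b + e' + m \<ge> 1" using m1 by simp
    have orth: "(\<Sum>k\<le>M. phi_coeff q M r (b + e' + m) k * inverse (P r (k + i + (b + e' + m)))) = 0" if "i < M" for i M
      using phi_coeff_orthogonal[OF that \<beta>, of r] by (simp add: P_def divide_inverse)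
    show ?thesis
    \<comment> \<open>The polynomial of larger degree is orthogonal to all lower powers, so the sum
      over its index is carried out first.\<close>
    proof (cases "N' < N")
      case True
      have "(\<Sum>k\<le>N. f k l) = 0" if "l \<le> N'" for l
      proof -
        have "(\<Sum>k\<le>N. f k l) = phi_coeff q N' r \<beta>' l * c * (\<Sum>k\<le>N. phi_coeff q N r \<beta> k * inverse (P r (k + l + (b + e' + m))))"
          unfolding f_def sum_distrib_left by (simp only: mult_ac)
        then show ?thesis using orth[of l N] that True h by simp
      qed
      then show ?thesis by (subst sum.swap) simp
    next
      case False
      have "(\<Sum>l\<le>N'. f k l) = 0" if "k \<le> N" for k
      proof -
        have "(\<Sum>l\<le>N'. f k l) = phi_coeff q N r \<beta> k * c * (\<Sum>l\<le>N'. phi_coeff q N' r \<beta>' l * inverse (P r (l + k + (b + e' + m))))"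
          unfolding f_def sum_distrib_left by (simp only: mult_ac add.commute)
        then show ?thesis using orth[of k N'] that False h by simp
      qed
      then show ?thesis by simp
    qed
  qed
  ultimately show ?thesis using cases[OF True] by auto
qed

lemma t_orthogonal:
  assumes Y: "Y \<in> hom_polys m z w b b'" and Y': "Y' \<in> hom_polys m z w e e'"
    and le: "b \<le> a" "b' \<le> a'" "e \<le> c" "e' \<le> c'"
    and cases: "H' (Y * S Y') = 0 \<or> (e = b \<and> e' = b' \<and> (a, a') \<noteq> (c, c'))"
  shows "H (t_poly q z w n a a' b b' * Y * S (t_poly q z w n c c' e e' * Y')) = 0"
proof -
  have n2: "n \<ge> 2" using m1 n_eq by simp
  have t: "\<exists>sg C. block_weight sg (max (a - b) (a' - b') - min (a - b) (a' - b')) = int (a - b) - int (a' - b') \<and>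
      t_poly q z w n a a' b b' * y = C *\<^sub>C block_sum sg (min (a - b) (a' - b')) (max (a - b) (a' - b') - min (a - b) (a' - b')) (b + b' + m) y"
    if ab: "b \<le> a" "b' \<le> a'" for a a' b b' y
  proof -
    obtain C where "t_poly q z w n a a' b b' * y = C *\<^sub>C block_sum (a - b \<ge> a' - b') (min (a - b) (a' - b'))
       (max (a - b) (a' - b') - min (a - b) (a' - b')) (b + b' + n - 1) y"
      using t_poly_mult[OF n2 ab refl refl refl] unfolding block_sum_def by blast
    moreover have "b + b' + n - 1 = b + b' + m" using n_eq by simp
    moreover have "block_weight (a - b \<ge> a' - b') (max (a - b) (a' - b') - min (a - b) (a' - b')) = int (a - b) - int (a' - b')"
      by (auto simp: block_weight_def)
    ultimately show ?thesis by metis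
  qed
  define N r N' r' where "N = min (a - b) (a' - b')" and "r = max (a - b) (a' - b') - N"
    and "N' = min (c - e) (c' - e')" and "r' = max (c - e) (c' - e') - N'"
  obtain sg C where 1: "block_weight sg r = int (a - b) - int (a' - b')"
    "t_poly q z w n a a' b b' * Y = C *\<^sub>C block_sum sg N r (b + b' + m) Y"
    using t[OF le(1,2), of Y] unfolding N_def r_def by blast
  obtain sg' C' where 2: "block_weight sg' r' = int (c - e) - int (c' - e')"
    "t_poly q z w n c c' e e' * Y' = C' *\<^sub>C block_sum sg' N' r' (e + e' + m) Y'"
    using t[OF le(3,4), of Y'] unfolding N'_def r'_def by blast
  have "H (block_sum sg N r (b + b' + m) Y * S (block_sum sg' N' r' (e + e' + m) Y')) = 0"
  proof (rule block_sum_orthogonal[OF Y Y'])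
    assume "block_weight sg r = block_weight sg' r'"
    \<comment> \<open>Equal weights fix the difference of the two exponents. For equal lower
      bidegrees, equal minima \<open>N\<close> and \<open>N'\<close> would then force
      \<open>(a, a')\<close> and \<open>(c, c')\<close> to coincide.\<close>
    then have "int (a - b) - int (a' - b') = int (c - e) - int (c' - e')" using 1 2 by simp
    then show "H' (Y * S Y') = 0 \<or> (N \<noteq> N' \<and> b + b' + m = b + e' + m \<and> e + e' + m = b + e' + m)"
      using cases le unfolding N_def N'_def min_def by (auto split: if_splits)
  qed
  then show ?thesis unfolding 1(2) 2(2) by (simp add: star_scale[OF star] mult_scaleC_left mult_scaleC_right clinear_scale[OF H_lin])
qed

end

text \<open>Orthogonality across all bidegrees is demanded because the elements of a single bidegree
  at one level come from many bidegrees of the level below.\<close>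

definition orthogonal_family :: "('a::complex_algebra_1 \<Rightarrow> 'a) \<Rightarrow> ('a \<Rightarrow> 'a) \<Rightarrow> (nat \<Rightarrow> nat \<Rightarrow> 'i set) \<Rightarrow> ('i \<Rightarrow> 'a) \<Rightarrow> bool" where
  "orthogonal_family S H I \<xi> \<longleftrightarrow>
     (\<forall>b b' e e'. \<forall>i\<in>I b b'. \<forall>j\<in>I e e'. (b, b', i) \<noteq> (e, e', j) \<longrightarrow> H (\<xi> i * S (\<xi> j)) = 0)"

lemma (in q_weyl) orthogonal_family_one:
  assumes "n = 1" "is_star n z w S" "is_integral n q z w H"
  shows "orthogonal_family S H (\<lambda>b b'. {c. b = nat c \<and> b' = nat (- c)}) (t_one z w)"
proof -
  have t: "t_one z w c \<in> weight_space n z w 1 c" for c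
    using weight_space_power[OF weight_space_z[of 1 n z w], of "nat c"] weight_space_power[OF weight_space_w[of 1 n w z], of "nat (- c)"] assms(1)
    by (auto simp: t_one_def)
  have "H (t_one z w c * S (t_one z w d)) = 0" if "c \<noteq> d" for c d
    by (rule integral_weight_space[OF assms(3) weight_space_mult[OF t star_weight_space[OF assms(2) order_refl t]]])
       (use that assms(1) in auto)
  then show ?thesis unfolding orthogonal_family_def by auto
qed

lemma (in q_weyl_orth) orthogonal_family_step:
  fixes I :: "nat \<Rightarrow> nat \<Rightarrow> 'i set" and \<xi> :: "'i \<Rightarrow> 'a" and J :: "nat \<Rightarrow> nat \<Rightarrow> 'j set" and \<xi>' :: "'j \<Rightarrow> 'a"
    and f f' :: "'j \<Rightarrow> nat" and g :: "'j \<Rightarrow> 'i"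
  assumes orth: "orthogonal_family S H' I \<xi>" and hom: "\<And>b b' i. i \<in> I b b' \<Longrightarrow> \<xi> i \<in> hom_polys m z w b b'"
    and J: "\<And>a a' j. j \<in> J a a' \<Longrightarrow> f j \<le> a \<and> f' j \<le> a' \<and> g j \<in> I (f j) (f' j)"
    and J_inj: "\<And>a a'. inj_on (\<lambda>j. (f j, f' j, g j)) (J a a')"
    and \<xi>': "\<And>a a' j. j \<in> J a a' \<Longrightarrow> \<xi>' j = t_poly q z w n a a' (f j) (f' j) * \<xi> (g j)"
  shows "orthogonal_family S H J \<xi>'"
  unfolding orthogonal_family_def
proof (intro allI ballI impI)
  fix a a' c c' i j assume i: "i \<in> J a a'" and j: "j \<in> J c c'" and ne: "(a, a', i) \<noteq> (c, c', j)"
  note Ji = J[OF i] and Jj = J[OF j]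
  show "H (\<xi>' i * S (\<xi>' j)) = 0"
    unfolding \<xi>'[OF i] \<xi>'[OF j]
  proof (rule t_orthogonal)
    show "\<xi> (g i) \<in> hom_polys m z w (f i) (f' i)" "\<xi> (g j) \<in> hom_polys m z w (f j) (f' j)" using hom Ji Jj by blast+
    show "f i \<le> a" "f' i \<le> a'" "f j \<le> c" "f' j \<le> c'" using Ji Jj by auto
    show "H' (\<xi> (g i) * S (\<xi> (g j))) = 0 \<or> f j = f i \<and> f' j = f' i \<and> (a, a') \<noteq> (c, c')"
    proof (cases "(f i, f' i, g i) = (f j, f' j, g j)")
      case True
      then have "(a, a') \<noteq> (c, c')" using inj_onD[OF J_inj[of a a'], of i j] i j ne by auto
      then show ?thesis using True by auto
    next
      case False
      then show ?thesis using orth Ji Jj unfolding orthogonal_family_def by blast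
    qed
  qed
qed

section \<open>Existence of the involution\<close>

definition rev_word :: "gen free_word \<Rightarrow> gen free_word" where
  "rev_word u = Free_Word (rev (letters u))"

lemma rev_word_plus: "rev_word (u + v) = rev_word v + rev_word u"
  by (simp add: rev_word_def plus_free_word_def)

text \<open>An antilinear, product-reversing evaluation of the free algebra. The involution arises
  by factoring it through \<open>eval_free\<close>.\<close>

definition star_eval :: "(nat \<Rightarrow> 'a::complex_algebra_1) \<Rightarrow> (nat \<Rightarrow> 'a) \<Rightarrow> free_poly \<Rightarrow> 'a" where
  "star_eval z w p = (\<Sum>u\<in>Poly_Mapping.keys p. cnj (Poly_Mapping.lookup p u) *\<^sub>C word_val w z (rev_word u))"

lemma star_eval_superset:
  "finite S \<Longrightarrow> Poly_Mapping.keys p \<subseteq> S \<Longrightarrow>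
   star_eval z w p = (\<Sum>u\<in>S. cnj (Poly_Mapping.lookup p u) *\<^sub>C word_val w z (rev_word u))"
  unfolding star_eval_def by (rule sum.mono_neutral_left) (auto simp: in_keys_iff)

lemma star_eval_single: "star_eval z w (Poly_Mapping.single u c) = cnj c *\<^sub>C word_val w z (rev_word u)"
  by (cases "c = 0") (simp_all add: star_eval_def)

lemma star_eval_add: "star_eval z w (p + p') = star_eval z w p + star_eval z w p'"
  by (simp add: star_eval_superset[of "Poly_Mapping.keys p \<union> Poly_Mapping.keys p'"] keys_add lookup_add
      scaleC_add_left sum.distrib)

lemma star_eval_zero: "star_eval z w 0 = 0"
  by (simp add: star_eval_def)

lemma star_eval_uminus: "star_eval z w (- p) = - star_eval z w p"
  by (simp add: star_eval_def sum_negf)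

lemma star_eval_diff: "star_eval z w (p - p') = star_eval z w p - star_eval z w p'"
  using star_eval_add[of z w p "- p'"] by (simp add: star_eval_uminus)

lemma star_eval_sum: "star_eval z w (sum f S) = (\<Sum>i\<in>S. star_eval z w (f i))"
  by (induction S rule: infinite_finite_induct) (simp_all add: star_eval_add star_eval_zero)

lemma star_eval_mult: "star_eval z w (p * p') = star_eval z w p' * star_eval z w p"
proof -
  have p: "p = (\<Sum>u\<in>Poly_Mapping.keys p. Poly_Mapping.single u (Poly_Mapping.lookup p u))" for p :: free_poly
    by (rule sum_single_lookup[symmetric])
  have "star_eval z w (p * p') = (\<Sum>u\<in>Poly_Mapping.keys p. \<Sum>v\<in>Poly_Mapping.keys p'.
     cnj (Poly_Mapping.lookup p u * Poly_Mapping.lookup p' v) *\<^sub>C word_val w z (rev_word (u + v)))"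
    by (subst p, subst (2) p) (simp only: sum_product mult_single star_eval_sum star_eval_single)
  also have "\<dots> = (\<Sum>v\<in>Poly_Mapping.keys p'. \<Sum>u\<in>Poly_Mapping.keys p.
     cnj (Poly_Mapping.lookup p u * Poly_Mapping.lookup p' v) *\<^sub>C word_val w z (rev_word (u + v)))"
    by (rule sum.swap)
  also have "\<dots> = star_eval z w p' * star_eval z w p"
    by (simp only: star_eval_def sum_product word_val_plus rev_word_plus mult_scaleC_left mult_scaleC_right scaleC_scaleC
      complex_cnj_mult)
  finally show ?thesis .
qed

lemma star_eval_const: "star_eval z w (free_const c) = cnj c *\<^sub>C 1"
  by (simp add: free_const_def star_eval_single rev_word_def zero_free_word_def)

lemma star_eval_gen: "star_eval z w (free_gen g) = (case g of GZ i \<Rightarrow> w i | GW i \<Rightarrow> z i)"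
  by (simp add: free_gen_def star_eval_single rev_word_def word_val_def split: gen.split)

lemmas star_eval_simps = star_eval_diff star_eval_add star_eval_mult star_eval_sum star_eval_const star_eval_gen

text \<open>Reversal and exchange of letters send each defining relation to a relation again; the
  reality of \<open>q\<close> enters through the conjugated coefficients.\<close>

lemma star_eval_eq_0:
  assumes "presents n q z w" "q \<noteq> 0" "\<forall>k>0. q ^ k \<noteq> 1" "cnj q = q" "p \<in> free_alg n" "eval_free z w p = 0"
  shows "star_eval z w p = 0"
proof -
  interpret q_weyl n q z w by (rule presents_q_weyl[OF assms(1-3)])
  have "p \<in> ideal_gen (free_alg n) (relators n q)"
    using assms(1,5,6) unfolding presents_def by blast
  then show ?thesis
  proof induction
    case (base p)
    then consider
        i j where "1 \<le> i" "i < j" "j \<le> n" "p = free_gen (GZ i) * free_gen (GZ j) - free_const q * free_gen (GZ j) * free_gen (GZ i)"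
      | i j where "1 \<le> i" "i < j" "j \<le> n" "p = free_gen (GW i) * free_gen (GW j) - free_const (inverse q) * free_gen (GW j) * free_gen (GW i)"
      | i j where "i \<in> {1..n}" "j \<in> {1..n}" "i \<noteq> j" "p = free_gen (GW j) * free_gen (GZ i) - free_const q * free_gen (GZ i) * free_gen (GW j)"
      | k where "k \<in> {1..n}" "p = free_gen (GW k) * free_gen (GZ k) - (free_gen (GZ k) * free_gen (GW k) +
          free_const (1 - q\<^sup>2) * (\<Sum>s\<in>{1..<k}. free_gen (GZ s) * free_gen (GW s)))"
      unfolding relators_def Let_def by blast
    then show ?case
    proof cases
      case 1
      have "w j * w i = q *\<^sub>C (w i * w j)" using ww'[OF 1(1-3)] by (simp add: q_commute_def)
      then show ?thesis unfolding 1(4) by (simp add: star_eval_simps scaleC_mult_simps assms(4))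
    next
      case 2
      have "z j * z i = inverse q *\<^sub>C (z i * z j)" using zz'[OF 2(1-3)] by (simp add: q_commute_def)
      then show ?thesis unfolding 2(4) by (simp add: star_eval_simps scaleC_mult_simps assms(4))
    next
      case 3
      have "w i * z j = q *\<^sub>C (z j * w i)" using wz[OF 3(2,1)] 3(3) by (simp add: q_commute_def)
      then show ?thesis unfolding 3(4) by (simp add: star_eval_simps scaleC_mult_simps assms(4))
    next
      case 4
      have "{1..<k} = {1..k - 1}" by auto
      then have "w k * z k = z k * w k + (1 - q\<^sup>2) *\<^sub>C (\<Sum>s\<in>{1..<k}. z s * w s)"
        using wzk[OF 4(1)] by (simp only: Qpoly_def)
      then show ?thesis unfolding 4(2) by (simp add: star_eval_simps scaleC_mult_simps assms(4))
    qed
  qed (simp_all add: star_eval_add star_eval_mult star_eval_zero)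
qed

lemma free_alg_add: "p \<in> free_alg n \<Longrightarrow> p' \<in> free_alg n \<Longrightarrow> p + p' \<in> free_alg n"
  unfolding free_alg_def using keys_add[of p p'] by blast

lemma free_alg_diff: "p \<in> free_alg n \<Longrightarrow> p' \<in> free_alg n \<Longrightarrow> p - p' \<in> free_alg n"
  using keys_diff[of p p'] by (auto simp: free_alg_def)

lemma free_alg_single: "u \<in> words n \<Longrightarrow> Poly_Mapping.single u c \<in> free_alg n"
  by (auto simp: free_alg_def)

lemma free_alg_mult: "p \<in> free_alg n \<Longrightarrow> p' \<in> free_alg n \<Longrightarrow> p * p' \<in> free_alg n"
  using keys_mult[of p p'] unfolding free_alg_def by fastforce

lemma ex_star:
  fixes z w :: "nat \<Rightarrow> 'a::complex_algebra_1"
  assumes "presents n q z w" "q \<noteq> 0" "\<forall>k>0. q ^ k \<noteq> 1" "cnj q = q"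
  shows "\<exists>S. is_star n z w S"
proof -
  \<comment> \<open>An arbitrary preimage is chosen; \<open>star_eval_eq_0\<close> makes the value
    independent of the choice.\<close>
  define S where "S x = star_eval z w (SOME p. p \<in> free_alg n \<and> eval_free z w p = x)" for x
  have S: "S (eval_free z w p) = star_eval z w p" if "p \<in> free_alg n" for p
  proof -
    define p' where "p' = (SOME p'. p' \<in> free_alg n \<and> eval_free z w p' = eval_free z w p)"
    have p': "p' \<in> free_alg n \<and> eval_free z w p' = eval_free z w p"
      unfolding p'_def by (rule someI[of _ p]) (simp add: that)
    have "star_eval z w (p' - p) = 0"
      by (rule star_eval_eq_0[OF assms free_alg_diff]) (use p' that in \<open>simp_all add: eval_free_diff\<close>)
    then show ?thesis by (simp add: S_def p'_def star_eval_diff)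
  qed
  have ex: "\<exists>p\<in>free_alg n. x = eval_free z w p" for x
    using assms(1) unfolding presents_def by (metis UNIV_I imageE)
  have add: "S (x + y) = S x + S y" for x y
  proof -
    obtain p p' where "p \<in> free_alg n" "x = eval_free z w p" "p' \<in> free_alg n" "y = eval_free z w p'" using ex by meson
    then show ?thesis using S free_alg_add[of p n p'] by (simp add: star_eval_add flip: eval_free_add)
  qed
  have mult: "S (x * y) = S y * S x" for x y
  proof -
    obtain p p' where "p \<in> free_alg n" "x = eval_free z w p" "p' \<in> free_alg n" "y = eval_free z w p'" using ex by meson
    then show ?thesis using S free_alg_mult[of p n p'] by (simp add: star_eval_mult flip: eval_free_mult)
  qed
  have const: "S (c *\<^sub>C 1) = cnj c *\<^sub>C 1" for c
    using S[of "free_const c"] free_alg_single[of 0 n c] unfolding free_const_def[symmetric]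
    by (simp add: eval_free_const star_eval_const)
  have scale: "S (c *\<^sub>C x) = cnj c *\<^sub>C S x" for c x
    using mult[of "c *\<^sub>C 1" x] const[of c] by (simp add: scaleC_mult_simps)
  have gen: "S (z i) = w i" "S (w i) = z i" if "i \<in> {1..n}" for i
    using S[of "free_gen (GZ i)"] S[of "free_gen (GW i)"] that
    by (simp_all add: free_alg_single free_gen_def[symmetric] eval_free_gen star_eval_gen free_alg_single[of "Free_Word [_]" n 1, folded free_gen_def])
  have invol: "S (S x) = x" for x
  proof -
    have *: "Free_Word gs \<in> words n \<Longrightarrow> S (S (word_val z w (Free_Word gs))) = word_val z w (Free_Word gs)" for gs
    proof (induction gs)
      case Nil
      show ?case using const[of 1] by (simp add: scaleC_one)
    next
      case (Cons g gs)
      then show ?case by (cases g) (simp_all add: word_val_Cons mult gen)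
    qed
    have zero: "S 0 = 0" using const[of 0] by simp
    have "x \<in> complex_vector.span (word_val z w ` words n)" using presents_sub_alg[OF assms(1)] by (simp add: sub_alg_def)
    then show ?thesis
    proof (induction rule: complex_vector.span_induct_alt)
      case (step c y x)
      then obtain u where "u \<in> words n" "y = word_val z w u" by blast
      then have "S (S y) = y" using *[of "letters u"] by simp
      then show ?case by (simp add: add scale step)
    qed (simp add: zero)
  qed
  show ?thesis unfolding is_star_def using add scale mult invol gen by blast
qed

lemma is_star_unique:
  assumes f: "is_star n z w f" and g: "is_star n z w g" and "sub_alg n z w = UNIV"
  shows "f = g"
proof
  fix x
  have *: "Free_Word gs \<in> words n \<Longrightarrow> f (word_val z w (Free_Word gs)) = g (word_val z w (Free_Word gs))" for gs
  proof (induction gs)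
    case (Cons h gs)
    then show ?case
      by (cases h) (simp_all add: word_val_Cons star_mult[OF f] star_mult[OF g] star_z[OF f] star_z[OF g] star_w[OF f] star_w[OF g])
  qed (simp add: star_one[OF f] star_one[OF g])
  have "x \<in> complex_vector.span (word_val z w ` words n)" using assms(3) by (simp add: sub_alg_def)
  then show "f x = g x"
  proof (induction rule: complex_vector.span_induct_alt)
    case (step c y x)
    then obtain u where "u \<in> words n" "y = word_val z w u" by blast
    then have "f y = g y" using *[of "letters u"] by simp
    then show ?case by (simp add: star_add[OF f] star_add[OF g] star_scale[OF f] star_scale[OF g] step)
  qed (simp add: star_zero[OF f] star_zero[OF g])
qed

lemma is_star_qstar:
  assumes "presents n q z w" "q \<noteq> 0" "\<forall>k>0. q ^ k \<noteq> 1" "cnj q = q"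
  shows "is_star n z w (qstar n z w)"
proof -
  have "qstar n z w = (THE f. is_star n z w f)" by (simp only: qstar_def is_star_def)
  moreover obtain S where "is_star n z w S" using ex_star[OF assms] by blast
  ultimately show ?thesis using is_star_unique[OF _ _ presents_sub_alg[OF assms(1)]] by (metis theI)
qed

lemma is_star_mono: "p \<le> n \<Longrightarrow> is_star n z w S \<Longrightarrow> is_star p z w S"
  unfolding is_star_def by auto

section \<open>Orthogonality of the basis\<close>

lemma (in q_weyl_ops) orthogonal_family_Xi:
  assumes "n \<ge> 2" "zw_free n z w" "zw_free n w z" "cnj q = q" "is_star n z w S" "is_integral n q z w H"
  shows "orthogonal_family S H (patterns n) (Xi n q z w)"
  using assms q_weyl_ops_axioms
\<comment> \<open>\<open>H\<close> is generalised because every level has its own functional, while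
  the involution is the same at all levels.\<close>
proof (induction n arbitrary: H rule: dec_induct)
  case base
  interpret p: q_weyl_ops 2 q z w d db by (rule base)
  interpret s: q_weyl_step 2 q z w d db 1 by unfold_locales simp
  have le: "(1::nat) \<le> 2" by simp
  note fr1 = zw_free_mono[OF le base(1)] zw_free_mono[OF le base(2)]
  obtain H' where H': "is_integral 1 q z w H'" using s.m.ex_integral[OF fr1(2)] by blast
  interpret o: q_weyl_orth 2 q z w d db 1 S H H' by unfold_locales (use base H' in auto)
  note I = s.m.orthogonal_family_one[OF refl is_star_mono[OF le base(4)] H']
  have hom: "t_one z w i \<in> hom_polys 1 z w b b'" if "i \<in> {c. b = nat c \<and> b' = nat (- c)}" for b b' i
    using s.m.harmonic_family_one[OF refl fr1(1)] that unfolding s.m.harmonic_family_def by blast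
  show ?case
    by (rule o.orthogonal_family_step[OF I hom, where f = "\<lambda>(M, M', c). nat c" and f' = "\<lambda>(M, M', c). nat (- c)" and g = "\<lambda>(M, M', c). c"])
      (rule patterns_two_inj | force simp: patterns_two Xi_two)+
next
  case (step m)
  interpret p: q_weyl_ops "Suc m" q z w d db by (rule step)
  interpret s: q_weyl_step "Suc m" q z w d db m by unfold_locales simp
  have le: "m \<le> Suc m" by simp
  note fr = zw_free_mono[OF le step(4)] zw_free_mono[OF le step(5)]
  obtain H' where H': "is_integral m q z w H'" using s.m.ex_integral[OF fr(2)] by blast
  interpret o: q_weyl_orth "Suc m" q z w d db m S H H' by unfold_locales (use step H' in auto)
  note I = step.IH[OF fr step.prems(3) is_star_mono[OF le step.prems(4)] H' s.m.q_weyl_ops_axioms]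
  have hom: "Xi m q z w i \<in> hom_polys m z w b b'" if "i \<in> patterns m b b'" for b b' i
    using s.m.harmonic_family_Xi[OF step(1) fr(1)] that unfolding s.m.harmonic_family_def by blast
  show ?case
    by (rule o.orthogonal_family_step[OF I hom, where f = "\<lambda>(M, M', c). M m" and f' = "\<lambda>(M, M', c). M' m"
        and g = "\<lambda>(M, M', c). (restrict M {2..m}, restrict M' {2..m}, c)"])
      (assumption | rule patterns_truncate_inj[OF step(1)] | rule patterns_truncate[OF step(1)], assumption |
        rule Xi_truncate[OF step(1)], assumption)+
qed

section \<open>The functional on the quantum sphere\<close>

definition is_sphere_functional :: "nat \<Rightarrow> complex \<Rightarrow> (nat \<Rightarrow> 'a::complex_algebra_1) \<Rightarrow> (nat \<Rightarrow> 'a) \<Rightarrow>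
    ('a \<Rightarrow> 'b::complex_algebra_1) \<Rightarrow> ('b \<Rightarrow> complex) \<Rightarrow> bool" where
  "is_sphere_functional n q z w \<tau> h \<longleftrightarrow> Vector_Spaces.linear scaleC (*) h \<and>
     (\<forall>\<nu>. \<nu> \<noteq> (\<lambda>_. 0) \<longrightarrow> (\<forall>x\<in>sphere_component n z w \<tau> \<nu>. h x = 0)) \<and>
     (\<forall>\<mu>. h (\<tau> (mono_up n w \<mu> * mono_down n z \<mu>)) = sphere_weight n (q\<^sup>2) \<mu>)"

lemma functional_iff:
  fixes h :: "'b::complex_algebra_1 \<Rightarrow> complex"
  shows "Vector_Spaces.linear scaleC (*) h \<longleftrightarrow> (\<forall>x y. h (x + y) = h x + h y) \<and> (\<forall>c x. h (c *\<^sub>C x) = c * h x)"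
proof -
  have "vector_space ((*) :: complex \<Rightarrow> complex \<Rightarrow> complex)" by unfold_locales (simp_all add: algebra_simps)
  then show ?thesis unfolding Vector_Spaces.linear_iff using complex_vector.vector_space_axioms by blast
qed

lemma mono_word_weight:
  "distinct ks \<Longrightarrow> word_weight (mono_word GZ ks r) i = (if i \<in> set ks then int (r i) else 0)"
  "distinct ks \<Longrightarrow> word_weight (mono_word GW ks r) i = (if i \<in> set ks then - int (r i) else 0)"
proof -
  have c: "count_list (replicate k g) x = (if g = x then k else 0)" for k and g x :: gen by (induction k) auto
  have "distinct ks \<Longrightarrow> word_weight (mono_word GZ ks r) i = (if i \<in> set ks then int (r i) else 0) \<and>
    word_weight (mono_word GW ks r) i = (if i \<in> set ks then - int (r i) else 0)"
    by (induction ks) (auto simp: mono_word_def word_weight_def c)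
  then show "distinct ks \<Longrightarrow> word_weight (mono_word GZ ks r) i = (if i \<in> set ks then int (r i) else 0)"
    "distinct ks \<Longrightarrow> word_weight (mono_word GW ks r) i = (if i \<in> set ks then - int (r i) else 0)" by blast+
qed

text \<open>On ordered monomials both sides agree: on diagonal ones by prescription, on the others
  because their nonzero weight puts them into a component on which \<open>h\<close> vanishes. This
  gives both the uniqueness of \<open>h\<close> and its values.\<close>

lemma sphere_functional_eq:
  fixes z w :: "nat \<Rightarrow> 'a::complex_algebra_1" and \<tau> :: "'a \<Rightarrow> 'b::complex_algebra_1"
  assumes h: "is_sphere_functional n q z w \<tau> h" and "\<tau> 0 = 0" and lin: "clinear \<tau>"
    and H: "is_integral n q z w H" and weyl: "q_weyl n q z w" and UNIV: "sub_alg n z w = UNIV"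
  shows "h (\<tau> x) *\<^sub>C 1 = H x"
proof -
  interpret q_weyl n q z w by (rule weyl)
  have x: "x \<in> complex_vector.span {mono_up n w r * mono_down n z s | r s. True}" using UNIV sub_alg_wz_down by simp
  have h': "h (a + b) = h a + h b" "h (c *\<^sub>C a) = c * h a" for a b c
    using h unfolding is_sphere_functional_def functional_iff by blast+
  have H_lin: "clinear H" using H by (simp add: is_integral_def)
  show ?thesis
  proof (rule clinear_eq_on_span[of "\<lambda>x. h (\<tau> x) *\<^sub>C (1::'a)" H, OF _ H_lin _ x])
    show "clinear (\<lambda>x. h (\<tau> x) *\<^sub>C (1::'a))"
      by (simp add: clinear_iff clinear_add[OF lin] clinear_scale[OF lin] h' scaleC_add_left scaleC_scaleC)
    fix y assume "y \<in> {mono_up n w r * mono_down n z s | r s. True}"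
    then obtain r s where y: "y = mono_up n w r * mono_down n z s" by blast
    show "h (\<tau> y) *\<^sub>C 1 = H y"
    proof (cases "\<forall>i\<in>{1..n}. r i = s i")
      case True
      then have "mono_down n z s = mono_down n z r" by (intro mono_down_cong) auto
      then have "h (\<tau> y) = sphere_weight n (q\<^sup>2) r" using h unfolding y is_sphere_functional_def by simp
      then show ?thesis using H True unfolding is_integral_def y by simp
    next
      case False
      then obtain i where i: "i \<in> {1..n}" "r i \<noteq> s i" by blast
      define u where "u = mono_word GW [1..<Suc n] r + mono_word GZ (rev [1..<Suc n]) s"
      have u: "u \<in> words n" unfolding u_def by (auto intro!: mono_word_words)
      have y': "y = word_val z w u" by (simp only: u_def y word_val_plus word_val_mono_up_w word_val_mono_down_z)
      have "word_weight u i = int (s i) - int (r i)"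
        unfolding u_def weight_simps using i(1) by (subst mono_word_weight, simp)+ (simp del: upt_Suc)
      then have "word_weight u i \<noteq> 0" using i(2) by simp
      then have "word_weight u \<noteq> (\<lambda>_. 0)" by auto
      moreover have "\<tau> y \<in> sphere_component n z w \<tau> (word_weight u)"
        unfolding sphere_component_def y' using u by (intro complex_vector.span_base) auto
      ultimately have "h (\<tau> y) = 0" using h unfolding is_sphere_functional_def by blast
      moreover have "H y = 0" using H False unfolding is_integral_def y by (simp only: if_False complex_vector.scale_zero_left)
      ultimately show ?thesis by simp
    qed
  qed
qed

text \<open>\<open>Q n\<close> is central, so the two-sided ideal consists of multiples of the
  single element \<open>Q n - 1\<close>.\<close>

lemma ideal_Q:
  fixes z w :: "nat \<Rightarrow> 'a::complex_algebra_1"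
  assumes "q_weyl n q z w" "sub_alg n z w = UNIV" "x \<in> ideal_gen UNIV {Qpoly z w n - 1}"
  shows "\<exists>y. x = (Qpoly z w n - 1) * y"
proof -
  interpret q_weyl n q z w by (rule assms)
  have comm: "y * (Q n - 1) = (Q n - 1) * y" for y
    using Q_comm[of y] assms(2) by (simp add: left_diff_distrib right_diff_distrib)
  show ?thesis using assms(3)
  proof induction
    case zero
    show ?case by (rule exI[of _ 0]) simp
  next
    case (base r)
    then show ?case by (intro exI[of _ 1]) simp
  next
    case (add x y)
    then show ?case by (metis distrib_left)
  next
    case (mult_left c x)
    then show ?case by (metis comm mult.assoc)
  next
    case (mult_right x c)
    then show ?case by (metis mult.assoc)
  qed
qed

text \<open>\<open>\<phi>\<close> reads the scalar off \<open>H\<close>, and \<open>H\<close>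
  vanishes on \<open>(Q n - 1) * v\<close> by \<open>integral_Q\<close>. Hence \<open>\<phi>\<close>
  is constant on the fibres of \<open>\<tau>\<close> and defines \<open>h\<close>.\<close>

lemma ex_sphere_functional:
  fixes z w :: "nat \<Rightarrow> 'a::complex_algebra_1" and \<tau> :: "'a \<Rightarrow> 'b::complex_algebra_1"
  assumes \<tau>: "sphere_quotient n z w \<tau>" and H: "is_integral n q z w H" and weyl: "q_weyl n q z w"
    and UNIV: "sub_alg n z w = UNIV" and n: "n \<ge> 1" and ne: "(1 :: 'a) \<noteq> 0"
  shows "\<exists>h. is_sphere_functional n q z w \<tau> h"
proof -
  interpret q_weyl n q z w by (rule weyl)
  have H_lin: "clinear H" using H by (simp add: is_integral_def)
  have lin: "clinear \<tau>" and surj: "surj \<tau>" and ker: "{x. \<tau> x = 0} = ideal_gen UNIV {Q n - 1}"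
    using \<tau> by (simp_all add: sphere_quotient_def)
  have scalar: "\<exists>c. H x = c *\<^sub>C 1" for x
  proof -
    have "x \<in> complex_vector.span {mono_up n w r * mono_down n z s | r s. True}" using UNIV sub_alg_wz_down by simp
    then have "H x \<in> complex_vector.span {1}"
    proof (rule clinear_maps_span[OF H_lin, rotated])
      fix y assume "y \<in> {mono_up n w r * mono_down n z s | r s. True}"
      then obtain r s where y: "y = mono_up n w r * mono_down n z s" by blast
      have "\<exists>c. H y = c *\<^sub>C 1" using H unfolding y is_integral_def by blast
      then show "H y \<in> complex_vector.span {1}" by (auto simp: complex_vector.span_singleton)
    qed
    then show ?thesis by (auto simp: complex_vector.span_singleton)
  qed
  define \<phi> where "\<phi> x = (SOME c. H x = c *\<^sub>C 1)" for x
  have \<phi>: "H x = \<phi> x *\<^sub>C 1" for x unfolding \<phi>_def by (rule someI_ex[OF scalar])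
  have \<phi>_eq: "\<phi> x = c" if "H x = c *\<^sub>C 1" for x c
    using that \<phi>[of x] ne by (simp add: complex_vector.scale_cancel_right)
  have wd: "\<phi> x = \<phi> y" if "\<tau> x = \<tau> y" for x y
  proof -
    have "\<tau> (x - y) = 0" using that by (simp add: clinear_diff[OF lin])
    then have "x - y \<in> ideal_gen UNIV {Q n - 1}" using ker by blast
    then obtain v where v: "x - y = (Q n - 1) * v" using ideal_Q[OF weyl UNIV] by blast
    have "H (x - y) = 0"
      unfolding v left_diff_distrib clinear_diff[OF H_lin] using integral_Q[OF n H, of v] UNIV by simp
    then have "H x = H y" by (simp add: clinear_diff[OF H_lin])
    then show ?thesis using \<phi>_eq[of x] \<phi>[of y] by simp
  qed
  define h where "h b = \<phi> (SOME x. \<tau> x = b)" for b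
  have h: "h (\<tau> x) = \<phi> x" for x
    unfolding h_def by (rule wd) (rule someI[of _ x], simp)
  have surj': "\<exists>x. b = \<tau> x" for b using surj by (metis surjD)
  have "is_sphere_functional n q z w \<tau> h"
    unfolding is_sphere_functional_def functional_iff
  proof (intro conjI allI impI ballI)
    show "h (a + b) = h a + h b" for a b
    proof -
      obtain x y where xy: "a = \<tau> x" "b = \<tau> y" using surj' by meson
      have "\<phi> (x + y) = \<phi> x + \<phi> y"
        by (rule \<phi>_eq) (simp only: clinear_add[OF H_lin] \<phi>[of x] \<phi>[of y] scaleC_add_left)
      then show ?thesis unfolding xy by (simp add: h flip: clinear_add[OF lin])
    qed
    show "h (c *\<^sub>C a) = c * h a" for c a
    proof -
      obtain x where x: "a = \<tau> x" using surj' by meson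
      have "\<phi> (c *\<^sub>C x) = c * \<phi> x"
        by (rule \<phi>_eq) (simp only: clinear_scale[OF H_lin] \<phi>[of x] scaleC_scaleC)
      then show ?thesis unfolding x by (simp add: h flip: clinear_scale[OF lin])
    qed
    then have h0: "h 0 = 0" using complex_vector.scale_zero_left[of "0::'b"] by (metis mult_zero_left)
    show "h (\<tau> (mono_up n w \<mu> * mono_down n z \<mu>)) = sphere_weight n (q\<^sup>2) \<mu>" for \<mu>
      unfolding h by (rule \<phi>_eq) (use H in \<open>simp add: is_integral_def\<close>)
    fix \<nu> :: "nat \<Rightarrow> int" and b assume \<nu>: "\<nu> \<noteq> (\<lambda>_. 0)" and b: "b \<in> sphere_component n z w \<tau> \<nu>"
    have word: "h (\<tau> (word_val z w u)) = 0" if u: "u \<in> words n" "word_weight u = \<nu>" for u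
    proof -
      obtain i where i: "word_weight u i \<noteq> 0" using \<nu> u(2) by (auto simp: fun_eq_iff)
      then have "GZ i \<in> set (letters u) \<or> GW i \<in> set (letters u)"
        by (auto simp: word_weight_def count_list_0_iff)
      then have "i \<in> {1..n}" using u(1) by (auto simp: words_def gens_def)
      from integral_weight[OF H u(1) this i] show ?thesis unfolding h by (intro \<phi>_eq) simp
    qed
    show "h b = 0" using b unfolding sphere_component_def
    proof (induction rule: complex_vector.span_induct_alt)
      case base
      show ?case by (rule h0)
    next
      case (step c x y)
      then show ?case using word \<open>\<And>a b. h (a + b) = h a + h b\<close> \<open>\<And>c a. h (c *\<^sub>C a) = c * h a\<close> by auto
    qed
  qed
  then show ?thesis by blast
qed

text \<open>Scalars are recovered from multiples of 1, which requires a nonzero algebra; the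
  monomial with all exponents zero supplies it.\<close>

lemma zw_free_one_neq_zero:
  assumes "zw_free n z w"
  shows "(1 :: 'a::complex_algebra_1) \<noteq> 0"
proof
  assume one: "(1 :: 'a) = 0"
  have "(\<Sum>x\<in>{(\<lambda>_. 0, \<lambda>_. 0)}. 1 *\<^sub>C (case x of (r, s) \<Rightarrow> mono_up n z r * mono_up n w s)) = 0"
    using one by (simp add: mono_up_zero)
  from family_independentD[OF assms[unfolded zw_free_def] _ _ this, of "(\<lambda>_. 0, \<lambda>_. 0)"]
  show False by (simp add: exponents_def)
qed

text \<open>Moves the scalar product from the quotient back to the algebra, where the orthogonality
  relations are available.\<close>

lemma scalar_prod_eq:
  fixes z w :: "nat \<Rightarrow> 'a::complex_algebra_1" and \<tau> :: "'a \<Rightarrow> 'b::complex_algebra_1"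
  assumes "presents n q z w" "q \<noteq> 0" "\<forall>k>0. q ^ k \<noteq> 1" "n \<ge> 1"
    and \<tau>: "sphere_quotient n z w \<tau>" and H: "is_integral n q z w H"
  shows "scalar_prod n q z w \<tau> x y *\<^sub>C 1 = H (x * qstar n z w y)"
proof -
  note weyl = presents_q_weyl[OF assms(1-3)] and UNIV = presents_sub_alg[OF assms(1)]
  have lin: "clinear \<tau>" and mult: "\<tau> (a * b) = \<tau> a * \<tau> b" for a b
    using \<tau> by (simp_all add: sphere_quotient_def)
  have ne: "(1 :: 'a) \<noteq> 0" by (rule zw_free_one_neq_zero[OF presents_zw_free(1)[OF assms(1-4)]])
  obtain h where h: "is_sphere_functional n q z w \<tau> h" using ex_sphere_functional[OF \<tau> H weyl UNIV assms(4) ne] by blast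
  have eq: "h' (\<tau> v) *\<^sub>C 1 = H v" if "is_sphere_functional n q z w \<tau> h'" for h' v
    by (rule sphere_functional_eq[OF that clinear_0[OF lin] lin H weyl UNIV])
  have "sphere_functional n q z w \<tau> = (THE h. is_sphere_functional n q z w \<tau> h)"
    by (simp only: sphere_functional_def is_sphere_functional_def sphere_weight_def)
  also have "\<dots> = h"
  proof (rule the_equality)
    show "is_sphere_functional n q z w \<tau> h" by (rule h)
    fix h' assume h': "is_sphere_functional n q z w \<tau> h'"
    show "h' = h"
    proof
      fix b
      obtain v where v: "b = \<tau> v" using \<tau> unfolding sphere_quotient_def by (metis surjD)
      show "h' b = h b" using eq[OF h', of v] eq[OF h, of v] ne unfolding v
        by (metis complex_vector.scale_cancel_right)
    qed
  qed
  finally have "scalar_prod n q z w \<tau> x y = h (\<tau> (x * qstar n z w y))" by (simp add: scalar_prod_def mult)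
  then show ?thesis using eq[OF h] by simp
qed

theorem Xi_orthogonal:
  fixes z w :: "nat \<Rightarrow> 'a::complex_algebra_1" and \<tau> :: "'a \<Rightarrow> 'b::complex_algebra_1"
  assumes "n \<ge> 2" "q \<noteq> 0" "\<forall>k>0. q ^ k \<noteq> 1" "presents n q z w" "q \<in> \<real>" "sphere_quotient n z w \<tau>"
    and "x \<in> patterns n m m'" "y \<in> patterns n m m'" "x \<noteq> y"
  shows "scalar_prod n q z w \<tau> (Xi n q z w x) (Xi n q z w y) = 0"
proof -
  have n1: "n \<ge> 1" using assms(1) by simp
  have q: "cnj q = q" using assms(5) by (simp add: Reals_cnj_iff)
  note free = presents_zw_free[OF assms(4,2,3) n1]
  interpret q_weyl_ops n q z w "pd n q z w" "pd_bar n q z w" by (rule presents_q_weyl_ops[OF assms(4,2,3) n1])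
  obtain H where H: "is_integral n q z w H" using ex_integral[OF free(2)] by blast
  have "H (Xi n q z w x * qstar n z w (Xi n q z w y)) = 0"
    using orthogonal_family_Xi[OF assms(1) free q is_star_qstar[OF assms(4,2,3) q] H] assms(7-9)
    unfolding orthogonal_family_def by blast
  then have "scalar_prod n q z w \<tau> (Xi n q z w x) (Xi n q z w y) *\<^sub>C (1 :: 'a) = 0"
    using scalar_prod_eq[OF assms(4,2,3) n1 assms(6) H] by simp
  then show ?thesis using zw_free_one_neq_zero[OF free(1)] by simp
qed

theorem mainTheorem5:
  fixes n m m' :: nat and q :: complex and z w :: "nat \<Rightarrow> 'a::complex_algebra_1"
  assumes "n \<ge> 2"
    and "q \<noteq> 0" and "\<forall>k>0. q ^ k \<noteq> 1"
    and "presents n q z w"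
  shows "(inj_on (Xi n q z w) (patterns n m m') \<and>
          complex_vector.independent (Xi n q z w ` patterns n m m') \<and>
          complex_vector.span (Xi n q z w ` patterns n m m') = q_harmonics n q z w m m') \<and>
         (q \<in> \<real> \<and> Re q > 0 \<longrightarrow>
          (\<forall>\<tau> :: 'a \<Rightarrow> 'b::complex_algebra_1. sphere_quotient n z w \<tau> \<longrightarrow>
            (\<forall>x\<in>patterns n m m'. \<forall>y\<in>patterns n m m'.
               x \<noteq> y \<longrightarrow> scalar_prod n q z w \<tau> (Xi n q z w x) (Xi n q z w y) = 0)))"
  using Xi_basis[OF assms] Xi_orthogonal[OF assms] by blast

end
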